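(* Let $j_0\ge1$, $0\le q\le d$, let $\boldsymbol b_j,\boldsymbol d_j\in\mathcal S$ with $\boldsymbol b_j\le\boldsymbol d_j$ for every $1\le j\le j_0$, and assume that $\{(X_i,M_i)\}_{i\ge1}$ is an independently marked homogeneous Poisson point process. Then, as $n\to\infty$, $$\frac{\big(\beta_{q,n}^{\boldsymbol b_j,\boldsymbol d_j}\big)_{j\le j_0}-\mathbb E\Big[\big(\beta_{q,n}^{\boldsymbol b_j,\boldsymbol d_j}\big)_{j\le j_0}\Big]}{n^{d/2}}\Rightarrow Z$$ (convergence in distribution in $\mathbb R^{j_0}$), where $Z$ is a $j_0$-dimensional centered normal random vector.
   Context: **Marked point process.** Fix $d\ge1$ and a positive integer $T$. $X=\{(X_i,M_i)\}_{i\ge1}$ is a marked point process with locations $X_i\in\mathbb R^d$ and marks $M_i\in[0,T]$. An independently marked homogeneous Poisson point process is one in which $\{X_i\}$ is a homogeneous Poisson point process of intensity $\lambda\in(0,\infty)$ and the marks $M_i$ are i.i.d. and independent of the locations. **Čech complex.** For a nonempty finite set $\sigma=\{x_0,\dots,x_p\}\subseteq\mathbb R^d$ let $r(\sigma):=\min\{t\ge0: B_t(x_0)\cap\cdots\cap B_t(x_p)\ne\varnothing\}$, where $B_t(y)$ is the closed Euclidean ball of radius $t$ around $y$. For $P\subseteq\mathbb R^d$, $\mathrm{Cech}_r(P)$ is the simplicial complex of all nonempty finite $\sigma\subseteq P$ with $r(\sigma)\le r$. **Multicover complex.** For $P\subseteq\mathbb R^d$, $r\ge0$ and an integer $k\ge1$,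 $\mathrm{Mult}_{(r,k)}(P)$ is the simplicial complex whose vertices are $k$-element subsets of $P$, and in which distinct $k$-element subsets $\varphi_0,\dots,\varphi_p\subseteq P$ form a $p$-simplex ($p\ge0$) if and only if $\varphi_0\cup\cdots\cup\varphi_p\in\mathrm{Cech}_r(P)$. **Multifiltration.** The index set is $\mathcal S:=[0,T]\times[0,T]\times\{1,\dots,T\}$, with $(r_1,r_2,k)\le(r_1',r_2',k')$ if and only if $r_1\le r_1'$, $r_2\le r_2'$ and $k\ge k'$ (reversed order in the last coordinate). For an integer $n\ge1$ and $(r_1,r_2,k)\in\mathcal S$ put $$\mathbb K_{(r_1,r_2,k),n}:=\mathrm{Mult}_{(r_1,k)}\big(\{X_i\in[0,n]^d: M_i\le r_2\}\big).$$ For $\boldsymbol a=(r_1,r_2,k)\le\boldsymbol a'=(r_1',r_2',k')$ the simplicial map $\mathbb K_{\boldsymbol a,n}\to\mathbb K_{\boldsymbol a',n}$ sends a vertex $\varphi$ (a $k$-element set) to the set of its $k'$ smallest elements in the lexicographic order of $\mathbb R^d$. **Persistent Betti numbers.** For $\boldsymbol b\le\boldsymbol d$ in $\mathcal S$, $$\beta_{q,n}^{\boldsymbol b,\boldsymbol d}:=\dim\,\mathrm{Im}\big(H_q(\mathbb K_{\boldsymbol b,n})\to H_q(\mathbb K_{\boldsymbol d,n})\big),$$ where $H_q$ is simplicial homology with $\mathbb Z/2$-coefficients. Convention: a centered normal random vector is allowed to be degenerate (singular covariance matrix). *)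

theory Defs
  imports
    "HOL-Probability.Probability"
    "HOL-Library.Z2"
    "HOL-Library.Poly_Mapping"
    "HOL-Algebra.QuotRing"
    "Jordan_Normal_Form.Missing_VectorSpace"
begin

section \<open>Simplicial homology with coefficients in the field with two elements\<close>

text \<open>
  An abstract simplicial complex is given by the set of its simplices, a simplex being a nonempty
  finite set of vertices. A chain is a finitely supported \<^typ>\<open>bit\<close>-valued function on simplices;
  over this field no orientations are needed. Vector spaces are records with an explicit carrier, so
  that the dimension of a quotient is \<open>vectorspace.dim\<close> of the AFP entry \<open>VectorSpace\<close>.
\<close>

definition F2 :: "bit ring" where
  "F2 = \<lparr>carrier = UNIV, mult = (*), one = 1, zero = 0, add = (+)\<rparr>"

definition chain_space :: "nat \<Rightarrow> 'v set set \<Rightarrow> (bit, 'v set \<Rightarrow>\<^sub>0 bit) module" where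
  "chain_space q K =
    \<lparr>carrier = {c. Poly_Mapping.keys c \<subseteq> {\<sigma> \<in> K. card \<sigma> = Suc q}},
     mult = undefined, one = undefined, zero = 0, add = (+),
     smult = (\<lambda>a c. Poly_Mapping.map ((*) a) c)\<rparr>"

text \<open>Homology is not reduced: the boundary of a vertex is zero.\<close>

definition boundary_map :: "nat \<Rightarrow> ('v set \<Rightarrow>\<^sub>0 bit) \<Rightarrow> ('v set \<Rightarrow>\<^sub>0 bit)" where
  "boundary_map q c =
    (if q = 0 then 0
     else \<Sum>\<sigma>\<in>Poly_Mapping.keys c. \<Sum>v\<in>\<sigma>.
            Poly_Mapping.single (\<sigma> - {v}) (Poly_Mapping.lookup c \<sigma>))"

definition cycles :: "nat \<Rightarrow> 'v set set \<Rightarrow> ('v set \<Rightarrow>\<^sub>0 bit) set" where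
  "cycles q K = {c \<in> carrier (chain_space q K). boundary_map q c = 0}"

definition boundaries :: "nat \<Rightarrow> 'v set set \<Rightarrow> ('v set \<Rightarrow>\<^sub>0 bit) set" where
  "boundaries q K = boundary_map (Suc q) ` carrier (chain_space (Suc q) K)"

text \<open>The vector space of cosets \<open>V / W\<close>, in the style of \<^const>\<open>FactRing\<close>.\<close>

definition quotient_space :: "('a, 'c) module \<Rightarrow> 'c set \<Rightarrow> ('a, 'c set) module" where
  "quotient_space V W =
    \<lparr>carrier = a_rcosets\<^bsub>V\<^esub> W, mult = undefined, one = undefined, zero = W, add = set_add V,
     smult = (\<lambda>a C. \<Union>c\<in>C. W +>\<^bsub>V\<^esub> (a \<odot>\<^bsub>V\<^esub> c))\<rparr>"

definition homology :: "nat \<Rightarrow> 'v set set \<Rightarrow> (bit, ('v set \<Rightarrow>\<^sub>0 bit) set) module" where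
  "homology q K = quotient_space ((chain_space q K)\<lparr>carrier := cycles q K\<rparr>) (boundaries q K)"

text \<open>As usual, simplices on which the vertex map is not injective are sent to zero.\<close>

definition chain_map :: "('v \<Rightarrow> 'w) \<Rightarrow> ('v set \<Rightarrow>\<^sub>0 bit) \<Rightarrow> ('w set \<Rightarrow>\<^sub>0 bit)" where
  "chain_map f c =
    (\<Sum>\<sigma>\<in>Poly_Mapping.keys c.
       if inj_on f \<sigma> then Poly_Mapping.single (f ` \<sigma>) (Poly_Mapping.lookup c \<sigma>) else 0)"

definition homology_map ::
    "nat \<Rightarrow> ('v \<Rightarrow> 'w) \<Rightarrow> 'w set set \<Rightarrow> ('v set \<Rightarrow>\<^sub>0 bit) set \<Rightarrow> ('w set \<Rightarrow>\<^sub>0 bit) set" where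
  "homology_map q f L C = (\<Union>c\<in>C. boundaries q L +>\<^bsub>chain_space q L\<^esub> chain_map f c)"

text \<open>Dimension of the image of \<open>H\<^sub>q(K) \<rightarrow> H\<^sub>q(L)\<close> induced by the vertex map \<open>f\<close>.\<close>

definition persistent_betti :: "nat \<Rightarrow> ('v \<Rightarrow> 'w) \<Rightarrow> 'v set set \<Rightarrow> 'w set set \<Rightarrow> nat" where
  "persistent_betti q f K L =
    vectorspace.dim F2
      ((homology q L)\<lparr>carrier := homology_map q f L ` carrier (homology q K)\<rparr>)"


section \<open>Multicover complexes and their multifiltration\<close>

text \<open>The minimum is attained for every nonempty finite \<open>\<sigma>\<close>.\<close>

definition cech_radius :: "('a::euclidean_space) set \<Rightarrow> real" where
  "cech_radius \<sigma> = (LEAST t. 0 \<le> t \<and> (\<Inter>x\<in>\<sigma>. cball x t) \<noteq> {})"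

definition cech_complex :: "real \<Rightarrow> ('a::euclidean_space) set \<Rightarrow> 'a set set" where
  "cech_complex r P = {\<sigma>. \<sigma> \<noteq> {} \<and> finite \<sigma> \<and> \<sigma> \<subseteq> P \<and> cech_radius \<sigma> \<le> r}"

definition mult_complex :: "real \<Rightarrow> nat \<Rightarrow> ('a::euclidean_space) set \<Rightarrow> 'a set set set" where
  "mult_complex r k P =
    {\<Phi>. \<Phi> \<noteq> {} \<and> finite \<Phi> \<and> (\<forall>\<phi>\<in>\<Phi>. \<phi> \<subseteq> P \<and> finite \<phi> \<and> card \<phi> = k) \<and> \<Union>\<Phi> \<in> cech_complex r P}"

text \<open>
  The order on \<open>real ^ 'd\<close> in the library is the componentwise one. Here the coordinates are
  indexed by a linearly ordered finite type, which determines the lexicographic order.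
\<close>

definition lex_less :: "(real, 'd::{finite,linorder}) vec \<Rightarrow> (real, 'd) vec \<Rightarrow> bool" where
  "lex_less x y \<longleftrightarrow> (\<exists>i. x $ i < y $ i \<and> (\<forall>j<i. x $ j = y $ j))"

definition lex_smallest :: "nat \<Rightarrow> (real, 'd::{finite,linorder}) vec set \<Rightarrow> (real, 'd) vec set" where
  "lex_smallest k \<phi> = {x \<in> \<phi>. card {y \<in> \<phi>. lex_less y x} < k}"

type_synonym param = "real \<times> real \<times> nat"

definition params :: "nat \<Rightarrow> param set" where
  "params T = {0..real T} \<times> {0..real T} \<times> {1..T}"

fun param_le :: "param \<Rightarrow> param \<Rightarrow> bool" where
  "param_le (r1, r2, k) (r1', r2', k') \<longleftrightarrow> r1 \<le> r1' \<and> r2 \<le> r2' \<and> k' \<le> k"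

text \<open>
  The arguments \<open>x\<close> and \<open>m\<close> are the sequences of locations and of marks of a realisation.
\<close>

fun filtration :: "(nat \<Rightarrow> real ^ 'd) \<Rightarrow> (nat \<Rightarrow> real) \<Rightarrow> nat \<Rightarrow> param \<Rightarrow> (real ^ 'd) set set set" where
  "filtration x m n (r1, r2, k) =
    mult_complex r1 k {x i | i. x i \<in> cbox 0 (vec (real n)) \<and> m i \<le> r2}"

definition filtration_betti ::
    "(nat \<Rightarrow> (real, 'd::{finite,linorder}) vec) \<Rightarrow> (nat \<Rightarrow> real) \<Rightarrow> nat \<Rightarrow> nat \<Rightarrow> param \<Rightarrow> param \<Rightarrow> nat" where
  "filtration_betti x m q n b d =
    persistent_betti q (lex_smallest (snd (snd d))) (filtration x m n b) (filtration x m n d)"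

definition betti_vector ::
    "(nat \<Rightarrow> (real, 'd::{finite,linorder}) vec) \<Rightarrow> (nat \<Rightarrow> real) \<Rightarrow> nat \<Rightarrow> nat \<Rightarrow>
     ('j \<Rightarrow> param) \<Rightarrow> ('j \<Rightarrow> param) \<Rightarrow> real ^ 'j" where
  "betti_vector x m q n b d = (\<chi> j. real (filtration_betti x m q n (b j) (d j)))"


section \<open>Independently marked homogeneous Poisson point processes\<close>

text \<open>
  Locations are locally finite in every realisation. Points are counted through their indices,
  that is, with multiplicity. A Borel set of volume zero almost surely contains no point,
  by \<open>0 ^ 0 = 1\<close>.
\<close>

definition homogeneous_poisson ::
    "'w measure \<Rightarrow> real \<Rightarrow> (nat \<Rightarrow> 'w \<Rightarrow> 'a::euclidean_space) \<Rightarrow> bool" where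
  "homogeneous_poisson W rate X \<longleftrightarrow>
    prob_space W \<and>
    (\<forall>i. X i \<in> borel_measurable W) \<and>
    (\<forall>\<omega>\<in>space W. \<forall>A. bounded A \<longrightarrow> finite {i. X i \<omega> \<in> A}) \<and>
    (\<forall>A\<in>sets borel. bounded A \<longrightarrow>
      (\<forall>k. measure W {\<omega> \<in> space W. card {i. X i \<omega> \<in> A} = k} =
        (rate * measure lborel A) ^ k / fact k * exp (- (rate * measure lborel A)))) \<and>
    (\<forall>(m::nat) A. (\<forall>l<m. A l \<in> sets borel \<and> bounded (A l)) \<longrightarrow> disjoint_family_on A {..<m} \<longrightarrow>
      prob_space.indep_vars W (\<lambda>_. count_space UNIV) (\<lambda>l \<omega>. card {i. X i \<omega> \<in> A l}) {..<m})"

text \<open>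
  \<open>prob_space.indep_var\<close> only relates random variables with values in the same type, so
  independence of the two sequences is stated through the sigma-algebras that they generate.
\<close>

definition independently_marked_poisson ::
    "'w measure \<Rightarrow> real \<Rightarrow> nat \<Rightarrow> (nat \<Rightarrow> 'w \<Rightarrow> 'a::euclidean_space) \<Rightarrow> (nat \<Rightarrow> 'w \<Rightarrow> real) \<Rightarrow> bool" where
  "independently_marked_poisson W rate T X M \<longleftrightarrow>
    homogeneous_poisson W rate X \<and>
    (\<forall>i. \<forall>\<omega>\<in>space W. M i \<omega> \<in> {0..real T}) \<and>
    prob_space.indep_vars W (\<lambda>_. borel) M UNIV \<and>
    (\<forall>i. distr W borel (M i) = distr W borel (M 0)) \<and>
    prob_space.indep_set W
      {(\<lambda>\<omega> i. X i \<omega>) -` A \<inter> space W | A. A \<in> sets (PiM UNIV (\<lambda>_. borel))}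
      {(\<lambda>\<omega> i. M i \<omega>) -` A \<inter> space W | A. A \<in> sets (PiM UNIV (\<lambda>_. borel))}"


section \<open>Convergence in distribution and normal random vectors\<close>

text \<open>
  The library has \<^const>\<open>weak_conv_m\<close> on the real line only. In general, weak convergence is
  convergence of the integrals of bounded continuous functions.
\<close>

definition weakly_converges ::
    "(nat \<Rightarrow> ('a::euclidean_space) measure) \<Rightarrow> 'a measure \<Rightarrow> bool" where
  "weakly_converges \<mu> \<nu> \<longleftrightarrow>
    (\<forall>f :: 'a \<Rightarrow> real. continuous_on UNIV f \<longrightarrow> bounded (range f) \<longrightarrow>
      (\<lambda>n. \<integral>x. f x \<partial>\<mu> n) \<longlonglongrightarrow> (\<integral>x. f x \<partial>\<nu>))"

text \<open>
  The law of a centered normal random vector, i.e. one all of whose linear functionals are centered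
  normal. The case \<open>\<sigma> = 0\<close> is the point mass at zero, so singular covariance is allowed.
\<close>

definition centered_normal :: "('a::euclidean_space) measure \<Rightarrow> bool" where
  "centered_normal \<nu> \<longleftrightarrow>
    prob_space \<nu> \<and> sets \<nu> = sets borel \<and>
    (\<forall>v. \<exists>\<sigma>\<ge>0. distr \<nu> borel (\<lambda>x. x \<bullet> v) =
      (if \<sigma> = 0 then return borel 0 else density lborel (\<lambda>x. ennreal (normal_density 0 \<sigma> x))))"

end

theory Submission
  imports Defs "HOL-Library.FSet"
begin

text \<open>
  The random variables are written as functionals of independent identically distributed data, and
  the central limit theorem for these functionals rests on two properties: removing the points of
  one unit cube changes a persistent Betti number by an amount with finite second moment, and this
  change is eventually constant when the observation window grows.

  Over the field with two elements all vector spaces are finite, so dimensions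
  are binary logarithms of cardinalities. The image of \<open>H\<^sub>q(K)\<close> in \<open>H\<^sub>q(L)\<close> is
  \<open>(f(Z\<^sub>q(K)) + B\<^sub>q(L)) / B\<^sub>q(L)\<close>, so a persistent Betti number is the difference of two such
  logarithms (\<open>persistent_betti_log\<close>). Adding simplices to \<open>K\<close> and \<open>L\<close> enlarges the two groups by
  at most one factor two per new simplex of dimension \<open>q\<close> in \<open>K\<close> and of dimension \<open>q + 1\<close> in \<open>L\<close>
  (\<open>pb_log_diff_bound\<close>). If the new simplices stay the same while both complexes grow, then the
  two enlargements are sums with fixed finite groups, and the factor
  \<open>card (U + G) / card U = card G / card (U \<inter> G)\<close> stabilizes because \<open>U \<inter> G\<close> increases inside
  the finite group \<open>G\<close> (\<open>pb_log_diff_stabilizes\<close>).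

  All vertices of a simplex of a multicover complex at scale \<open>r \<le> T\<close> lie within
  distance \<open>2 * T\<close> of each other. Hence the simplices that use a point of a given unit cube are
  determined by the points in finitely many neighbouring cubes, and their number in each dimension is at most
  exponential in the number of these points, which has all exponential moments.

  The Poisson process splits into the configurations in the unit cubes of the
  integer lattice. Only occupied locations and marks matter for the complexes, so a configuration is a
  finite set, and its law is determined by the probabilities that given sets contain no point; these
  are exponentials of an additive translation invariant intensity (\<open>void_probability\<close>). Therefore the
  cells are independent and identically distributed (\<open>cells_law\<close>). For functionals of independent
  data, the variance is at most the sum of the mean square effects of the deletion of one coordinate
  (\<open>efron_stein_deletion\<close>). Applied to the difference between the functional on a large cube and
  the sum of its values on disjoint blocks of side \<open>L\<close>, this shows that the error is negligible: deep
  inside a block the two deletion effects nearly cancel by stabilization, and the proportion of the other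
  cells is small for large \<open>L\<close>. The sum over the blocks obeys the classical central limit theorem
  (\<open>central_limit\<close>).

  The argument applies to every linear combination of the Betti numbers.
  The limit variances form a positive semidefinite quadratic form, which is a sum of squares of
  linear forms and so is the covariance of a normal vector, possibly degenerate. Convergence of the
  characteristic functions together with tightness gives weak convergence
  (\<open>gaussian_limit_from_projections\<close>).
\<close>

section \<open>Weak convergence from characteristic functions\<close>

text \<open>
  Trigonometric polynomials with arbitrary real frequencies. Their expectations are determined by
  finitely many values of the characteristic function.
\<close>

inductive trig :: "('a::euclidean_space \<Rightarrow> real) \<Rightarrow> bool" where
  trig_cos: "trig (\<lambda>x. a * cos (v \<bullet> x + c))"
| trig_add: "trig f \<Longrightarrow> trig g \<Longrightarrow> trig (\<lambda>x. f x + g x)"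

lemma trig_const: "trig (\<lambda>x. a)"
  using trig_cos[of a 0 0] by simp

text \<open>
  Closure under products comes from the product-to-sum formula for cosines; it is what makes the
  Stone-Weierstrass theorem applicable.
\<close>

lemma trig_cos_mult: "trig g \<Longrightarrow> trig (\<lambda>x. a * cos (v \<bullet> x + c) * g x)"
proof (induction rule: trig.induct)
  case (trig_cos b w e)
  have "(\<lambda>x. a * cos (v \<bullet> x + c) * (b * cos (w \<bullet> x + e))) =
    (\<lambda>x. (a * b / 2) * cos ((v - w) \<bullet> x + (c - e)) + (a * b / 2) * cos ((v + w) \<bullet> x + (c + e)))"
  proof
    fix x
    have "cos (v \<bullet> x + c) * cos (w \<bullet> x + e)
        = (cos ((v \<bullet> x + c) - (w \<bullet> x + e)) + cos ((v \<bullet> x + c) + (w \<bullet> x + e))) / 2"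
      by (rule cos_times_cos)
    moreover have "(v - w) \<bullet> x + (c - e) = (v \<bullet> x + c) - (w \<bullet> x + e)"
      "(v + w) \<bullet> x + (c + e) = (v \<bullet> x + c) + (w \<bullet> x + e)"
      by (simp_all add: inner_diff_left inner_add_left)
    moreover have "a * cos (v \<bullet> x + c) * (b * cos (w \<bullet> x + e))
        = (a * b) * (cos (v \<bullet> x + c) * cos (w \<bullet> x + e))"
      by (simp only: ac_simps)
    ultimately show "a * cos (v \<bullet> x + c) * (b * cos (w \<bullet> x + e)) =
      (a * b / 2) * cos ((v - w) \<bullet> x + (c - e)) + (a * b / 2) * cos ((v + w) \<bullet> x + (c + e))"
      by (simp only:) (simp only: times_divide_eq_left times_divide_eq_right distrib_left add_divide_distrib)
  qed
  then show ?case by (simp only:) (intro trig.intros)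
next
  case (trig_add f g)
  then show ?case using trig.trig_add by (auto simp: distrib_left)
qed

lemma trig_mult: "trig f \<Longrightarrow> trig g \<Longrightarrow> trig (\<lambda>x. f x * g x)"
proof (induction f rule: trig.induct)
  case (trig_cos a v c)
  then show ?case by (rule trig_cos_mult)
next
  case (trig_add f1 f2)
  then show ?case using trig.trig_add by (auto simp: distrib_right)
qed

lemma continuous_on_trig: "trig f \<Longrightarrow> continuous_on UNIV f"
  by (induction rule: trig.induct) (auto intro!: continuous_intros)

lemma bounded_trig: "trig f \<Longrightarrow> \<exists>B. \<forall>x. \<bar>f x\<bar> \<le> B"
proof (induction rule: trig.induct)
  case (trig_cos a v c)
  show ?case by (rule exI[of _ "\<bar>a\<bar>"]) (auto simp: abs_mult mult_left_le)
next
  case (trig_add f g)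
  then obtain B C where "\<forall>x. \<bar>f x\<bar> \<le> B" "\<forall>x. \<bar>g x\<bar> \<le> C" by blast
  then show ?case by (metis abs_triangle_ineq add_mono order_trans)
qed

lemma integrable_trig:
  assumes "trig f" "prob_space M" "sets M = sets borel"
  shows "integrable M f"
proof -
  interpret prob_space M by fact
  obtain B where "\<forall>x. \<bar>f x\<bar> \<le> B" using bounded_trig[OF assms(1)] by blast
  moreover have "f \<in> borel_measurable M"
    using borel_measurable_continuous_onI[OF continuous_on_trig[OF assms(1)]] assms(3)
    by (simp cong: measurable_cong_sets)
  ultimately show ?thesis by (intro integrable_const_bound[of _ B]) auto
qed

lemma trig_expectation_converges:
  fixes \<nu> :: "'a::euclidean_space measure"
  assumes M: "\<And>n. prob_space (\<mu> n)" "\<And>n. sets (\<mu> n) = sets borel"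
    and N: "prob_space \<nu>" "sets \<nu> = sets borel"
    and conv: "\<And>v. (\<lambda>n. LINT x|\<mu> n. cis (v \<bullet> x)) \<longlonglongrightarrow> (LINT x|\<nu>. cis (v \<bullet> x))"
    and "trig f"
  shows "(\<lambda>n. LINT x|\<mu> n. f x) \<longlonglongrightarrow> (LINT x|\<nu>. f x)"
  using \<open>trig f\<close>
proof (induction rule: trig.induct)
  case (trig_cos a v c)
  have eq: "(LINT x|m. a * cos (v \<bullet> x + c)) = a * Re (cis c * (LINT x|m. cis (v \<bullet> x)))"
    if m: "prob_space m" "sets m = sets borel" for m :: "'a measure"
  proof -
    interpret prob_space m by fact
    have "(\<lambda>x. cis (v \<bullet> x)) \<in> borel_measurable m"
      using borel_measurable_continuous_onI[of "\<lambda>x. cis (v \<bullet> x)"] m(2)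
      by (auto simp: cis_conv_exp intro!: continuous_intros cong: measurable_cong_sets)
    then have i: "integrable m (\<lambda>x. cis c * cis (v \<bullet> x))"
      by (intro integrable_mult_right integrable_const_bound[of _ 1]) auto
    have "Re (cis c * (LINT x|m. cis (v \<bullet> x))) = Re (LINT x|m. cis c * cis (v \<bullet> x))"
      by simp
    also have "\<dots> = (LINT x|m. Re (cis c * cis (v \<bullet> x)))"
      using i by (simp only: integral_Re)
    also have "\<dots> = (LINT x|m. cos (v \<bullet> x + c))"
      by (simp add: cis_mult add.commute)
    finally show ?thesis by simp
  qed
  show ?case
    unfolding eq[OF M] eq[OF N] by (intro tendsto_intros conv)
next
  case (trig_add f g)
  then have "(\<lambda>n. (LINT x|\<mu> n. f x) + (LINT x|\<mu> n. g x)) \<longlonglongrightarrow> (LINT x|\<nu>. f x) + (LINT x|\<nu>. g x)"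
    by (intro tendsto_add)
  then show ?case
    using trig_add.hyps by (simp add: integrable_trig M N)
qed

lemma cis_eq_imp_diff:
  assumes "cis a = cis b" shows "\<exists>n::int. a - b = 2 * pi * of_int n"
proof -
  have "exp (\<i> * of_real a) = exp (\<i> * of_real b)" using assms by (simp add: cis_conv_exp)
  then obtain n :: int where "\<i> * of_real a = \<i> * of_real b + (of_int (2 * n) * pi) * \<i>"
    by (auto simp: exp_eq)
  then have "\<i> * of_real a = \<i> * of_real (b + 2 * pi * of_int n)" by (simp add: algebra_simps)
  then have "a = b + 2 * pi * of_int n" by (simp only: mult_cancel_left of_real_eq_iff) auto
  then show ?thesis by auto
qed

text \<open>
  A function that vanishes near the boundary of a cube and outside it becomes a continuous
  function on a torus after the opposite faces are glued. There the Stone-Weierstrass theorem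
  gives a trigonometric approximation. It is close to \<open>f\<close> only on the cube, but its
  bound holds everywhere by periodicity, which is what a tightness argument needs.
\<close>

lemma trig_approximation:
  fixes f :: "real^'j::finite \<Rightarrow> real"
  assumes f: "continuous_on UNIV f" and A: "A > 0"
    and zero: "\<And>x k. A \<le> \<bar>x $ k\<bar> \<Longrightarrow> f x = 0" and B: "\<And>x. \<bar>f x\<bar> \<le> B" and e: "e > 0"
  shows "\<exists>g. trig g \<and> (\<forall>x. (\<forall>k. \<bar>x $ k\<bar> \<le> A) \<longrightarrow> \<bar>f x - g x\<bar> < e) \<and> (\<forall>x. \<bar>g x\<bar> \<le> B + e)"
proof -
  \<comment> \<open>The map \<open>\<Theta>\<close> wraps the cube of side \<open>2 * A\<close> around
    a torus; it identifies exactly the opposite faces, where \<open>f\<close> is zero.\<close>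
  define \<delta> where "\<delta> = pi / A"
  define \<Theta> :: "real^'j \<Rightarrow> complex^'j" where "\<Theta> x = (\<chi> k. cis (\<delta> * x $ k))" for x
  define K :: "(real^'j) set" where "K = cbox (\<chi> k. - A) (\<chi> k. A)"
  define S where "S = \<Theta> ` K"
  have K: "x \<in> K \<longleftrightarrow> (\<forall>k. \<bar>x $ k\<bar> \<le> A)" for x
    by (auto simp: K_def mem_box_cart abs_le_iff minus_le_iff)
  have cont: "continuous_on X \<Theta>" for X
    unfolding \<Theta>_def[abs_def] cis_conv_exp by (intro continuous_intros)
  have compS: "compact S"
    unfolding S_def K_def by (intro compact_continuous_image cont compact_cbox)
  have surj: "\<exists>y\<in>K. \<Theta> y = \<Theta> x" for x
  proof
    let ?y = "\<chi> k. x $ k - 2 * A * of_int (round (x $ k / (2 * A)))"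
    show "?y \<in> K"
      unfolding K
    proof
      fix k
      have "\<bar>of_int (round (x $ k / (2 * A))) - x $ k / (2 * A)\<bar> \<le> 1 / 2" by (rule of_int_round_abs_le)
      then have "2 * A * \<bar>of_int (round (x $ k / (2 * A))) - x $ k / (2 * A)\<bar> \<le> 2 * A * (1 / 2)"
        using A by (intro mult_left_mono) auto
      also have "2 * A * \<bar>of_int (round (x $ k / (2 * A))) - x $ k / (2 * A)\<bar>
          = \<bar>2 * A * (of_int (round (x $ k / (2 * A))) - x $ k / (2 * A))\<bar>"
        using A by (simp add: abs_mult)
      also have "2 * A * (of_int (round (x $ k / (2 * A))) - x $ k / (2 * A)) = - ?y $ k"
        using A by (simp add: field_simps)
      finally show "\<bar>?y $ k\<bar> \<le> A" by simp
    qed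
    show "\<Theta> ?y = \<Theta> x"
    proof -
      have "cis (\<delta> * (x $ k - 2 * A * of_int n)) = cis (\<delta> * x $ k)" for k and n :: int
      proof -
        have "\<delta> * (x $ k - 2 * A * of_int n) = \<delta> * x $ k + 2 * pi * of_int (- n)"
          using A by (simp add: \<delta>_def field_simps)
        then show ?thesis
          by (simp only: cis_mult[symmetric] cis_multiple_2pi Ints_of_int mult_1_right)
      qed
      then show ?thesis by (simp add: \<Theta>_def)
    qed
  qed
  define G where "G z = f (inv_into K \<Theta> z)" for z
  have G: "G (\<Theta> y) = f y" if y: "y \<in> K" for y
  proof -
    let ?y = "inv_into K \<Theta> (\<Theta> y)"
    have y': "?y \<in> K" "\<Theta> ?y = \<Theta> y"
      using y by (auto intro: inv_into_into f_inv_into_f)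
    show ?thesis
    proof (cases "?y = y")
      case False
      then obtain k where k: "?y $ k \<noteq> y $ k" by (auto simp: vec_eq_iff)
      have "cis (\<delta> * ?y $ k) = cis (\<delta> * y $ k)"
        using y'(2) unfolding \<Theta>_def by (simp add: vec_eq_iff)
      then obtain n :: int where n: "\<delta> * ?y $ k - \<delta> * y $ k = 2 * pi * of_int n"
        using cis_eq_imp_diff by blast
      have "?y $ k - y $ k = (\<delta> * ?y $ k - \<delta> * y $ k) / \<delta>"
        using A by (simp add: \<delta>_def field_simps)
      then have n': "?y $ k - y $ k = 2 * A * of_int n" using n A by (simp add: \<delta>_def)
      then have "n \<noteq> 0" using k by auto
      then have "1 \<le> \<bar>real_of_int n\<bar>" by linarith
      then have "2 * A \<le> \<bar>?y $ k - y $ k\<bar>" using A by (simp add: n' abs_mult)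
      moreover have "\<bar>?y $ k\<bar> \<le> A" "\<bar>y $ k\<bar> \<le> A" using y' y by (auto simp: K)
      ultimately have "A \<le> \<bar>?y $ k\<bar>" "A \<le> \<bar>y $ k\<bar>" by linarith+
      then show ?thesis by (simp add: G_def zero)
    qed (simp add: G_def)
  qed
  have contG: "continuous_on S G"
    unfolding continuous_on_closed_invariant
  proof (intro allI impI)
    fix T :: "real set" assume "closed T"
    have "compact (K \<inter> f -` T)"
      using continuous_closed_vimage[OF \<open>closed T\<close>, of f] f
      by (auto simp: K_def continuous_on_eq_continuous_at intro!: compact_Int_closed)
    then have "closed (\<Theta> ` (K \<inter> f -` T))"
      by (intro compact_imp_closed compact_continuous_image cont)
    moreover have "\<Theta> ` (K \<inter> f -` T) \<inter> S = G -` T \<inter> S"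
      using G by (auto simp: S_def)
    ultimately show "\<exists>C. closed C \<and> C \<inter> S = G -` T \<inter> S" by blast
  qed
  define R where "R = {g. continuous_on S g \<and> trig (\<lambda>x. g (\<Theta> x))}"
  interpret function_ring_on R S
  proof
    show "\<exists>f\<in>R. f x \<noteq> f y" if xy: "x \<in> S" "y \<in> S" "x \<noteq> y" for x y
    proof -
    from xy obtain k where k: "x $ k \<noteq> y $ k" by (auto simp: vec_eq_iff)
    have co: "(\<lambda>x. cos (\<delta> * x $ k)) = (\<lambda>x. 1 * cos (axis k \<delta> \<bullet> x + 0))"
      by (simp add: inner_axis' )
    have si: "(\<lambda>x. sin (\<delta> * x $ k)) = (\<lambda>x. 1 * cos (axis k \<delta> \<bullet> x + (- (pi / 2))))"
      by (simp add: inner_axis' cos_diff)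
    have "trig (\<lambda>x. cos (\<delta> * x $ k))" "trig (\<lambda>x. sin (\<delta> * x $ k))"
      unfolding co si by (rule trig_cos)+
    then have R: "(\<lambda>z. Re (z $ k)) \<in> R" "(\<lambda>z. Im (z $ k)) \<in> R"
      by (auto simp: R_def \<Theta>_def intro!: continuous_intros)
    have "Re (x $ k) \<noteq> Re (y $ k) \<or> Im (x $ k) \<noteq> Im (y $ k)"
      using k by (simp add: complex_eq_iff)
    then show ?thesis using bexI[OF _ R(1)] bexI[OF _ R(2)] by (elim disjE) simp_all
    qed
    show "compact S" by (rule compS)
    show "continuous_on S g" if "g \<in> R" for g using that by (simp add: R_def)
    show "(\<lambda>x. c) \<in> R" for c by (simp add: R_def trig_const)
    fix g h assume "g \<in> R" "h \<in> R"
    then show "(\<lambda>x. g x + h x) \<in> R" "(\<lambda>x. g x * h x) \<in> R"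
      using trig_add[of "\<lambda>x. g (\<Theta> x)" "\<lambda>x. h (\<Theta> x)"] trig_mult[of "\<lambda>x. g (\<Theta> x)" "\<lambda>x. h (\<Theta> x)"]
      by (simp_all add: R_def continuous_on_add continuous_on_mult)
  qed
  obtain g where g: "g \<in> R" "\<And>z. z \<in> S \<Longrightarrow> \<bar>G z - g z\<bar> < e"
    using Stone_Weierstrass_basic[OF contG e] by blast
  have "\<bar>g (\<Theta> x)\<bar> \<le> B + e" for x
  proof -
    obtain y where y: "y \<in> K" "\<Theta> y = \<Theta> x" using surj by blast
    then have "\<bar>f y - g (\<Theta> x)\<bar> < e" using g(2)[of "\<Theta> y"] G[OF y(1)] imageI[OF y(1), of \<Theta>]
      by (simp add: S_def)
    then show ?thesis using B[of y] by linarith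
  qed
  moreover have "\<bar>f x - g (\<Theta> x)\<bar> < e" if "\<forall>k. \<bar>x $ k\<bar> \<le> A" for x
    using g(2)[of "\<Theta> x"] G[of x] that by (auto simp: S_def K)
  ultimately show ?thesis using g(1) by (intro exI[of _ "\<lambda>x. g (\<Theta> x)"]) (auto simp: R_def)
qed

lemma prob_tight:
  fixes \<nu> :: "'a::euclidean_space measure"
  assumes "prob_space \<nu>" "sets \<nu> = sets borel" "e > 0"
  shows "\<exists>R0. \<forall>R\<ge>R0. measure \<nu> {x. R < norm x} \<le> e"
proof -
  interpret prob_space \<nu> by fact
  have m: "{x. R < norm x} \<in> sets \<nu>" for R :: real
    unfolding assms(2) by measurable
  have "(\<lambda>n. measure \<nu> {x. real n < norm x}) \<longlonglongrightarrow> measure \<nu> (\<Inter>n. {x. real n < norm x})"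
    by (rule finite_Lim_measure_decseq) (use m in \<open>auto simp: decseq_def\<close>)
  moreover have "(\<Inter>n. {x::'a. real n < norm x}) = {}"
  proof -
    have "\<exists>n. \<not> real n < norm x" for x :: 'a
      using real_arch_simple[of "norm x"] by (simp add: not_less)
    then show ?thesis by blast
  qed
  ultimately have "(\<lambda>n. measure \<nu> {x. real n < norm x}) \<longlonglongrightarrow> 0" by simp
  then have "eventually (\<lambda>n. measure \<nu> {x. real n < norm x} < e) sequentially"
    using assms(3) by (rule order_tendstoD(2))
  then obtain n :: nat where n: "measure \<nu> {x. real n < norm x} < e"
    by (auto simp: eventually_sequentially)
  have "measure \<nu> {x. R < norm x} \<le> e" if "R \<ge> real n" for R
    using finite_measure_mono[of "{x. R < norm x}" "{x. real n < norm x}"] that n m by force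
  then show ?thesis by blast
qed

text \<open>
  By tightness the integrand may be cut off outside a large ball, up to a small error for all
  measures at once; the cut off function is then replaced by a trigonometric polynomial.
\<close>

theorem weakly_convergesI_char:
  fixes \<mu> :: "nat \<Rightarrow> (real^'j::finite) measure"
  assumes M: "\<And>n. prob_space (\<mu> n)" "\<And>n. sets (\<mu> n) = sets borel"
    and N: "prob_space \<nu>" "sets \<nu> = sets borel"
    and conv: "\<And>v. (\<lambda>n. LINT x|\<mu> n. cis (v \<bullet> x)) \<longlonglongrightarrow> (LINT x|\<nu>. cis (v \<bullet> x))"
    and tight: "\<And>e. e > 0 \<Longrightarrow> \<exists>R0. \<forall>R\<ge>R0. \<forall>n. measure (\<mu> n) {x. R < norm x} \<le> e"
  shows "weakly_converges \<mu> \<nu>"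
  unfolding weakly_converges_def
proof (intro allI impI)
  fix f :: "real^'j \<Rightarrow> real"
  assume f: "continuous_on UNIV f" and "bounded (range f)"
  then obtain B where B: "\<And>x. \<bar>f x\<bar> \<le> B" and B1: "B > 0"
    unfolding bounded_pos by auto
  show "(\<lambda>n. \<integral>x. f x \<partial>\<mu> n) \<longlonglongrightarrow> (\<integral>x. f x \<partial>\<nu>)"
  proof (rule LIMSEQ_I)
    fix r :: real assume r: "r > 0"
    \<comment> \<open>The total error \<open>e + (2 * B + 1) * e\<close> of the approximation below is
      then at most \<open>r / 4\<close> for each measure.\<close>
    define e where "e = min 1 (r / (4 * (2 * B + 2)))"
    have e: "e > 0" "e \<le> 1" using r B1 by (auto simp: e_def)
    have "e * (2 * B + 2) \<le> r / 4"
    proof -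
      have "e * (2 * B + 2) \<le> r / (4 * (2 * B + 2)) * (2 * B + 2)"
        using B1 by (intro mult_right_mono) (auto simp: e_def)
      also have "\<dots> = r / 4" using B1 by (simp add: field_simps)
      finally show ?thesis .
    qed
    obtain R1 where R1: "\<And>R n. R \<ge> R1 \<Longrightarrow> measure (\<mu> n) {x. R < norm x} \<le> e" using tight[OF e(1)] by blast
    obtain R2 where R2: "\<And>R. R \<ge> R2 \<Longrightarrow> measure \<nu> {x. R < norm x} \<le> e" using prob_tight[OF N e(1)] by blast
    define R where "R = max 1 (max R1 R2)"
    \<comment> \<open>The cut off is continuous, equals one on the ball of radius \<open>R\<close> and
      zero outside the ball of radius \<open>R + 1\<close>.\<close>
    define h where "h x = f x * max 0 (min 1 (R + 1 - norm x))" for x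
    have hB: "\<bar>h x\<bar> \<le> B" for x
    proof -
      have "\<bar>f x\<bar> * \<bar>max 0 (min 1 (R + 1 - norm x))\<bar> \<le> B * 1" using B[of x] B1 by (intro mult_mono) auto
      then show ?thesis by (simp add: h_def abs_mult)
    qed
    have "\<exists>g. trig g \<and> (\<forall>x. (\<forall>k. \<bar>x $ k\<bar> \<le> R + 1) \<longrightarrow> \<bar>h x - g x\<bar> < e) \<and> (\<forall>x. \<bar>g x\<bar> \<le> B + e)"
    proof (rule trig_approximation[OF _ _ _ hB e(1)])
      show "continuous_on UNIV h" unfolding h_def[abs_def] by (intro continuous_intros f)
      show "R + 1 > 0" by (simp add: R_def)
      show "h x = 0" if "R + 1 \<le> \<bar>x $ k\<bar>" for x k
        using that component_le_norm_cart[of x k] by (simp add: h_def)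
    qed
    then obtain g where g: "trig g" "\<And>x. (\<forall>k. \<bar>x $ k\<bar> \<le> R + 1) \<Longrightarrow> \<bar>h x - g x\<bar> < e" "\<And>x. \<bar>g x\<bar> \<le> B + e"
      by blast
    have close: "\<bar>(LINT x|m. f x) - (LINT x|m. g x)\<bar> \<le> r / 4"
      if m: "prob_space m" "sets m = sets borel" "measure m {x. R < norm x} \<le> e" for m
    proof -
      interpret prob_space m by fact
      have ig: "integrable m g" by (rule integrable_trig[OF g(1) m(1,2)])
      have if': "integrable m f"
        using B borel_measurable_continuous_onI[OF f] m(2)
        by (intro integrable_const_bound[of _ B]) (auto cong: measurable_cong_sets)
      have ms: "{x. R < norm x} \<in> sets m" unfolding m(2) by measurable
      have sp: "space m = UNIV" using sets_eq_imp_space_eq[OF m(2)] by simp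
      have ii: "integrable m (indicat_real {x. R < norm x})"
        by (rule integrable_real_indicator) (use ms in \<open>auto simp: less_top[symmetric]\<close>)
      have bd: "\<bar>f x - g x\<bar> \<le> e + (2 * B + 1) * indicat_real {x. R < norm x} x" for x
      proof (cases "R < norm x")
        case True
        then show ?thesis using B[of x] g(3)[of x] e by (simp add: indicator_def)
      next
        case False
        then have "h x = f x" by (simp add: h_def)
        moreover have "\<forall>k. \<bar>x $ k\<bar> \<le> R + 1"
          using False component_le_norm_cart[of x] by (metis add_increasing2 linorder_not_less order.trans zero_le_one)
        ultimately show ?thesis using g(2)[of x] False by (simp add: indicator_def)
      qed
      have "\<bar>(LINT x|m. f x) - (LINT x|m. g x)\<bar> = \<bar>LINT x|m. f x - g x\<bar>"
        using ig if' by simp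
      also have "\<dots> \<le> (LINT x|m. \<bar>f x - g x\<bar>)" by (rule integral_abs_bound)
      also have "\<dots> \<le> (LINT x|m. e + (2 * B + 1) * indicat_real {x. R < norm x} x)"
        by (intro integral_mono Bochner_Integration.integrable_add bd)
          (use ig if' ii in auto)
      also have "\<dots> = e + (2 * B + 1) * measure m {x. R < norm x}"
        using ii prob_space by (simp add: sp)
      also have "\<dots> \<le> e + (2 * B + 1) * e" using m(3) B1 by (intro add_left_mono mult_left_mono) auto
      also have "\<dots> = e * (2 * B + 2)" by (simp add: algebra_simps)
      also have "\<dots> \<le> r / 4" by fact
      finally show ?thesis .
    qed
    have cM: "\<bar>(LINT x|\<mu> n. f x) - (LINT x|\<mu> n. g x)\<bar> \<le> r / 4" for n
      by (rule close[OF M R1]) (simp add: R_def)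
    have cN: "\<bar>(LINT x|\<nu>. f x) - (LINT x|\<nu>. g x)\<bar> \<le> r / 4"
      by (rule close[OF N R2]) (simp add: R_def)
    obtain n0 where n0: "\<And>n. n \<ge> n0 \<Longrightarrow> \<bar>(LINT x|\<mu> n. g x) - (LINT x|\<nu>. g x)\<bar> < r / 4"
      using LIMSEQ_D[OF trig_expectation_converges[OF M N conv g(1)], of "r/4"] r by auto
    show "\<exists>n0. \<forall>n\<ge>n0. norm ((LINT x|\<mu> n. f x) - (LINT x|\<nu>. f x)) < r"
    proof (intro exI allI impI)
      fix n assume "n \<ge> n0"
      from n0[OF this] cM[of n] cN r
      show "norm ((LINT x|\<mu> n. f x) - (LINT x|\<nu>. f x)) < r" unfolding real_norm_def by linarith
    qed
  qed
qed

section \<open>Positive semidefinite forms and centered normal vectors\<close>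

lemma psd_cauchy_schwarz:
  fixes B :: "'a::real_vector \<Rightarrow> 'a \<Rightarrow> real"
  assumes lin: "\<And>x. linear (B x)" and sym: "\<And>x y. B x y = B y x" and psd: "\<And>x. 0 \<le> B x x"
  shows "(B e x)\<^sup>2 \<le> B e e * B x x"
proof -
  have add: "B (x + y) z = B x z + B y z" "B z (x + y) = B z x + B z y" for x y z
    using linear_add[OF lin] sym by metis+
  have sc: "B (t *\<^sub>R x) z = t * B x z" "B z (t *\<^sub>R x) = t * B z x" for t x z
    using linear_cmul[OF lin] sym by (metis real_scaleR_def)+
  have exp: "0 \<le> B x x + 2 * t * B e x + t\<^sup>2 * B e e" for t
    using psd[of "x + t *\<^sub>R e"] by (simp add: add sc sym[of x e] power2_eq_square algebra_simps)
  show ?thesis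
  proof (cases "B e e = 0")
    case True
    have "B e x = 0"
    proof (rule ccontr)
      assume n: "B e x \<noteq> 0"
      have "2 * (- (B x x + 1) / (2 * B e x)) * B e x = - (B x x + 1)" using n by simp
      then show False using exp[of "- (B x x + 1) / (2 * B e x)"] True by simp
    qed
    then show ?thesis using True by simp
  next
    case False
    then have pos: "B e e > 0" using psd[of e] by simp
    have "0 \<le> B x x + 2 * (- B e x / B e e) * B e x + (- B e x / B e e)\<^sup>2 * B e e" by (rule exp)
    also have "\<dots> = B x x - (B e x)\<^sup>2 / B e e"
      using pos by (simp add: power2_eq_square field_simps)
    finally show ?thesis using pos by (simp add: field_simps)
  qed
qed

text \<open>
  Gauss reduction to diagonal form: each basis vector \<open>e\<close> contributes the square of
  the linear form \<open>B e / sqrt (B e e)\<close>, and the remainder stays positive semidefinite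
  by the Cauchy-Schwarz inequality while it vanishes on \<open>e\<close>.
\<close>

lemma psd_reduction:
  fixes B :: "'a::real_vector \<Rightarrow> 'a \<Rightarrow> real"
  assumes "finite E" and lin: "\<And>x. linear (B x)" and sym: "\<And>x y. B x y = B y x" and psd: "\<And>x. 0 \<le> B x x"
  shows "\<exists>(l :: 'a \<Rightarrow> 'a \<Rightarrow> real) B'. (\<forall>e. linear (l e)) \<and> (\<forall>x y. B x y = (\<Sum>e\<in>E. l e x * l e y) + B' x y) \<and>
    (\<forall>x. linear (B' x)) \<and> (\<forall>x y. B' x y = B' y x) \<and> (\<forall>x. 0 \<le> B' x x) \<and> (\<forall>e\<in>E. \<forall>y. B' e y = 0)"
  using \<open>finite E\<close>
proof (induction E)
  case empty
  show ?case using lin sym psd by (intro exI[of _ "\<lambda>_ _. 0"] exI[of _ B]) (auto simp: linear_iff)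
next
  case (insert e E)
  then obtain l B' where l: "\<And>e. linear (l e :: 'a \<Rightarrow> real)" and B: "\<And>x y. B x y = (\<Sum>e\<in>E. l e x * l e y) + B' x y"
    and B': "\<And>x. linear (B' x)" "\<And>x y. B' x y = B' y x" "\<And>x. 0 \<le> B' x x" "\<And>e y. e \<in> E \<Longrightarrow> B' e y = 0"
    by blast
  \<comment> \<open>If \<open>B' e e = 0\<close>, division by zero makes \<open>k\<close> the zero functional.\<close>
  define k where "k x = B' e x / sqrt (B' e e)" for x
  have cs: "(B' e x)\<^sup>2 \<le> B' e e * B' x x" for x by (rule psd_cauchy_schwarz[OF B'(1-3)])
  have kk: "k x * k y = B' e x * B' e y / B' e e" for x y
    using B'(3)[of e] by (simp add: k_def)
  have lin_k: "linear k"
    using linear_add[OF B'(1)] linear_cmul[OF B'(1)]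
    by (intro linearI) (auto simp: k_def add_divide_distrib)
  define B'' where "B'' x y = B' x y - k x * k y" for x y
  have C1: "linear ((l(e := k)) f)" for f using l lin_k by simp
  have C2: "B x y = (\<Sum>f\<in>insert e E. (l(e := k)) f x * (l(e := k)) f y) + B'' x y" for x y
  proof -
    have "(\<Sum>f\<in>E. (l(e := k)) f x * (l(e := k)) f y) = (\<Sum>f\<in>E. l f x * l f y)"
      using insert.hyps by (intro sum.cong) auto
    then show ?thesis using insert.hyps B[of x y] by (simp add: B''_def)
  qed
  have C3: "linear (B'' x)" for x
    using linear_add[OF B'(1)] linear_cmul[OF B'(1)] linear_add[OF lin_k] linear_cmul[OF lin_k]
    by (intro linearI) (auto simp: B''_def algebra_simps)
  have C4: "B'' x y = B'' y x" for x y by (simp add: B''_def B'(2)[of x y])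
  have C5: "0 \<le> B'' x x" for x
    using cs[of x] B'(3)[of e] B'(3)[of x]
    by (cases "B' e e = 0") (auto simp: B''_def kk power2_eq_square field_simps)
  have C6: "B'' f y = 0" if "f \<in> insert e E" for f y
  proof (cases "f = e")
    case True
    show ?thesis
    proof (cases "B' e e = 0")
      case z: True
      then have "B' e y = 0" using cs[of y] by simp
      then show ?thesis by (simp add: True B''_def kk)
    qed (simp add: True B''_def kk)
  next
    case False
    then have "B' f y = 0" "B' e f = 0" using that B'(4)[of f] B'(2)[of e f] by auto
    then show ?thesis by (simp add: B''_def k_def)
  qed
  show ?case
    by (intro exI[of _ "l(e := k)"] exI[of _ B''] conjI allI ballI C1 C2 C3 C4 C5 C6)
qed

text \<open>
  After the reduction along a whole basis the remainder is zero, and linear forms on a Euclidean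
  space are inner products.
\<close>

theorem psd_form_sum_of_squares:
  fixes B :: "'a::euclidean_space \<Rightarrow> 'a \<Rightarrow> real"
  assumes lin: "\<And>x. linear (B x)" and sym: "\<And>x y. B x y = B y x" and psd: "\<And>x. 0 \<le> B x x"
  shows "\<exists>a :: 'a \<Rightarrow> 'a. \<forall>x. B x x = (\<Sum>e\<in>Basis. (x \<bullet> a e)\<^sup>2)"
proof -
  obtain l B' where l: "\<And>e. linear (l e :: 'a \<Rightarrow> real)" and B: "\<And>x y. B x y = (\<Sum>e\<in>(Basis :: 'a set). l e x * l e y) + B' x y"
    and B': "\<And>x. linear (B' x)" "\<And>x y. B' x y = B' y x" "\<And>e y. e \<in> Basis \<Longrightarrow> B' e y = 0"
    using psd_reduction[OF finite_Basis lin sym psd] by blast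
  have "B' x x = 0" for x
  proof -
    have "B' x x = B' x (\<Sum>e\<in>Basis. (x \<bullet> e) *\<^sub>R e)" by (simp add: euclidean_representation)
    also have "\<dots> = (\<Sum>e\<in>Basis. (x \<bullet> e) * B' x e)"
      by (simp add: linear_sum[OF B'(1)] linear_cmul[OF B'(1)])
    also have "\<dots> = 0" using B'(2,3) by (intro sum.neutral) (metis mult_zero_right)
    finally show ?thesis .
  qed
  then have Q: "B x x = (\<Sum>e\<in>Basis. (l e x)\<^sup>2)" for x
    using B[of x x] by (simp add: power2_eq_square)
  have l': "l e x = x \<bullet> (\<Sum>f\<in>Basis. l e f *\<^sub>R f)" for e x
  proof -
    have "l e x = l e (\<Sum>f\<in>Basis. (x \<bullet> f) *\<^sub>R f)" by (simp add: euclidean_representation)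
    also have "\<dots> = (\<Sum>f\<in>Basis. (x \<bullet> f) * l e f)" by (simp add: linear_sum[OF l] linear_cmul[OF l])
    finally show ?thesis by (simp add: inner_sum_right mult.commute)
  qed
  show ?thesis
    by (intro exI[of _ "\<lambda>e. \<Sum>f\<in>Basis. l e f *\<^sub>R f"]) (simp only: Q l'[symmetric] simp_thms)
qed

lemma char_scaled:
  fixes f :: "'a \<Rightarrow> real"
  assumes "f \<in> borel_measurable M"
  shows "char (distr M borel (\<lambda>x. c * f x)) t = char (distr M borel f) (c * t)"
  using assms by (simp add: char_def integral_distr mult_ac)

definition normal_law :: "real \<Rightarrow> real measure" where
  "normal_law s = (if s = 0 then return borel 0 else density lborel (\<lambda>x. ennreal (normal_density 0 s x)))"

lemma normal_law_eq_distr: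
  assumes "s \<ge> 0"
  shows "normal_law s = distr std_normal_distribution borel (\<lambda>x. s * x)"
proof (cases "s = 0")
  case True
  interpret real_distribution std_normal_distribution by (rule real_dist_normal_dist)
  show ?thesis using True by (simp add: normal_law_def distr_const)
next
  case False
  interpret real_distribution std_normal_distribution by (rule real_dist_normal_dist)
  have "distributed std_normal_distribution lborel (\<lambda>x. x) std_normal_density"
  proof -
    have "distr std_normal_distribution lborel (\<lambda>x. x) = std_normal_distribution"
      by (rule distr_id2) simp
    then show ?thesis by (simp add: distributed_def)
  qed
  from normal_density_affine[OF this, of s 0] False assms
  have "distributed std_normal_distribution lborel (\<lambda>x. s * x) (normal_density 0 s)" by simp
  then have "distr std_normal_distribution lborel (\<lambda>x. s * x) = density lborel (normal_density 0 s)"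
    by (simp add: distributed_def)
  moreover have "distr std_normal_distribution lborel (\<lambda>x. s * x) = distr std_normal_distribution borel (\<lambda>x. s * x)"
    by (rule distr_cong) auto
  ultimately show ?thesis using False by (simp add: normal_law_def)
qed

lemma real_distribution_normal_law: "s \<ge> 0 \<Longrightarrow> real_distribution (normal_law s)"
proof -
  interpret real_distribution std_normal_distribution by (rule real_dist_normal_dist)
  show "s \<ge> 0 \<Longrightarrow> real_distribution (normal_law s)"
    by (simp add: normal_law_eq_distr real_distribution_distr)
qed

lemma char_normal_law:
  assumes "s \<ge> 0"
  shows "char (normal_law s) t = complex_of_real (exp (- (s\<^sup>2 * t\<^sup>2) / 2))"
proof -
  have "char (normal_law s) t = char (distr std_normal_distribution borel (\<lambda>x. x)) (s * t)"
    unfolding normal_law_eq_distr[OF assms] by (rule char_scaled) auto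
  also have "distr std_normal_distribution borel (\<lambda>x. x) = std_normal_distribution"
    by (rule distr_id2) simp
  finally show ?thesis by (simp add: char_std_normal_distribution power_mult_distrib)
qed

text \<open>
  The normal vector is the image \<open>\<Sum>e. \<omega> e *\<^sub>R a e\<close> of independent
  standard normal coordinates \<open>\<omega> e\<close>, so a degenerate covariance causes no
  difficulty.
\<close>

theorem centered_normal_exists:
  fixes a :: "'a::euclidean_space \<Rightarrow> 'a"
  shows "\<exists>\<nu> :: 'a measure. centered_normal \<nu> \<and>
    (\<forall>v. (LINT x|\<nu>. cis (v \<bullet> x)) = complex_of_real (exp (- (\<Sum>e\<in>Basis. (v \<bullet> a e)\<^sup>2) / 2)))"
proof -
  interpret N: real_distribution std_normal_distribution by (rule real_dist_normal_dist)
  define P where "P = PiM (Basis :: 'a set) (\<lambda>_. std_normal_distribution)"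
  interpret P: prob_space P unfolding P_def by (intro prob_space_PiM N.prob_space_axioms)
  have setsP: "sets P = sets (PiM (Basis :: 'a set) (\<lambda>_. borel))"
    unfolding P_def by (intro sets_PiM_cong) auto
  have comp: "(\<lambda>\<omega>. \<omega> e) \<in> borel_measurable P" if "e \<in> Basis" for e
    unfolding measurable_cong_sets[OF setsP refl] using that by measurable
  define G where "G \<omega> = (\<Sum>e\<in>Basis. \<omega> e *\<^sub>R a e)" for \<omega>
  have G: "G \<in> borel_measurable P"
    unfolding G_def[abs_def] by (intro borel_measurable_sum borel_measurable_scaleR comp) auto
  define \<nu> where "\<nu> = distr P borel G"
  have indep: "P.indep_vars (\<lambda>_. borel) (\<lambda>e \<omega>. (v \<bullet> a e) * \<omega> e) Basis" for v
  proof -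
    have "P.indep_vars (\<lambda>_. borel) (\<lambda>e \<omega>. \<omega> e) Basis"
    proof (subst P.indep_vars_iff_distr_eq_PiM')
      have d: "distr P borel (\<lambda>\<omega>. \<omega> e) = std_normal_distribution" if "e \<in> Basis" for e
      proof -
        have "distr P borel (\<lambda>\<omega>. \<omega> e) = distr P std_normal_distribution (\<lambda>\<omega>. \<omega> e)"
          by (rule distr_cong) auto
        also have "\<dots> = std_normal_distribution"
          unfolding P_def by (rule distr_PiM_component) (auto simp: that N.prob_space_axioms)
        finally show ?thesis .
      qed
      have "distr P (PiM Basis (\<lambda>_. borel)) (\<lambda>x. \<lambda>i\<in>Basis. x i) = distr P P (\<lambda>x. x)"
        using setsP by (intro distr_cong) (auto simp: P_def space_PiM)
      also have "\<dots> = P" by simp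
      also have "\<dots> = PiM Basis (\<lambda>i. distr P borel (\<lambda>x. x i))"
        unfolding P_def[symmetric] by (subst P_def) (intro PiM_cong refl d[symmetric])
      finally show "distr P (PiM Basis (\<lambda>_. borel)) (\<lambda>x. \<lambda>i\<in>Basis. x i) = PiM Basis (\<lambda>i. distr P borel (\<lambda>x. x i))" .
    qed (auto intro: comp)
    then show ?thesis by (rule P.indep_vars_compose2) auto
  qed
  have vG: "v \<bullet> G \<omega> = (\<Sum>e\<in>Basis. (v \<bullet> a e) * \<omega> e)" for v \<omega>
    by (simp add: G_def inner_sum_right mult.commute)
  have char: "char (distr P borel (\<lambda>\<omega>. v \<bullet> G \<omega>)) t = exp (- ((\<Sum>e\<in>Basis. (v \<bullet> a e)\<^sup>2) * t\<^sup>2) / 2)" for v t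
  proof -
    have "char (distr P borel (\<lambda>\<omega>. v \<bullet> G \<omega>)) t = (\<Prod>e\<in>Basis. char (distr P borel (\<lambda>\<omega>. (v \<bullet> a e) * \<omega> e)) t)"
      unfolding vG by (rule P.char_distr_sum[OF indep])
    also have "\<dots> = (\<Prod>e\<in>Basis. complex_of_real (exp (- ((v \<bullet> a e)\<^sup>2 * t\<^sup>2) / 2)))"
    proof (intro prod.cong refl)
      fix e :: 'a assume e: "e \<in> Basis"
      have "distr P borel (\<lambda>\<omega>. \<omega> e) = distr P std_normal_distribution (\<lambda>\<omega>. \<omega> e)"
          by (rule distr_cong) auto
      also have "\<dots> = std_normal_distribution"
          unfolding P_def by (rule distr_PiM_component) (auto simp: e N.prob_space_axioms)
      finally show "char (distr P borel (\<lambda>\<omega>. (v \<bullet> a e) * \<omega> e)) t = complex_of_real (exp (- ((v \<bullet> a e)\<^sup>2 * t\<^sup>2) / 2))"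
        by (simp add: char_scaled[OF comp[OF e]] char_std_normal_distribution power_mult_distrib)
    qed
    also have "\<dots> = complex_of_real (exp (\<Sum>e\<in>Basis. - ((v \<bullet> a e)\<^sup>2 * t\<^sup>2) / 2))"
      by (simp add: exp_sum)
    also have "(\<Sum>e\<in>Basis. - ((v \<bullet> a e)\<^sup>2 * t\<^sup>2) / 2) = - ((\<Sum>e\<in>Basis. (v \<bullet> a e)\<^sup>2) * t\<^sup>2) / 2"
      by (simp add: sum_divide_distrib[symmetric] sum_distrib_right sum_negf)
    finally show ?thesis .
  qed
  have vGm: "(\<lambda>\<omega>. v \<bullet> G \<omega>) \<in> borel_measurable P" for v
    by (intro borel_measurable_inner G) auto
  have "centered_normal \<nu>"
    unfolding centered_normal_def
  proof (intro conjI allI)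
    show "prob_space \<nu>" "sets \<nu> = sets borel" unfolding \<nu>_def using G by (auto intro: P.prob_space_distr)
    fix v :: 'a
    let ?s = "sqrt (\<Sum>e\<in>Basis. (v \<bullet> a e)\<^sup>2)"
    have s: "?s \<ge> 0" "?s\<^sup>2 = (\<Sum>e\<in>Basis. (v \<bullet> a e)\<^sup>2)" by (simp_all add: sum_nonneg)
    have "distr \<nu> borel (\<lambda>x. x \<bullet> v) = distr P borel (\<lambda>\<omega>. v \<bullet> G \<omega>)"
      unfolding \<nu>_def using G by (subst distr_distr) (auto simp: comp_def inner_commute)
    also have "\<dots> = normal_law ?s"
    proof (rule Levy_uniqueness)
      show "real_distribution (distr P borel (\<lambda>\<omega>. v \<bullet> G \<omega>))"
        by (rule P.real_distribution_distr[OF vGm])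
      show "char (distr P borel (\<lambda>\<omega>. v \<bullet> G \<omega>)) = char (normal_law ?s)"
        using char[of v] char_normal_law[OF s(1)] s(2) by auto
    qed (rule real_distribution_normal_law[OF s(1)])
    finally show "\<exists>\<sigma>\<ge>0. distr \<nu> borel (\<lambda>x. x \<bullet> v) =
        (if \<sigma> = 0 then return borel 0 else density lborel (\<lambda>x. ennreal (normal_density 0 \<sigma> x)))"
      using s(1) unfolding normal_law_def by blast
  qed
  moreover have "(LINT x|\<nu>. cis (v \<bullet> x)) = complex_of_real (exp (- (\<Sum>e\<in>Basis. (v \<bullet> a e)\<^sup>2) / 2))" for v
  proof -
    have "(LINT x|\<nu>. cis (v \<bullet> x)) = (LINT \<omega>|P. cis (v \<bullet> G \<omega>))"
      unfolding \<nu>_def using G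
      by (intro integral_distr borel_measurable_continuous_onI) (auto simp: cis_conv_exp intro!: continuous_intros)
    also have "\<dots> = char (distr P borel (\<lambda>\<omega>. v \<bullet> G \<omega>)) 1"
      unfolding char_def using vGm by (simp add: integral_distr cis_conv_exp)
    finally show ?thesis by (simp add: char)
  qed
  ultimately show ?thesis by blast
qed

section \<open>Counting in finite abelian groups\<close>

definition subgp :: "'a::ab_group_add set \<Rightarrow> bool" where
  "subgp U \<longleftrightarrow> 0 \<in> U \<and> (\<forall>x\<in>U. \<forall>y\<in>U. x + y \<in> U) \<and> (\<forall>x\<in>U. - x \<in> U)"

lemma subgpD:
  assumes "subgp U"
  shows "0 \<in> U" "x \<in> U \<Longrightarrow> y \<in> U \<Longrightarrow> x + y \<in> U" "x \<in> U \<Longrightarrow> - x \<in> U" "x \<in> U \<Longrightarrow> y \<in> U \<Longrightarrow> x - y \<in> U"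
proof -
  show "0 \<in> U" "x \<in> U \<Longrightarrow> y \<in> U \<Longrightarrow> x + y \<in> U" "x \<in> U \<Longrightarrow> - x \<in> U" using assms by (auto simp: subgp_def)
  show "x \<in> U \<Longrightarrow> y \<in> U \<Longrightarrow> x - y \<in> U"
    using assms unfolding subgp_def diff_conv_add_uminus by blast
qed

definition plus_set :: "'a::ab_group_add set \<Rightarrow> 'a set \<Rightarrow> 'a set" where
  "plus_set U V = (\<lambda>(u, v). u + v) ` (U \<times> V)"

lemma plus_setI: "u \<in> U \<Longrightarrow> v \<in> V \<Longrightarrow> u + v \<in> plus_set U V" by (auto simp: plus_set_def)

lemma plus_setE:
  assumes "w \<in> plus_set U V" obtains u v where "u \<in> U" "v \<in> V" "w = u + v"
  using assms by (auto simp: plus_set_def)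

lemma finite_plus_set: "finite U \<Longrightarrow> finite V \<Longrightarrow> finite (plus_set U V)"
  by (simp add: plus_set_def)

lemma card_plus_set_le: "finite U \<Longrightarrow> finite V \<Longrightarrow> card (plus_set U V) \<le> card U * card V"
  unfolding plus_set_def by (metis card_cartesian_product card_image_le finite_cartesian_product)

lemma plus_set_mono: "U \<subseteq> U' \<Longrightarrow> V \<subseteq> V' \<Longrightarrow> plus_set U V \<subseteq> plus_set U' V'"
  unfolding plus_set_def by (intro image_mono Sigma_mono) auto

lemma subgp_plus_set:
  assumes U: "subgp U" and V: "subgp V" shows "subgp (plus_set U V)"
  unfolding subgp_def
proof (intro conjI ballI)
  show "0 \<in> plus_set U V" using plus_setI[OF subgpD(1)[OF U] subgpD(1)[OF V]] by simp
  fix x assume "x \<in> plus_set U V"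
  then obtain a b where x: "a \<in> U" "b \<in> V" "x = a + b" by (rule plus_setE)
  show "- x \<in> plus_set U V"
    using plus_setI[OF subgpD(3)[OF U x(1)] subgpD(3)[OF V x(2)]] x(3) by (simp add: add.commute)
  fix y assume "y \<in> plus_set U V"
  then obtain c d where y: "c \<in> U" "d \<in> V" "y = c + d" by (rule plus_setE)
  have "x + y = (a + c) + (b + d)" using x(3) y(3) by (simp add: ac_simps)
  then show "x + y \<in> plus_set U V"
    using plus_setI[OF subgpD(2)[OF U x(1) y(1)] subgpD(2)[OF V x(2) y(2)]] by simp
qed

lemma subgp_Int: "subgp U \<Longrightarrow> subgp V \<Longrightarrow> subgp (U \<inter> V)" by (auto simp: subgp_def)

text \<open>
  Every fibre of the addition map from \<open>U \<times> V\<close> onto the sumset is a translate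
  of \<open>U \<inter> V\<close>.
\<close>

lemma card_plus_set:
  fixes U V :: "'a::ab_group_add set"
  assumes U: "subgp U" "finite U" and V: "subgp V" "finite V"
  shows "card (plus_set U V) * card (U \<inter> V) = card U * card V"
proof -
  have fib: "card {p \<in> U \<times> V. (\<lambda>(u, v). u + v) p = w} = card (U \<inter> V)" if "w \<in> plus_set U V" for w
  proof -
    obtain a b where ab: "a \<in> U" "b \<in> V" "w = a + b" using \<open>w \<in> plus_set U V\<close> by (rule plus_setE)
    have "bij_betw (\<lambda>x. (a + x, b - x)) (U \<inter> V) {p \<in> U \<times> V. (\<lambda>(u, v). u + v) p = w}"
    proof (rule bij_betw_byWitness[where f' = "\<lambda>p. fst p - a"])
      show "(\<lambda>x. (a + x, b - x)) ` (U \<inter> V) \<subseteq> {p \<in> U \<times> V. (\<lambda>(u, v). u + v) p = w}"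
        using ab subgpD[OF U(1)] subgpD[OF V(1)] by auto
      show "(\<lambda>p. fst p - a) ` {p \<in> U \<times> V. (\<lambda>(u, v). u + v) p = w} \<subseteq> U \<inter> V"
      proof (rule subsetI)
        fix x assume "x \<in> (\<lambda>p. fst p - a) ` {p \<in> U \<times> V. (\<lambda>(u, v). u + v) p = w}"
        then obtain u v where uv: "u \<in> U" "v \<in> V" "u + v = w" "x = u - a" by auto
        have "u - a = b - v" using uv(3) ab(3) by (simp add: algebra_simps)
        then show "x \<in> U \<inter> V" using subgpD(4)[OF U(1) uv(1) ab(1)] subgpD(4)[OF V(1) ab(2) uv(2)] uv(4) by simp
      qed
      show "\<forall>p\<in>{p \<in> U \<times> V. (\<lambda>(u, v). u + v) p = w}. (a + (fst p - a), b - (fst p - a)) = p"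
        using ab(3) by (auto simp: algebra_simps)
    qed auto
    then show ?thesis by (rule bij_betw_same_card[symmetric])
  qed
  have "card U * card V = card (U \<times> V)" by (simp add: card_cartesian_product)
  also have "U \<times> V = (\<Union>w\<in>plus_set U V. {p \<in> U \<times> V. (\<lambda>(u, v). u + v) p = w})"
    by (auto simp: plus_set_def)
  also have "card \<dots> = (\<Sum>w\<in>plus_set U V. card {p \<in> U \<times> V. (\<lambda>(u, v). u + v) p = w})"
    using U V by (intro card_UN_disjoint) (auto simp: finite_plus_set)
  also have "\<dots> = card (plus_set U V) * card (U \<inter> V)" using fib by simp
  finally show ?thesis by simp
qed

definition coset :: "'a::ab_group_add set \<Rightarrow> 'a \<Rightarrow> 'a set" where "coset B x = (\<lambda>b. b + x) ` B"

lemma coset_eq_iff: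
  assumes B: "subgp B" shows "coset B x = coset B y \<longleftrightarrow> x - y \<in> B"
proof
  assume "coset B x = coset B y"
  then have "0 + x \<in> coset B y" using subgpD(1)[OF B] unfolding coset_def by blast
  then show "x - y \<in> B" by (auto simp: coset_def)
next
  assume d: "x - y \<in> B"
  show "coset B x = coset B y"
  proof (rule subset_antisym; rule subsetI)
    fix w assume "w \<in> coset B x"
    then obtain b where b: "b \<in> B" "w = b + x" by (auto simp: coset_def)
    then have "w = (b + (x - y)) + y" by simp
    then show "w \<in> coset B y" unfolding coset_def using subgpD(2)[OF B b(1) d] by (rule image_eqI)
  next
    fix w assume "w \<in> coset B y"
    then obtain b where b: "b \<in> B" "w = b + y" by (auto simp: coset_def)
    then have "w = (b - (x - y)) + x" by simp
    then show "w \<in> coset B x" unfolding coset_def using subgpD(4)[OF B b(1) d] by (rule image_eqI)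
  qed
qed

lemma card_coset: "card (coset B x) = card B"
  unfolding coset_def by (rule card_image) (auto simp: inj_on_def)

lemma card_cosets:
  assumes A: "subgp A" "finite A" and B: "subgp B" "finite B"
  shows "card (coset B ` A) * card B = card (plus_set A B)"
proof -
  have "card B * card (coset B ` A) = card (\<Union>(coset B ` A))"
  proof (rule card_partition)
    show "finite (coset B ` A)" using A by simp
    show "finite (\<Union>(coset B ` A))" using A B by (auto simp: coset_def)
    show "card c = card B" if "c \<in> coset B ` A" for c using that card_coset by auto
    show "c1 \<inter> c2 = {}" if c: "c1 \<in> coset B ` A" "c2 \<in> coset B ` A" "c1 \<noteq> c2" for c1 c2
    proof (rule ccontr)
      assume "c1 \<inter> c2 \<noteq> {}"
      moreover obtain x y where xy: "c1 = coset B x" "c2 = coset B y" using c by blast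
      ultimately obtain b b' where b: "b \<in> B" "b' \<in> B" "b + x = b' + y" by (auto simp: coset_def)
      have "x - y = b' - b" using b(3) by (simp add: algebra_simps)
      then have "x - y \<in> B" using subgpD(4)[OF B(1) b(2) b(1)] by simp
      then show False using c(3) xy coset_eq_iff[OF B(1)] by blast
    qed
  qed
  moreover have "\<Union>(coset B ` A) = plus_set A B"
    by (auto simp: coset_def plus_set_def add.commute)
  ultimately show ?thesis by (simp add: mult.commute)
qed

section \<open>Vector spaces over the field with two elements\<close>

lemma field_F2: "field F2"
proof -
  have u: "(UNIV :: bit set) = {0, 1}" by (auto simp: bit_not_zero_iff)
  have "cring F2"
  proof (rule cringI)
    show "abelian_group F2"
      by (rule abelian_groupI) (auto simp: F2_def ac_simps intro: exI[of _ "- x" for x] bexI[of _ "- x" for x])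
    show "Group.comm_monoid F2" by (rule comm_monoidI) (auto simp: F2_def ac_simps)
  qed (auto simp: F2_def distrib_right)
  moreover have "Units F2 = carrier F2 - {\<zero>\<^bsub>F2\<^esub>}"
    by (auto simp: F2_def Units_def bit_not_zero_iff)
  ultimately show ?thesis by (rule cring.cring_fieldI)
qed

text \<open>
  Coordinates with respect to a basis identify the space with the functions from the basis into a
  field with two elements.
\<close>

lemma card_F2_vectorspace:
  assumes "vectorspace F2 V" and finV: "finite (carrier V)"
  shows "card (carrier V) = 2 ^ vectorspace.dim F2 V"
proof -
  interpret vectorspace F2 V by fact
  have "fin_dim"
    unfolding fin_dim_def
    using finV in_own_span[of "carrier V"] span_is_subset2[of "carrier V"]
    by (intro exI[of _ "carrier V"]) (auto simp: subset_antisym)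
  then obtain B where B: "finite B" "basis B" using finite_basis_exists by blast
  have BC: "B \<subseteq> carrier V" using B(2) by (simp add: basis_def)
  have uni: "\<exists>!a. a \<in> B \<rightarrow>\<^sub>E carrier F2 \<and> lincomb a B = v" if "v \<in> carrier V" for v
    using basis_criterion[OF B(1) BC] B(2) that by blast
  have cl: "lincomb a B \<in> carrier V" for a
    by (rule lincomb_closed[OF BC]) (auto simp: F2_def)
  have "bij_betw (\<lambda>a. lincomb a B) (B \<rightarrow>\<^sub>E carrier F2) (carrier V)"
    unfolding bij_betw_def
  proof
    show "inj_on (\<lambda>a. lincomb a B) (B \<rightarrow>\<^sub>E carrier F2)"
      by (rule inj_onI) (metis uni cl)
    show "(\<lambda>a. lincomb a B) ` (B \<rightarrow>\<^sub>E carrier F2) = carrier V"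
    proof
      show "carrier V \<subseteq> (\<lambda>a. lincomb a B) ` (B \<rightarrow>\<^sub>E carrier F2)"
      proof
        fix v assume "v \<in> carrier V"
        then obtain a where "a \<in> B \<rightarrow>\<^sub>E carrier F2" "lincomb a B = v" using uni by blast
        then show "v \<in> (\<lambda>a. lincomb a B) ` (B \<rightarrow>\<^sub>E carrier F2)" by (intro image_eqI[of _ _ a]) simp_all
      qed
    qed (use cl in auto)
  qed
  then have "card (carrier V) = card (B \<rightarrow>\<^sub>E carrier F2)" by (simp add: bij_betw_same_card)
  also have "\<dots> = 2 ^ card B"
  proof -
    have "(UNIV :: bit set) = {0, 1}" by (auto simp: bit_not_zero_iff)
    then have "card (carrier F2) = card {0, 1 :: bit}" by (simp only: F2_def partial_object.simps)
    then have "card (carrier F2) = 2" by simp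
    then show ?thesis using B(1) by (simp add: card_PiE)
  qed
  also have "card B = dim" by (rule dim_basis[OF B, symmetric])
  finally show ?thesis .
qed

section \<open>Chains\<close>

type_synonym 'v chain = "'v set \<Rightarrow>\<^sub>0 bit"

lemma bit_add_self [simp]: "(x::bit) + x = 0"
  by (cases x) auto

lemma chain_add_self: "(c::'v chain) + c = 0"
  by (rule poly_mapping_eqI) (simp add: lookup_add)

lemma chain_uminus: "- (c::'v chain) = c"
  using chain_add_self[of c] by (simp add: eq_neg_iff_add_eq_0[symmetric])

definition chains :: "'v set set \<Rightarrow> 'v chain set" where "chains S = {c. Poly_Mapping.keys c \<subseteq> S}"

lemma subgp_chains: "subgp (chains S)"
  unfolding subgp_def
proof (intro conjI ballI)
  fix x y :: "'a chain" assume "x \<in> chains S" "y \<in> chains S"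
  then show "x + y \<in> chains S" using Poly_Mapping.keys_add[of x y] by (auto simp: chains_def)
qed (auto simp: chains_def chain_uminus)

lemma chains_mono: "S \<subseteq> T \<Longrightarrow> chains S \<subseteq> chains T" by (auto simp: chains_def)

lemma card_chains: assumes "finite S" shows "finite (chains S)" "card (chains S) = 2 ^ card S"
proof -
  have "bij_betw Poly_Mapping.keys (chains S) (Pow S)"
  proof (rule bij_betwI')
    fix c d :: "'v chain"
    show "(Poly_Mapping.keys c = Poly_Mapping.keys d) = (c = d)"
    proof
      assume k: "Poly_Mapping.keys c = Poly_Mapping.keys d"
      show "c = d"
      proof (rule poly_mapping_eqI)
        fix x
        have "Poly_Mapping.lookup c x \<noteq> 0 \<longleftrightarrow> Poly_Mapping.lookup d x \<noteq> 0"
          unfolding in_keys_iff[symmetric] k ..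
        then show "Poly_Mapping.lookup c x = Poly_Mapping.lookup d x" by (metis bit_not_zero_iff)
      qed
    qed simp
  next
    fix T assume T: "T \<in> Pow S"
    then have fT: "finite T" using assms by (auto intro: finite_subset)
    let ?c = "\<Sum>x\<in>T. Poly_Mapping.single x (1::bit)"
    have l: "Poly_Mapping.lookup ?c y = (if y \<in> T then 1 else 0)" for y
      using fT by (simp add: lookup_sum lookup_single when_def)
    then have "Poly_Mapping.keys ?c = T"
      by (auto simp: in_keys_iff l split: if_splits)
    then show "\<exists>c\<in>chains S. T = Poly_Mapping.keys c" using T by (intro bexI[of _ ?c]) (auto simp: chains_def)
  qed (auto simp: chains_def)
  then show "finite (chains S)" "card (chains S) = 2 ^ card S"
    using assms by (simp_all add: bij_betw_finite bij_betw_same_card card_Pow)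
qed

definition additive_map :: "('a::ab_group_add \<Rightarrow> 'b::ab_group_add) \<Rightarrow> bool" where
  "additive_map F \<longleftrightarrow> (\<forall>x y. F (x + y) = F x + F y)"

lemma additive_mapD:
  assumes "additive_map F"
  shows "F (x + y) = F x + F y" "F 0 = 0" "F (- x) = - F x" "F (x - y) = F x - F y"
proof -
  show add: "F (x + y) = F x + F y" for x y using assms by (simp add: additive_map_def)
  show z: "F 0 = 0" using add[of 0 0] by simp
  show m: "F (- x) = - F x" for x using add[of x "- x"] z by (simp add: eq_neg_iff_add_eq_0 add.commute)
  show "F (x - y) = F x - F y" using add[of x "- y"] m[of y] by simp
qed

lemma additive_map_sum: "additive_map F \<Longrightarrow> F (\<Sum>i\<in>I. g i) = (\<Sum>i\<in>I. F (g i))"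
  by (induction I rule: infinite_finite_induct) (simp_all add: additive_mapD)

lemma subgp_image: "additive_map F \<Longrightarrow> subgp U \<Longrightarrow> subgp (F ` U)"
proof -
  assume F: "additive_map F" and U: "subgp U"
  show "subgp (F ` U)"
    unfolding subgp_def
  proof (intro conjI ballI)
    show "0 \<in> F ` U" using additive_mapD(2)[OF F] subgpD(1)[OF U] by (metis imageI)
    fix x assume "x \<in> F ` U"
    then obtain a where a: "a \<in> U" "x = F a" by blast
    show "- x \<in> F ` U" unfolding a(2) additive_mapD(3)[OF F, symmetric] by (rule imageI[OF subgpD(3)[OF U a(1)]])
    fix y assume "y \<in> F ` U"
    then obtain b where b: "b \<in> U" "y = F b" by blast
    show "x + y \<in> F ` U"
      unfolding a(2) b(2) additive_mapD(1)[OF F, symmetric] by (rule imageI[OF subgpD(2)[OF U a(1) b(1)]])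
  qed
qed

text \<open>
  Additive maps on chains are determined by their values on single simplices, since the only
  nonzero coefficient is one.
\<close>

lemma additive_chain_eqI:
  assumes F: "additive_map F" and G: "additive_map G"
    and eq: "\<And>\<sigma>. \<sigma> \<in> Poly_Mapping.keys c \<Longrightarrow> F (Poly_Mapping.single \<sigma> 1) = G (Poly_Mapping.single \<sigma> 1)"
  shows "F (c :: 'v chain) = G c"
proof -
  have c: "c = (\<Sum>\<sigma>\<in>Poly_Mapping.keys c. Poly_Mapping.single \<sigma> 1)"
  proof -
    have "Poly_Mapping.lookup c \<sigma> = 1" if "\<sigma> \<in> Poly_Mapping.keys c" for \<sigma>
      using that by (auto simp: in_keys_iff bit_not_zero_iff)
    then have "(\<Sum>\<sigma>\<in>Poly_Mapping.keys c. Poly_Mapping.single \<sigma> (Poly_Mapping.lookup c \<sigma>)) = (\<Sum>\<sigma>\<in>Poly_Mapping.keys c. Poly_Mapping.single \<sigma> 1)"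
      by (intro sum.cong) auto
    moreover have "c = (\<Sum>\<sigma>\<in>Poly_Mapping.keys c. Poly_Mapping.single \<sigma> (Poly_Mapping.lookup c \<sigma>))"
      by (rule poly_mapping_eqI) (simp add: lookup_sum lookup_single when_def in_keys_iff)
    ultimately show ?thesis by simp
  qed
  show ?thesis
    by (subst (1 2) c) (simp only: additive_map_sum[OF F] additive_map_sum[OF G] eq cong: sum.cong)
qed

lemma additive_boundary: "additive_map (boundary_map q)"
proof (cases "q = 0")
  case False
  have "(\<Sum>\<sigma>\<in>Poly_Mapping.keys (x + y). \<Sum>v\<in>\<sigma>. Poly_Mapping.single (\<sigma> - {v}) (Poly_Mapping.lookup (x + y) \<sigma>)) =
      (\<Sum>\<sigma>\<in>Poly_Mapping.keys x. \<Sum>v\<in>\<sigma>. Poly_Mapping.single (\<sigma> - {v}) (Poly_Mapping.lookup x \<sigma>)) +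
      (\<Sum>\<sigma>\<in>Poly_Mapping.keys y. \<Sum>v\<in>\<sigma>. Poly_Mapping.single (\<sigma> - {v}) (Poly_Mapping.lookup y \<sigma>))" for x y :: "'a chain"
    by (rule setsum_keys_plus_distrib[where f = "\<lambda>\<sigma> a. \<Sum>v\<in>\<sigma>. Poly_Mapping.single (\<sigma> - {v}) a"])
      (simp_all only: single_add sum.distrib single_zero sum.neutral_const)
  then show ?thesis using False unfolding additive_map_def boundary_map_def by (simp only: if_False simp_thms)
qed (simp add: additive_map_def boundary_map_def)

lemma additive_chain_map: "additive_map (chain_map f)"
  unfolding additive_map_def chain_map_def
proof (intro allI)
  fix x y :: "'a chain"
  show "(\<Sum>\<sigma>\<in>Poly_Mapping.keys (x + y). if inj_on f \<sigma> then Poly_Mapping.single (f ` \<sigma>) (Poly_Mapping.lookup (x + y) \<sigma>) else 0) =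
      (\<Sum>\<sigma>\<in>Poly_Mapping.keys x. if inj_on f \<sigma> then Poly_Mapping.single (f ` \<sigma>) (Poly_Mapping.lookup x \<sigma>) else 0) +
      (\<Sum>\<sigma>\<in>Poly_Mapping.keys y. if inj_on f \<sigma> then Poly_Mapping.single (f ` \<sigma>) (Poly_Mapping.lookup y \<sigma>) else 0)"
  proof (rule setsum_keys_plus_distrib[where f = "\<lambda>\<sigma> a. if inj_on f \<sigma> then Poly_Mapping.single (f ` \<sigma>) a else 0"])
    show "(if inj_on f k then Poly_Mapping.single (f ` k) (a + b) else 0) =
      (if inj_on f k then Poly_Mapping.single (f ` k) a else 0) + (if inj_on f k then Poly_Mapping.single (f ` k) b else 0)" for k and a b :: bit
      by (cases "inj_on f k") (simp_all only: single_add if_True if_False add_0_left)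
  qed simp
qed

lemma boundary_single: "boundary_map (Suc q) (Poly_Mapping.single \<sigma> 1) = (\<Sum>v\<in>\<sigma>. Poly_Mapping.single (\<sigma> - {v}) (1::bit))"
  by (simp add: boundary_map_def)

lemma chain_map_single: "chain_map f (Poly_Mapping.single \<sigma> (1::bit)) = (if inj_on f \<sigma> then Poly_Mapping.single (f ` \<sigma>) 1 else 0)"
  by (simp add: chain_map_def)

text \<open>
  The only delicate case is a simplex on which \<open>f\<close> is not injective: if exactly two
  vertices have the same image, the two faces that omit one of them have the same image and
  cancel, as coefficients are taken modulo two.
\<close>

lemma chain_map_boundary:
  assumes fin: "\<And>\<sigma>. \<sigma> \<in> Poly_Mapping.keys c \<Longrightarrow> finite \<sigma>"
  shows "chain_map f (boundary_map (Suc q) c) = boundary_map (Suc q) (chain_map f c)"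
proof -
  have "additive_map (\<lambda>c. chain_map f (boundary_map (Suc q) c))" "additive_map (\<lambda>c. boundary_map (Suc q) (chain_map f c))"
    unfolding additive_map_def additive_mapD(1)[OF additive_boundary] additive_mapD(1)[OF additive_chain_map] by simp_all
  then show ?thesis
  proof (rule additive_chain_eqI)
    fix \<sigma> assume "\<sigma> \<in> Poly_Mapping.keys c"
    then have fs: "finite \<sigma>" by (rule fin)
    have L: "chain_map f (boundary_map (Suc q) (Poly_Mapping.single \<sigma> 1))
        = (\<Sum>v\<in>\<sigma>. if inj_on f (\<sigma> - {v}) then Poly_Mapping.single (f ` (\<sigma> - {v})) (1::bit) else 0)"
      by (simp add: boundary_single additive_map_sum[OF additive_chain_map] chain_map_single)
    show "chain_map f (boundary_map (Suc q) (Poly_Mapping.single \<sigma> 1)) = boundary_map (Suc q) (chain_map f (Poly_Mapping.single \<sigma> 1))"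
    proof (cases "inj_on f \<sigma>")
      case True
      have "chain_map f (boundary_map (Suc q) (Poly_Mapping.single \<sigma> 1)) = (\<Sum>v\<in>\<sigma>. Poly_Mapping.single (f ` \<sigma> - {f v}) (1::bit))"
        unfolding L
      proof (intro sum.cong refl)
        fix v assume "v \<in> \<sigma>"
        then have "f ` (\<sigma> - {v}) = f ` \<sigma> - {f v}" using inj_on_image_set_diff[OF True, of \<sigma> "{v}"] by simp
        then show "(if inj_on f (\<sigma> - {v}) then Poly_Mapping.single (f ` (\<sigma> - {v})) (1::bit) else 0) = Poly_Mapping.single (f ` \<sigma> - {f v}) 1"
          using inj_on_subset[OF True] by simp
      qed
      also have "\<dots> = (\<Sum>w\<in>f ` \<sigma>. Poly_Mapping.single (f ` \<sigma> - {w}) 1)"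
        by (simp add: sum.reindex[OF True])
      finally show ?thesis using True by (simp add: chain_map_single boundary_single)
    next
      case False
      have "(\<Sum>v\<in>\<sigma>. if inj_on f (\<sigma> - {v}) then Poly_Mapping.single (f ` (\<sigma> - {v})) (1::bit) else 0) = 0"
      proof (cases "\<exists>v\<in>\<sigma>. inj_on f (\<sigma> - {v})")
        case False
        then show ?thesis by (intro sum.neutral) auto
      next
        case True
        then obtain v where v: "v \<in> \<sigma>" "inj_on f (\<sigma> - {v})" by blast
        have "\<exists>w\<in>\<sigma> - {v}. f w = f v"
        proof (rule ccontr)
          assume "\<not> (\<exists>w\<in>\<sigma> - {v}. f w = f v)"
          then have "f v \<notin> f ` (\<sigma> - {v})" by (metis imageE)
          then have "inj_on f (insert v (\<sigma> - {v}))" using v(2) unfolding inj_on_insert by auto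
          then show False using \<open>\<not> inj_on f \<sigma>\<close> v(1) by (simp add: insert_absorb)
        qed
        then obtain w where w: "w \<in> \<sigma>" "w \<noteq> v" "f w = f v" by blast
        have inj_w: "inj_on f (\<sigma> - {w})"
        proof (rule inj_onI)
          fix x y assume xy: "x \<in> \<sigma> - {w}" "y \<in> \<sigma> - {w}" "f x = f y"
          define r where "r x = (if x = v then w else x)" for x
          have "r x \<in> \<sigma> - {v}" "r y \<in> \<sigma> - {v}" "f (r x) = f (r y)" using xy w by (auto simp: r_def)
          then have "r x = r y" using v(2) by (meson inj_onD)
          then show "x = y" using xy by (auto simp: r_def split: if_splits)
        qed
        have other: "\<not> inj_on f (\<sigma> - {x})" if "x \<in> \<sigma> - {v, w}" for x
        proof
          assume "inj_on f (\<sigma> - {x})"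
          moreover have "v \<in> \<sigma> - {x}" "w \<in> \<sigma> - {x}" using v w that by auto
          ultimately show False using w by (metis inj_onD)
        qed
        have img: "f ` (\<sigma> - {v}) = f ` (\<sigma> - {w})"
        proof -
          have "\<sigma> = insert v (\<sigma> - {v})" "\<sigma> = insert w (\<sigma> - {w})" using v w by auto
          moreover have "f v \<in> f ` (\<sigma> - {v})" using w by (metis Diff_iff imageI singletonD)
          moreover have "f w \<in> f ` (\<sigma> - {w})" using w v by (metis Diff_iff imageI singletonD)
          ultimately have "f ` (\<sigma> - {v}) = f ` \<sigma>" "f ` (\<sigma> - {w}) = f ` \<sigma>"
            by (metis image_insert insert_absorb)+
          then show ?thesis by simp
        qed
        have "(\<Sum>x\<in>\<sigma>. if inj_on f (\<sigma> - {x}) then Poly_Mapping.single (f ` (\<sigma> - {x})) (1::bit) else 0)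
            = (\<Sum>x\<in>{v, w}. if inj_on f (\<sigma> - {x}) then Poly_Mapping.single (f ` (\<sigma> - {x})) (1::bit) else 0)"
          using v w other fs by (intro sum.mono_neutral_right) auto
        also have "\<dots> = Poly_Mapping.single (f ` (\<sigma> - {w})) 1 + Poly_Mapping.single (f ` (\<sigma> - {w})) (1::bit)"
          using w(2) v(2) inj_w img by simp
        finally show ?thesis by (simp add: chain_add_self)
      qed
      then show ?thesis using False unfolding L by (simp add: chain_map_single additive_mapD[OF additive_boundary])
    qed
  qed
qed

section \<open>Persistent Betti numbers by counting\<close>

lemma carrier_chain_space: "carrier (chain_space q K) = chains {\<sigma> \<in> K. card \<sigma> = Suc q}"
  by (simp add: chain_space_def chains_def)

lemma subgp_cycles: "subgp (cycles q K)"
  unfolding cycles_def carrier_chain_space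
  by (auto simp: subgp_def subgpD[OF subgp_chains] additive_mapD[OF additive_boundary])

lemma subgp_boundaries: "subgp (boundaries q K)"
  unfolding boundaries_def carrier_chain_space by (intro subgp_image additive_boundary subgp_chains)

lemma finite_cycles: "finite K \<Longrightarrow> finite (cycles q K)"
  unfolding cycles_def carrier_chain_space by (rule finite_subset[OF _ card_chains(1)[of "{\<sigma> \<in> K. card \<sigma> = Suc q}"]]) auto

lemma finite_boundaries: "finite K \<Longrightarrow> finite (boundaries q K)"
  unfolding boundaries_def carrier_chain_space by (intro finite_imageI card_chains(1)) auto

lemma a_r_coset_chain_space: "B +>\<^bsub>chain_space q L\<^esub> x = coset B x"
  by (auto simp: a_r_coset_def r_coset_def coset_def chain_space_def)

lemma coset_add:
  assumes "subgp B"
  shows "set_add ((chain_space q L)\<lparr>carrier := Z\<rparr>) (coset B x) (coset B y) = coset B (x + y)"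
proof -
  have "set_add ((chain_space q L)\<lparr>carrier := Z\<rparr>) (coset B x) (coset B y) = {a + b |a b. a \<in> coset B x \<and> b \<in> coset B y}"
    by (auto simp: set_add_def set_mult_def chain_space_def)
  also have "\<dots> = coset B (x + y)"
  proof (rule subset_antisym; rule subsetI)
    fix w assume "w \<in> {a + b |a b. a \<in> coset B x \<and> b \<in> coset B y}"
    then obtain a b where ab: "a \<in> B" "b \<in> B" "w = (a + x) + (b + y)" by (auto simp: coset_def)
    then have "w = (a + b) + (x + y)" by (simp add: ac_simps)
    then show "w \<in> coset B (x + y)" unfolding coset_def using subgpD(2)[OF assms ab(1,2)] by (rule image_eqI)
  next
    fix w assume "w \<in> coset B (x + y)"
    then obtain b where b: "b \<in> B" "w = b + (x + y)" by (auto simp: coset_def)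
    then have "w = (b + x) + (0 + y)" by (simp add: ac_simps)
    then show "w \<in> {a + b |a b. a \<in> coset B x \<and> b \<in> coset B y}"
      using b(1) subgpD(1)[OF assms] unfolding coset_def by blast
  qed
  finally show ?thesis .
qed

lemma Union_coset_coset:
  assumes "subgp B" shows "(\<Union>c\<in>coset B x. coset B c) = coset B x"
proof -
  have "coset B c = coset B x" if "c \<in> coset B x" for c
    using that coset_eq_iff[OF assms, of c x] by (auto simp: coset_def)
  moreover have "coset B x \<noteq> {}" using subgpD(1)[OF assms] by (auto simp: coset_def)
  ultimately show ?thesis by auto
qed

lemma smult_coset:
  assumes B: "subgp B"
  shows "(\<Union>c\<in>coset B x. B +>\<^bsub>(chain_space q L)\<lparr>carrier := Z\<rparr>\<^esub> (a \<odot>\<^bsub>(chain_space q L)\<lparr>carrier := Z\<rparr>\<^esub> c)) = coset B (if a = 0 then 0 else x)"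
proof -
  have r: "B +>\<^bsub>(chain_space q L)\<lparr>carrier := Z\<rparr>\<^esub> y = coset B y" for y
    by (auto simp: a_r_coset_def r_coset_def coset_def chain_space_def)
  have s: "a \<odot>\<^bsub>(chain_space q L)\<lparr>carrier := Z\<rparr>\<^esub> c = (if a = 0 then 0 else c)" for c
  proof (cases "a = 0")
    case True
    then show ?thesis by (auto simp: chain_space_def intro!: poly_mapping_eqI) (transfer, simp)
  next
    case False
    then have "a = 1" by (simp add: bit_not_zero_iff)
    then show ?thesis by (auto simp: chain_space_def intro!: poly_mapping_eqI) (transfer, simp add: when_def)
  qed
  show ?thesis
  proof (cases "a = 0")
    case True
    moreover have "coset B x \<noteq> {}" using subgpD(1)[OF B] by (auto simp: coset_def)
    ultimately show ?thesis unfolding r s by simp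
  next
    case False
    then show ?thesis unfolding r s using Union_coset_coset[OF B] by simp
  qed
qed

text \<open>
  A group of cosets of chains is a vector space over the field with two elements for free, because
  every chain is its own inverse.
\<close>

lemma vectorspace_cosets:
  fixes L :: "'a set set"
  assumes A: "subgp A" and B: "subgp B"
    and V_def: "V = (quotient_space ((chain_space q L)\<lparr>carrier := Z\<rparr>) B)\<lparr>carrier := coset B ` A\<rparr>"
  shows "vectorspace F2 V"
proof -
  have car: "carrier V = coset B ` A" by (simp add: V_def)
  have add: "coset B x \<oplus>\<^bsub>V\<^esub> coset B y = coset B (x + y)" for x y
    unfolding V_def by (simp add: quotient_space_def coset_add[OF B])
  have zero: "\<zero>\<^bsub>V\<^esub> = coset B 0" by (simp add: V_def quotient_space_def coset_def)
  have smult: "a \<odot>\<^bsub>V\<^esub> coset B x = coset B (if a = 0 then 0 else x)" for a x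
    unfolding V_def smult_coset[OF B, where q = q and L = L and Z = Z, symmetric] by (simp add: quotient_space_def)
  have self: "x + x = 0" for x :: "'a chain" by (rule chain_add_self)
  have bit: "b = 0 \<or> b = 1" for b :: bit by (cases b) auto
  have F2: "carrier F2 = UNIV" "a \<oplus>\<^bsub>F2\<^esub> b = a + b" "a \<otimes>\<^bsub>F2\<^esub> b = a * b" "\<one>\<^bsub>F2\<^esub> = 1" for a b
    by (simp_all add: F2_def)
  have "abelian_group V"
  proof (rule abelian_groupI)
    fix x y z assume "x \<in> carrier V" "y \<in> carrier V" "z \<in> carrier V"
    then obtain a b c where abc: "x = coset B a" "y = coset B b" "z = coset B c" "a \<in> A" "b \<in> A" "c \<in> A"
      unfolding car by blast
    show "x \<oplus>\<^bsub>V\<^esub> y \<in> carrier V" unfolding abc add car using subgpD(2)[OF A abc(4,5)] by (rule imageI)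
    show "x \<oplus>\<^bsub>V\<^esub> y \<oplus>\<^bsub>V\<^esub> z = x \<oplus>\<^bsub>V\<^esub> (y \<oplus>\<^bsub>V\<^esub> z)" unfolding abc add by (simp add: add.assoc)
    show "x \<oplus>\<^bsub>V\<^esub> y = y \<oplus>\<^bsub>V\<^esub> x" unfolding abc add by (simp add: add.commute)
    show "\<zero>\<^bsub>V\<^esub> \<oplus>\<^bsub>V\<^esub> x = x" unfolding abc add zero by simp
    show "\<exists>y\<in>carrier V. y \<oplus>\<^bsub>V\<^esub> x = \<zero>\<^bsub>V\<^esub>"
      unfolding abc car zero using abc(4) self[of a] add by (metis imageI)
  next
    show "\<zero>\<^bsub>V\<^esub> \<in> carrier V" unfolding car zero using subgpD(1)[OF A] by (rule imageI)
  qed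
  moreover have "module_axioms F2 V"
  proof
    fix a b x y
    assume "x \<in> carrier V"
    then obtain u where u: "x = coset B u" "u \<in> A" unfolding car by blast
    show "a \<odot>\<^bsub>V\<^esub> x \<in> carrier V" unfolding u smult car using u(2) subgpD(1)[OF A] by auto
    show "(a \<oplus>\<^bsub>F2\<^esub> b) \<odot>\<^bsub>V\<^esub> x = a \<odot>\<^bsub>V\<^esub> x \<oplus>\<^bsub>V\<^esub> b \<odot>\<^bsub>V\<^esub> x"
      unfolding u smult add F2 using bit[of a] bit[of b] self[of u] by auto
    show "(a \<otimes>\<^bsub>F2\<^esub> b) \<odot>\<^bsub>V\<^esub> x = a \<odot>\<^bsub>V\<^esub> (b \<odot>\<^bsub>V\<^esub> x)"
      unfolding u smult F2 using bit[of a] bit[of b] by auto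
    show "\<one>\<^bsub>F2\<^esub> \<odot>\<^bsub>V\<^esub> x = x" unfolding u smult F2 by simp
    assume "y \<in> carrier V"
    then obtain v where v: "y = coset B v" "v \<in> A" unfolding car by blast
    show "a \<odot>\<^bsub>V\<^esub> (x \<oplus>\<^bsub>V\<^esub> y) = a \<odot>\<^bsub>V\<^esub> x \<oplus>\<^bsub>V\<^esub> a \<odot>\<^bsub>V\<^esub> y"
      unfolding u v smult add by (simp add: smult add)
  qed
  ultimately have "module F2 V"
    using field_F2 by (simp add: module_def field_def domain_def)
  then show ?thesis using field_F2 by (simp add: vectorspace_def)
qed

text \<open>
  The image of the map on homology consists of the cosets \<open>f(z) + B\<^sub>q(L)\<close> of
  the images of cycles, which are counted by Lagrange's theorem.
\<close>

theorem card_persistent_betti: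
  fixes K :: "'v set set" and L :: "'w set set"
  assumes K: "finite K" "\<And>\<sigma>. \<sigma> \<in> K \<Longrightarrow> finite \<sigma>" and L: "finite L"
    and simp: "\<And>\<sigma>. \<sigma> \<in> K \<Longrightarrow> f ` \<sigma> \<in> L"
  shows "card (plus_set (chain_map f ` cycles q K) (boundaries q L))
    = 2 ^ persistent_betti q f K L * card (boundaries q L)"
proof -
  let ?B = "boundaries q L" and ?A = "chain_map f ` cycles q K"
  note B = subgp_boundaries[of q L]
  have A: "subgp ?A" by (rule subgp_image[OF additive_chain_map subgp_cycles])
  have fB: "chain_map f b \<in> ?B" if bK: "b \<in> boundaries q K" for b
  proof -
    obtain c where c: "c \<in> chains {\<sigma> \<in> K. card \<sigma> = Suc (Suc q)}" "b = boundary_map (Suc q) c"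
      using bK unfolding boundaries_def carrier_chain_space by blast
    have "chain_map f c \<in> chains {\<sigma> \<in> L. card \<sigma> = Suc (Suc q)}"
    proof -
      have sum_in: "(\<Sum>\<sigma>\<in>I. g \<sigma>) \<in> chains S" if "finite I" "\<And>\<sigma>. \<sigma> \<in> I \<Longrightarrow> g \<sigma> \<in> chains S"
        for I :: "'v set set" and g :: "'v set \<Rightarrow> 'w chain" and S
        using that by (induction I rule: finite_induct) (auto simp: subgpD[OF subgp_chains])
      show ?thesis
        unfolding chain_map_def
      proof (rule sum_in)
        fix \<sigma> assume "\<sigma> \<in> Poly_Mapping.keys c"
        then have "\<sigma> \<in> K" "card \<sigma> = Suc (Suc q)" using c(1) by (auto simp: chains_def)
        then show "(if inj_on f \<sigma> then Poly_Mapping.single (f ` \<sigma>) (Poly_Mapping.lookup c \<sigma>) else 0) \<in> chains {\<sigma> \<in> L. card \<sigma> = Suc (Suc q)}"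
          using simp[of \<sigma>] by (auto simp: chains_def card_image split: if_splits)
      qed simp
    qed
    moreover have "chain_map f b = boundary_map (Suc q) (chain_map f c)"
      unfolding c(2) by (rule chain_map_boundary) (use c(1) K(2) in \<open>auto simp: chains_def\<close>)
    ultimately show ?thesis by (auto simp: boundaries_def carrier_chain_space)
  qed
  have car: "carrier (homology q K) = coset (boundaries q K) ` cycles q K"
    by (auto simp: homology_def quotient_space_def A_RCOSETS_def RCOSETS_def coset_def r_coset_def chain_space_def)
  have hm: "homology_map q f L (coset (boundaries q K) z) = coset ?B (chain_map f z)" for z
  proof -
    have "coset ?B (chain_map f c) = coset ?B (chain_map f z)" if cz: "c \<in> coset (boundaries q K) z" for c
    proof -
      obtain b where b: "b \<in> boundaries q K" "c = b + z" using cz unfolding coset_def by blast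
      then have "chain_map f c - chain_map f z = chain_map f b" by (simp add: additive_mapD[OF additive_chain_map])
      then show ?thesis using fB[OF b(1)] coset_eq_iff[OF B] by simp
    qed
    moreover have "coset (boundaries q K) z \<noteq> {}" using subgpD(1)[OF subgp_boundaries] by (auto simp: coset_def)
    ultimately show ?thesis unfolding homology_map_def a_r_coset_chain_space by auto
  qed
  have img: "homology_map q f L ` carrier (homology q K) = coset ?B ` ?A"
    unfolding car image_image hm ..
  have "vectorspace F2 ((homology q L)\<lparr>carrier := coset ?B ` ?A\<rparr>)"
    unfolding homology_def by (rule vectorspace_cosets[OF A B refl])
  from card_F2_vectorspace[OF this]
  have "card (coset ?B ` ?A) = 2 ^ persistent_betti q f K L"
    unfolding persistent_betti_def img using finite_cycles[OF K(1)] by simp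
  then show ?thesis
    using card_cosets[OF A _ B finite_boundaries[OF L]] finite_cycles[OF K(1)] by simp
qed

section \<open>Comparing nested complexes\<close>

lemma log2_card_mono: "U \<subseteq> V \<Longrightarrow> finite V \<Longrightarrow> U \<noteq> {} \<Longrightarrow> log 2 (card U) \<le> log 2 (card V)"
proof -
  assume a: "U \<subseteq> V" "finite V" "U \<noteq> {}"
  then have "card U \<le> card V" "card U > 0" by (auto simp: card_gt_0_iff intro: card_mono finite_subset)
  then show ?thesis by simp
qed

lemma subgp_nonempty: "subgp U \<Longrightarrow> U \<noteq> {}" using subgpD(1) by blast

text \<open>
  \<open>f(Z\<^sub>q(K)) + B\<^sub>q(L)\<close>, the group of all cycles of \<open>L\<close> whose
  class comes from \<open>K\<close>.
\<close>

definition pb_sum :: "nat \<Rightarrow> ('v \<Rightarrow> 'v) \<Rightarrow> 'v set set \<Rightarrow> 'v set set \<Rightarrow> 'v chain set" where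
  "pb_sum q f K L = plus_set (chain_map f ` cycles q K) (boundaries q L)"

lemma subgp_pb_sum: "subgp (pb_sum q f K L)"
  unfolding pb_sum_def by (intro subgp_plus_set subgp_image additive_chain_map subgp_cycles subgp_boundaries)

lemma finite_pb_sum: "finite K \<Longrightarrow> finite L \<Longrightarrow> finite (pb_sum q f K L)"
  unfolding pb_sum_def by (intro finite_plus_set finite_imageI finite_cycles finite_boundaries)

lemma persistent_betti_log:
  assumes "finite K" "\<And>\<sigma>. \<sigma> \<in> K \<Longrightarrow> finite \<sigma>" "finite L" "\<And>\<sigma>. \<sigma> \<in> K \<Longrightarrow> f ` \<sigma> \<in> L"
  shows "real (persistent_betti q f K L) = log 2 (card (pb_sum q f K L)) - log 2 (card (boundaries q L))"
proof -
  have "card (boundaries q L) > 0"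
    using finite_boundaries[OF assms(3)] subgp_nonempty[OF subgp_boundaries] by (simp add: card_gt_0_iff)
  moreover have "real (card (pb_sum q f K L)) = 2 ^ persistent_betti q f K L * real (card (boundaries q L))"
    using arg_cong[OF card_persistent_betti[OF assms, of q], of real] by (simp add: pb_sum_def)
  ultimately show ?thesis by (simp add: log_mult log_nat_power)
qed

lemma cycles_mono: "K \<subseteq> K' \<Longrightarrow> cycles q K \<subseteq> cycles q K'"
  by (auto simp: cycles_def chain_space_def)

lemma boundaries_mono: "L \<subseteq> L' \<Longrightarrow> boundaries q L \<subseteq> boundaries q L'"
  unfolding boundaries_def by (intro image_mono) (auto simp: chain_space_def)

lemma pb_sum_mono: "K \<subseteq> K' \<Longrightarrow> L \<subseteq> L' \<Longrightarrow> pb_sum q f K L \<subseteq> pb_sum q f K' L'"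
  unfolding pb_sum_def by (intro plus_set_mono image_mono cycles_mono boundaries_mono)

text \<open>Part of a chain supported on \<open>S\<close>.\<close>

definition restr :: "'v set set \<Rightarrow> 'v chain \<Rightarrow> 'v chain" where
  "restr S c = (\<Sum>\<sigma>\<in>Poly_Mapping.keys c. if \<sigma> \<in> S then Poly_Mapping.single \<sigma> (Poly_Mapping.lookup c \<sigma>) else 0)"

lemma lookup_restr: "Poly_Mapping.lookup (restr S c) \<sigma> = (if \<sigma> \<in> S then Poly_Mapping.lookup c \<sigma> else 0)"
proof -
  have "Poly_Mapping.lookup (restr S c) \<sigma> = (\<Sum>\<tau>\<in>Poly_Mapping.keys c. if \<sigma> = \<tau> then (if \<sigma> \<in> S then Poly_Mapping.lookup c \<sigma> else 0) else 0)"
    unfolding restr_def lookup_sum by (intro sum.cong) (auto simp: lookup_single when_def)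
  then show ?thesis by (auto simp: in_keys_iff)
qed

lemma restr_diff: "restr S (c - d) = restr S c - restr S d"
  by (rule poly_mapping_eqI) (simp add: lookup_restr lookup_minus)

lemma restr_chains: "c \<in> chains T \<Longrightarrow> restr S c \<in> chains (S \<inter> T)"
  unfolding chains_def by (auto simp: in_keys_iff lookup_restr split: if_splits)

lemma restr_eq_0_iff: "restr S c = 0 \<longleftrightarrow> Poly_Mapping.keys c \<inter> S = {}"
  by (auto simp: poly_mapping_eq_iff fun_eq_iff lookup_restr in_keys_iff)

lemma chains_split:
  assumes "c \<in> chains (S \<union> T)" shows "c \<in> plus_set (chains S) (chains T)"
proof -
  have "\<sigma> \<in> S \<union> T" if "Poly_Mapping.lookup c \<sigma> \<noteq> 0" for \<sigma>
    using assms that by (auto simp: chains_def simp del: bit_not_zero_iff simp flip: in_keys_iff)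
  then have "c - restr T c \<in> chains S"
    unfolding chains_def by (auto simp: in_keys_iff lookup_minus lookup_restr split: if_splits) blast
  moreover have "restr T c \<in> chains T"
    unfolding chains_def by (auto simp: in_keys_iff lookup_restr split: if_splits)
  ultimately have "(c - restr T c) + restr T c \<in> plus_set (chains S) (chains T)" by (rule plus_setI)
  then show ?thesis by simp
qed

text \<open>
  The boundary operator is additive and a chain of \<open>L\<close> splits into its old and its
  new part.
\<close>

lemma boundaries_split:
  assumes "L0 \<subseteq> L"
  shows "boundaries q L = plus_set (boundaries q L0) (boundaries q (L - L0))"
proof (rule subset_antisym)
  show "boundaries q L \<subseteq> plus_set (boundaries q L0) (boundaries q (L - L0))"
  proof
    fix b assume "b \<in> boundaries q L"
    then obtain c where c: "c \<in> chains {\<sigma> \<in> L. card \<sigma> = Suc (Suc q)}" "b = boundary_map (Suc q) c"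
      unfolding boundaries_def carrier_chain_space by blast
    have "{\<sigma> \<in> L. card \<sigma> = Suc (Suc q)} = {\<sigma> \<in> L0. card \<sigma> = Suc (Suc q)} \<union> {\<sigma> \<in> L - L0. card \<sigma> = Suc (Suc q)}"
      using assms by auto
    from chains_split[OF c(1)[unfolded this]]
    obtain u v where uv: "u \<in> chains {\<sigma> \<in> L0. card \<sigma> = Suc (Suc q)}" "v \<in> chains {\<sigma> \<in> L - L0. card \<sigma> = Suc (Suc q)}" "c = u + v"
      by (rule plus_setE)
    show "b \<in> plus_set (boundaries q L0) (boundaries q (L - L0))"
      unfolding c(2) uv(3) additive_mapD(1)[OF additive_boundary]
      unfolding boundaries_def carrier_chain_space by (intro plus_setI imageI uv)
  qed
  show "plus_set (boundaries q L0) (boundaries q (L - L0)) \<subseteq> boundaries q L"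
  proof
    fix b assume "b \<in> plus_set (boundaries q L0) (boundaries q (L - L0))"
    then obtain u v where "u \<in> boundaries q L0" "v \<in> boundaries q (L - L0)" "b = u + v" by (rule plus_setE)
    then show "b \<in> boundaries q L"
      using boundaries_mono[OF assms] boundaries_mono[of "L - L0" L] subgpD(2)[OF subgp_boundaries[of q L]] by blast
  qed
qed

lemma card_boundaries_le: "finite L \<Longrightarrow> card (boundaries q L) \<le> 2 ^ card {\<sigma> \<in> L. card \<sigma> = Suc (Suc q)}"
  unfolding boundaries_def carrier_chain_space
  using card_image_le[OF card_chains(1)[of "{\<sigma> \<in> L. card \<sigma> = Suc (Suc q)}"], of "boundary_map (Suc q)"] card_chains(2)[of "{\<sigma> \<in> L. card \<sigma> = Suc (Suc q)}"]
  by simp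

abbreviation new_cycles :: "nat \<Rightarrow> 'v set set \<Rightarrow> 'v set set \<Rightarrow> 'v chain set" where
  "new_cycles q K0 K \<equiv> restr (K - K0) ` cycles q K"

lemma new_cycles_subset: "new_cycles q K0 K \<subseteq> chains {\<sigma> \<in> K - K0. card \<sigma> = Suc q}"
proof clarify
  fix z assume "z \<in> cycles q K"
  then have "z \<in> chains {\<sigma> \<in> K. card \<sigma> = Suc q}" by (simp add: cycles_def carrier_chain_space)
  from restr_chains[OF this, of "K - K0"]
  show "restr (K - K0) z \<in> chains {\<sigma> \<in> K - K0. card \<sigma> = Suc q}"
    by (rule subsetD[OF chains_mono, rotated]) auto
qed

text \<open>The coefficients on the new simplices cancel in the difference.\<close>

lemma cycle_diff_old:
  assumes z: "z \<in> cycles q K" "w \<in> cycles q K" and eq: "restr (K - K0) z = restr (K - K0) w"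
  shows "z - w \<in> cycles q K0"
proof -
  have d: "z - w \<in> cycles q K" using subgpD(4)[OF subgp_cycles z] .
  have "restr (K - K0) (z - w) = 0" using eq by (simp add: restr_diff)
  then have "Poly_Mapping.keys (z - w) \<inter> (K - K0) = {}" by (simp add: restr_eq_0_iff)
  then show ?thesis using d by (auto simp: cycles_def chain_space_def)
qed

text \<open>
  One cycle is chosen for each possible restriction to the new simplices of \<open>K\<close>;
  every other cycle differs from a chosen one by a cycle of \<open>K0\<close>. The chosen cycles
  and the boundaries of new simplices together cost at most one binary digit per new simplex.
\<close>

lemma pb_sum_le:
  assumes K: "finite K" and L: "finite L" "L0 \<subseteq> L" and K0: "K0 \<subseteq> K"
  shows "card (pb_sum q f K L) \<le> card (pb_sum q f K0 L0) *
    2 ^ (card {\<sigma> \<in> K - K0. card \<sigma> = Suc q} + card {\<sigma> \<in> L - L0. card \<sigma> = Suc (Suc q)})"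
proof -
  let ?N = "new_cycles q K0 K"
  \<comment> \<open>Representatives of the cycles modulo the cycles of \<open>K0\<close>.\<close>
  define rep where "rep p = (SOME z. z \<in> cycles q K \<and> restr (K - K0) z = p)" for p
  have rep: "rep p \<in> cycles q K \<and> restr (K - K0) (rep p) = p" if "p \<in> ?N" for p
    unfolding rep_def by (rule someI_ex) (use that in blast)
  define G where "G = plus_set (chain_map f ` rep ` ?N) (boundaries q (L - L0))"
  have fin: "finite ?N" "finite (chain_map f ` rep ` ?N)" "finite (boundaries q (L - L0))"
    "finite (pb_sum q f K0 L0)" "finite G"
    using finite_cycles[OF K] finite_boundaries[of "L - L0"] L K0 K
    by (auto simp: G_def intro!: finite_plus_set finite_pb_sum intro: finite_subset)
  have sub: "pb_sum q f K L \<subseteq> plus_set (pb_sum q f K0 L0) G"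
  proof
    fix u assume "u \<in> pb_sum q f K L"
    then obtain z b where zb: "z \<in> cycles q K" "b \<in> boundaries q L" "u = chain_map f z + b"
      unfolding pb_sum_def by (auto elim!: plus_setE)
    obtain b0 b1 where b: "b0 \<in> boundaries q L0" "b1 \<in> boundaries q (L - L0)" "b = b0 + b1"
      using zb(2) boundaries_split[OF L(2)] by (metis plus_setE)
    let ?w = "rep (restr (K - K0) z)"
    have w: "?w \<in> cycles q K" "restr (K - K0) ?w = restr (K - K0) z" using rep[of "restr (K - K0) z"] zb(1) by auto
    have "z - ?w \<in> cycles q K0" by (rule cycle_diff_old[OF zb(1) w(1) w(2)[symmetric]])
    then have 1: "chain_map f (z - ?w) + b0 \<in> pb_sum q f K0 L0" unfolding pb_sum_def using b(1) by (intro plus_setI imageI)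
    have 2: "chain_map f ?w + b1 \<in> G" unfolding G_def using b(2) zb(1) by (intro plus_setI imageI)
    have "u = (chain_map f (z - ?w) + b0) + (chain_map f ?w + b1)"
      unfolding zb(3) b(3) additive_mapD(4)[OF additive_chain_map] by simp
    then show "u \<in> plus_set (pb_sum q f K0 L0) G" using plus_setI[OF 1 2] by simp
  qed
  have "card (chain_map f ` rep ` ?N) \<le> card ?N" using fin(1) by (metis card_image_le finite_imageI order_trans)
  also have "\<dots> \<le> card (chains {\<sigma> \<in> K - K0. card \<sigma> = Suc q})"
    using K by (intro card_mono new_cycles_subset card_chains(1)) auto
  also have "\<dots> = 2 ^ card {\<sigma> \<in> K - K0. card \<sigma> = Suc q}" using K by (intro card_chains(2)) auto
  finally have a: "card (chain_map f ` rep ` ?N) \<le> 2 ^ card {\<sigma> \<in> K - K0. card \<sigma> = Suc q}" .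
  have b: "card (boundaries q (L - L0)) \<le> 2 ^ card {\<sigma> \<in> L - L0. card \<sigma> = Suc (Suc q)}"
    using L by (intro card_boundaries_le) auto
  have "card G \<le> card (chain_map f ` rep ` ?N) * card (boundaries q (L - L0))"
    unfolding G_def by (rule card_plus_set_le[OF fin(2,3)])
  also have "\<dots> \<le> 2 ^ card {\<sigma> \<in> K - K0. card \<sigma> = Suc q} * 2 ^ card {\<sigma> \<in> L - L0. card \<sigma> = Suc (Suc q)}"
    by (rule mult_le_mono[OF a b])
  finally have G: "card G \<le> 2 ^ (card {\<sigma> \<in> K - K0. card \<sigma> = Suc q} + card {\<sigma> \<in> L - L0. card \<sigma> = Suc (Suc q)})"
    by (simp add: power_add)
  have "card (pb_sum q f K L) \<le> card (plus_set (pb_sum q f K0 L0) G)"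
    by (rule card_mono[OF finite_plus_set[OF fin(4,5)] sub])
  also have "\<dots> \<le> card (pb_sum q f K0 L0) * card G" by (rule card_plus_set_le[OF fin(4,5)])
  also have "\<dots> \<le> card (pb_sum q f K0 L0) * 2 ^ (card {\<sigma> \<in> K - K0. card \<sigma> = Suc q} + card {\<sigma> \<in> L - L0. card \<sigma> = Suc (Suc q)})"
    using G by (rule mult_le_mono2)
  finally show ?thesis .
qed

text \<open>
  The persistent Betti number as a difference of logarithms. This form makes sense for every
  vertex map, simplicial or not.
\<close>

definition pb_log :: "nat \<Rightarrow> ('v \<Rightarrow> 'v) \<Rightarrow> 'v set set \<Rightarrow> 'v set set \<Rightarrow> real" where
  "pb_log q f K L = log 2 (card (pb_sum q f K L)) - log 2 (card (boundaries q L))"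

lemma log2_le_of_card_le:
  assumes "card V \<le> card U * 2 ^ n" "finite U" "U \<noteq> {}" "finite V" "V \<noteq> {}"
  shows "log 2 (card V) \<le> log 2 (card U) + n"
proof -
  have p: "card U > 0" "card V > 0" using assms by (auto simp: card_gt_0_iff)
  have "real (card V) \<le> real (card U) * 2 ^ n" using of_nat_mono[OF assms(1), where 'a = real] by simp
  then have "log 2 (card V) \<le> log 2 (real (card U) * 2 ^ n)" using p by simp
  also have "\<dots> = log 2 (card U) + n" using p by (simp add: log_mult log_nat_power)
  finally show ?thesis .
qed

text \<open>
  The number of cycles and the number of boundaries both grow with the complexes, so the two
  logarithms increase by amounts between zero and the bound.
\<close>

theorem pb_log_diff_bound:
  assumes K: "finite K" "K0 \<subseteq> K" and L: "finite L" "L0 \<subseteq> L"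
  shows "\<bar>pb_log q f K L - pb_log q f K0 L0\<bar> \<le>
    card {\<sigma> \<in> K - K0. card \<sigma> = Suc q} + card {\<sigma> \<in> L - L0. card \<sigma> = Suc (Suc q)}"
proof -
  have K0: "finite K0" and L0: "finite L0" using K L finite_subset by blast+
  note ne = subgp_nonempty[OF subgp_pb_sum] subgp_nonempty[OF subgp_boundaries]
  have 1: "log 2 (card (pb_sum q f K0 L0)) \<le> log 2 (card (pb_sum q f K L))"
    by (rule log2_card_mono[OF pb_sum_mono[OF K(2) L(2)] finite_pb_sum[OF K(1) L(1)] ne(1)])
  have 2: "log 2 (card (boundaries q L0)) \<le> log 2 (card (boundaries q L))"
    by (rule log2_card_mono[OF boundaries_mono[OF L(2)] finite_boundaries[OF L(1)] ne(2)])
  have 3: "log 2 (card (pb_sum q f K L)) \<le> log 2 (card (pb_sum q f K0 L0)) + real (card {\<sigma> \<in> K - K0. card \<sigma> = Suc q} + card {\<sigma> \<in> L - L0. card \<sigma> = Suc (Suc q)})"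
    by (rule log2_le_of_card_le[OF pb_sum_le[OF K(1) L K(2)] finite_pb_sum[OF K0 L0] ne(1) finite_pb_sum[OF K(1) L(1)] ne(1)])
  have "card (boundaries q L) \<le> card (boundaries q L0) * card (boundaries q (L - L0))"
    unfolding boundaries_split[OF L(2)] using L L0 by (intro card_plus_set_le finite_boundaries) auto
  also have "\<dots> \<le> card (boundaries q L0) * 2 ^ card {\<sigma> \<in> L - L0. card \<sigma> = Suc (Suc q)}"
    using L by (intro mult_le_mono2 card_boundaries_le) auto
  finally have 4: "log 2 (card (boundaries q L)) \<le> log 2 (card (boundaries q L0)) + card {\<sigma> \<in> L - L0. card \<sigma> = Suc (Suc q)}"
    by (rule log2_le_of_card_le[OF _ finite_boundaries[OF L0] ne(2) finite_boundaries[OF L(1)] ne(2)])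
  show ?thesis using 1 2 3 4 unfolding pb_log_def by simp
qed

text \<open>Along a directed order, a value of maximal cardinality cannot increase any further.\<close>

lemma monotone_sets_stabilize:
  fixes g :: "'i set \<Rightarrow> 'x set"
  assumes X: "finite X" "\<And>A. finite A \<Longrightarrow> A1 \<subseteq> A \<Longrightarrow> g A \<subseteq> X"
    and mono: "\<And>A A'. finite A' \<Longrightarrow> A1 \<subseteq> A \<Longrightarrow> A \<subseteq> A' \<Longrightarrow> g A \<subseteq> g A'" and A1: "finite A1"
  shows "\<exists>A2. finite A2 \<and> A1 \<subseteq> A2 \<and> (\<forall>A. finite A \<longrightarrow> A2 \<subseteq> A \<longrightarrow> g A = g A2)"
proof -
  have "\<exists>A2. (finite A2 \<and> A1 \<subseteq> A2) \<and> (\<forall>A. finite A \<and> A1 \<subseteq> A \<longrightarrow> card (g A) \<le> card (g A2))"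
    by (rule ex_has_greatest_nat[where k = A1 and b = "card X + 1"])
      (use A1 X card_mono[OF X(1)] in \<open>auto simp: less_Suc_eq_le\<close>)
  then obtain A2 where A2: "finite A2" "A1 \<subseteq> A2" "\<And>A. finite A \<Longrightarrow> A1 \<subseteq> A \<Longrightarrow> card (g A) \<le> card (g A2)" by blast
  have "g A = g A2" if "finite A" "A2 \<subseteq> A" for A
  proof -
    have "finite (g A)" using X that A2(2) by (meson finite_subset order_trans)
    moreover have "g A2 \<subseteq> g A" by (rule mono[OF that(1) A2(2) that(2)])
    moreover have "card (g A) \<le> card (g A2)" using A2(2) that by (intro A2(3)) auto
    ultimately show ?thesis by (metis card_seteq)
  qed
  then show ?thesis using A2(1,2) by blast
qed

text \<open>
  For all large \<open>A\<close> the numerator and the denominator groups of \<open>(K A, L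
  A)\<close> are sums of those of \<open>(K0 A, L0 A)\<close> with fixed finite groups
  \<open>G2\<close> and \<open>G1\<close>. Hence the difference depends on \<open>A\<close> only
  through intersections with \<open>G2\<close> and \<open>G1\<close>, which increase and are
  therefore eventually constant.
\<close>

theorem pb_log_diff_stabilizes:
  fixes K0 K L0 L :: "'i set \<Rightarrow> 'v set set"
  assumes A0: "finite A0"
    and fin: "\<And>A. finite A \<Longrightarrow> finite (K A)" "\<And>A. finite A \<Longrightarrow> finite (L A)"
    and sub: "\<And>A. K0 A \<subseteq> K A" "\<And>A. L0 A \<subseteq> L A"
    and mono: "\<And>A A'. A \<subseteq> A' \<Longrightarrow> K0 A \<subseteq> K0 A'" "\<And>A A'. A \<subseteq> A' \<Longrightarrow> K A \<subseteq> K A'"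
      "\<And>A A'. A \<subseteq> A' \<Longrightarrow> L0 A \<subseteq> L0 A'" "\<And>A A'. A \<subseteq> A' \<Longrightarrow> L A \<subseteq> L A'"
    and new: "\<And>A. A0 \<subseteq> A \<Longrightarrow> K A - K0 A = K A0 - K0 A0" "\<And>A. A0 \<subseteq> A \<Longrightarrow> L A - L0 A = L A0 - L0 A0"
  shows "\<exists>A2. finite A2 \<and> (\<forall>A A'. finite A \<longrightarrow> finite A' \<longrightarrow> A2 \<subseteq> A \<longrightarrow> A2 \<subseteq> A' \<longrightarrow>
    pb_log q f (K A) (L A) - pb_log q f (K0 A) (L0 A) = pb_log q f (K A') (L A') - pb_log q f (K0 A') (L0 A'))"
proof -
  define G1 where "G1 = boundaries q (L A0 - L0 A0)"
  define \<rho> where "\<rho> = restr (K A0 - K0 A0)"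
  have G1: "subgp G1" "finite G1"
    unfolding G1_def using fin(2)[OF A0] by (auto intro: subgp_boundaries finite_boundaries)
  have fin0: "finite (K0 A)" "finite (L0 A)" if "finite A" for A
    using fin sub that by (meson finite_subset)+
  have B: "boundaries q (L A) = plus_set (boundaries q (L0 A)) G1" if "A0 \<subseteq> A" for A
    using boundaries_split[OF sub(2)[of A], of q] new(2)[OF that] by (simp add: G1_def)
  \<comment> \<open>The restrictions of cycles to the new simplices form an increasing family.\<close>
  have "\<exists>A1. finite A1 \<and> A0 \<subseteq> A1 \<and> (\<forall>A. finite A \<longrightarrow> A1 \<subseteq> A \<longrightarrow> \<rho> ` cycles q (K A) = \<rho> ` cycles q (K A1))"
  proof (rule monotone_sets_stabilize[where X = "chains (K A0 - K0 A0)"])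
    show "finite (chains (K A0 - K0 A0))" using fin(1)[OF A0] by (intro card_chains) auto
    show "\<rho> ` cycles q (K A) \<subseteq> chains (K A0 - K0 A0)" for A
      unfolding \<rho>_def by (auto simp: chains_def in_keys_iff lookup_restr split: if_splits)
    show "\<rho> ` cycles q (K A) \<subseteq> \<rho> ` cycles q (K A')" if "A \<subseteq> A'" for A A'
      by (intro image_mono cycles_mono mono(2) that)
  qed (rule A0)
  then obtain A1 where A1: "finite A1" "A0 \<subseteq> A1" "\<And>A. finite A \<Longrightarrow> A1 \<subseteq> A \<Longrightarrow> \<rho> ` cycles q (K A) = \<rho> ` cycles q (K A1)" by blast
  define G2 where "G2 = plus_set (chain_map f ` cycles q (K A1)) G1"
  have G2: "subgp G2" "finite G2"
    unfolding G2_def using G1 fin(1)[OF A1(1)]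
    by (auto intro!: subgp_plus_set subgp_image additive_chain_map subgp_cycles finite_plus_set finite_cycles)
  have U: "pb_sum q f (K A) (L A) = plus_set (pb_sum q f (K0 A) (L0 A)) G2" if A: "finite A" "A1 \<subseteq> A" for A
  proof (rule subset_antisym; rule subsetI)
    fix u assume "u \<in> pb_sum q f (K A) (L A)"
    then obtain z b where zb: "z \<in> cycles q (K A)" "b \<in> boundaries q (L A)" "u = chain_map f z + b"
      unfolding pb_sum_def by (auto elim!: plus_setE)
    have A0A: "A0 \<subseteq> A" using A A1(2) by blast
    obtain b0 b1 where b: "b0 \<in> boundaries q (L0 A)" "b1 \<in> G1" "b = b0 + b1"
      using zb(2) B[OF A0A] by (metis plus_setE)
    obtain w where w: "w \<in> cycles q (K A1)" "\<rho> z = \<rho> w" using A1(3)[OF A] zb(1) by (metis imageE imageI)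
    have "w \<in> cycles q (K A)" using w(1) cycles_mono[OF mono(2)[OF A(2)]] by blast
    then have "z - w \<in> cycles q (K0 A)"
      using w(2) new(1)[OF A0A] by (intro cycle_diff_old[OF zb(1)]) (simp_all add: \<rho>_def)
    then have 1: "chain_map f (z - w) + b0 \<in> pb_sum q f (K0 A) (L0 A)" unfolding pb_sum_def using b(1) by (intro plus_setI imageI)
    have 2: "chain_map f w + b1 \<in> G2" unfolding G2_def using b(2) w(1) by (intro plus_setI imageI)
    have "u = (chain_map f (z - w) + b0) + (chain_map f w + b1)"
      unfolding zb(3) b(3) additive_mapD(4)[OF additive_chain_map] by simp
    then show "u \<in> plus_set (pb_sum q f (K0 A) (L0 A)) G2" using plus_setI[OF 1 2] by simp
  next
    fix u assume "u \<in> plus_set (pb_sum q f (K0 A) (L0 A)) G2"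
    then obtain u0 g where ug: "u0 \<in> pb_sum q f (K0 A) (L0 A)" "g \<in> G2" "u = u0 + g" by (rule plus_setE)
    have "A0 \<subseteq> A" using A A1(2) by blast
    then have "G1 \<subseteq> boundaries q (L A)"
      unfolding G1_def using new(2)[of A] by (metis Diff_subset boundaries_mono)
    then have "G2 \<subseteq> pb_sum q f (K A) (L A)"
      unfolding G2_def pb_sum_def by (intro plus_set_mono image_mono cycles_mono mono(2) A(2))
    moreover have "pb_sum q f (K0 A) (L0 A) \<subseteq> pb_sum q f (K A) (L A)" by (rule pb_sum_mono[OF sub])
    ultimately show "u \<in> pb_sum q f (K A) (L A)"
      using ug subgpD(2)[OF subgp_pb_sum[of q f "K A" "L A"]] by blast
  qed
  have "\<exists>A2. finite A2 \<and> A1 \<subseteq> A2 \<and> (\<forall>A. finite A \<longrightarrow> A2 \<subseteq> A \<longrightarrow> pb_sum q f (K0 A) (L0 A) \<inter> G2 = pb_sum q f (K0 A2) (L0 A2) \<inter> G2)"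
    by (rule monotone_sets_stabilize[OF G2(2) _ _ A1(1)]) (auto dest: subsetD[OF pb_sum_mono[OF mono(1) mono(3)]])
  then obtain A2 where A2: "finite A2" "A1 \<subseteq> A2" "\<And>A. finite A \<Longrightarrow> A2 \<subseteq> A \<Longrightarrow> pb_sum q f (K0 A) (L0 A) \<inter> G2 = pb_sum q f (K0 A2) (L0 A2) \<inter> G2" by blast
  have "\<exists>A3. finite A3 \<and> A2 \<subseteq> A3 \<and> (\<forall>A. finite A \<longrightarrow> A3 \<subseteq> A \<longrightarrow> boundaries q (L0 A) \<inter> G1 = boundaries q (L0 A3) \<inter> G1)"
    by (rule monotone_sets_stabilize[OF G1(2) _ _ A2(1)]) (auto dest: subsetD[OF boundaries_mono[OF mono(3)]])
  then obtain A3 where A3: "finite A3" "A2 \<subseteq> A3" "\<And>A. finite A \<Longrightarrow> A3 \<subseteq> A \<Longrightarrow> boundaries q (L0 A) \<inter> G1 = boundaries q (L0 A3) \<inter> G1" by blast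
  have logs: "log 2 (card (plus_set V G)) - log 2 (card V) = log 2 (card G) - log 2 (card (V \<inter> G))"
    if V: "subgp V" "finite V" and G: "subgp G" "finite G" for V G :: "'v chain set"
  proof -
    have pos: "card V > 0" "card G > 0" "card (V \<inter> G) > 0" "card (plus_set V G) > 0"
      using V G subgp_nonempty[OF V(1)] subgp_nonempty[OF G(1)] subgp_nonempty[OF subgp_Int[OF V(1) G(1)]] subgp_nonempty[OF subgp_plus_set[OF V(1) G(1)]]
      by (simp_all add: card_gt_0_iff finite_plus_set)
    have "real (card (plus_set V G)) * real (card (V \<inter> G)) = real (card V) * real (card G)"
      using card_plus_set[OF V G] by (metis of_nat_mult)
    then have "log 2 (real (card (plus_set V G)) * real (card (V \<inter> G))) = log 2 (real (card V) * real (card G))" by (rule arg_cong)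
    then show ?thesis using pos by (simp add: log_mult)
  qed
  have val: "pb_log q f (K A) (L A) - pb_log q f (K0 A) (L0 A)
      = (log 2 (card G2) - log 2 (card (pb_sum q f (K0 A2) (L0 A2) \<inter> G2))) - (log 2 (card G1) - log 2 (card (boundaries q (L0 A3) \<inter> G1)))"
    if A: "finite A" "A3 \<subseteq> A" for A
  proof -
    have c: "A2 \<subseteq> A" "A1 \<subseteq> A" "A0 \<subseteq> A" using A A1(2) A2(2) A3(2) by blast+
    have "log 2 (card (pb_sum q f (K A) (L A))) - log 2 (card (pb_sum q f (K0 A) (L0 A))) = log 2 (card G2) - log 2 (card (pb_sum q f (K0 A2) (L0 A2) \<inter> G2))"
      unfolding U[OF A(1) c(2)] A2(3)[OF A(1) c(1), symmetric]
      by (rule logs[OF subgp_pb_sum finite_pb_sum[OF fin0[OF A(1)]] G2])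
    moreover have "log 2 (card (boundaries q (L A))) - log 2 (card (boundaries q (L0 A))) = log 2 (card G1) - log 2 (card (boundaries q (L0 A3) \<inter> G1))"
      unfolding B[OF c(3)] A3(3)[OF A, symmetric]
      by (rule logs[OF subgp_boundaries finite_boundaries[OF fin0(2)[OF A(1)]] G1])
    ultimately show ?thesis unfolding pb_log_def by linarith
  qed
  show ?thesis
    by (rule exI[of _ A3]) (simp add: A3(1) val)
qed

section \<open>Invariance under relabelling\<close>

lemma chain_map_closed:
  assumes c: "c \<in> chains S" and S: "\<And>\<sigma>. \<sigma> \<in> S \<Longrightarrow> inj_on f \<sigma> \<Longrightarrow> f ` \<sigma> \<in> T"
  shows "chain_map f c \<in> chains T"
proof -
  have sum_in: "(\<Sum>\<sigma>\<in>I. g \<sigma>) \<in> chains T" if "finite I" "\<And>\<sigma>. \<sigma> \<in> I \<Longrightarrow> g \<sigma> \<in> chains T"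
    for I :: "'a set set" and g :: "'a set \<Rightarrow> 'b chain"
    using that by (induction I rule: finite_induct) (auto simp: subgpD[OF subgp_chains])
  show ?thesis
    unfolding chain_map_def
  proof (rule sum_in)
    fix \<sigma> assume "\<sigma> \<in> Poly_Mapping.keys c"
    then have "\<sigma> \<in> S" using c by (auto simp: chains_def)
    then show "(if inj_on f \<sigma> then Poly_Mapping.single (f ` \<sigma>) (Poly_Mapping.lookup c \<sigma>) else 0) \<in> chains T"
      using S[of \<sigma>] by (auto simp: chains_def split: if_splits)
  qed simp
qed

lemma additive_map_comp: "additive_map F \<Longrightarrow> additive_map G \<Longrightarrow> additive_map (\<lambda>x. F (G x))"
  by (simp add: additive_map_def)

lemma chain_map_inv:
  assumes g: "inj_on g V" and c: "c \<in> chains (Pow V)"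
  shows "chain_map (inv_into V g) (chain_map g c) = c"
proof -
  have "additive_map (\<lambda>c. chain_map (inv_into V g) (chain_map g c))"
    by (rule additive_map_comp[OF additive_chain_map additive_chain_map])
  then show ?thesis
  proof (rule additive_chain_eqI[where G = "\<lambda>c. c"])
    show "additive_map (\<lambda>c. c)" by (simp add: additive_map_def)
    fix \<sigma> assume "\<sigma> \<in> Poly_Mapping.keys c"
    then have s: "\<sigma> \<subseteq> V" using c by (auto simp: chains_def)
    have "inj_on g \<sigma>" "inj_on (inv_into V g) (g ` \<sigma>)" "inv_into V g ` g ` \<sigma> = \<sigma>"
      using g s by (auto intro: inj_on_subset inj_on_inv_into simp: inv_into_image_cancel)
    then show "chain_map (inv_into V g) (chain_map g (Poly_Mapping.single \<sigma> 1)) = Poly_Mapping.single \<sigma> 1"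
      by (simp add: chain_map_single)
  qed
qed

text \<open>
  An injective relabelling maps cycles to cycles and boundaries to boundaries injectively. Only
  inequalities are shown, since the inverse relabelling gives the reverse ones.
\<close>

lemma pb_card_relabel_le:
  assumes g: "inj_on g V" and K: "\<And>\<sigma>. \<sigma> \<in> K \<Longrightarrow> \<sigma> \<subseteq> V \<and> finite \<sigma>" and L: "\<And>\<sigma>. \<sigma> \<in> L \<Longrightarrow> \<sigma> \<subseteq> V \<and> finite \<sigma>"
    and KK: "\<And>\<sigma>. \<sigma> \<in> K \<Longrightarrow> g ` \<sigma> \<in> K'" and LL: "\<And>\<sigma>. \<sigma> \<in> L \<Longrightarrow> g ` \<sigma> \<in> L'"
    and f: "\<And>\<sigma> v. \<sigma> \<in> K \<Longrightarrow> v \<in> \<sigma> \<Longrightarrow> f v \<in> V \<and> f' (g v) = g (f v)"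
    and fin: "finite K'" "finite L'"
  shows "card (pb_sum q f K L) \<le> card (pb_sum q f' K' L')" "card (boundaries q L) \<le> card (boundaries q L')"
proof -
  let ?g = "chain_map g"
  have inj: "inj_on ?g (chains (Pow V))" by (rule inj_on_inverseI[where g = "chain_map (inv_into V g)"]) (rule chain_map_inv[OF g])
  have bound: "boundary_map (Suc q) c \<in> chains (Pow V)" if c: "c \<in> chains {\<sigma>. \<sigma> \<subseteq> V \<and> finite \<sigma>}" for q and c :: "'a chain"
  proof -
    have sum_in: "(\<Sum>i\<in>I. h i) \<in> chains (Pow V)" if "finite I" "\<And>i. i \<in> I \<Longrightarrow> h i \<in> chains (Pow V)"
      for I :: "'x set" and h :: "'x \<Rightarrow> 'a chain"
      using that by (induction I rule: finite_induct) (auto simp: subgpD[OF subgp_chains])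
    have "(\<Sum>\<sigma>\<in>Poly_Mapping.keys c. \<Sum>v\<in>\<sigma>. Poly_Mapping.single (\<sigma> - {v}) (Poly_Mapping.lookup c \<sigma>)) \<in> chains (Pow V)"
      using c by (intro sum_in) (auto simp: chains_def)
    then show ?thesis by (simp add: boundary_map_def)
  qed
  have gc: "card_chain \<in> chains {\<sigma> \<in> K'. card \<sigma> = n}" if "card_chain = ?g c" "c \<in> chains {\<sigma> \<in> K. card \<sigma> = n}" for c card_chain n
    unfolding that(1) using KK by (intro chain_map_closed[OF that(2)]) (auto simp: card_image)
  have gcL: "?g c \<in> chains {\<sigma> \<in> L'. card \<sigma> = n}" if "c \<in> chains {\<sigma> \<in> L. card \<sigma> = n}" for c n
    using LL by (intro chain_map_closed[OF that]) (auto simp: card_image)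
  have com: "?g (boundary_map (Suc q) c) = boundary_map (Suc q) (?g c)" if "c \<in> chains {\<sigma>. \<sigma> \<subseteq> V \<and> finite \<sigma>}" for q c
    by (rule chain_map_boundary) (use that in \<open>auto simp: chains_def\<close>)
  have cyc: "?g z \<in> cycles q K'" if z: "z \<in> cycles q K" for z
  proof -
    have zc: "z \<in> chains {\<sigma> \<in> K. card \<sigma> = Suc q}" "boundary_map q z = 0" using z by (auto simp: cycles_def carrier_chain_space)
    have "z \<in> chains {\<sigma>. \<sigma> \<subseteq> V \<and> finite \<sigma>}" using zc(1) K by (auto simp: chains_def)
    have "boundary_map q (?g z) = 0"
    proof (cases q)
      case (Suc p)
      then show ?thesis
        using com[OF \<open>z \<in> chains {\<sigma>. \<sigma> \<subseteq> V \<and> finite \<sigma>}\<close>, of p] zc(2) by (simp add: additive_mapD(2)[OF additive_chain_map])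
    qed (simp add: boundary_map_def)
    then show ?thesis using gc[OF refl zc(1)] by (simp add: cycles_def carrier_chain_space)
  qed
  have bnd: "?g b \<in> boundaries q L'" if b: "b \<in> boundaries q L" for b
  proof -
    obtain c where c: "c \<in> chains {\<sigma> \<in> L. card \<sigma> = Suc (Suc q)}" "b = boundary_map (Suc q) c"
      using b unfolding boundaries_def carrier_chain_space by blast
    have cV: "c \<in> chains {\<sigma>. \<sigma> \<subseteq> V \<and> finite \<sigma>}" using c(1) L by (auto simp: chains_def)
    show ?thesis unfolding c(2) com[OF cV] boundaries_def carrier_chain_space by (intro imageI gcL c(1))
  qed
  have bV: "boundaries q L \<subseteq> chains (Pow V)"
  proof
    fix b assume "b \<in> boundaries q L"
    then obtain c where c: "c \<in> chains {\<sigma> \<in> L. card \<sigma> = Suc (Suc q)}" "b = boundary_map (Suc q) c"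
      unfolding boundaries_def carrier_chain_space by blast
    show "b \<in> chains (Pow V)" unfolding c(2) by (rule bound) (use c(1) L in \<open>auto simp: chains_def\<close>)
  qed
  show "card (boundaries q L) \<le> card (boundaries q L')"
    by (rule card_inj_on_le[OF inj_on_subset[OF inj bV]]) (use bnd finite_boundaries[OF fin(2)] in auto)
  have ff: "chain_map f' (?g z) = ?g (chain_map f z)" "chain_map f z \<in> chains (Pow V)" if z: "z \<in> cycles q K" for z
  proof -
    have zc: "z \<in> chains K" using z by (auto simp: cycles_def carrier_chain_space chains_def)
    show "chain_map f z \<in> chains (Pow V)" by (rule chain_map_closed[OF zc]) (use f in auto)
    show "chain_map f' (?g z) = ?g (chain_map f z)"
    proof (rule additive_chain_eqI[where F = "\<lambda>z. chain_map f' (?g z)" and G = "\<lambda>z. ?g (chain_map f z)"])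
      fix \<sigma> assume "\<sigma> \<in> Poly_Mapping.keys z"
      then have s: "\<sigma> \<in> K" using zc by (auto simp: chains_def)
      have ig: "inj_on g \<sigma>" "inj_on g (f ` \<sigma>)"
        using inj_on_subset[OF g, of \<sigma>] inj_on_subset[OF g, of "f ` \<sigma>"] K[OF s] f[OF s] by auto
      have eq: "f' ` g ` \<sigma> = g ` f ` \<sigma>" unfolding image_image using f[OF s] by (intro image_cong) auto
      have "inj_on f' (g ` \<sigma>) \<longleftrightarrow> inj_on (f' \<circ> g) \<sigma>" using ig(1) by (auto simp: comp_inj_on_iff)
      also have "\<dots> \<longleftrightarrow> inj_on (g \<circ> f) \<sigma>" using f[OF s] by (intro inj_on_cong) auto
      also have "\<dots> \<longleftrightarrow> inj_on f \<sigma>" using ig(2) by (metis comp_inj_on inj_on_imageI2)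
      finally show "chain_map f' (?g (Poly_Mapping.single \<sigma> 1)) = ?g (chain_map f (Poly_Mapping.single \<sigma> 1))"
        using ig eq by (simp add: chain_map_single additive_mapD(2)[OF additive_chain_map])
    qed (rule additive_map_comp[OF additive_chain_map additive_chain_map])+
  qed
  show "card (pb_sum q f K L) \<le> card (pb_sum q f' K' L')"
  proof (rule card_inj_on_le)
    show "inj_on ?g (pb_sum q f K L)"
    proof (rule inj_on_subset[OF inj], rule subsetI)
      fix u assume "u \<in> pb_sum q f K L"
      then obtain z b where "z \<in> cycles q K" "b \<in> boundaries q L" "u = chain_map f z + b"
        unfolding pb_sum_def by (auto elim!: plus_setE)
      then show "u \<in> chains (Pow V)" using ff(2) bV subgpD(2)[OF subgp_chains] by blast
    qed
    show "?g ` pb_sum q f K L \<subseteq> pb_sum q f' K' L'"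
    proof
      fix w assume "w \<in> ?g ` pb_sum q f K L"
      then obtain z b where zb: "z \<in> cycles q K" "b \<in> boundaries q L" "w = ?g (chain_map f z + b)"
        unfolding pb_sum_def by (auto elim!: plus_setE)
      have "w = chain_map f' (?g z) + ?g b"
        unfolding zb(3) additive_mapD(1)[OF additive_chain_map] ff(1)[OF zb(1)] ..
      then show "w \<in> pb_sum q f' K' L'"
        unfolding pb_sum_def using cyc[OF zb(1)] bnd[OF zb(2)] by (auto intro!: plus_setI)
    qed
  qed (rule finite_pb_sum[OF fin])
qed

theorem pb_log_relabel:
  assumes g: "inj_on g V" and K: "\<And>\<sigma>. \<sigma> \<in> K \<Longrightarrow> \<sigma> \<subseteq> V \<and> finite \<sigma>" and L: "\<And>\<sigma>. \<sigma> \<in> L \<Longrightarrow> \<sigma> \<subseteq> V \<and> finite \<sigma>"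
    and fin: "finite K" "finite L"
    and f: "\<And>\<sigma> v. \<sigma> \<in> K \<Longrightarrow> v \<in> \<sigma> \<Longrightarrow> f v \<in> V \<and> f' (g v) = g (f v)"
  shows "pb_log q f' ((`) g ` K) ((`) g ` L) = pb_log q f K L"
proof -
  let ?h = "inv_into V g"
  have h: "inj_on ?h (g ` V)" using g by (simp add: inj_on_inv_into)
  have bk: "?h ` g ` \<sigma> = \<sigma>" if "\<sigma> \<subseteq> V" for \<sigma> using g that by (simp add: inv_into_image_cancel)
  have hv: "?h (g v) = v" if "v \<in> V" for v using g that by (simp add: inv_into_f_f)
  have 1: "card (pb_sum q f K L) \<le> card (pb_sum q f' ((`) g ` K) ((`) g ` L))" "card (boundaries q L) \<le> card (boundaries q ((`) g ` L))"
    by (rule pb_card_relabel_le[where g = g and V = V and f = f and f' = f',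
      OF g K L imageI[of _ K "(`) g"] imageI[of _ L "(`) g"] f finite_imageI[OF fin(1)] finite_imageI[OF fin(2)]]; assumption)+
  have 2: "card (pb_sum q f' ((`) g ` K) ((`) g ` L)) \<le> card (pb_sum q f K L)" "card (boundaries q ((`) g ` L)) \<le> card (boundaries q L)"
  proof -
    have a: "\<And>\<sigma>. \<sigma> \<in> (`) g ` K \<Longrightarrow> \<sigma> \<subseteq> g ` V \<and> finite \<sigma>" "\<And>\<sigma>. \<sigma> \<in> (`) g ` L \<Longrightarrow> \<sigma> \<subseteq> g ` V \<and> finite \<sigma>"
      using K L by blast+
    have b: "\<And>\<sigma>. \<sigma> \<in> (`) g ` K \<Longrightarrow> ?h ` \<sigma> \<in> K" "\<And>\<sigma>. \<sigma> \<in> (`) g ` L \<Longrightarrow> ?h ` \<sigma> \<in> L"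
      using K L bk by fastforce+
    have c: "f' v \<in> g ` V \<and> f (?h v) = ?h (f' v)" if sv: "\<sigma> \<in> (`) g ` K" "v \<in> \<sigma>" for \<sigma> v
    proof -
      obtain \<tau> w where w: "\<tau> \<in> K" "w \<in> \<tau>" "v = g w" using sv by blast
      then have "w \<in> V" using K by blast
      then show ?thesis using f[OF w(1,2)] by (simp add: w(3) hv)
    qed
    show "card (pb_sum q f' ((`) g ` K) ((`) g ` L)) \<le> card (pb_sum q f K L)" "card (boundaries q ((`) g ` L)) \<le> card (boundaries q L)"
      by (rule pb_card_relabel_le[where g = ?h and V = "g ` V" and f = f' and f' = f, OF h a b c fin]; assumption)+
  qed
  show ?thesis unfolding pb_log_def using 1 2 by (simp add: le_antisym)
qed

section \<open>Lexicographic order\<close>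

lemma lex_less_irrefl: "\<not> lex_less x x" by (simp add: lex_less_def)

lemma lex_less_trans: assumes "lex_less x y" "lex_less y z" shows "lex_less x z"
proof -
  obtain i where i: "x $ i < y $ i" "\<And>j. j < i \<Longrightarrow> x $ j = y $ j" using assms(1) by (auto simp: lex_less_def)
  obtain k where k: "y $ k < z $ k" "\<And>j. j < k \<Longrightarrow> y $ j = z $ j" using assms(2) by (auto simp: lex_less_def)
  show ?thesis
    unfolding lex_less_def
  proof (intro exI conjI allI impI)
    show "x $ min i k < z $ min i k" using i k by (cases i k rule: linorder_cases) (auto simp: min_def)
    show "x $ j = z $ j" if "j < min i k" for j using i(2)[of j] k(2)[of j] that by simp
  qed
qed

lemma lex_less_total: assumes "x \<noteq> y" shows "lex_less x y \<or> lex_less y x"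
proof -
  define i where "i = Min {i. x $ i \<noteq> y $ i}"
  have ne: "{i. x $ i \<noteq> y $ i} \<noteq> {}" using assms by (auto simp: vec_eq_iff)
  then have "x $ i \<noteq> y $ i" unfolding i_def using Min_in[OF _ ne] by simp
  moreover have "x $ j = y $ j" if "j < i" for j
  proof (rule ccontr)
    assume "x $ j \<noteq> y $ j"
    then have "i \<le> j" unfolding i_def by (intro Min_le) auto
    then show False using that by simp
  qed
  ultimately show ?thesis unfolding lex_less_def by (metis linorder_neqE)
qed

lemma lex_smallest_subset: "lex_smallest k \<phi> \<subseteq> \<phi>" by (auto simp: lex_smallest_def)

text \<open>
  For a strict total order, the map that counts the predecessors numbers the elements of
  \<open>\<phi>\<close> consecutively from zero.
\<close>

lemma card_lex_smallest:
  assumes fin: "finite \<phi>" and k: "k \<le> card \<phi>"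
  shows "card (lex_smallest k \<phi>) = k"
proof -
  let ?r = "\<lambda>x. card {y \<in> \<phi>. lex_less y x}"
  have lt: "?r x < ?r y" if "x \<in> \<phi>" "y \<in> \<phi>" "lex_less x y" for x y
  proof (rule psubset_card_mono)
    have "x \<in> {z \<in> \<phi>. lex_less z y}" "x \<notin> {z \<in> \<phi>. lex_less z x}" using that by (auto simp: lex_less_irrefl)
    moreover have "{z \<in> \<phi>. lex_less z x} \<subseteq> {z \<in> \<phi>. lex_less z y}" using lex_less_trans[OF _ that(3)] by blast
    ultimately show "{z \<in> \<phi>. lex_less z x} \<subset> {z \<in> \<phi>. lex_less z y}" by blast
  qed (use fin in simp)
  have inj: "inj_on ?r \<phi>"
  proof (rule inj_onI, rule ccontr)
    fix x y assume xy: "x \<in> \<phi>" "y \<in> \<phi>" "?r x = ?r y" "x \<noteq> y"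
    then show False using lex_less_total[OF xy(4)] lt[OF xy(1,2)] lt[OF xy(2,1)] by auto
  qed
  have "?r ` \<phi> \<subseteq> {..<card \<phi>}"
  proof (rule image_subsetI)
    fix x assume "x \<in> \<phi>"
    then have "{y \<in> \<phi>. lex_less y x} \<subset> \<phi>" using lex_less_irrefl by blast
    then show "?r x \<in> {..<card \<phi>}" using fin by (simp add: psubset_card_mono)
  qed
  then have img: "?r ` \<phi> = {..<card \<phi>}"
    by (intro card_subset_eq) (simp_all add: card_image[OF inj])
  have "?r ` lex_smallest k \<phi> = {..<k}"
  proof (rule subset_antisym; rule subsetI)
    fix m assume "m \<in> {..<k}"
    then have "m \<in> ?r ` \<phi>" using k unfolding img by simp
    then show "m \<in> ?r ` lex_smallest k \<phi>" using \<open>m \<in> {..<k}\<close> by (auto simp: lex_smallest_def)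
  qed (auto simp: lex_smallest_def)
  moreover have "card (?r ` lex_smallest k \<phi>) = card (lex_smallest k \<phi>)"
    by (rule card_image[OF inj_on_subset[OF inj lex_smallest_subset]])
  ultimately show ?thesis by (metis card_lessThan)
qed

lemma lex_smallest_image:
  assumes "inj_on h \<phi>" "\<And>x y. x \<in> \<phi> \<Longrightarrow> y \<in> \<phi> \<Longrightarrow> lex_less (h x) (h y) \<longleftrightarrow> lex_less x y"
  shows "lex_smallest k (h ` \<phi>) = h ` lex_smallest k \<phi>"
proof -
  have "card {y \<in> h ` \<phi>. lex_less y (h x)} = card {y \<in> \<phi>. lex_less y x}" if "x \<in> \<phi>" for x
  proof -
    have "{y \<in> h ` \<phi>. lex_less y (h x)} = h ` {y \<in> \<phi>. lex_less y x}" using assms(2) that by auto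
    then show ?thesis by (simp add: card_image inj_on_subset[OF assms(1)])
  qed
  then show ?thesis by (auto simp: lex_smallest_def)
qed

section \<open>Cech radius\<close>

text \<open>
  The smallest enclosing ball exists: the largest distance to a point of \<open>\<sigma>\<close>
  is a continuous function of the centre and exceeds its value at \<open>y \<in> \<sigma>\<close>
  outside a compact ball around \<open>y\<close>.
\<close>

lemma cech_radius_exists:
  fixes \<sigma> :: "'a::euclidean_space set"
  assumes "finite \<sigma>" "\<sigma> \<noteq> {}"
  shows "\<exists>c. (\<forall>x\<in>\<sigma>. dist c x \<le> cech_radius \<sigma>) \<and> (\<forall>c' t. (\<forall>x\<in>\<sigma>. dist c' x \<le> t) \<longrightarrow> cech_radius \<sigma> \<le> t)"
proof -
  define g where "g c = Max (dist c ` \<sigma>)" for c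
  have g: "g c \<le> t \<longleftrightarrow> (\<forall>x\<in>\<sigma>. dist c x \<le> t)" for c t unfolding g_def using assms by simp
  have cont: "continuous_on A g" for A
    unfolding g_def[abs_def] using assms
  proof (induction \<sigma> rule: finite_ne_induct)
    case (insert x F)
    then have "(\<lambda>c. Max (dist c ` insert x F)) = (\<lambda>c. max (dist c x) (Max (dist c ` F)))" by (intro ext) simp
    then show ?case using insert.IH by (simp only:) (intro continuous_intros)
  qed (simp add: continuous_intros)
  obtain y where y: "y \<in> \<sigma>" using assms by auto
  have g0: "0 \<le> g c" for c using g[of c "g c"] y by (metis order_refl order_trans zero_le_dist)
  obtain c where c: "c \<in> cball y (g y)" "\<And>c'. c' \<in> cball y (g y) \<Longrightarrow> g c \<le> g c'"
    using continuous_attains_inf[OF compact_cball _ cont, of y "g y"] g0[of y] by fastforce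
  have min: "g c \<le> g c'" for c'
  proof (cases "c' \<in> cball y (g y)")
    case False
    then have "g y < dist c' y" by (simp add: dist_commute)
    moreover have "dist c' y \<le> g c'" using g[of c' "g c'"] y by simp
    moreover have "g c \<le> g y" using c(2)[of y] g0 by simp
    ultimately show ?thesis by linarith
  qed (rule c(2))
  have "cech_radius \<sigma> = g c"
    unfolding cech_radius_def
  proof (rule Least_equality)
    show "0 \<le> g c \<and> (\<Inter>x\<in>\<sigma>. cball x (g c)) \<noteq> {}"
    proof
      have "c \<in> (\<Inter>x\<in>\<sigma>. cball x (g c))" using g[of c "g c"] by (simp add: dist_commute)
      then show "(\<Inter>x\<in>\<sigma>. cball x (g c)) \<noteq> {}" by blast
    qed (rule g0)
    fix t assume "0 \<le> t \<and> (\<Inter>x\<in>\<sigma>. cball x t) \<noteq> {}"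
    then obtain c' where "\<forall>x\<in>\<sigma>. dist c' x \<le> t" by (auto simp: dist_commute)
    then show "g c \<le> t" using g min[of c'] by (meson order_trans)
  qed
  then show ?thesis using g min by (metis order_refl order_trans)
qed

lemma cech_radius_le_iff:
  fixes \<sigma> :: "'a::euclidean_space set"
  assumes "finite \<sigma>" "\<sigma> \<noteq> {}"
  shows "cech_radius \<sigma> \<le> r \<longleftrightarrow> (\<exists>c. \<forall>x\<in>\<sigma>. dist c x \<le> r)"
  using cech_radius_exists[OF assms] by (meson order_trans)

lemma cech_radius_mono:
  fixes \<sigma> :: "'a::euclidean_space set"
  assumes "finite \<tau>" "\<sigma> \<subseteq> \<tau>" "\<sigma> \<noteq> {}" "cech_radius \<tau> \<le> r" shows "cech_radius \<sigma> \<le> r"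
  using assms cech_radius_le_iff[of \<sigma> r] cech_radius_le_iff[of \<tau> r] finite_subset[of \<sigma> \<tau>] by blast

lemma dist_le_cech_radius:
  fixes \<sigma> :: "'a::euclidean_space set"
  assumes "finite \<sigma>" "x \<in> \<sigma>" "y \<in> \<sigma>" "cech_radius \<sigma> \<le> r" shows "dist x y \<le> 2 * r"
proof -
  obtain c where "\<forall>x\<in>\<sigma>. dist c x \<le> r" using cech_radius_le_iff[of \<sigma> r] assms by blast
  then show ?thesis using assms dist_triangle2[of x y c] by (smt (verit) dist_commute)
qed

lemma cech_radius_translate:
  fixes \<sigma> :: "'a::euclidean_space set"
  assumes "finite \<sigma>" "\<sigma> \<noteq> {}"
  shows "cech_radius ((+) v ` \<sigma>) \<le> r \<longleftrightarrow> cech_radius \<sigma> \<le> r"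
proof -
  have "(\<exists>c. \<forall>x\<in>(+) v ` \<sigma>. dist c x \<le> r) \<longleftrightarrow> (\<exists>c. \<forall>x\<in>\<sigma>. dist c x \<le> r)"
  proof
    assume "\<exists>c. \<forall>x\<in>(+) v ` \<sigma>. dist c x \<le> r"
    then obtain c where c: "\<forall>x\<in>\<sigma>. dist c (v + x) \<le> r" by auto
    have "dist (c - v) x = dist c (v + x)" for x by (simp add: dist_norm diff_diff_eq)
    then show "\<exists>c. \<forall>x\<in>\<sigma>. dist c x \<le> r" using c by (intro exI[of _ "c - v"]) simp
  next
    assume "\<exists>c. \<forall>x\<in>\<sigma>. dist c x \<le> r"
    then obtain c where c: "\<forall>x\<in>\<sigma>. dist c x \<le> r" by auto
    then show "\<exists>c. \<forall>x\<in>(+) v ` \<sigma>. dist c x \<le> r" by (intro exI[of _ "v + c"]) simp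
  qed
  then show ?thesis using assms by (simp add: cech_radius_le_iff)
qed

section \<open>Multicover complexes\<close>

lemma mult_complex_mono: "P \<subseteq> P' \<Longrightarrow> mult_complex r k P \<subseteq> mult_complex r k P'"
  unfolding mult_complex_def cech_complex_def by blast

lemma mult_complexD:
  assumes "\<Phi> \<in> mult_complex r k P"
  shows "\<Phi> \<noteq> {}" "finite \<Phi>" "\<Phi> \<subseteq> Pow P" "\<And>\<phi>. \<phi> \<in> \<Phi> \<Longrightarrow> finite \<phi> \<and> card \<phi> = k" "\<Union>\<Phi> \<noteq> {}" "finite (\<Union>\<Phi>)" "\<Union>\<Phi> \<subseteq> P" "cech_radius (\<Union>\<Phi>) \<le> r"
  using assms unfolding mult_complex_def cech_complex_def by auto

lemma finite_mult_complex: "finite P \<Longrightarrow> finite (mult_complex r k P)"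
  by (rule finite_subset[of _ "Pow (Pow P)"]) (rule subsetI, rule PowI, erule mult_complexD(3), simp)

text \<open>
  Passing to the smallest vertices shrinks the union of the subsets, and the radius is monotone;
  so the transition maps of the multifiltration are simplicial.
\<close>

lemma mult_complex_simplicial:
  assumes \<Phi>: "\<Phi> \<in> mult_complex r k P" and le: "r \<le> r'" "P \<subseteq> P'" "1 \<le> k'" "k' \<le> k"
  shows "lex_smallest k' ` \<Phi> \<in> mult_complex r' k' P'"
proof -
  note D = mult_complexD[OF \<Phi>]
  have c: "card (lex_smallest k' \<phi>) = k'" if "\<phi> \<in> \<Phi>" for \<phi> using D(4)[OF that] le by (intro card_lex_smallest) auto
  have U: "\<Union>(lex_smallest k' ` \<Phi>) \<subseteq> \<Union>\<Phi>" using lex_smallest_subset by fastforce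
  have ne: "\<Union>(lex_smallest k' ` \<Phi>) \<noteq> {}"
  proof -
    obtain \<phi> where p: "\<phi> \<in> \<Phi>" using D(1) by blast
    then have "lex_smallest k' \<phi> \<noteq> {}" using c[OF p] le(3) by auto
    then show ?thesis using p by blast
  qed
  have "cech_radius (\<Union>(lex_smallest k' ` \<Phi>)) \<le> r'"
    using cech_radius_mono[OF D(6) U ne D(8)] le(1) by linarith
  moreover have "finite (\<Union>(lex_smallest k' ` \<Phi>))" using D(6) U finite_subset by blast
  moreover have "lex_smallest k' \<phi> \<subseteq> P' \<and> finite (lex_smallest k' \<phi>) \<and> card (lex_smallest k' \<phi>) = k'" if "\<phi> \<in> \<Phi>" for \<phi>
  proof -
    have "\<phi> \<subseteq> P'" "finite \<phi>" using D(3,4) that le(2) by blast+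
    then show ?thesis using c[OF that] lex_smallest_subset[of k' \<phi>] by (auto intro: finite_subset)
  qed
  ultimately show ?thesis
    unfolding mult_complex_def cech_complex_def using D(1,2) U D(7) le(2) ne by blast
qed

lemma mult_complex_image:
  assumes P: "finite P" "inj_on h P"
    and cech: "\<And>\<sigma>. \<sigma> \<subseteq> P \<Longrightarrow> \<sigma> \<noteq> {} \<Longrightarrow> cech_radius (h ` \<sigma>) \<le> u \<longleftrightarrow> cech_radius \<sigma> \<le> r"
  shows "mult_complex u k (h ` P) = (`) ((`) h) ` mult_complex r k P"
proof -
  have key: "(`) h ` \<Phi> \<in> mult_complex u k (h ` P) \<longleftrightarrow> \<Phi> \<in> mult_complex r k P" if \<Phi>: "\<Phi> \<subseteq> Pow P" for \<Phi>
  proof -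
    have fin: "finite \<Phi>" "finite (\<Union>\<Phi>)" using \<Phi> P(1) by (auto intro: finite_subset)
    have c: "card (h ` \<phi>) = card \<phi>" if "\<phi> \<in> \<Phi>" for \<phi> using that \<Phi> by (intro card_image inj_on_subset[OF P(2)]) auto
    have f: "finite \<phi>" if "\<phi> \<in> \<Phi>" for \<phi> using that \<Phi> P(1) by (auto intro: finite_subset)
    have U: "\<Union>((`) h ` \<Phi>) = h ` \<Union>\<Phi>" by auto
    have UP: "\<Union>\<Phi> \<subseteq> P" using \<Phi> by auto
    have 1: "(\<forall>\<phi>\<in>(`) h ` \<Phi>. \<phi> \<subseteq> h ` P \<and> finite \<phi> \<and> card \<phi> = k) \<longleftrightarrow> (\<forall>\<phi>\<in>\<Phi>. \<phi> \<subseteq> P \<and> finite \<phi> \<and> card \<phi> = k)"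
    proof -
      have "h ` \<phi> \<subseteq> h ` P \<and> finite (h ` \<phi>)" "\<phi> \<subseteq> P \<and> finite \<phi>" if "\<phi> \<in> \<Phi>" for \<phi> using that \<Phi> f[OF that] by auto
      then show ?thesis using c by simp
    qed
    have 2: "\<Union>((`) h ` \<Phi>) \<in> cech_complex u (h ` P) \<longleftrightarrow> \<Union>\<Phi> \<in> cech_complex r P"
      unfolding U cech_complex_def using fin UP cech[OF UP] by (cases "\<Union>\<Phi> = {}") (simp_all add: image_mono)
    show ?thesis
      unfolding mult_complex_def mem_Collect_eq 1 2 using fin(1) by simp
  qed
  show ?thesis
  proof (rule subset_antisym; rule subsetI)
    fix \<Psi> assume Psi: "\<Psi> \<in> mult_complex u k (h ` P)"
    have "\<Psi> = (`) h ` (\<lambda>\<psi>. P \<inter> h -` \<psi>) ` \<Psi>"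
    proof -
      have "h ` (P \<inter> h -` \<psi>) = \<psi>" if "\<psi> \<in> \<Psi>" for \<psi>
      proof (rule subset_antisym)
        have "\<psi> \<subseteq> h ` P" using mult_complexD(3)[OF Psi] that by blast
        then show "\<psi> \<subseteq> h ` (P \<inter> h -` \<psi>)" by blast
      qed auto
      then show ?thesis unfolding image_image by simp
    qed
    moreover have "(\<lambda>\<psi>. P \<inter> h -` \<psi>) ` \<Psi> \<subseteq> Pow P" by auto
    ultimately show "\<Psi> \<in> (`) ((`) h) ` mult_complex r k P" using key Psi by (metis image_eqI)
  next
    fix \<Psi> assume "\<Psi> \<in> (`) ((`) h) ` mult_complex r k P"
    then obtain \<Phi> where "\<Phi> \<in> mult_complex r k P" "\<Psi> = (`) h ` \<Phi>" by (rule imageE) auto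
    then show "\<Psi> \<in> mult_complex u k (h ` P)" using key[OF mult_complexD(3)] by simp
  qed
qed

text \<open>
  The persistent Betti number depends on the positions only through the order of the points and
  through the sets that pass the two thresholds. The thresholds \<open>u, u'\<close> for the image
  may differ from the thresholds \<open>r, r'\<close>, which allows for small displacements of the
  points.
\<close>

theorem pb_log_mult_relabel:
  fixes h :: "(real, 'd::{finite,linorder}) vec \<Rightarrow> (real, 'd) vec"
  assumes P: "finite P" "inj_on h P" "Pb \<subseteq> P" "Pd \<subseteq> P"
    and lex: "\<And>x y. x \<in> P \<Longrightarrow> y \<in> P \<Longrightarrow> lex_less (h x) (h y) \<longleftrightarrow> lex_less x y"
    and cech: "\<And>\<sigma>. \<sigma> \<subseteq> P \<Longrightarrow> \<sigma> \<noteq> {} \<Longrightarrow> cech_radius (h ` \<sigma>) \<le> u \<longleftrightarrow> cech_radius \<sigma> \<le> r"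
      "\<And>\<sigma>. \<sigma> \<subseteq> P \<Longrightarrow> \<sigma> \<noteq> {} \<Longrightarrow> cech_radius (h ` \<sigma>) \<le> u' \<longleftrightarrow> cech_radius \<sigma> \<le> r'"
  shows "pb_log q (lex_smallest k') (mult_complex u k (h ` Pb)) (mult_complex u' k' (h ` Pd))
    = pb_log q (lex_smallest k') (mult_complex r k Pb) (mult_complex r' k' Pd)"
proof -
  have fin: "finite Pb" "finite Pd" using P finite_subset by blast+
  have eq: "mult_complex u k (h ` Pb) = (`) ((`) h) ` mult_complex r k Pb" "mult_complex u' k' (h ` Pd) = (`) ((`) h) ` mult_complex r' k' Pd"
    by (rule mult_complex_image[OF fin(1) inj_on_subset[OF P(2,3)]], use cech(1) P(3) in blast)
      (rule mult_complex_image[OF fin(2) inj_on_subset[OF P(2,4)]], use cech(2) P(4) in blast)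
  show ?thesis
    unfolding eq
  proof (rule pb_log_relabel[where V = "Pow P"])
    show "inj_on ((`) h) (Pow P)" by (rule inj_on_image_Pow[OF P(2)])
    show "\<sigma> \<subseteq> Pow P \<and> finite \<sigma>" if "\<sigma> \<in> mult_complex r k Pb" for \<sigma> using mult_complexD(2,3)[OF that] P(3) by blast
    show "\<sigma> \<subseteq> Pow P \<and> finite \<sigma>" if "\<sigma> \<in> mult_complex r' k' Pd" for \<sigma> using mult_complexD(2,3)[OF that] P(4) by blast
    show "lex_smallest k' \<phi> \<in> Pow P \<and> lex_smallest k' (h ` \<phi>) = h ` lex_smallest k' \<phi>" if "\<sigma> \<in> mult_complex r k Pb" "\<phi> \<in> \<sigma>" for \<sigma> \<phi>
    proof -
      have "\<phi> \<subseteq> P" using mult_complexD(3)[OF that(1)] that(2) P(3) by blast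
      have "lex_smallest k' (h ` \<phi>) = h ` lex_smallest k' \<phi>"
        using \<open>\<phi> \<subseteq> P\<close> lex by (intro lex_smallest_image inj_on_subset[OF P(2)]) blast+
      then show ?thesis
        using \<open>\<phi> \<subseteq> P\<close> lex_smallest_subset[of k' \<phi>] by blast
    qed
  qed (intro finite_mult_complex fin)+
qed

text \<open>
  A simplex that is lost with the points outside \<open>P0\<close> has such a point as a vertex,
  and the enclosing ball of radius \<open>r\<close> bounds its diameter.
\<close>

lemma new_simplices_local:
  assumes \<Phi>: "\<Phi> \<in> mult_complex r k P" "\<Phi> \<notin> mult_complex r k P0"
  obtains x where "x \<in> \<Union>\<Phi>" "x \<in> P - P0" "\<And>y. y \<in> \<Union>\<Phi> \<Longrightarrow> dist x y \<le> 2 * r"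
proof -
  note D = mult_complexD[OF \<Phi>(1)]
  have "\<not> \<Union>\<Phi> \<subseteq> P0" using \<Phi> unfolding mult_complex_def cech_complex_def by blast
  then obtain x where x: "x \<in> \<Union>\<Phi>" "x \<in> P - P0" using D(7) by blast
  show ?thesis by (rule that[OF x]) (rule dist_le_cech_radius[OF D(6) x(1) _ D(8)])
qed

lemma card_simplices_le:
  assumes "finite Q" "\<And>\<Phi>. \<Phi> \<in> X \<Longrightarrow> \<Phi> \<subseteq> Pow Q \<and> card \<Phi> = m"
  shows "card X \<le> 2 ^ (m * card Q)"
proof -
  have "card X \<le> card {\<Phi>. \<Phi> \<subseteq> Pow Q \<and> card \<Phi> = m}"
    using assms by (intro card_mono) auto
  also have "\<dots> = 2 ^ card Q choose m" using assms(1) by (simp add: n_subsets card_Pow)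
  also have "\<dots> \<le> (2 ^ card Q) ^ m"
    by (cases "m \<le> 2 ^ card Q") (simp_all add: binomial_le_pow binomial_eq_0)
  finally show ?thesis by (simp add: power_mult[symmetric] mult.commute)
qed

section \<open>Square integrable functions\<close>

definition L2 :: "'a measure \<Rightarrow> ('a \<Rightarrow> real) \<Rightarrow> bool" where
  "L2 M f \<longleftrightarrow> f \<in> borel_measurable M \<and> integrable M (\<lambda>x. (f x)\<^sup>2)"

lemma L2_measurable: "L2 M f \<Longrightarrow> f \<in> borel_measurable M" by (simp add: L2_def)

lemma L2_integrable_mult:
  assumes "L2 M f" "L2 M g" shows "integrable M (\<lambda>x. f x * g x)"
proof (rule Bochner_Integration.integrable_bound)
  show "integrable M (\<lambda>x. (f x)\<^sup>2 + (g x)\<^sup>2)" using assms by (simp add: L2_def)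
  show "(\<lambda>x. f x * g x) \<in> borel_measurable M"
    using assms unfolding L2_def by (intro borel_measurable_times) auto
  have "\<bar>a * b\<bar> \<le> a\<^sup>2 + b\<^sup>2" for a b :: real
  proof -
    have "2 * \<bar>a\<bar> * \<bar>b\<bar> \<le> a\<^sup>2 + b\<^sup>2" using sum_squares_bound[of "\<bar>a\<bar>" "\<bar>b\<bar>"] by simp
    moreover have "0 \<le> \<bar>a\<bar> * \<bar>b\<bar>" by simp
    ultimately show ?thesis unfolding abs_mult by linarith
  qed
  then show "AE x in M. norm (f x * g x) \<le> norm ((f x)\<^sup>2 + (g x)\<^sup>2)"
    by simp
qed

lemma L2_add: "L2 M f \<Longrightarrow> L2 M g \<Longrightarrow> L2 M (\<lambda>x. f x + g x)"
proof -
  assume fg: "L2 M f" "L2 M g"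
  have "integrable M (\<lambda>x. (f x)\<^sup>2 + (g x)\<^sup>2 + 2 * (f x * g x))"
    using fg L2_integrable_mult[OF fg] unfolding L2_def
    by (intro Bochner_Integration.integrable_add integrable_mult_right) auto
  moreover have "(\<lambda>x. f x + g x) \<in> borel_measurable M"
    using fg unfolding L2_def by (intro borel_measurable_add) auto
  ultimately show "L2 M (\<lambda>x. f x + g x)"
    unfolding L2_def power2_sum mult.assoc by (intro conjI)
qed

lemma L2_cmult: "L2 M f \<Longrightarrow> L2 M (\<lambda>x. c * f x)"
  unfolding L2_def power_mult_distrib by (intro conjI integrable_mult_right borel_measurable_times) auto

lemma L2_abs: "L2 M f \<Longrightarrow> L2 M (\<lambda>x. \<bar>f x\<bar>)"
  unfolding L2_def power2_abs by (intro conjI borel_measurable_abs) auto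

lemma L2_diff: "L2 M f \<Longrightarrow> L2 M g \<Longrightarrow> L2 M (\<lambda>x. f x - g x)"
  using L2_add[OF _ L2_cmult[of M g "-1"], of f] by (simp only: mult_minus1 diff_conv_add_uminus)

lemma L2_divide: "L2 M f \<Longrightarrow> L2 M (\<lambda>x. f x / c)"
  using L2_cmult[of M f "1/c"] by (simp only: times_divide_eq_left mult_1_left)

lemma L2_bound:
  assumes "L2 M h" "f \<in> borel_measurable M" "\<And>x. x \<in> space M \<Longrightarrow> \<bar>f x\<bar> \<le> h x"
  shows "L2 M f"
  unfolding L2_def
proof
  show "integrable M (\<lambda>x. (f x)\<^sup>2)"
  proof (rule Bochner_Integration.integrable_bound)
    show "integrable M (\<lambda>x. (h x)\<^sup>2)" using assms by (simp add: L2_def)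
    show "AE x in M. norm ((f x)\<^sup>2) \<le> norm ((h x)\<^sup>2)"
      using assms(3) by (auto intro!: AE_I2) (metis abs_ge_zero power2_abs power_mono)
  qed (use assms in simp)
qed fact

context prob_space begin

lemma L2_const: "L2 M (\<lambda>x. c)" by (simp add: L2_def)

lemma L2_integrable: "L2 M f \<Longrightarrow> integrable M f"
  unfolding L2_def by (elim conjE) (rule square_integrable_imp_integrable)

lemma L2_sum: "(\<And>i. i \<in> I \<Longrightarrow> L2 M (f i)) \<Longrightarrow> L2 M (\<lambda>x. \<Sum>i\<in>I. f i x)"
proof (induction I rule: infinite_finite_induct)
  case (insert i I)
  then have "L2 M (\<lambda>x. f i x + (\<Sum>i\<in>I. f i x))" by (intro L2_add) auto
  then show ?case using insert.hyps by simp
qed (simp_all add: L2_const)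

lemma L2_jensen:
  assumes "L2 M f" shows "(expectation f)\<^sup>2 \<le> expectation (\<lambda>x. (f x)\<^sup>2)"
proof -
  have "variance f = expectation (\<lambda>x. (f x)\<^sup>2) - (expectation f)\<^sup>2"
    by (rule variance_eq[OF L2_integrable[OF assms]]) (use assms in \<open>simp add: L2_def\<close>)
  then show ?thesis using variance_positive[of f] by linarith
qed

end

definition norm2 :: "'a measure \<Rightarrow> ('a \<Rightarrow> real) \<Rightarrow> real" where
  "norm2 M f = sqrt (\<integral>x. (f x)\<^sup>2 \<partial>M)"

lemma norm2_sq: "(norm2 M f)\<^sup>2 = (\<integral>x. (f x)\<^sup>2 \<partial>M)"
  by (simp add: norm2_def)

lemma norm2_nonneg: "norm2 M f \<ge> 0" by (simp add: norm2_def)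

lemma L2_cauchy_schwarz:
  assumes f: "L2 M f" and g: "L2 M g"
  shows "(\<integral>x. f x * g x \<partial>M) \<le> norm2 M f * norm2 M g"
proof -
  have a: "0 \<le> (norm2 M f)\<^sup>2 * t\<^sup>2 - 2 * t * (\<integral>x. f x * g x \<partial>M) + (norm2 M g)\<^sup>2" for t
  proof -
    have "0 \<le> (\<integral>x. (t * f x - g x)\<^sup>2 \<partial>M)" by simp
    also have "(\<lambda>x. (t * f x - g x)\<^sup>2) = (\<lambda>x. t\<^sup>2 * (f x)\<^sup>2 - 2 * t * (f x * g x) + (g x)\<^sup>2)"
      by (auto simp: power2_diff power_mult_distrib algebra_simps)
    also have "(\<integral>x. t\<^sup>2 * (f x)\<^sup>2 - 2 * t * (f x * g x) + (g x)\<^sup>2 \<partial>M) = t\<^sup>2 * (\<integral>x. (f x)\<^sup>2 \<partial>M) - 2 * t * (\<integral>x. f x * g x \<partial>M) + (\<integral>x. (g x)\<^sup>2 \<partial>M)"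
      using f g L2_integrable_mult[OF f g] unfolding L2_def
      by simp
    finally show ?thesis by (simp add: norm2_sq mult.commute)
  qed
  show ?thesis
  proof (cases "norm2 M f = 0")
    case True
    have "(\<integral>x. f x * g x \<partial>M) \<le> 0"
    proof (rule ccontr)
      let ?I = "\<integral>x. f x * g x \<partial>M"
      assume "\<not> ?I \<le> 0"
      then have p: "?I > 0" by simp
      have "2 * (((norm2 M g)\<^sup>2 + 1) / (2 * ?I)) * ?I = (norm2 M g)\<^sup>2 + 1" using p by simp
      then show False using a[of "((norm2 M g)\<^sup>2 + 1) / (2 * ?I)"] True by simp
    qed
    then show ?thesis using True by simp
  next
    case False
    then have p: "norm2 M f > 0" using norm2_nonneg[of M f] by simp
    have eq: "norm2 M f * (norm2 M g / norm2 M f) = norm2 M g" using p by simp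
    have "0 \<le> (norm2 M f)\<^sup>2 * (norm2 M g / norm2 M f)\<^sup>2 - 2 * (norm2 M g / norm2 M f) * (\<integral>x. f x * g x \<partial>M) + (norm2 M g)\<^sup>2"
      by (rule a)
    also have "\<dots> = 2 * (norm2 M g)\<^sup>2 - 2 * (norm2 M g / norm2 M f) * (\<integral>x. f x * g x \<partial>M)"
      unfolding power_mult_distrib[symmetric] eq by simp
    finally have *: "(norm2 M g / norm2 M f) * (\<integral>x. f x * g x \<partial>M) \<le> (norm2 M g)\<^sup>2" by simp
    show ?thesis
    proof (cases "norm2 M g = 0")
      case True
      have 1: "0 \<le> (norm2 M f)\<^sup>2 * t\<^sup>2 - 2 * t * (\<integral>x. f x * g x \<partial>M)" for t using a[of t] True by simp
      have "0 \<le> (norm2 M f)\<^sup>2 * ((\<integral>x. f x * g x \<partial>M) / (norm2 M f)\<^sup>2)\<^sup>2 - 2 * ((\<integral>x. f x * g x \<partial>M) / (norm2 M f)\<^sup>2) * (\<integral>x. f x * g x \<partial>M)" by (rule 1)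
      also have "\<dots> = - ((\<integral>x. f x * g x \<partial>M)\<^sup>2 / (norm2 M f)\<^sup>2)"
        using p by (simp add: field_simps power2_eq_square)
      finally have "(\<integral>x. f x * g x \<partial>M)\<^sup>2 / (norm2 M f)\<^sup>2 \<le> 0" by simp
      then have "(\<integral>x. f x * g x \<partial>M)\<^sup>2 \<le> 0" using p by (simp add: divide_le_0_iff)
      then show ?thesis using True by simp
    next
      case False
      then have "norm2 M g > 0" using norm2_nonneg[of M g] by simp
      then show ?thesis using * p by (simp add: field_simps power2_eq_square)
    qed
  qed
qed

lemma norm2_triangle:
  assumes f: "L2 M f" and g: "L2 M g"
  shows "norm2 M (\<lambda>x. f x + g x) \<le> norm2 M f + norm2 M g"
proof (rule power2_le_imp_le)
  have "(norm2 M (\<lambda>x. f x + g x))\<^sup>2 = (\<integral>x. (f x)\<^sup>2 + 2 * (f x * g x) + (g x)\<^sup>2 \<partial>M)"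
    by (simp add: norm2_sq power2_sum algebra_simps)
  also have "\<dots> = (norm2 M f)\<^sup>2 + 2 * (\<integral>x. f x * g x \<partial>M) + (norm2 M g)\<^sup>2"
    using f g L2_integrable_mult[OF f g] unfolding norm2_sq L2_def by simp
  also have "\<dots> \<le> (norm2 M f + norm2 M g)\<^sup>2"
    using L2_cauchy_schwarz[OF f g] by (simp add: power2_sum)
  finally show "(norm2 M (\<lambda>x. f x + g x))\<^sup>2 \<le> (norm2 M f + norm2 M g)\<^sup>2" .
qed (simp add: norm2_nonneg)

lemma norm2_cmult: "norm2 M (\<lambda>x. c * f x) = \<bar>c\<bar> * norm2 M f"
  by (simp add: norm2_def power_mult_distrib real_sqrt_mult)

lemma norm2_reverse_triangle:
  assumes f: "L2 M f" and g: "L2 M g"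
  shows "\<bar>norm2 M f - norm2 M g\<bar> \<le> norm2 M (\<lambda>x. f x - g x)"
proof -
  have "norm2 M (\<lambda>x. g x - f x) = norm2 M (\<lambda>x. f x - g x)"
    by (simp add: norm2_def power2_commute)
  then show ?thesis
    using norm2_triangle[OF L2_diff[OF f g] g] norm2_triangle[OF L2_diff[OF g f] f] by simp
qed

text \<open>
  The function \<open>cis\<close> is Lipschitz with constant one, and a mean absolute value is at
  most the quadratic mean.
\<close>

lemma (in prob_space) cis_expectation_close:
  assumes f: "L2 M f" and g: "L2 M g"
  shows "cmod (expectation (\<lambda>x. cis (f x)) - expectation (\<lambda>x. cis (g x))) \<le> norm2 M (\<lambda>x. f x - g x)"
proof -
  have m: "(\<lambda>x. cis (h x)) \<in> borel_measurable M" if "L2 M h" for h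
    using L2_measurable[OF that] unfolding cis_conv_exp by measurable
  have i: "integrable M (\<lambda>x. cis (h x))" if "L2 M h" for h
    by (rule integrable_const_bound[of _ 1]) (auto intro: m that)
  have le: "cmod (cis a - cis b) \<le> \<bar>a - b\<bar>" for a b
  proof -
    have "cmod (cis a - cis b) = cmod (cis b * (cis (a - b) - 1))"
      by (simp add: right_diff_distrib cis_mult)
    also have "\<dots> = cmod (cis (a - b) - 1)" by (simp add: norm_mult)
    also have "\<dots> \<le> \<bar>a - b\<bar>" using iexp_approx1[of "a - b" 0] by (simp add: cis_conv_exp)
    finally show ?thesis .
  qed
  have "cmod (expectation (\<lambda>x. cis (f x)) - expectation (\<lambda>x. cis (g x))) = cmod (expectation (\<lambda>x. cis (f x) - cis (g x)))"
    using i f g by simp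
  also have "\<dots> \<le> expectation (\<lambda>x. cmod (cis (f x) - cis (g x)))" by (rule integral_norm_bound)
  also have "\<dots> \<le> expectation (\<lambda>x. \<bar>f x - g x\<bar>)"
    using L2_integrable[OF L2_diff[OF f g]] i f g by (intro integral_mono le) auto
  also have "\<dots> \<le> norm2 M (\<lambda>x. f x - g x)"
  proof -
    have "L2 M (\<lambda>x. \<bar>f x - g x\<bar>)" by (rule L2_abs[OF L2_diff[OF f g]])
    from L2_jensen[OF this] show ?thesis unfolding norm2_def by (intro real_le_rsqrt) simp
  qed
  finally show ?thesis .
qed

section \<open>Variance and deletion of coordinates\<close>

text \<open>Conditionals that arise from updates are folded back, so that rules about updates apply.\<close>

declare fun_upd_def [symmetric, simp]

definition depends_on :: "'i set \<Rightarrow> (('i \<Rightarrow> 's) \<Rightarrow> 'b) \<Rightarrow> bool" where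
  "depends_on A F \<longleftrightarrow> (\<forall>s s'. (\<forall>i\<in>A. s i = s' i) \<longrightarrow> F s = F s')"

lemma depends_onD: "depends_on A F \<Longrightarrow> (\<And>i. i \<in> A \<Longrightarrow> s i = s' i) \<Longrightarrow> F s = F s'"
  by (auto simp: depends_on_def)

lemma measurable_update_PiM:
  assumes "x \<in> space S"
  shows "(\<lambda>s. s(i := x)) \<in> PiM UNIV (\<lambda>_. S) \<rightarrow>\<^sub>M PiM UNIV (\<lambda>_. S)"
proof (rule measurable_PiM_single')
  fix j show "(\<lambda>s. (s(i := x)) j) \<in> PiM UNIV (\<lambda>_. S) \<rightarrow>\<^sub>M S"
    using assms by (cases "i = j") (auto)
qed (use assms in \<open>auto simp: space_PiM\<close>)

text \<open>
  Replacing one coordinate of a product measure by an independent copy does not change the law.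
\<close>

lemma distr_resample_coordinate:
  fixes S :: "'s measure" and i :: 'i
  assumes "prob_space S"
  defines "P \<equiv> PiM (UNIV :: 'i set) (\<lambda>_. S)"
  shows "distr (P \<Otimes>\<^sub>M S) P (\<lambda>(s, x). s(i := x)) = P"
    and "(\<lambda>(s, x). s(i := x)) \<in> P \<Otimes>\<^sub>M S \<rightarrow>\<^sub>M P"
proof -
  interpret S: prob_space S by fact
  interpret P: prob_space P unfolding P_def by (intro prob_space_PiM assms)
  interpret SP: pair_sigma_finite S P ..
  interpret PS: pair_sigma_finite P S ..
  have m: "(\<lambda>(x, s). s(i := x)) \<in> S \<Otimes>\<^sub>M P \<rightarrow>\<^sub>M P"
    unfolding P_def split_beta'
    by (rule measurable_PiM_single') (auto simp: space_PiM space_pair_measure split: if_splits)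
  have "(\<lambda>p. (\<lambda>(x, s). s(i := x)) ((\<lambda>(s, x). (x, s)) p)) \<in> P \<Otimes>\<^sub>M S \<rightarrow>\<^sub>M P"
    by (rule measurable_compose[OF measurable_pair_swap' m])
  then show m2: "(\<lambda>(s, x). s(i := x)) \<in> P \<Otimes>\<^sub>M S \<rightarrow>\<^sub>M P"
    by (simp add: split_beta')
  have "P = distr (S \<Otimes>\<^sub>M P) P (\<lambda>(x, s). s(i := x))"
    using distr_pair_PiM_eq_PiM[of "UNIV :: 'i set" "\<lambda>_. S" i] assms(1) by (simp add: P_def)
  also have "\<dots> = distr (distr (P \<Otimes>\<^sub>M S) (S \<Otimes>\<^sub>M P) (\<lambda>(s, x). (x, s))) P (\<lambda>(x, s). s(i := x))"
    by (subst SP.distr_pair_swap) simp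
  also have "\<dots> = distr (P \<Otimes>\<^sub>M S) P (\<lambda>(s, x). s(i := x))"
    by (subst distr_distr[OF m measurable_pair_swap']) (simp add: comp_def split_beta')
  finally show "distr (P \<Otimes>\<^sub>M S) P (\<lambda>(s, x). s(i := x)) = P" ..
qed

lemma integral_resample_coordinate:
  fixes S :: "'s measure" and i :: 'i and f :: "('i \<Rightarrow> 's) \<Rightarrow> real"
  assumes S: "prob_space S"
  defines "P \<equiv> PiM (UNIV :: 'i set) (\<lambda>_. S)"
  assumes f: "integrable P f"
  shows "integrable P (\<lambda>s. \<integral>x. f (s(i := x)) \<partial>S)"
    and "(\<integral>s. (\<integral>x. f (s(i := x)) \<partial>S) \<partial>P) = (\<integral>s. f s \<partial>P)"
    and "AE s in P. integrable S (\<lambda>x. f (s(i := x)))"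
proof -
  interpret S: prob_space S by fact
  interpret P: prob_space P unfolding P_def by (intro prob_space_PiM assms)
  interpret PS: pair_sigma_finite P S ..
  note d = distr_resample_coordinate[OF S, of i, folded P_def]
  have "integrable (distr (P \<Otimes>\<^sub>M S) P (\<lambda>(s, x). s(i := x))) f" using f d by simp
  then have i: "integrable (P \<Otimes>\<^sub>M S) (\<lambda>p. f ((fst p)(i := snd p)))"
    using integrable_distr[OF d(2)] by (simp add: split_beta')
  show "integrable P (\<lambda>s. \<integral>x. f (s(i := x)) \<partial>S)" using PS.integrable_fst'[OF i] by simp
  show "AE s in P. integrable S (\<lambda>x. f (s(i := x)))" using PS.AE_integrable_fst'[OF i] by simp
  have "(\<integral>s. f s \<partial>P) = (\<integral>s. f s \<partial>distr (P \<Otimes>\<^sub>M S) P (\<lambda>(s, x). s(i := x)))" using d by simp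
  also have "\<dots> = (\<integral>p. f ((fst p)(i := snd p)) \<partial>(P \<Otimes>\<^sub>M S))"
    by (subst integral_distr) (use d f in \<open>auto simp: split_beta'\<close>)
  also have "\<dots> = (\<integral>s. (\<integral>x. f (s(i := x)) \<partial>S) \<partial>P)" using PS.integral_fst'[OF i] by simp
  finally show "(\<integral>s. (\<integral>x. f (s(i := x)) \<partial>S) \<partial>P) = (\<integral>s. f s \<partial>P)" by simp
qed

text \<open>
  A variant of the Efron-Stein inequality. Coordinates are averaged out one after the other. Among
  all functions that ignore coordinate \<open>z\<close>, the average over \<open>z\<close> is the
  best mean square approximation of \<open>F\<close>, so it is at least as good as
  \<open>F\<close> with coordinate \<open>z\<close> deleted, that is, replaced by a fixed value
  \<open>e\<close>; and averaging does not increase the effects of the other deletions, by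
  Jensen's inequality.
\<close>

theorem efron_stein_deletion:
  fixes S :: "'s measure" and F :: "('i \<Rightarrow> 's) \<Rightarrow> real"
  assumes S: "prob_space S" and e: "e \<in> space S"
  defines "P \<equiv> PiM (UNIV :: 'i set) (\<lambda>_. S)"
  assumes "finite A" and dep: "depends_on A F" and F: "L2 P F"
    and D: "\<And>i. i \<in> A \<Longrightarrow> L2 P (\<lambda>s. F s - F (s(i := e)))"
  shows "(\<integral>s. (F s)\<^sup>2 \<partial>P) - (\<integral>s. F s \<partial>P)\<^sup>2 \<le> (\<Sum>i\<in>A. \<integral>s. (F s - F (s(i := e)))\<^sup>2 \<partial>P)"
  using assms(4-)
proof (induction A arbitrary: F)
  case empty
  interpret P: prob_space P unfolding P_def by (intro prob_space_PiM S)
  define c where "c = F undefined"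
  have c: "F s = c" for s unfolding c_def by (rule depends_onD[OF empty(1)]) simp
  have "(\<integral>s. (F s)\<^sup>2 \<partial>P) = c\<^sup>2" "(\<integral>s. F s \<partial>P) = c"
    unfolding c by (simp_all add: P.prob_space)
  then show ?case by simp
next
  case (insert z A)
  interpret S: prob_space S by fact
  interpret P: prob_space P unfolding P_def by (intro prob_space_PiM S)
  note R = integral_resample_coordinate[OF S, of _ z, folded P_def]
  define G where "G s = (\<integral>x. F (s(z := x)) \<partial>S)" for s
  have iF: "integrable P F" and iF2: "integrable P (\<lambda>s. (F s)\<^sup>2)"
    using P.L2_integrable[OF insert.prems(2)] insert.prems(2) by (simp_all add: L2_def)
  have mupd: "(\<lambda>x. s(z := x)) \<in> S \<rightarrow>\<^sub>M P" if "s \<in> space P" for s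
    unfolding P_def
  proof (rule measurable_PiM_single')
    show "(\<lambda>x. (s(z := x)) i) \<in> S \<rightarrow>\<^sub>M S" for i
      using that by (cases "i = z") (auto simp: P_def space_PiM PiE_iff)
  qed (use that in \<open>auto simp: P_def space_PiM\<close>)
  have AEF: "AE s in P. L2 S (\<lambda>x. F (s(z := x)))"
    using R(3)[OF iF2]
  proof (rule AE_mp, intro AE_I2 impI)
    fix s assume "s \<in> space P" "integrable S (\<lambda>x. (F (s(z := x)))\<^sup>2)"
    then show "L2 S (\<lambda>x. F (s(z := x)))"
      using measurable_compose[OF mupd L2_measurable[OF insert.prems(2)]] by (auto simp: L2_def)
  qed
  have iG: "integrable P G" unfolding G_def[abs_def] by (rule R(1)[OF iF])
  have EG: "(\<integral>s. G s \<partial>P) = (\<integral>s. F s \<partial>P)" unfolding G_def by (rule R(2)[OF iF])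
  have G2: "L2 P G"
    unfolding L2_def
  proof
    show "integrable P (\<lambda>s. (G s)\<^sup>2)"
    proof (rule Bochner_Integration.integrable_bound[OF R(1)[OF iF2]])
      show "AE s in P. norm ((G s)\<^sup>2) \<le> norm (\<integral>x. (F (s(z := x)))\<^sup>2 \<partial>S)"
        using AEF by (rule AE_mp) (auto intro!: AE_I2 S.L2_jensen simp: G_def)
    qed (use iG in auto)
  qed (use iG in auto)
  \<comment> \<open>Deleting coordinate \<open>z\<close> is a particular predictor that ignores \<open>z\<close>; averaging over \<open>z\<close> is the best one.\<close>
  have main: "(\<integral>s. (F s)\<^sup>2 \<partial>P) - (\<integral>s. (G s)\<^sup>2 \<partial>P) \<le> (\<integral>s. (F s - F (s(z := e)))\<^sup>2 \<partial>P)"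
  proof -
    have iD: "integrable P (\<lambda>s. (F s - F (s(z := e)))\<^sup>2)" using insert.prems(3)[of z] by (simp add: L2_def)
    have "(\<integral>s. (F s)\<^sup>2 \<partial>P) - (\<integral>s. (G s)\<^sup>2 \<partial>P) = (\<integral>s. (\<integral>x. (F (s(z := x)))\<^sup>2 \<partial>S) - (G s)\<^sup>2 \<partial>P)"
      using R(1)[OF iF2] R(2)[OF iF2] G2 by (simp add: L2_def)
    also have "\<dots> \<le> (\<integral>s. (\<integral>x. (F (s(z := x)) - F ((s(z := x))(z := e)))\<^sup>2 \<partial>S) \<partial>P)"
    proof (rule integral_mono_AE)
      show "AE s in P. (\<integral>x. (F (s(z := x)))\<^sup>2 \<partial>S) - (G s)\<^sup>2 \<le> (\<integral>x. (F (s(z := x)) - F ((s(z := x))(z := e)))\<^sup>2 \<partial>S)"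
        using AEF
      proof (rule AE_mp, intro AE_I2 impI)
        fix s assume s: "L2 S (\<lambda>x. F (s(z := x)))"
        let ?c = "F (s(z := e))"
        have i: "integrable S (\<lambda>x. F (s(z := x)))" "integrable S (\<lambda>x. (F (s(z := x)))\<^sup>2)"
          using s S.L2_integrable[OF s] by (auto simp: L2_def)
        have "(\<integral>x. (F (s(z := x)) - ?c)\<^sup>2 \<partial>S) = (\<integral>x. (F (s(z := x)))\<^sup>2 + ?c\<^sup>2 - 2 * F (s(z := x)) * ?c \<partial>S)"
          by (simp add: power2_diff)
        also have "\<dots> = (\<integral>x. (F (s(z := x)))\<^sup>2 \<partial>S) + ?c\<^sup>2 - 2 * G s * ?c"
          using i by (simp add: G_def S.prob_space)
        also have "\<dots> \<ge> (\<integral>x. (F (s(z := x)))\<^sup>2 \<partial>S) - (G s)\<^sup>2"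
          using zero_le_power2[of "G s - ?c"] by (simp add: power2_diff)
        finally show "(\<integral>x. (F (s(z := x)))\<^sup>2 \<partial>S) - (G s)\<^sup>2 \<le> (\<integral>x. (F (s(z := x)) - F ((s(z := x))(z := e)))\<^sup>2 \<partial>S)"
          by simp
      qed
      show "integrable P (\<lambda>s. \<integral>x. (F (s(z := x)) - F ((s(z := x))(z := e)))\<^sup>2 \<partial>S)"
        using R(1)[OF iD] by simp
    qed (use R(1)[OF iF2] G2 in \<open>simp add: L2_def\<close>)
    also have "\<dots> = (\<integral>s. (F s - F (s(z := e)))\<^sup>2 \<partial>P)" using R(2)[OF iD] by simp
    finally show ?thesis .
  qed
  have depG: "depends_on A G"
    unfolding depends_on_def G_def
  proof (intro allI impI)
    fix s s' :: "'i \<Rightarrow> 's" assume "\<forall>i\<in>A. s i = s' i"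
    then have "F (s(z := x)) = F (s'(z := x))" for x
      by (intro depends_onD[OF insert.prems(1)]) auto
    then show "(\<integral>x. F (s(z := x)) \<partial>S) = (\<integral>x. F (s'(z := x)) \<partial>S)" by simp
  qed
  have DG: "L2 P (\<lambda>s. G s - G (s(y := e))) \<and>
      (\<integral>s. (G s - G (s(y := e)))\<^sup>2 \<partial>P) \<le> (\<integral>s. (F s - F (s(y := e)))\<^sup>2 \<partial>P)" if y: "y \<in> A" for y
  proof -
    have yz: "y \<noteq> z" using y insert.hyps by auto
    have tw: "s(y := e, z := x) = s(z := x, y := e)" for s :: "'i \<Rightarrow> 's" and x
      by (rule fun_upd_twist[OF yz])
    have LD: "L2 P (\<lambda>s. F s - F (s(y := e)))" using insert.prems(3)[of y] y by simp
    then have iD: "integrable P (\<lambda>s. F s - F (s(y := e)))" and iD2: "integrable P (\<lambda>s. (F s - F (s(y := e)))\<^sup>2)"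
      using P.L2_integrable[OF LD] by (simp_all add: L2_def)
    have mG: "(\<lambda>s. G s - G (s(y := e))) \<in> borel_measurable P"
      using iG measurable_compose[OF measurable_update_PiM[OF e, of y] borel_measurable_integrable[OF iG[unfolded P_def]]]
      by (auto simp: P_def)
    have LS: "AE s in P. L2 S (\<lambda>x. F (s(z := x)) - F ((s(z := x))(y := e)))"
      using R(3)[OF iD2]
    proof (rule AE_mp, intro AE_I2 impI)
      fix s assume "s \<in> space P" "integrable S (\<lambda>x. (F (s(z := x)) - F ((s(z := x))(y := e)))\<^sup>2)"
      then show "L2 S (\<lambda>x. F (s(z := x)) - F ((s(z := x))(y := e)))"
        using measurable_compose[OF mupd L2_measurable[OF LD]] by (auto simp: L2_def)
    qed
    have le: "AE s in P. (G s - G (s(y := e)))\<^sup>2 \<le> (\<integral>x. (F (s(z := x)) - F ((s(z := x))(y := e)))\<^sup>2 \<partial>S)"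
      using LS R(3)[OF iF]
    proof eventually_elim
      case (elim s)
      have "integrable S (\<lambda>x. F (s(z := x)) - (F (s(z := x)) - F ((s(z := x))(y := e))))"
        by (rule Bochner_Integration.integrable_diff[OF elim(2) S.L2_integrable[OF elim(1)]])
      moreover have "(\<lambda>x. F (s(z := x)) - (F (s(z := x)) - F ((s(z := x))(y := e)))) = (\<lambda>x. F ((s(z := x))(y := e)))"
        by (rule ext) simp
      ultimately have "integrable S (\<lambda>x. F ((s(z := x))(y := e)))" by (simp only:)
      then have "(\<integral>x. F (s(z := x)) - F ((s(z := x))(y := e)) \<partial>S) = G s - G (s(y := e))"
        using elim(2) by (simp add: G_def tw)
      then show ?case using S.L2_jensen[OF elim(1)] by simp
    qed
    have i2: "integrable P (\<lambda>s. (G s - G (s(y := e)))\<^sup>2)"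
      by (rule Bochner_Integration.integrable_bound[OF R(1)[OF iD2]])
        (use le mG in auto)
    have "(\<integral>s. (G s - G (s(y := e)))\<^sup>2 \<partial>P) \<le> (\<integral>s. (\<integral>x. (F (s(z := x)) - F ((s(z := x))(y := e)))\<^sup>2 \<partial>S) \<partial>P)"
      by (rule integral_mono_AE[OF i2 R(1)[OF iD2] le])
    also have "\<dots> = (\<integral>s. (F s - F (s(y := e)))\<^sup>2 \<partial>P)" by (rule R(2)[OF iD2])
    finally show ?thesis using i2 mG by (simp add: L2_def)
  qed
  have "(\<integral>s. (G s)\<^sup>2 \<partial>P) - (\<integral>s. G s \<partial>P)\<^sup>2 \<le> (\<Sum>i\<in>A. \<integral>s. (G s - G (s(i := e)))\<^sup>2 \<partial>P)"
    by (rule insert.IH[OF depG G2]) (use DG in auto)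
  also have "\<dots> \<le> (\<Sum>i\<in>A. \<integral>s. (F s - F (s(i := e)))\<^sup>2 \<partial>P)" by (rule sum_mono) (use DG in auto)
  finally show ?case using main insert.hyps by (simp add: EG)
qed

section \<open>Powers of a characteristic function\<close>

text \<open>
  The central limit theorem for independent copies of \<open>\<nu>\<close>, read through
  characteristic functions. The degenerate case is included.
\<close>

lemma char_power_tendsto_gaussian:
  assumes "real_distribution \<nu>" and L: "L2 \<nu> (\<lambda>x. x)" and m: "(\<integral>x. x \<partial>\<nu>) = 0"
  shows "(\<lambda>n. char \<nu> (t / sqrt (real n)) ^ n) \<longlonglongrightarrow> complex_of_real (exp (- (t\<^sup>2 * (\<integral>x. x\<^sup>2 \<partial>\<nu>)) / 2))"
proof -
  interpret N: real_distribution \<nu> by fact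
  define v where "v = (\<integral>x. x\<^sup>2 \<partial>\<nu>)"
  have v0: "v \<ge> 0" by (simp add: v_def)
  show ?thesis
  proof (cases "v = 0")
    case True
    have "AE x in \<nu>. x\<^sup>2 = 0"
      using True L by (subst integral_nonneg_eq_0_iff_AE[symmetric]) (auto simp: v_def L2_def)
    then have ae: "AE x in \<nu>. x = 0" by simp
    have "char \<nu> u = 1" for u
    proof -
      have "char \<nu> u = (CLINT x|\<nu>. 1)"
        unfolding char_def by (rule integral_cong_AE) (use ae in auto)
      then show ?thesis using N.prob_space by simp
    qed
    then show ?thesis using True by (simp add: v_def)
  next
    case False
    then have v: "v > 0" using v0 by simp
    \<comment> \<open>An infinite product space carries the independent copies.\<close>
    define Q where "Q = PiM (UNIV :: nat set) (\<lambda>_. \<nu>)"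
    interpret Q: prob_space Q unfolding Q_def by (intro prob_space_PiM N.prob_space_axioms)
    have mc: "(\<lambda>\<omega>. \<omega> n) \<in> borel_measurable Q" for n
      using measurable_component_singleton[of n UNIV "\<lambda>_. \<nu>"] by (simp add: Q_def cong: measurable_cong_sets)
    have d: "distr Q borel (\<lambda>\<omega>. \<omega> n) = \<nu>" for n
    proof -
      have "distr Q borel (\<lambda>\<omega>. \<omega> n) = distr Q \<nu> (\<lambda>\<omega>. \<omega> n)" by (rule distr_cong) auto
      also have "\<dots> = \<nu>" unfolding Q_def by (rule distr_PiM_component) (auto simp: N.prob_space_axioms)
      finally show ?thesis .
    qed
    have ind: "Q.indep_vars (\<lambda>i. borel) (\<lambda>n \<omega>. \<omega> n) UNIV"
    proof (subst Q.indep_vars_iff_distr_eq_PiM')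
      have "distr Q (PiM UNIV (\<lambda>_. borel)) (\<lambda>x. \<lambda>i\<in>UNIV. x i) = distr Q Q (\<lambda>x. x)"
        by (intro distr_cong) (auto simp: Q_def intro!: sets_PiM_cong)
      also have "\<dots> = PiM UNIV (\<lambda>i. distr Q borel (\<lambda>x. x i))" by (simp add: d) (simp add: Q_def)
      finally show "distr Q (PiM UNIV (\<lambda>_. borel)) (\<lambda>x. \<lambda>i\<in>UNIV. x i) = PiM UNIV (\<lambda>i. distr Q borel (\<lambda>x. x i))" .
    qed (auto intro: mc)
    have E: "Q.expectation (\<lambda>\<omega>. g (\<omega> n)) = (\<integral>x. g x \<partial>\<nu>)" if "g \<in> borel_measurable borel" for n and g :: "real \<Rightarrow> real"
      using integral_distr[OF mc that, of n] by (simp add: d)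
    have m0: "Q.expectation (\<lambda>\<omega>. \<omega> n) = 0" for n
      by (rule trans[OF E[of "\<lambda>x. x" n] m]) measurable
    have i2: "integrable Q (\<lambda>\<omega>. (\<omega> n)\<^sup>2)" for n
    proof -
      have "integrable (distr Q borel (\<lambda>\<omega>. \<omega> n)) (\<lambda>x. x\<^sup>2)" using L by (simp only: d L2_def)
      then show ?thesis by (rule integrable_distr[OF mc])
    qed
    have var: "Q.variance (\<lambda>\<omega>. \<omega> n) = (sqrt v)\<^sup>2" for n
    proof -
      have "Q.variance (\<lambda>\<omega>. \<omega> n) = Q.expectation (\<lambda>\<omega>. (\<omega> n)\<^sup>2)" by (simp only: m0 diff_0_right)
      also have "\<dots> = v" unfolding v_def by (rule E[of "\<lambda>x. x\<^sup>2" n]) measurable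
      also have "v = (sqrt v)\<^sup>2" using v0 by simp
      finally show ?thesis .
    qed
    have w: "weak_conv_m (\<lambda>n. distr Q borel (\<lambda>\<omega>. (\<Sum>i<n. \<omega> i) / sqrt (n * (sqrt v)\<^sup>2))) std_normal_distribution"
    proof (rule Q.central_limit_theorem_zero_mean[where X = "\<lambda>n \<omega>. \<omega> n" and \<mu> = \<nu> and \<sigma> = "sqrt v"])
      show "0 < sqrt v" using v by (simp only: real_sqrt_gt_0_iff)
    qed (fact ind m0 i2 var d)+
    have "(\<lambda>n. char (distr Q borel (\<lambda>\<omega>. (\<Sum>i<n. \<omega> i) / sqrt (n * (sqrt v)\<^sup>2))) (t * sqrt v)) \<longlonglongrightarrow> char std_normal_distribution (t * sqrt v)"
    proof (rule levy_continuity1[OF _ real_dist_normal_dist w])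
      show "real_distribution (distr Q borel (\<lambda>\<omega>. (\<Sum>i<n. \<omega> i) / sqrt (n * (sqrt v)\<^sup>2)))" for n
        by (rule Q.real_distribution_distr) (intro borel_measurable_divide borel_measurable_sum mc borel_measurable_const)
    qed
    moreover have "char (distr Q borel (\<lambda>\<omega>. (\<Sum>i<n. \<omega> i) / sqrt (n * (sqrt v)\<^sup>2))) (t * sqrt v) = char \<nu> (t / sqrt (real n)) ^ n" for n
    proof -
      let ?c = "1 / sqrt (n * (sqrt v)\<^sup>2)"
      have "char (distr Q borel (\<lambda>\<omega>. (\<Sum>i<n. \<omega> i) / sqrt (n * (sqrt v)\<^sup>2))) (t * sqrt v)
          = char (distr Q borel (\<lambda>\<omega>. (\<Sum>i<n. ?c * \<omega> i))) (t * sqrt v)"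
        by (simp add: sum_divide_distrib)
      also have "\<dots> = (\<Prod>i<n. char (distr Q borel (\<lambda>\<omega>. ?c * \<omega> i)) (t * sqrt v))"
        by (rule Q.char_distr_sum, rule Q.indep_vars_compose2[OF Q.indep_vars_subset[OF ind]]) auto
      also have "\<dots> = (\<Prod>i<n. char \<nu> (t / sqrt (real n)))"
      proof (intro prod.cong refl)
        fix i
        have "char (distr Q borel (\<lambda>\<omega>. ?c * \<omega> i)) (t * sqrt v) = char (distr Q borel (\<lambda>\<omega>. \<omega> i)) (?c * (t * sqrt v))"
          using mc by (simp add: char_def integral_distr mult_ac)
        also have "?c * (t * sqrt v) = t / sqrt (real n)" using v by (simp add: real_sqrt_mult)
        finally show "char (distr Q borel (\<lambda>\<omega>. ?c * \<omega> i)) (t * sqrt v) = char \<nu> (t / sqrt (real n))" by (simp add: d)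
      qed
      finally show ?thesis by simp
    qed
    moreover have "char std_normal_distribution (t * sqrt v) = complex_of_real (exp (- (t\<^sup>2 * v) / 2))"
      using v by (simp add: char_std_normal_distribution power_mult_distrib)
    ultimately show ?thesis by (simp add: v_def)
  qed
qed

section \<open>Central limit theorem for stabilizing functionals\<close>

definition box_cube :: "nat \<Rightarrow> (int^'d) set" where
  "box_cube n = {z. \<forall>k. 0 \<le> z $ k \<and> z $ k < int n}"

definition box_ball :: "nat \<Rightarrow> (int^'d) set" where
  "box_ball R = {z. \<forall>k. \<bar>z $ k\<bar> \<le> int R}"

lemma box_cube_eq: "box_cube n = (\<lambda>f. \<chi> k. f k) ` (PiE UNIV (\<lambda>_. {0..<int n}))"
proof (rule subset_antisym; rule subsetI)
  fix z :: "int^'d" assume "z \<in> box_cube n"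
  then have "($) z \<in> PiE UNIV (\<lambda>_. {0..<int n})" by (auto simp: box_cube_def)
  then show "z \<in> (\<lambda>f. \<chi> k. f k) ` (PiE UNIV (\<lambda>_. {0..<int n}))"
    by (rule image_eqI[rotated]) (simp add: vec_eq_iff)
qed (auto simp: box_cube_def)

lemma finite_box_cube: "finite (box_cube n :: (int^'d) set)"
  unfolding box_cube_eq by (intro finite_imageI finite_PiE) auto

lemma card_box_cube: "card (box_cube n :: (int^'d) set) = n ^ CARD('d)"
proof -
  have "inj_on (\<lambda>f. \<chi> k. f k) (PiE UNIV (\<lambda>_::'d. {0..<int n}))"
    by (auto simp: inj_on_def vec_eq_iff)
  then show ?thesis unfolding box_cube_eq by (simp add: card_image card_PiE)
qed

lemma finite_box_ball: "finite (box_ball R :: (int^'d) set)"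
proof -
  have "box_ball R = (+) (- (\<chi> k. int R)) ` (box_cube (2 * R + 1) :: (int^'d) set)"
  proof (rule subset_antisym; rule subsetI)
    fix z :: "int^'d" assume z: "z \<in> box_ball R"
    have "(\<chi> k. int R) + z \<in> box_cube (2 * R + 1)"
      unfolding box_cube_def
    proof (intro CollectI allI)
      fix k
      have "\<bar>z $ k\<bar> \<le> int R" using z by (simp add: box_ball_def)
      then show "0 \<le> ((\<chi> k. int R) + z) $ k \<and> ((\<chi> k. int R) + z) $ k < int (2 * R + 1)"
        by (simp add: abs_le_iff)
    qed
    then show "z \<in> (+) (- (\<chi> k. int R)) ` (box_cube (2 * R + 1))"
      by (rule image_eqI[rotated]) simp
  next
    fix z :: "int^'d" assume "z \<in> (+) (- (\<chi> k. int R)) ` (box_cube (2 * R + 1))"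
    then obtain w :: "int^'d" where w: "w \<in> box_cube (2 * R + 1)" "z = - (\<chi> k. int R) + w" by blast
    have "\<bar>z $ k\<bar> \<le> int R" for k
    proof -
      have "0 \<le> w $ k" "w $ k < int (2 * R + 1)" using w(1) by (auto simp: box_cube_def)
      then show ?thesis by (simp add: w(2) abs_le_iff)
    qed
    then show "z \<in> box_ball R" by (simp add: box_ball_def)
  qed
  then show ?thesis by (simp add: finite_box_cube)
qed

lemma box_ball_mono: "R \<le> R' \<Longrightarrow> box_ball R \<subseteq> (box_ball R' :: (int^'d) set)"
  by (auto simp: box_ball_def intro: order_trans[of _ "int R"])

lemma finite_subset_box_ball:
  assumes "finite (A :: (int^'d) set)" shows "\<exists>R. A \<subseteq> box_ball R"
proof -
  define R where "R = (\<Sum>z\<in>A. \<Sum>k\<in>UNIV. nat \<bar>z $ k\<bar>)"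
  have "\<bar>z $ k\<bar> \<le> int R" if "z \<in> A" for z k
  proof -
    have "nat \<bar>z $ k\<bar> \<le> (\<Sum>k\<in>UNIV. nat \<bar>z $ k\<bar>)" by (rule member_le_sum) auto
    also have "\<dots> \<le> R" unfolding R_def using assms that by (intro member_le_sum) auto
    finally show ?thesis by simp
  qed
  then show ?thesis by (auto simp: box_ball_def)
qed

definition block :: "nat \<Rightarrow> int^'d \<Rightarrow> (int^'d) set" where
  "block L y = (+) (\<chi> k. int L * y $ k) ` box_cube L"

lemma mem_block: "z \<in> block L y \<longleftrightarrow> (\<forall>k. int L * y $ k \<le> z $ k \<and> z $ k < int L * y $ k + int L)"
proof
  assume "\<forall>k. int L * y $ k \<le> z $ k \<and> z $ k < int L * y $ k + int L"
  then have "z - (\<chi> k. int L * y $ k) \<in> box_cube L"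
    by (simp add: box_cube_def diff_less_eq add.commute)
  then show "z \<in> block L y" unfolding block_def by (rule image_eqI[rotated]) simp
qed (auto simp: block_def box_cube_def)

lemma finite_block: "finite (block L y)" by (simp add: block_def finite_box_cube)

lemma mem_block_imp_div:
  assumes "z \<in> block L y" shows "y $ k = z $ k div int L"
proof -
  have "int L * y $ k \<le> z $ k" "z $ k < int L * y $ k + int L" using assms by (auto simp: mem_block)
  then have "z $ k = int L * y $ k + (z $ k - int L * y $ k)" "0 \<le> z $ k - int L * y $ k" "z $ k - int L * y $ k < int L" by auto
  then show ?thesis by (metis int_div_pos_eq)
qed

lemma block_disjoint: "z \<in> block L y \<Longrightarrow> z \<in> block L y' \<Longrightarrow> y = y'"
  using mem_block_imp_div by (metis vec_eq_iff)

lemma block_subset_cube: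
  assumes "y \<in> box_cube (n div L)" shows "block L y \<subseteq> box_cube n"
proof
  fix z assume z: "z \<in> block L y"
  show "z \<in> box_cube n"
    unfolding box_cube_def
  proof (intro CollectI allI)
    fix k
    have "0 \<le> y $ k" "y $ k < int (n div L)" using assms unfolding box_cube_def by blast+
    then have y: "0 \<le> y $ k" "y $ k + 1 \<le> int (n div L)" by linarith+
    have zk: "int L * y $ k \<le> z $ k" "z $ k < int L * y $ k + int L" using z by (auto simp: mem_block)
    have "int L * (y $ k + 1) \<le> int L * int (n div L)" using y(2) by (rule mult_left_mono) simp
    also have "\<dots> \<le> int n" by (metis of_nat_le_iff of_nat_mult times_div_less_eq_dividend)
    finally have "z $ k < int n" using zk by (simp add: distrib_left)
    moreover have "0 \<le> z $ k" using zk(1) y(1) by (smt (verit) mult_nonneg_nonneg of_nat_0_le_iff)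
    ultimately show "0 \<le> z $ k \<and> z $ k < int n" by simp
  qed
qed

text \<open>
  Points at distance more than \<open>R\<close> from the boundary of their block fill a cube of
  side \<open>L - 2 * R\<close> in each of the blocks.
\<close>

lemma card_deep_points:
  assumes "2 * R \<le> L"
  shows "(n div L * (L - 2 * R)) ^ CARD('d) \<le>
    card {z :: int^'d. \<exists>y\<in>box_cube (n div L). (+) z ` box_ball R \<subseteq> block L y}"
    and "{z :: int^'d. \<exists>y\<in>box_cube (n div L). (+) z ` box_ball R \<subseteq> block L y} \<subseteq> box_cube n"
proof -
  let ?G = "{z :: int^'d. \<exists>y\<in>box_cube (n div L). (+) z ` box_ball R \<subseteq> block L y}"
  have z0: "0 \<in> (box_ball R :: (int^'d) set)" by (simp add: box_ball_def)
  show sub: "?G \<subseteq> box_cube n"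
  proof
    fix z assume "z \<in> ?G"
    then obtain y where y: "y \<in> box_cube (n div L)" "(+) z ` box_ball R \<subseteq> block L y" by blast
    have "z + 0 \<in> (+) z ` box_ball R" using z0 by blast
    then show "z \<in> box_cube n" using y block_subset_cube[OF y(1)] by auto
  qed
  \<comment> \<open>The point \<open>h y w\<close> of block \<open>y\<close> is moved by
    \<open>R\<close> away from the lower faces.\<close>
  define h :: "int^'d \<Rightarrow> int^'d \<Rightarrow> int^'d" where "h y w = (\<chi> k. int L * y $ k + w $ k + int R)" for y w
  have h: "(+) (h y w) ` box_ball R \<subseteq> block L y" if "w \<in> box_cube (L - 2 * R)" for y w
  proof
    fix z assume "z \<in> (+) (h y w) ` box_ball R"
    then obtain u where u: "u \<in> box_ball R" "z = h y w + u" by blast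
    have "int L * y $ k \<le> z $ k \<and> z $ k < int L * y $ k + int L" for k
    proof -
      have "\<bar>u $ k\<bar> \<le> int R" using u by (simp add: box_ball_def)
      moreover have "0 \<le> w $ k" "w $ k < int (L - 2 * R)" using that by (auto simp: box_cube_def)
      moreover have "int (L - 2 * R) = int L - 2 * int R" using assms by simp
      ultimately show ?thesis unfolding u(2) h_def by (simp add: abs_le_iff)
    qed
    then show "z \<in> block L y" by (simp add: mem_block)
  qed
  have "(n div L * (L - 2 * R)) ^ CARD('d) = card ((box_cube (n div L) :: (int^'d) set) \<times> (box_cube (L - 2 * R) :: (int^'d) set))"
    by (simp add: card_cartesian_product card_box_cube power_mult_distrib)
  also have "\<dots> = card ((\<lambda>(y, w). h y w) ` (box_cube (n div L) \<times> box_cube (L - 2 * R)))"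
  proof (rule card_image[symmetric], rule inj_onI, clarify)
    fix y w y' w' :: "int^'d"
    assume w: "w \<in> box_cube (L - 2 * R)" "w' \<in> box_cube (L - 2 * R)" and e: "h y w = h y' w'"
    have "h y w + 0 \<in> block L y" "h y' w' + 0 \<in> block L y'" using h[OF w(1)] h[OF w(2)] z0 by blast+
    then have "y = y'" using e block_disjoint by metis
    then show "y = y' \<and> w = w'" using e by (auto simp: h_def vec_eq_iff)
  qed
  also have "\<dots> \<le> card ?G"
  proof (rule card_mono)
    show "finite ?G" using sub finite_box_cube by (rule finite_subset)
    show "(\<lambda>(y, w). h y w) ` (box_cube (n div L) \<times> box_cube (L - 2 * R)) \<subseteq> ?G"
    proof clarify
      fix y w :: "int^'d" assume "y \<in> box_cube (n div L)" "w \<in> box_cube (L - 2 * R)"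
      then show "\<exists>y'\<in>box_cube (n div L). (+) (h y w) ` box_ball R \<subseteq> block L y'"
        using h by (intro bexI[of _ y]) simp_all
    qed
  qed
  finally show "(n div L * (L - 2 * R)) ^ CARD('d) \<le> card ?G" .
qed

lemma div_ratio_tendsto:
  assumes "L \<ge> (1::nat)"
  shows "(\<lambda>n. real (n div L) / real n) \<longlonglongrightarrow> 1 / real L"
proof (rule tendsto_sandwich)
    have "real (n div L) \<ge> real n / real L - 1" for n
    proof -
      have "n < L * (n div L) + L" using assms dividend_less_times_div[of L n] by simp
      then have "real n < real L * (real (n div L) + 1)"
        by (metis distrib_left mult.right_neutral of_nat_1 of_nat_add of_nat_less_iff of_nat_mult)
      then show ?thesis using assms by (simp add: field_simps)
    qed
    then show "eventually (\<lambda>n. (real n / real L - 1) / real n \<le> real (n div L) / real n) sequentially"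
      by (intro always_eventually allI divide_right_mono) auto
    show "eventually (\<lambda>n. real (n div L) / real n \<le> (real n / real L) / real n) sequentially"
      by (intro always_eventually allI divide_right_mono of_nat_div_le_of_nat) auto
    have "(\<lambda>n. 1 / real L - 1 / real n) \<longlonglongrightarrow> 1 / real L - 0"
      by (intro tendsto_diff tendsto_const lim_const_over_n)
    then have "(\<lambda>n. 1 / real L - 1 / real n) \<longlonglongrightarrow> 1 / real L" by simp
    moreover have "eventually (\<lambda>n. 1 / real L - 1 / real n = (real n / real L - 1) / real n) sequentially"
      using eventually_gt_at_top[of 0] by eventually_elim (simp add: diff_divide_distrib)
    ultimately show "(\<lambda>n. (real n / real L - 1) / real n) \<longlonglongrightarrow> 1 / real L"
      by (rule Lim_transform_eventually)
    have "eventually (\<lambda>n. 1 / real L = (real n / real L) / real n) sequentially"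
      using eventually_gt_at_top[of 0] by eventually_elim simp
    then show "(\<lambda>n. (real n / real L) / real n) \<longlonglongrightarrow> 1 / real L"
      by (rule Lim_transform_eventually[OF tendsto_const])
  qed

text \<open>
  Functionals \<open>F A s\<close> of the data \<open>s\<close> in a finite window
  \<open>A\<close> of the lattice. The point \<open>e\<close> is the empty value: replacing a
  coordinate by \<open>e\<close> deletes it. The deletion effect at the origin is dominated by a
  square integrable function for all windows at once, and for each fixed \<open>s\<close> it is
  the same for all large windows.
\<close>

locale stabilizing_functional = S: prob_space S for S :: "'s measure" +
  fixes e :: 's and F :: "(int^'d) set \<Rightarrow> ((int^'d) \<Rightarrow> 's) \<Rightarrow> real" and H :: "((int^'d) \<Rightarrow> 's) \<Rightarrow> real"
  assumes spS: "space S = UNIV"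
    and sq: "finite A \<Longrightarrow> L2 (PiM UNIV (\<lambda>_. S)) (F A)"
    and dep: "finite A \<Longrightarrow> depends_on A (F A)"
    and shift: "finite A \<Longrightarrow> F ((+) z ` A) s = F A (\<lambda>y. s (z + y))"
    and H: "L2 (PiM UNIV (\<lambda>_. S)) H"
    and bound: "finite A \<Longrightarrow> \<bar>F A s - F A (s(0 := e))\<bar> \<le> H s"
    and stab: "\<exists>B. finite B \<and> (\<forall>A A'. finite A \<longrightarrow> finite A' \<longrightarrow> B \<subseteq> A \<longrightarrow> B \<subseteq> A' \<longrightarrow>
        F A s - F A (s(0 := e)) = F A' s - F A' (s(0 := e)))"
begin

definition P where "P = PiM (UNIV :: (int^'d) set) (\<lambda>_. S)"

lemma prob_P: "prob_space P"
  unfolding P_def by (rule prob_space_PiM) (rule S.prob_space_axioms)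

sublocale P: prob_space P by (rule prob_P)

lemma spP: "space P = UNIV" by (simp add: P_def space_PiM spS PiE_UNIV_domain)

lemmas sqP = sq[folded P_def] and HP = H[folded P_def]

definition D :: "int^'d \<Rightarrow> (int^'d) set \<Rightarrow> ((int^'d) \<Rightarrow> 's) \<Rightarrow> real" where
  "D z A s = F A s - F A (s(z := e))"

lemma F_shift_back: "finite A \<Longrightarrow> F A s = F ((+) (- z) ` A) (\<lambda>y. s (z + y))"
  using shift[of "(+) (- z) ` A" z s] by (simp add: image_image)

lemma D_shift: "finite A \<Longrightarrow> D z A s = D 0 ((+) (- z) ` A) (\<lambda>y. s (z + y))"
proof -
  assume A: "finite A"
  have "(\<lambda>y. (s(z := e)) (z + y)) = (\<lambda>y. s (z + y))(0 := e)" by auto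
  then show ?thesis
    unfolding D_def by (subst (1 2) F_shift_back[OF A, of _ z]) simp
qed

lemma D_outside: "finite A \<Longrightarrow> z \<notin> A \<Longrightarrow> D z A s = 0"
proof -
  assume "finite A" "z \<notin> A"
  then have "F A s = F A (s(z := e))" by (intro depends_onD[OF dep]) auto
  then show "D z A s = 0" unfolding D_def by linarith
qed

lemma D_bound: "finite A \<Longrightarrow> \<bar>D z A s\<bar> \<le> H (\<lambda>y. s (z + y))"
proof -
  assume A: "finite A"
  show "\<bar>D z A s\<bar> \<le> H (\<lambda>y. s (z + y))"
    unfolding D_shift[OF A] unfolding D_def by (rule bound[OF finite_imageI[OF A]])
qed

lemma shift_measurable: "(\<lambda>s y. s (z + y)) \<in> P \<rightarrow>\<^sub>M P"
  unfolding P_def by (rule measurable_PiM_single') (auto simp: space_PiM)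

lemma distr_shift: "distr P P (\<lambda>s y. s (z + y)) = P"
proof -
  have "distr (PiM UNIV (\<lambda>_. S)) (PiM UNIV (\<lambda>i. S)) (\<lambda>\<omega>. \<lambda>n\<in>UNIV. \<omega> (z + n)) = PiM (UNIV :: (int^'d) set) (\<lambda>i. S)"
    by (rule distr_PiM_reindex[of UNIV "\<lambda>_. S" "(+) z" UNIV]) (auto intro: S.prob_space_axioms)
  then show ?thesis by (simp add: P_def restrict_def)
qed

lemma integral_shift:
  fixes f :: "_ \<Rightarrow> 'b :: {banach, second_countable_topology}"
  assumes "f \<in> borel_measurable P"
  shows "(\<integral>s. f (\<lambda>y. s (z + y)) \<partial>P) = (\<integral>s. f s \<partial>P)"
    and "integrable P f \<Longrightarrow> integrable P (\<lambda>s. f (\<lambda>y. s (z + y)))"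
  using integral_distr[OF shift_measurable[of z] , of f] integrable_distr_eq[OF shift_measurable[of z], of f] assms
  by (simp_all add: distr_shift)

lemma L2_shift: "L2 P f \<Longrightarrow> L2 P (\<lambda>s. f (\<lambda>y. s (z + y)))"
  using measurable_compose[OF shift_measurable[of z], of f borel] integral_shift(2)[of "\<lambda>s. (f s)\<^sup>2" z]
  by (simp add: L2_def borel_measurable_power)

lemma D_measurable: "finite A \<Longrightarrow> D z A \<in> borel_measurable P"
proof -
  assume A: "finite A"
  have "(\<lambda>s. s(z := e)) \<in> P \<rightarrow>\<^sub>M P" unfolding P_def by (rule measurable_update_PiM) (simp add: spS)
  from measurable_compose[OF this L2_measurable[OF sqP[OF A]]] L2_measurable[OF sqP[OF A]]
  show ?thesis unfolding D_def[abs_def] by (rule borel_measurable_diff[rotated])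
qed

lemma L2_D: "finite A \<Longrightarrow> L2 P (D z A)"
  by (rule L2_bound[OF L2_shift[OF HP] D_measurable]) (auto intro: D_bound)

definition H_moment where "H_moment = (\<integral>s. (H s)\<^sup>2 \<partial>P)"

text \<open>
  The data for which windows containing the ball of radius \<open>R\<close> do not yet determine
  the deletion effect at the origin. It is measurable as a countable union, since there are only
  countably many finite windows.
\<close>

definition bad :: "nat \<Rightarrow> ((int^'d) \<Rightarrow> 's) set" where
  "bad R = (\<Union>A\<in>{A. finite A \<and> box_ball R \<subseteq> A}. \<Union>A'\<in>{A. finite A \<and> box_ball R \<subseteq> A}. {s. D 0 A s \<noteq> D 0 A' s})"

lemma bad_sets: "bad R \<in> sets P"
proof -
  have c: "countable {A. finite A \<and> (box_ball R :: (int^'d) set) \<subseteq> A}"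
    by (rule countable_subset[OF _ countable_Collect_finite]) auto
  have "{s. D 0 A s \<noteq> D 0 A' s} \<in> sets P" if "finite A" "finite A'" for A A'
  proof -
    have "{s \<in> space P. D 0 A s \<noteq> D 0 A' s} \<in> sets P"
      by (intro borel_measurable_neq D_measurable that)
    then show ?thesis by (simp add: spP)
  qed
  then show ?thesis unfolding bad_def by (intro sets.countable_UN'' c) auto
qed

lemma badI:
  assumes "finite A" "box_ball R \<subseteq> A" "finite A'" "box_ball R \<subseteq> A'" "D 0 A s \<noteq> D 0 A' s"
  shows "s \<in> bad R"
  unfolding bad_def by (rule UN_I[of A], use assms in simp, rule UN_I[of A'], use assms in simp, use assms in simp)

definition \<epsilon> :: "nat \<Rightarrow> real" where "\<epsilon> R = (\<integral>s. indicator (bad R) s * (2 * H s)\<^sup>2 \<partial>P)"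

lemma \<epsilon>_integrable: "integrable P (\<lambda>s. indicator (bad R) s * (2 * H s)\<^sup>2)"
proof (rule Bochner_Integration.integrable_bound)
  show "integrable P (\<lambda>s. (2 * H s)\<^sup>2)" using L2_cmult[OF HP, of 2] by (simp add: L2_def)
  show "(\<lambda>s. indicator (bad R) s * (2 * H s)\<^sup>2) \<in> borel_measurable P"
    using bad_sets[of R] L2_measurable[OF HP] by measurable
qed (auto simp: indicator_def)

text \<open>
  By stabilization every \<open>s\<close> leaves the sets \<open>bad R\<close> eventually;
  dominated convergence does the rest.
\<close>

lemma \<epsilon>_tendsto_0: "\<epsilon> \<longlonglongrightarrow> 0"
proof -
  have "(\<lambda>R. \<integral>s. indicator (bad R) s * (2 * H s)\<^sup>2 \<partial>P) \<longlonglongrightarrow> (\<integral>s. 0 \<partial>P)"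
  proof (rule integral_dominated_convergence[where w = "\<lambda>s. (2 * H s)\<^sup>2"])
    show "integrable P (\<lambda>s. (2 * H s)\<^sup>2)" using L2_cmult[OF HP, of 2] by (simp add: L2_def)
    show "AE s in P. (\<lambda>R. indicator (bad R) s * (2 * H s)\<^sup>2) \<longlonglongrightarrow> 0"
    proof (rule AE_I2)
      fix s
      obtain B where B: "finite B" "\<And>A A'. finite A \<Longrightarrow> finite A' \<Longrightarrow> B \<subseteq> A \<Longrightarrow> B \<subseteq> A' \<Longrightarrow> D 0 A s = D 0 A' s"
        using stab[of s] unfolding D_def by blast
      obtain R0 where R0: "B \<subseteq> box_ball R0" using finite_subset_box_ball[OF B(1)] by blast
      have "indicator (bad R) s * (2 * H s)\<^sup>2 = 0" if "R \<ge> R0" for R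
      proof -
        have sub: "B \<subseteq> A" if "box_ball R \<subseteq> A" for A
          using R0 box_ball_mono[OF \<open>R \<ge> R0\<close>] that by blast
        have "s \<notin> bad R" unfolding bad_def using B(2) sub by auto
        then show ?thesis by simp
      qed
      then show "(\<lambda>R. indicator (bad R) s * (2 * H s)\<^sup>2) \<longlonglongrightarrow> 0"
        by (intro tendsto_eventually) (auto simp: eventually_sequentially)
    qed
    show "(\<lambda>s. indicator (bad R) s * (2 * H s)\<^sup>2) \<in> borel_measurable P" for R
      using \<epsilon>_integrable by (rule borel_measurable_integrable)
  qed (auto simp: indicator_def)
  then show ?thesis by (simp add: \<epsilon>_def[abs_def])
qed

text \<open>
  After translation to the origin the two effects agree outside \<open>bad R\<close>, and on
  \<open>bad R\<close> each is at most \<open>H\<close>.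
\<close>

lemma D_diff_far:
  assumes A: "finite A" "finite A'" and far: "(+) z ` box_ball R \<subseteq> A" "(+) z ` box_ball R \<subseteq> A'"
  shows "(\<integral>s. (D z A s - D z A' s)\<^sup>2 \<partial>P) \<le> \<epsilon> R"
proof -
  let ?I = "\<lambda>s. indicator (bad R) s * (2 * H s)\<^sup>2"
  have "(\<integral>s. (D z A s - D z A' s)\<^sup>2 \<partial>P) \<le> (\<integral>s. ?I (\<lambda>y. s (z + y)) \<partial>P)"
  proof (rule integral_mono)
    show "integrable P (\<lambda>s. (D z A s - D z A' s)\<^sup>2)"
      using L2_diff[OF L2_D[OF A(1)] L2_D[OF A(2)]] by (simp add: L2_def)
    show "integrable P (\<lambda>s. ?I (\<lambda>y. s (z + y)))"
      by (rule integral_shift(2)[OF borel_measurable_integrable[OF \<epsilon>_integrable] \<epsilon>_integrable])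
    fix s :: "int^'d \<Rightarrow> 's"
    let ?s = "\<lambda>y. s (z + y)"
    have "box_ball R = (+) (- z) ` (+) z ` box_ball R" by (simp add: image_image)
    then have sub: "box_ball R \<subseteq> (+) (- z) ` A" "box_ball R \<subseteq> (+) (- z) ` A'"
      using image_mono[OF far(1), of "(+) (- z)"] image_mono[OF far(2), of "(+) (- z)"] by simp_all
    have b: "\<bar>D z A s - D z A' s\<bar> \<le> 2 * H ?s" using D_bound[OF A(1), of z s] D_bound[OF A(2), of z s] by linarith
    show "(D z A s - D z A' s)\<^sup>2 \<le> ?I ?s"
    proof (cases "?s \<in> bad R")
      case True
      have "(D z A s - D z A' s)\<^sup>2 = \<bar>D z A s - D z A' s\<bar>\<^sup>2" by simp
      also have "\<dots> \<le> (2 * H ?s)\<^sup>2" using b by (intro power_mono) auto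
      finally show ?thesis using True by simp
    next
      case False
      then have "D 0 B ?s = D 0 B' ?s"
        if "finite B" "box_ball R \<subseteq> B" "finite B'" "box_ball R \<subseteq> B'" for B B'
        using False badI[OF that] by blast
      from this[OF finite_imageI[OF A(1)] sub(1) finite_imageI[OF A(2)] sub(2)]
      have "D z A s = D z A' s"
        by (simp only: D_shift[OF A(1), of z s] D_shift[OF A(2), of z s])
      then show ?thesis by simp
    qed
  qed
  also have "\<dots> = \<epsilon> R"
    unfolding \<epsilon>_def by (rule integral_shift(1)) (rule borel_measurable_integrable[OF \<epsilon>_integrable])
  finally show ?thesis .
qed

lemma variance_bound:
  assumes "finite A" "depends_on A G" "L2 P G" "\<And>z. z \<in> A \<Longrightarrow> L2 P (\<lambda>s. G s - G (s(z := e)))"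
  shows "P.variance G \<le> (\<Sum>z\<in>A. \<integral>s. (G s - G (s(z := e)))\<^sup>2 \<partial>P)"
proof -
  have "P.variance G = P.expectation (\<lambda>s. (G s)\<^sup>2) - (P.expectation G)\<^sup>2"
    by (rule P.variance_eq[OF P.L2_integrable[OF assms(3)]]) (use assms(3) in \<open>simp add: L2_def\<close>)
  then show ?thesis
    using efron_stein_deletion[OF S.prob_space_axioms _ assms(1,2) assms(3)[unfolded P_def] assms(4)[unfolded P_def], folded P_def]
    by (simp add: spS)
qed

definition block_error :: "nat \<Rightarrow> nat \<Rightarrow> ((int^'d) \<Rightarrow> 's) \<Rightarrow> real" where
  "block_error L n s = F (box_cube n) s - (\<Sum>y\<in>box_cube (n div L). F (block L y) s)"

lemma L2_block_error: "L2 P (block_error L n)"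
  unfolding block_error_def[abs_def]
  by (intro L2_diff P.L2_sum sqP finite_box_cube finite_block)

lemma block_error_D:
  "block_error L n s - block_error L n (s(z := e)) =
    D z (box_cube n) s - (\<Sum>y\<in>box_cube (n div L). D z (block L y) s)"
  by (simp add: block_error_def D_def sum_subtractf)

lemma block_error_D_in:
  assumes "y \<in> box_cube (n div L)" "z \<in> block L y"
  shows "block_error L n s - block_error L n (s(z := e)) = D z (box_cube n) s - D z (block L y) s"
proof -
  have "(\<Sum>y'\<in>box_cube (n div L). D z (block L y') s) = (\<Sum>y'\<in>{y}. D z (block L y') s)"
  proof (intro sum.mono_neutral_right finite_box_cube ballI)
    fix y' assume "y' \<in> box_cube (n div L) - {y}"
    then have "z \<notin> block L y'" using block_disjoint[OF assms(2), of y'] by blast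
    then show "D z (block L y') s = 0" by (rule D_outside[OF finite_block])
  qed (use assms in simp)
  then show ?thesis by (simp add: block_error_D)
qed

lemma block_error_D_bound:
  "\<bar>block_error L n s - block_error L n (s(z := e))\<bar> \<le> 2 * H (\<lambda>y. s (z + y))"
proof (cases "\<exists>y\<in>box_cube (n div L). z \<in> block L y")
  case True
  then obtain y where "y \<in> box_cube (n div L)" "z \<in> block L y" by blast
  from block_error_D_in[OF this] show ?thesis
    using D_bound[OF finite_box_cube, of z n s] D_bound[OF finite_block, of z L y s] by simp
next
  case False
  then have "(\<Sum>y\<in>box_cube (n div L). D z (block L y) s) = 0"
    by (intro sum.neutral ballI D_outside finite_block) auto
  then show ?thesis
    using D_bound[OF finite_box_cube, of z n s] by (simp add: block_error_D)
qed

lemma L2_block_error_D: "L2 P (\<lambda>s. block_error L n s - block_error L n (s(z := e)))"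
  unfolding block_error_D by (intro L2_diff P.L2_sum L2_D finite_box_cube finite_block)

lemma depends_block_error: "depends_on (box_cube n) (block_error L n)"
  unfolding depends_on_def
proof (intro allI impI)
  fix s s' :: "int^'d \<Rightarrow> 's" assume a: "\<forall>i\<in>box_cube n. s i = s' i"
  have "F (block L y) s = F (block L y) s'" if "y \<in> box_cube (n div L)" for y
    using a block_subset_cube[OF that] by (intro depends_onD[OF dep[OF finite_block]]) auto
  moreover have "F (box_cube n) s = F (box_cube n) s'"
    using a by (intro depends_onD[OF dep[OF finite_box_cube]]) auto
  ultimately show "block_error L n s = block_error L n s'" by (simp add: block_error_def)
qed

text \<open>
  The deletion effect of the block error at a cell deep inside a block is a difference of effects
  in two large windows, so it is at most \<open>\<epsilon> R\<close> in mean square. For the other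
  cells the trivial bound is used.
\<close>

lemma variance_block_error:
  assumes "2 * R \<le> L"
  shows "P.variance (block_error L n) \<le>
    n ^ CARD('d) * \<epsilon> R + (real (n ^ CARD('d)) - real ((n div L * (L - 2 * R)) ^ CARD('d))) * (4 * H_moment)"
proof -
  let ?G = "{z :: int^'d. \<exists>y\<in>box_cube (n div L). (+) z ` box_ball R \<subseteq> block L y}"
  let ?d = "\<lambda>z s. block_error L n s - block_error L n (s(z := e))"
  note G = card_deep_points[OF assms, where 'd='d and n=n]
  have e0: "\<epsilon> R \<ge> 0" unfolding \<epsilon>_def by (intro integral_nonneg_AE) auto
  have H_moment0: "H_moment \<ge> 0" unfolding H_moment_def by simp
  \<comment> \<open>The set \<open>?G\<close> consists of the cells at distance more than
    \<open>R\<close> from the boundary of their block.\<close>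
  have good: "(\<integral>s. (?d z s)\<^sup>2 \<partial>P) \<le> \<epsilon> R" if z: "z \<in> ?G" for z
  proof -
    obtain y where y: "y \<in> box_cube (n div L)" "(+) z ` box_ball R \<subseteq> block L y" using z by blast
    have "0 \<in> (box_ball R :: (int^'d) set)" by (simp add: box_ball_def)
    then have "z + 0 \<in> (+) z ` box_ball R" by blast
    then have "z \<in> block L y" using y by auto
    then show ?thesis
      unfolding block_error_D_in[OF y(1) \<open>z \<in> block L y\<close>]
      using y block_subset_cube[OF y(1)] by (intro D_diff_far finite_box_cube finite_block) auto
  qed
  have all: "(\<integral>s. (?d z s)\<^sup>2 \<partial>P) \<le> 4 * H_moment" for z
  proof -
    have "(\<integral>s. (?d z s)\<^sup>2 \<partial>P) \<le> (\<integral>s. 4 * (H (\<lambda>y. s (z + y)))\<^sup>2 \<partial>P)"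
    proof (rule integral_mono)
      show "integrable P (\<lambda>s. (?d z s)\<^sup>2)" using L2_block_error_D by (simp add: L2_def)
      show "integrable P (\<lambda>s. 4 * (H (\<lambda>y. s (z + y)))\<^sup>2)"
        using L2_shift[OF HP, of z] by (simp add: L2_def)
      fix s
      have "(?d z s)\<^sup>2 = \<bar>?d z s\<bar>\<^sup>2" by simp
      also have "\<dots> \<le> (2 * H (\<lambda>y. s (z + y)))\<^sup>2" by (intro power_mono block_error_D_bound) simp
      finally show "(?d z s)\<^sup>2 \<le> 4 * (H (\<lambda>y. s (z + y)))\<^sup>2" by (simp add: power_mult_distrib)
    qed
    also have "\<dots> = 4 * (\<integral>s. (H (\<lambda>y. s (z + y)))\<^sup>2 \<partial>P)" by simp
    also have "\<dots> = 4 * H_moment"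
      unfolding H_moment_def by (intro arg_cong[where f = "\<lambda>x. 4 * x"] integral_shift(1)[of "\<lambda>s. (H s)\<^sup>2" z]
        borel_measurable_power L2_measurable[OF HP])
    finally show ?thesis .
  qed
  have "P.variance (block_error L n) \<le> (\<Sum>z\<in>box_cube n. \<integral>s. (?d z s)\<^sup>2 \<partial>P)"
    by (rule variance_bound[OF finite_box_cube depends_block_error L2_block_error L2_block_error_D])
  also have "\<dots> = (\<Sum>z\<in>?G. \<integral>s. (?d z s)\<^sup>2 \<partial>P) + (\<Sum>z\<in>box_cube n - ?G. \<integral>s. (?d z s)\<^sup>2 \<partial>P)"
    using G(2) finite_box_cube by (subst sum.subset_diff[of ?G]) auto
  also have "\<dots> \<le> (\<Sum>z\<in>?G. \<epsilon> R) + (\<Sum>z\<in>box_cube n - ?G. 4 * H_moment)"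
    by (intro add_mono sum_mono good all)
  also have "\<dots> = card ?G * \<epsilon> R + (real (n ^ CARD('d)) - real (card ?G)) * (4 * H_moment)"
  proof -
    have fG: "finite ?G" by (rule finite_subset[OF G(2) finite_box_cube])
    have "card (box_cube n - ?G) = n ^ CARD('d) - card ?G"
      using card_Diff_subset[OF fG G(2)] by (simp add: card_box_cube)
    moreover have "card ?G \<le> n ^ CARD('d)" using card_mono[OF finite_box_cube G(2)] by (simp add: card_box_cube)
    ultimately show ?thesis by (simp only: sum_constant of_nat_diff)
  qed
  also have "\<dots> \<le> n ^ CARD('d) * \<epsilon> R + (real (n ^ CARD('d)) - real ((n div L * (L - 2 * R)) ^ CARD('d))) * (4 * H_moment)"
  proof (intro add_mono mult_right_mono e0)
    have "card ?G \<le> n ^ CARD('d)" using card_mono[OF finite_box_cube G(2)] by (simp add: card_box_cube)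
    then show "real (card ?G) \<le> real (n ^ CARD('d))" by linarith
    show "real (n ^ CARD('d)) - real (card ?G) \<le> real (n ^ CARD('d)) - real ((n div L * (L - 2 * R)) ^ CARD('d))"
      using G(1) by linarith
  qed (use H_moment0 in simp)
  finally show ?thesis by simp
qed

text \<open>
  First \<open>R\<close> is chosen to make \<open>\<epsilon> R\<close> small, then
  \<open>L\<close> so large that most cells are deep inside their blocks.
\<close>

lemma block_error_small:
  assumes r: "r > 0"
  shows "\<exists>L\<ge>1. eventually (\<lambda>n. P.variance (block_error L n) \<le> r * real n ^ CARD('d)) sequentially"
proof -
  have H_moment0: "H_moment \<ge> 0" unfolding H_moment_def by simp
  have "eventually (\<lambda>R. \<epsilon> R < r / 2) sequentially"
    by (rule order_tendstoD(2)[OF \<epsilon>_tendsto_0]) (use r in simp)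
  then obtain R where R: "\<epsilon> R < r / 2"
    using eventually_happens'[OF sequentially_bot] by blast
  \<comment> \<open>The summand one avoids division by zero when \<open>H\<close> vanishes almost
    surely.\<close>
  define c where "c = r / (2 * (4 * H_moment + 1))"
  have c: "c > 0" "c * (4 * H_moment) \<le> r / 2"
  proof -
    show "c > 0" using r H_moment0 by (simp add: c_def)
    have "c * (4 * H_moment) \<le> c * (4 * H_moment + 1)" using \<open>c > 0\<close> by (simp add: mult_left_mono)
    also have "\<dots> = r / 2" using H_moment0 by (simp add: c_def field_simps)
    finally show "c * (4 * H_moment) \<le> r / 2" .
  qed
  have "(\<lambda>L. 1 - (2 * real R) / real L) \<longlonglongrightarrow> 1 - 0"
    by (intro tendsto_diff tendsto_const lim_const_over_n)
  then have "(\<lambda>L. 1 - (2 * real R) / real L) \<longlonglongrightarrow> 1" by simp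
  moreover have "eventually (\<lambda>L. 1 - (2 * real R) / real L = (real L - 2 * real R) / real L) sequentially"
    using eventually_gt_at_top[of 0] by eventually_elim (simp add: diff_divide_distrib)
  ultimately have "(\<lambda>L. (real L - 2 * real R) / real L) \<longlonglongrightarrow> 1"
    by (rule Lim_transform_eventually)
  then have "(\<lambda>L. 1 - ((real L - 2 * real R) / real L) ^ CARD('d)) \<longlonglongrightarrow> 1 - 1 ^ CARD('d)"
    by (rule tendsto_diff[OF tendsto_const tendsto_power])
  then have "eventually (\<lambda>L. 1 - ((real L - 2 * real R) / real L) ^ CARD('d) < c) sequentially"
    using c(1) by (intro order_tendstoD(2)) simp_all
  moreover have "eventually (\<lambda>L. L \<ge> 2 * R + 1) sequentially" by (rule eventually_ge_at_top)
  ultimately have "eventually (\<lambda>L. 1 - ((real L - 2 * real R) / real L) ^ CARD('d) < c \<and> L \<ge> 2 * R + 1) sequentially"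
    by (rule eventually_conj)
  then obtain L where L: "1 - ((real L - 2 * real R) / real L) ^ CARD('d) < c" "L \<ge> 2 * R + 1"
    using eventually_happens'[OF sequentially_bot] by blast
  have "(\<lambda>n. real (n div L) / real n) \<longlonglongrightarrow> 1 / real L" using L(2) by (intro div_ratio_tendsto) simp
  then have "(\<lambda>n. 1 - (real (n div L) / real n * real (L - 2 * R)) ^ CARD('d)) \<longlonglongrightarrow> 1 - (1 / real L * real (L - 2 * R)) ^ CARD('d)"
    by (rule tendsto_diff[OF tendsto_const tendsto_power[OF tendsto_mult[OF _ tendsto_const]]])
  moreover have "1 - (1 / real L * real (L - 2 * R)) ^ CARD('d) < c" using L by (simp add: of_nat_diff)
  ultimately have "eventually (\<lambda>n. 1 - (real (n div L) / real n * real (L - 2 * R)) ^ CARD('d) < c) sequentially"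
    by (rule order_tendstoD(2))
  then have "eventually (\<lambda>n. P.variance (block_error L n) \<le> r * real n ^ CARD('d)) sequentially"
    using eventually_gt_at_top[of 0]
  proof eventually_elim
    case (elim n)
    have n: "real n ^ CARD('d) > 0" using elim(2) by simp
    have "real ((n div L * (L - 2 * R)) ^ CARD('d)) = real n ^ CARD('d) * (real (n div L) / real n * real (L - 2 * R)) ^ CARD('d)"
      using elim(2) by (simp add: power_mult_distrib[symmetric])
    then have "real (n ^ CARD('d)) - real ((n div L * (L - 2 * R)) ^ CARD('d)) = real n ^ CARD('d) * (1 - (real (n div L) / real n * real (L - 2 * R)) ^ CARD('d))"
      by (simp add: right_diff_distrib)
    also have "\<dots> \<le> real n ^ CARD('d) * c" using elim(1) n by (intro mult_left_mono) auto
    finally have "(real (n ^ CARD('d)) - real ((n div L * (L - 2 * R)) ^ CARD('d))) * (4 * H_moment) \<le> real n ^ CARD('d) * c * (4 * H_moment)"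
      using H_moment0 by (intro mult_right_mono) auto
    also have "\<dots> \<le> real n ^ CARD('d) * (r / 2)" using c(2) n by (simp add: mult.assoc)
    finally have "P.variance (block_error L n) \<le> real n ^ CARD('d) * \<epsilon> R + real n ^ CARD('d) * (r / 2)"
      using variance_block_error[of R L n] L(2) by simp
    also have "\<dots> \<le> real n ^ CARD('d) * (r / 2) + real n ^ CARD('d) * (r / 2)"
      using R n by (intro add_right_mono mult_left_mono) auto
    finally show ?case by (simp add: algebra_simps)
  qed
  then show ?thesis using L(2) by (intro exI[of _ L]) auto
qed

lemma F_block_shift: "F (block L y) s = F (box_cube L) (\<lambda>x. s ((\<chi> k. int L * y $ k) + x))"
  unfolding block_def by (rule shift[OF finite_box_cube])

definition centered_cube :: "nat \<Rightarrow> ((int^'d) \<Rightarrow> 's) \<Rightarrow> real" where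
  "centered_cube L s = F (box_cube L) s - P.expectation (F (box_cube L))"

lemma L2_centered_cube: "L2 P (centered_cube L)"
  unfolding centered_cube_def[abs_def] by (intro L2_diff sqP finite_box_cube P.L2_const)

lemma expectation_centered_cube: "P.expectation (centered_cube L) = 0"
  unfolding centered_cube_def[abs_def]
  using P.L2_integrable[OF sqP[OF finite_box_cube, of L]] by (simp add: P.prob_space)

lemma expectation_block: "P.expectation (F (block L y)) = P.expectation (F (box_cube L))"
proof -
  have "P.expectation (F (block L y)) = P.expectation (\<lambda>s. F (box_cube L) (\<lambda>x. s ((\<chi> k. int L * y $ k) + x)))"
    by (rule Bochner_Integration.integral_cong[OF refl F_block_shift])
  also have "\<dots> = P.expectation (F (box_cube L))"
    by (rule integral_shift(1)[OF L2_measurable[OF sqP[OF finite_box_cube]]])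
  finally show ?thesis .
qed

definition block_term :: "nat \<Rightarrow> int^'d \<Rightarrow> ((int^'d) \<Rightarrow> 's) \<Rightarrow> real" where
  "block_term L y s = F (block L y) s - P.expectation (F (box_cube L))"

lemma block_term_shift: "block_term L y s = centered_cube L (\<lambda>x. s ((\<chi> k. int L * y $ k) + x))"
  unfolding block_term_def centered_cube_def F_block_shift ..

lemma L2_block_term: "L2 P (block_term L y)"
  unfolding block_term_def[abs_def] by (intro L2_diff sqP finite_block P.L2_const)

lemma distr_block_term: "distr P borel (block_term L y) = distr P borel (centered_cube L)"
proof -
  have "distr P borel (centered_cube L) = distr (distr P P (\<lambda>s x. s ((\<chi> k. int L * y $ k) + x))) borel (centered_cube L)"
    by (simp only: distr_shift)
  also have "\<dots> = distr P borel (centered_cube L \<circ> (\<lambda>s x. s ((\<chi> k. int L * y $ k) + x)))"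
    by (rule distr_distr[OF L2_measurable[OF L2_centered_cube] shift_measurable])
  also have "centered_cube L \<circ> (\<lambda>s x. s ((\<chi> k. int L * y $ k) + x)) = block_term L y"
    by (rule ext) (simp only: block_term_shift comp_def)
  finally show ?thesis by (rule sym)
qed

lemma indep_coordinates: "P.indep_vars (\<lambda>_. S) (\<lambda>i s. s i) UNIV"
proof (subst P.indep_vars_iff_distr_eq_PiM')
  have m: "(\<lambda>s. s i) \<in> P \<rightarrow>\<^sub>M S" for i unfolding P_def by measurable
  then show "(\<lambda>s. s i) \<in> P \<rightarrow>\<^sub>M S" for i .
  have d: "distr P S (\<lambda>s. s i) = S" for i
    unfolding P_def by (rule distr_PiM_component) (auto intro: S.prob_space_axioms)
  have "distr P (PiM UNIV (\<lambda>_. S)) (\<lambda>x. \<lambda>i\<in>UNIV. x i) = distr P P (\<lambda>x. x)"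
    by (simp add: P_def restrict_def)
  also have "\<dots> = PiM UNIV (\<lambda>i. distr P S (\<lambda>x. x i))"
    unfolding d by (simp add: P_def)
  finally show "distr P (PiM UNIV (\<lambda>_. S)) (\<lambda>x. \<lambda>i\<in>UNIV. x i) = PiM UNIV (\<lambda>i. distr P S (\<lambda>x. x i))" .
qed simp

text \<open>Disjoint blocks depend on disjoint sets of independent coordinates.\<close>

lemma indep_block_terms: "P.indep_vars (\<lambda>_. borel) (block_term L) J"
proof -
  have "P.indep_vars (\<lambda>y. PiM (block L y) (\<lambda>_. S)) (\<lambda>y s. restrict (\<lambda>i. s i) (block L y)) J"
    by (rule P.indep_vars_restrict[OF indep_coordinates])
      (auto simp: disjoint_family_on_def dest: block_disjoint)
  then have "P.indep_vars (\<lambda>_. borel)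
      (\<lambda>y s. block_term L y (\<lambda>i. if i \<in> block L y then restrict (\<lambda>i. s i) (block L y) i else e)) J"
  proof (rule P.indep_vars_compose2)
    fix y
    have "(\<lambda>r i. if i \<in> block L y then r i else e) \<in> PiM (block L y) (\<lambda>_. S) \<rightarrow>\<^sub>M P"
      unfolding P_def
    proof (rule measurable_PiM_single')
      fix i show "(\<lambda>r. if i \<in> block L y then r i else e) \<in> PiM (block L y) (\<lambda>_. S) \<rightarrow>\<^sub>M S"
        by (cases "i \<in> block L y") (auto simp: spS)
    qed (auto simp: spS)
    from measurable_compose[OF this L2_measurable[OF L2_block_term[of L y]]]
    show "(\<lambda>r. block_term L y (\<lambda>i. if i \<in> block L y then r i else e)) \<in> borel_measurable (PiM (block L y) (\<lambda>_. S))" .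
  qed
  moreover have "block_term L y (\<lambda>i. if i \<in> block L y then restrict (\<lambda>i. s i) (block L y) i else e) = block_term L y s" for y s
    unfolding block_term_def
    by (rule arg_cong[where f = "\<lambda>x. x - _"], rule depends_onD[OF dep[OF finite_block]]) simp
  ultimately show ?thesis by (simp only:)
qed

definition block_sd :: "nat \<Rightarrow> real" where
  "block_sd L = norm2 P (centered_cube L) / sqrt (real L ^ CARD('d))"

definition block_sum :: "nat \<Rightarrow> nat \<Rightarrow> ((int^'d) \<Rightarrow> 's) \<Rightarrow> real" where
  "block_sum L n s = (\<Sum>y\<in>box_cube (n div L). block_term L y s)"

lemma L2_block_sum: "L2 P (block_sum L n)"
  unfolding block_sum_def[abs_def] by (intro P.L2_sum L2_block_term)

lemma char_block_sum:
  "char (distr P borel (block_sum L n)) t = char (distr P borel (centered_cube L)) t ^ ((n div L) ^ CARD('d))"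
proof -
  have "char (distr P borel (block_sum L n)) t = (\<Prod>y\<in>box_cube (n div L). char (distr P borel (block_term L y)) t)"
    unfolding block_sum_def[abs_def] by (rule P.char_distr_sum[OF indep_block_terms])
  then show ?thesis by (simp add: distr_block_term card_box_cube)
qed

lemma norm2_block_sum: "norm2 P (block_sum L n) = sqrt ((n div L) ^ CARD('d)) * norm2 P (centered_cube L)"
proof -
  have i: "P.expectation (block_term L y) = 0" "P.expectation (\<lambda>s. (block_term L y s)\<^sup>2) = (norm2 P (centered_cube L))\<^sup>2" for y
  proof -
    have "P.expectation (block_term L y) = (\<integral>x. x \<partial>distr P borel (block_term L y))"
      by (rule integral_distr[symmetric, OF L2_measurable[OF L2_block_term]]) measurable
    also have "\<dots> = P.expectation (centered_cube L)"
      unfolding distr_block_term by (rule integral_distr[OF L2_measurable[OF L2_centered_cube]]) measurable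
    finally show "P.expectation (block_term L y) = 0" by (simp only: expectation_centered_cube)
    have "P.expectation (\<lambda>s. (block_term L y s)\<^sup>2) = (\<integral>x. x\<^sup>2 \<partial>distr P borel (block_term L y))"
      by (rule integral_distr[symmetric, OF L2_measurable[OF L2_block_term]]) measurable
    also have "\<dots> = P.expectation (\<lambda>s. (centered_cube L s)\<^sup>2)"
      unfolding distr_block_term by (rule integral_distr[OF L2_measurable[OF L2_centered_cube]]) measurable
    finally show "P.expectation (\<lambda>s. (block_term L y s)\<^sup>2) = (norm2 P (centered_cube L))\<^sup>2" by (simp only: norm2_sq)
  qed
  have int: "integrable P (block_term L y)" for y by (rule P.L2_integrable[OF L2_block_term])
  have orth: "P.expectation (\<lambda>s. block_term L y s * block_term L y' s) = 0" if "y \<noteq> y'" for y y'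
  proof -
    have "P.expectation (\<lambda>s. \<Prod>x\<in>{y, y'}. block_term L x s) = (\<Prod>x\<in>{y, y'}. P.expectation (block_term L x))"
      by (rule P.indep_vars_lebesgue_integral[OF _ indep_block_terms int]) simp
    then show ?thesis using that by (simp add: i(1))
  qed
  have "(norm2 P (block_sum L n))\<^sup>2 = P.expectation (\<lambda>s. \<Sum>y\<in>box_cube (n div L). \<Sum>y'\<in>box_cube (n div L). block_term L y s * block_term L y' s)"
    unfolding norm2_sq unfolding block_sum_def power2_eq_square sum_product ..
  also have "\<dots> = (\<Sum>y\<in>(box_cube (n div L) :: (int^'d) set). \<Sum>y'\<in>box_cube (n div L). P.expectation (\<lambda>s. block_term L y s * block_term L y' s))"
    by (simp add: Bochner_Integration.integral_sum L2_integrable_mult[OF L2_block_term L2_block_term])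
  also have "\<dots> = (\<Sum>y\<in>(box_cube (n div L) :: (int^'d) set). (norm2 P (centered_cube L))\<^sup>2)"
  proof (rule sum.cong[OF refl])
    fix y :: "int^'d" assume y: "y \<in> box_cube (n div L)"
    have "(\<Sum>y'\<in>box_cube (n div L). P.expectation (\<lambda>s. block_term L y s * block_term L y' s)) = (\<Sum>y'\<in>{y}. P.expectation (\<lambda>s. block_term L y s * block_term L y' s))"
    proof (intro sum.mono_neutral_right finite_box_cube ballI)
      fix y' assume "y' \<in> box_cube (n div L) - {y}"
      then have "y \<noteq> y'" by blast
      then show "P.expectation (\<lambda>s. block_term L y s * block_term L y' s) = 0" by (rule orth)
    qed (use y in simp)
    then show "(\<Sum>y'\<in>box_cube (n div L). P.expectation (\<lambda>s. block_term L y s * block_term L y' s)) = (norm2 P (centered_cube L))\<^sup>2"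
      using i(2)[of y] by (simp add: power2_eq_square)
  qed
  also have "\<dots> = real (card (box_cube (n div L) :: (int^'d) set)) * (norm2 P (centered_cube L))\<^sup>2" by simp
  also have "\<dots> = real ((n div L) ^ CARD('d)) * (norm2 P (centered_cube L))\<^sup>2" by (simp add: card_box_cube)
  finally have "norm2 P (block_sum L n) = sqrt (real ((n div L) ^ CARD('d)) * (norm2 P (centered_cube L))\<^sup>2)"
    by (intro real_sqrt_unique[symmetric] norm2_nonneg)
  then show ?thesis using norm2_nonneg[of P "centered_cube L"] by (simp add: real_sqrt_mult)
qed

text \<open>
  For fixed \<open>L\<close> the blocks are independent and identically distributed, so the number
  of blocks may be taken to infinity in the classical central limit theorem.
\<close>

lemma cis_block_sum_tendsto:
  assumes L: "L \<ge> 1"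
  shows "(\<lambda>n. P.expectation (\<lambda>s. cis (block_sum L n s / (sqrt (real L ^ CARD('d)) * sqrt (real ((n div L) ^ CARD('d)))))))
    \<longlonglongrightarrow> complex_of_real (exp (- (block_sd L)\<^sup>2 / 2))"
proof -
  define \<nu> where "\<nu> = distr P borel (centered_cube L)"
  define t where "t = 1 / sqrt (real L ^ CARD('d))"
  have mc: "centered_cube L \<in> borel_measurable P" by (rule L2_measurable[OF L2_centered_cube])
  have sq: "(\<integral>x. x\<^sup>2 \<partial>\<nu>) = (norm2 P (centered_cube L))\<^sup>2"
    unfolding \<nu>_def norm2_sq by (rule integral_distr[OF mc]) measurable
  have int: "integrable \<nu> (\<lambda>x. x\<^sup>2)"
    unfolding \<nu>_def using L2_centered_cube by (subst integrable_distr_eq[OF mc]) (auto simp: L2_def)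
  have "(\<lambda>n. char \<nu> (t / sqrt (real n)) ^ n) \<longlonglongrightarrow> complex_of_real (exp (- (t\<^sup>2 * (\<integral>x. x\<^sup>2 \<partial>\<nu>)) / 2))"
  proof (rule char_power_tendsto_gaussian)
    show "real_distribution \<nu>" unfolding \<nu>_def by (rule P.real_distribution_distr[OF mc])
    show "L2 \<nu> (\<lambda>x. x)" using int by (simp add: L2_def \<nu>_def)
    have "(\<integral>x. x \<partial>\<nu>) = P.expectation (centered_cube L)"
      unfolding \<nu>_def by (rule integral_distr[OF mc]) measurable
    then show "(\<integral>x. x \<partial>\<nu>) = 0" by (simp only: expectation_centered_cube)
  qed
  moreover have "t\<^sup>2 * (\<integral>x. x\<^sup>2 \<partial>\<nu>) = (block_sd L)\<^sup>2"
    by (simp add: t_def sq block_sd_def power_divide)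
  ultimately have lim: "(\<lambda>n. char \<nu> (t / sqrt (real n)) ^ n) \<longlonglongrightarrow> complex_of_real (exp (- (block_sd L)\<^sup>2 / 2))"
    by (simp only: minus_mult_left)
  have "filterlim (\<lambda>n. (n div L) ^ CARD('d)) at_top sequentially"
  proof (rule filterlim_at_top_mono)
    have "L > 0" using L by simp
    show "filterlim (\<lambda>n. n div L) at_top sequentially"
      unfolding filterlim_at_top eventually_sequentially
    proof (intro allI exI impI)
      fix Z n assume "L * Z \<le> n" then show "Z \<le> n div L" using \<open>L > 0\<close> by (simp add: less_eq_div_iff_mult_less_eq mult.commute)
    qed
    show "eventually (\<lambda>n. n div L \<le> (n div L) ^ CARD('d)) sequentially"
    proof (intro always_eventually allI)
      fix n show "n div L \<le> (n div L) ^ CARD('d)"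
        by (cases "n div L = 0") (auto intro: self_le_power)
    qed
  qed
  from filterlim_compose[OF lim this]
  have "(\<lambda>n. char \<nu> (t / sqrt (real ((n div L) ^ CARD('d)))) ^ ((n div L) ^ CARD('d))) \<longlonglongrightarrow> complex_of_real (exp (- (block_sd L)\<^sup>2 / 2))" .
  moreover have "char \<nu> (t / sqrt (real ((n div L) ^ CARD('d)))) ^ ((n div L) ^ CARD('d))
    = P.expectation (\<lambda>s. cis (block_sum L n s / (sqrt (real L ^ CARD('d)) * sqrt (real ((n div L) ^ CARD('d))))))" for n
  proof -
    have "char \<nu> (t / sqrt (real ((n div L) ^ CARD('d)))) ^ ((n div L) ^ CARD('d)) = char (distr P borel (block_sum L n)) (t / sqrt (real ((n div L) ^ CARD('d))))"
      unfolding char_block_sum \<nu>_def ..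
    also have "\<dots> = P.expectation (\<lambda>s. cis (t / sqrt (real ((n div L) ^ CARD('d))) * block_sum L n s))"
      unfolding char_def cis_conv_exp by (rule integral_distr[OF L2_measurable[OF L2_block_sum]]) measurable
    finally show ?thesis by (simp add: t_def)
  qed
  ultimately show ?thesis by (simp only:)
qed

definition normalized :: "nat \<Rightarrow> ((int^'d) \<Rightarrow> 's) \<Rightarrow> real" where
  "normalized n s = centered_cube n s / sqrt (real n ^ CARD('d))"

lemma L2_normalized: "L2 P (normalized n)"
  unfolding normalized_def[abs_def] by (intro L2_divide L2_centered_cube)

text \<open>
  The second term accounts for the two normalizations, by the number of cells of the cube and by
  the number of cells in the blocks.
\<close>

lemma normalized_close:
  assumes "L \<ge> 1" "n \<ge> L" and v: "P.variance (block_error L n) \<le> r\<^sup>2 * real n ^ CARD('d)" and r: "r \<ge> 0"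
  shows "norm2 P (\<lambda>s. normalized n s - block_sum L n s / (sqrt (real L ^ CARD('d)) * sqrt (real ((n div L) ^ CARD('d)))))
    \<le> r + norm2 P (centered_cube L) * \<bar>sqrt ((real (n div L) / real n) ^ CARD('d)) - 1 / sqrt (real L ^ CARD('d))\<bar>"
proof -
  let ?N = "sqrt (real n ^ CARD('d))" and ?M = "sqrt (real ((n div L) ^ CARD('d)))" and ?L = "sqrt (real L ^ CARD('d))"
  have pos: "?N > 0" "?L > 0" "?M > 0" using assms by (simp_all add: div_greater_zero_iff)
  define E where "E s = block_error L n s - P.expectation (block_error L n)" for s
  have LE: "L2 P E" unfolding E_def[abs_def] by (intro L2_diff L2_block_error P.L2_const)
  have cE: "centered_cube n s = E s + block_sum L n s" for s
  proof -
    have iF: "integrable P (F A)" if "finite A" for A by (rule P.L2_integrable[OF sqP[OF that]])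
    have "P.expectation (block_error L n) = P.expectation (F (box_cube n)) - (\<Sum>y\<in>box_cube (n div L). P.expectation (F (block L y)))"
      unfolding block_error_def[abs_def] by (simp add: iF finite_box_cube finite_block)
    then show ?thesis
      by (simp add: E_def block_sum_def centered_cube_def block_error_def block_term_def expectation_block sum_subtractf)
  qed
  have nE: "norm2 P E \<le> r * ?N"
  proof -
    have "norm2 P E \<le> sqrt (r\<^sup>2 * real n ^ CARD('d))"
      unfolding norm2_def E_def using v by (intro real_sqrt_le_mono) simp
    then show ?thesis using r by (simp add: real_sqrt_mult)
  qed
  have eq: "(\<lambda>s. normalized n s - block_sum L n s / (?L * ?M)) = (\<lambda>s. (1 / ?N) * E s + (1 / ?N - 1 / (?L * ?M)) * block_sum L n s)"
    by (rule ext) (simp add: normalized_def cE add_divide_distrib left_diff_distrib)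
  have "norm2 P (\<lambda>s. normalized n s - block_sum L n s / (?L * ?M))
      \<le> norm2 P (\<lambda>s. (1 / ?N) * E s) + norm2 P (\<lambda>s. (1 / ?N - 1 / (?L * ?M)) * block_sum L n s)"
    unfolding eq by (rule norm2_triangle[OF L2_cmult[OF LE] L2_cmult[OF L2_block_sum]])
  also have "\<dots> = norm2 P E / ?N + \<bar>1 / ?N - 1 / (?L * ?M)\<bar> * (?M * norm2 P (centered_cube L))"
    using pos by (simp only: norm2_cmult norm2_block_sum) (simp add: abs_mult)
  also have "\<dots> \<le> r + \<bar>1 / ?N - 1 / (?L * ?M)\<bar> * (?M * norm2 P (centered_cube L))"
    using nE pos by (simp add: divide_le_eq)
  also have "\<bar>1 / ?N - 1 / (?L * ?M)\<bar> * (?M * norm2 P (centered_cube L)) = norm2 P (centered_cube L) * \<bar>(1 / ?N - 1 / (?L * ?M)) * ?M\<bar>"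
    using pos(3) by (simp only: abs_mult abs_of_pos) (simp only: ac_simps)
  also have "(1 / ?N - 1 / (?L * ?M)) * ?M = ?M / ?N - 1 / ?L"
    using pos by (simp add: left_diff_distrib)
  also have "?M / ?N = sqrt ((real (n div L) / real n) ^ CARD('d))"
    by (simp add: real_sqrt_divide power_divide)
  finally show ?thesis .
qed

text \<open>
  For every tolerance a suitable block length gives a normal approximation with standard deviation
  \<open>block_sd L\<close>. These approximations force the standard deviations of the normalized
  functional to converge, and by continuity the limit is normal with the limiting variance.
\<close>

theorem central_limit:
  "\<exists>\<sigma>\<ge>0. (\<lambda>n. norm2 P (normalized n)) \<longlonglongrightarrow> \<sigma> \<and>
    (\<lambda>n. P.expectation (\<lambda>s. cis (normalized n s))) \<longlonglongrightarrow> complex_of_real (exp (- \<sigma>\<^sup>2 / 2))"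
proof -
  \<comment> \<open>The number \<open>\<tau>\<close> is the standard deviation \<open>block_sd
    L\<close> for a suitable \<open>L\<close>, which depends on the tolerance.\<close>
  have approx: "\<exists>\<tau>. eventually (\<lambda>n. \<bar>norm2 P (normalized n) - \<tau>\<bar> < r \<and>
      cmod (P.expectation (\<lambda>s. cis (normalized n s)) - complex_of_real (exp (- \<tau>\<^sup>2 / 2))) < r) sequentially"
    if r: "r > 0" for r
  proof -
    obtain L where L: "L \<ge> 1" "eventually (\<lambda>n. P.variance (block_error L n) \<le> (r/4)\<^sup>2 * real n ^ CARD('d)) sequentially"
      using block_error_small[of "(r/4)\<^sup>2"] r by auto
    let ?V = "\<lambda>n s. block_sum L n s / (sqrt (real L ^ CARD('d)) * sqrt (real ((n div L) ^ CARD('d))))"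
    have LV: "L2 P (?V n)" for n by (intro L2_divide L2_block_sum)
    have "(\<lambda>n. norm2 P (centered_cube L) * \<bar>sqrt ((real (n div L) / real n) ^ CARD('d)) - 1 / sqrt (real L ^ CARD('d))\<bar>)
      \<longlonglongrightarrow> norm2 P (centered_cube L) * \<bar>sqrt ((1 / real L) ^ CARD('d)) - 1 / sqrt (real L ^ CARD('d))\<bar>"
      by (intro tendsto_mult tendsto_const tendsto_rabs tendsto_diff tendsto_real_sqrt tendsto_power div_ratio_tendsto L(1))
    then have "(\<lambda>n. norm2 P (centered_cube L) * \<bar>sqrt ((real (n div L) / real n) ^ CARD('d)) - 1 / sqrt (real L ^ CARD('d))\<bar>) \<longlonglongrightarrow> 0"
      by (simp add: power_divide real_sqrt_divide)
    then have e1: "eventually (\<lambda>n. norm2 P (centered_cube L) * \<bar>sqrt ((real (n div L) / real n) ^ CARD('d)) - 1 / sqrt (real L ^ CARD('d))\<bar> < r / 4) sequentially"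
      by (rule order_tendstoD(2)) (use r in simp)
    have e2: "eventually (\<lambda>n. cmod (P.expectation (\<lambda>s. cis (?V n s)) - complex_of_real (exp (- (block_sd L)\<^sup>2 / 2))) < r / 2) sequentially"
      using tendstoD[OF cis_block_sum_tendsto[OF L(1)], of "r / 2"] r by (simp add: dist_norm)
    show ?thesis
    proof (rule exI[of _ "block_sd L"])
      show "eventually (\<lambda>n. \<bar>norm2 P (normalized n) - block_sd L\<bar> < r \<and>
        cmod (P.expectation (\<lambda>s. cis (normalized n s)) - complex_of_real (exp (- (block_sd L)\<^sup>2 / 2))) < r) sequentially"
        using L(2) e1 e2 eventually_ge_at_top[of L]
      proof eventually_elim
        case (elim n)
        have close: "norm2 P (\<lambda>s. normalized n s - ?V n s) < r / 2"
          using normalized_close[OF L(1) elim(4,1)] r elim(2) by simp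
        have M: "sqrt (real ((n div L) ^ CARD('d))) > 0" using L(1) elim(4) by (simp add: div_greater_zero_iff)
        have "norm2 P (?V n) = norm2 P (\<lambda>s. (1 / (sqrt (real L ^ CARD('d)) * sqrt (real ((n div L) ^ CARD('d))))) * block_sum L n s)"
          by simp
        also have "\<dots> = block_sd L"
          using M by (simp only: norm2_cmult norm2_block_sum) (simp add: block_sd_def abs_mult)
        finally have "norm2 P (?V n) = block_sd L" .
        then have "\<bar>norm2 P (normalized n) - block_sd L\<bar> < r"
          using norm2_reverse_triangle[OF L2_normalized[of n] LV[of n]] close r by simp
        moreover have "cmod (P.expectation (\<lambda>s. cis (normalized n s)) - P.expectation (\<lambda>s. cis (?V n s))) < r / 2"
          using P.cis_expectation_close[OF L2_normalized[of n] LV[of n]] close by linarith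
        then have "cmod (P.expectation (\<lambda>s. cis (normalized n s)) - complex_of_real (exp (- (block_sd L)\<^sup>2 / 2))) < r"
          using norm_triangle_lt[of "P.expectation (\<lambda>s. cis (normalized n s)) - P.expectation (\<lambda>s. cis (?V n s))" "P.expectation (\<lambda>s. cis (?V n s)) - complex_of_real (exp (- (block_sd L)\<^sup>2 / 2))" r] elim(3)
          by simp
        ultimately show ?case by simp
      qed
    qed
  qed
  have "Cauchy (\<lambda>n. norm2 P (normalized n))"
  proof (rule metric_CauchyI)
    fix r :: real assume "r > 0"
    then obtain \<tau> where "eventually (\<lambda>n. \<bar>norm2 P (normalized n) - \<tau>\<bar> < r / 2) sequentially"
      using approx[of "r / 2"] by (auto simp: eventually_conj_iff)
    then obtain n0 where n0: "\<And>n. n \<ge> n0 \<Longrightarrow> \<bar>norm2 P (normalized n) - \<tau>\<bar> < r / 2"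
      unfolding eventually_sequentially by blast
    have "dist (norm2 P (normalized m)) (norm2 P (normalized n)) < r" if "m \<ge> n0" "n \<ge> n0" for m n
      using n0[OF that(1)] n0[OF that(2)] unfolding dist_real_def by linarith
    then show "\<exists>M. \<forall>m\<ge>M. \<forall>n\<ge>M. dist (norm2 P (normalized m)) (norm2 P (normalized n)) < r" by blast
  qed
  then obtain \<sigma> where \<sigma>: "(\<lambda>n. norm2 P (normalized n)) \<longlonglongrightarrow> \<sigma>"
    using Cauchy_convergent convergent_def by blast
  have \<sigma>0: "\<sigma> \<ge> 0" by (rule LIMSEQ_le_const[OF \<sigma>]) (simp add: norm2_nonneg)
  have "(\<lambda>n. P.expectation (\<lambda>s. cis (normalized n s))) \<longlonglongrightarrow> complex_of_real (exp (- \<sigma>\<^sup>2 / 2))"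
  proof (rule tendstoI)
    fix r :: real assume r: "r > 0"
    have "isCont (\<lambda>t::real. complex_of_real (exp (- t\<^sup>2 / 2))) \<sigma>" by (intro continuous_intros) simp
    then obtain \<delta> where \<delta>: "\<delta> > 0" "\<And>t. \<bar>t - \<sigma>\<bar> < \<delta> \<Longrightarrow> cmod (complex_of_real (exp (- t\<^sup>2 / 2)) - complex_of_real (exp (- \<sigma>\<^sup>2 / 2))) < r / 2"
      using r unfolding continuous_at_eps_delta dist_norm by (metis half_gt_zero real_norm_def)
    obtain \<tau> where \<tau>: "eventually (\<lambda>n. \<bar>norm2 P (normalized n) - \<tau>\<bar> < min (r / 2) (\<delta> / 2) \<and>
      cmod (P.expectation (\<lambda>s. cis (normalized n s)) - complex_of_real (exp (- \<tau>\<^sup>2 / 2))) < min (r / 2) (\<delta> / 2)) sequentially"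
      using approx[of "min (r / 2) (\<delta> / 2)"] r \<delta>(1) by auto
    have "eventually (\<lambda>n. \<bar>norm2 P (normalized n) - \<sigma>\<bar> < \<delta> / 2) sequentially"
      using tendstoD[OF \<sigma>, of "\<delta> / 2"] \<delta>(1) by (simp add: dist_real_def)
    with \<tau> show "eventually (\<lambda>n. dist (P.expectation (\<lambda>s. cis (normalized n s))) (complex_of_real (exp (- \<sigma>\<^sup>2 / 2))) < r) sequentially"
    proof eventually_elim
      case (elim n)
      then have "\<bar>\<tau> - \<sigma>\<bar> < \<delta>" by linarith
      from \<delta>(2)[OF this] elim(1) show ?case
        using norm_triangle_lt[of "P.expectation (\<lambda>s. cis (normalized n s)) - complex_of_real (exp (- \<tau>\<^sup>2 / 2))" "complex_of_real (exp (- \<tau>\<^sup>2 / 2)) - complex_of_real (exp (- \<sigma>\<^sup>2 / 2))" r]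
        by (simp add: dist_norm)
    qed
  qed
  with \<sigma> \<sigma>0 show ?thesis by blast
qed

end

section \<open>Configurations in unit cubes\<close>

text \<open>The corner of the unit cube with a given integer index.\<close>

definition rv :: "int^'d \<Rightarrow> real^'d" where "rv z = (\<chi> k. of_int (z $ k))"

definition unit_cube :: "(real^'d) set" where "unit_cube = {x. \<forall>k. 0 \<le> x $ k \<and> x $ k < 1}"

lemma rv_add: "rv (z + y) = rv z + rv y" by (simp add: rv_def vec_eq_iff)

lemma cube_index:
  assumes "x \<in> unit_cube" shows "\<lfloor>(rv z + x) $ k\<rfloor> = z $ k"
  using assms by (simp add: rv_def unit_cube_def floor_eq_iff)

lemma cube_unique:
  assumes "x \<in> unit_cube" "y \<in> unit_cube" "rv z + x = rv w + y" shows "z = w"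
  using cube_index[OF assms(1), of z] cube_index[OF assms(2), of w] assms(3) by (simp add: vec_eq_iff)

type_synonym 'd mpoint = "(real, 'd) vec \<times> real"

text \<open>
  The points of cell \<open>z\<close> are stored relative to the corner of their cube. Stored
  points outside of the unit cube are ignored, so that arbitrary data give points in disjoint
  cubes.
\<close>

definition cell :: "(int^'d \<Rightarrow> 'd mpoint fset) \<Rightarrow> int^'d \<Rightarrow> 'd mpoint set" where
  "cell s z = (\<lambda>p. (rv z + fst p, snd p)) ` {p. p \<in> fset (s z) \<and> fst p \<in> unit_cube}"

definition conf :: "(int^'d \<Rightarrow> 'd mpoint fset) \<Rightarrow> (int^'d) set \<Rightarrow> 'd mpoint set" where
  "conf s A = (\<Union>z\<in>A. cell s z)"

lemma finite_cell: "finite (cell s z)" unfolding cell_def by (rule finite_imageI) (rule finite_subset[of _ "fset (s z)"], auto)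

lemma finite_conf: "finite A \<Longrightarrow> finite (conf s A)" by (simp add: conf_def finite_cell)

lemma cellE:
  assumes "p \<in> cell s z" obtains x where "x \<in> unit_cube" "fst p = rv z + x"
  using assms unfolding cell_def by auto

lemma conf_mono: "A \<subseteq> A' \<Longrightarrow> conf s A \<subseteq> conf s A'" unfolding conf_def by blast

lemma conf_delete: "conf (s(z := {||})) A = conf s (A - {z})"
proof -
  have "cell (s(z := {||})) y = (if y = z then {} else cell s y)" for y by (simp add: cell_def)
  then show ?thesis unfolding conf_def by auto
qed

lemma conf_shift: "conf s ((+) z ` A) = (\<lambda>p. (rv z + fst p, snd p)) ` conf (\<lambda>y. s (z + y)) A"
proof -
  have "cell s (z + y) = (\<lambda>p. (rv z + fst p, snd p)) ` cell (\<lambda>y. s (z + y)) y" for y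
    unfolding cell_def image_image by (simp add: rv_add add.assoc)
  then show ?thesis unfolding conf_def image_UN by simp
qed

lemma conf_agree: "(\<And>z. z \<in> A \<Longrightarrow> s z = s' z) \<Longrightarrow> conf s A = conf s' A"
  unfolding conf_def cell_def by simp

definition locs :: "'d mpoint set \<Rightarrow> real \<Rightarrow> (real, 'd) vec set" where
  "locs C r = fst ` {p \<in> C. snd p \<le> r}"

lemma locs_mono: "C \<subseteq> C' \<Longrightarrow> r \<le> r' \<Longrightarrow> locs C r \<subseteq> locs C' r'" unfolding locs_def by auto

lemma finite_locs: "finite C \<Longrightarrow> finite (locs C r)" by (simp add: locs_def)

fun cplx :: "('d::finite) mpoint set \<Rightarrow> param \<Rightarrow> (real, 'd) vec set set set" where
  "cplx C (r1, r2, k) = mult_complex r1 k (locs C r2)"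

definition pbeta :: "nat \<Rightarrow> param \<Rightarrow> param \<Rightarrow> ('d::{finite,linorder}) mpoint set \<Rightarrow> real" where
  "pbeta q b d C = pb_log q (lex_smallest (snd (snd d))) (cplx C b) (cplx C d)"

lemma finite_cplx: "finite C \<Longrightarrow> finite (cplx C b)"
  by (cases b) (simp add: finite_mult_complex finite_locs)

lemma cplx_mono: "C \<subseteq> C' \<Longrightarrow> cplx C b \<subseteq> cplx C' b"
  by (cases b) (simp add: mult_complex_mono locs_mono)

lemma persistent_betti_eq_pbeta:
  assumes C: "finite C" and p: "b \<in> params T" "d \<in> params T" "param_le b d"
  shows "real (persistent_betti q (lex_smallest (snd (snd d))) (cplx C b) (cplx C d)) = pbeta q b d C"
  unfolding pbeta_def pb_log_def
proof (rule persistent_betti_log)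
  obtain r1 r2 k where b: "b = (r1, r2, k)" by (cases b)
  obtain r1' r2' k' where d: "d = (r1', r2', k')" by (cases d)
  show "finite \<sigma>" if "\<sigma> \<in> cplx C b" for \<sigma> using that mult_complexD(2) by (simp add: b)
  have le: "r1 \<le> r1'" "r2 \<le> r2'" "1 \<le> k'" "k' \<le> k"
    using p by (auto simp: b d params_def)
  moreover have "locs C r2 \<subseteq> locs C r2'" by (rule locs_mono[OF subset_refl le(2)])
  ultimately show "lex_smallest (snd (snd d)) ` \<sigma> \<in> cplx C d" if "\<sigma> \<in> cplx C b" for \<sigma>
    using that mult_complex_simplicial[of \<sigma> r1 k "locs C r2" r1' "locs C r2'" k'] by (simp add: b d)
qed (rule finite_cplx[OF C])+

lemma locs_image: "locs ((\<lambda>p. (h (fst p), snd p)) ` C) r = h ` locs C r"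
  unfolding locs_def by force

lemma lex_less_translate: "lex_less (v + x) (v + y) \<longleftrightarrow> lex_less x y"
  by (simp add: lex_less_def)

lemma pbeta_translate:
  assumes C: "finite C"
  shows "pbeta q b d ((\<lambda>p. (v + fst p, snd p)) ` C) = pbeta q b d C"
proof -
  obtain r1 r2 k where b: "b = (r1, r2, k)" by (cases b)
  obtain r1' r2' k' where d: "d = (r1', r2', k')" by (cases d)
  have sub: "finite \<sigma>" if "\<sigma> \<subseteq> fst ` C" for \<sigma> using that C finite_subset by blast
  show ?thesis
    unfolding pbeta_def b d cplx.simps snd_conv locs_image
    by (rule pb_log_mult_relabel[where P = "fst ` C"])
      (use C in \<open>auto simp: lex_less_translate locs_def cech_radius_translate sub\<close>)
qed

section \<open>Effect of the points in one unit cube\<close>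

definition local_ball :: "nat \<Rightarrow> (int^'d) set" where "local_ball T = box_ball (2 * T + 1)"

lemma near_cubes:
  assumes "x \<in> unit_cube" "y \<in> unit_cube" "dist (rv 0 + x) (rv z + y) \<le> 2 * real T"
  shows "z \<in> local_ball T"
  unfolding local_ball_def box_ball_def
proof (intro CollectI allI)
  fix k
  have "\<bar>((rv 0 + x) - (rv z + y)) $ k\<bar> \<le> norm ((rv 0 + x) - (rv z + y))" by (rule component_le_norm_cart)
  also have "\<dots> \<le> 2 * real T" using assms(3) by (simp only: dist_norm)
  finally have "\<bar>x $ k - (of_int (z $ k) + y $ k)\<bar> \<le> 2 * real T" by (simp add: rv_def)
  moreover have "0 \<le> x $ k" "x $ k < 1" "0 \<le> y $ k" "y $ k < 1" using assms(1,2) by (auto simp: unit_cube_def)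
  ultimately have "\<bar>of_int (z $ k)\<bar> < 2 * real T + 2" by linarith
  then have "real_of_int \<bar>z $ k\<bar> < real_of_int (2 * int T + 2)" by simp
  then have "\<bar>z $ k\<bar> < 2 * int T + 2" by (simp only: of_int_less_iff)
  then show "\<bar>z $ k\<bar> \<le> int (2 * T + 1)" by simp
qed

definition point_count :: "(int^'d) set \<Rightarrow> (int^'d \<Rightarrow> 'd mpoint fset) \<Rightarrow> nat" where
  "point_count A s = (\<Sum>z\<in>A. card (fst ` fset (s z)))"

lemma finite_local_ball: "finite (local_ball T)" by (simp add: local_ball_def finite_box_ball)

lemma card_locs_conf:
  assumes "finite A"
  shows "card (fst ` conf s A) \<le> point_count A s"
proof -
  have "card (fst ` conf s A) \<le> (\<Sum>z\<in>A. card (fst ` cell s z))"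
    unfolding conf_def image_UN by (rule card_UN_le[OF assms])
  also have "\<dots> \<le> (\<Sum>z\<in>A. card (fst ` fset (s z)))"
  proof (rule sum_mono)
    fix z
    have "fst ` cell s z \<subseteq> (+) (rv z) ` fst ` fset (s z)" unfolding cell_def by force
    then have "card (fst ` cell s z) \<le> card ((+) (rv z) ` fst ` fset (s z))" by (intro card_mono) auto
    also have "\<dots> \<le> card (fst ` fset (s z))" by (rule card_image_le) simp
    finally show "card (fst ` cell s z) \<le> card (fst ` fset (s z))" .
  qed
  finally show ?thesis by (simp add: point_count_def)
qed

text \<open>
  A simplex that uses a point of the cube at the origin has all its vertices within distance
  \<open>2 * T\<close> of this point, hence in cubes with indices in the local ball.
\<close>

lemma new_simplex_local:
  assumes "\<Phi> \<in> cplx (conf s A) b" "\<Phi> \<notin> cplx (conf s (A - {0})) b" "b \<in> params T"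
  shows "\<Union>\<Phi> \<subseteq> locs (conf s (A \<inter> local_ball T)) (fst (snd b))"
proof
  obtain r1 r2 k where b: "b = (r1, r2, k)" by (cases b)
  have r1: "r1 \<le> real T" using assms(3) by (simp add: b params_def)
  have \<Phi>: "\<Phi> \<in> mult_complex r1 k (locs (conf s A) r2)" "\<Phi> \<notin> mult_complex r1 k (locs (conf s (A - {0})) r2)"
    using assms(1,2) by (simp_all add: b)
  obtain x where x: "x \<in> \<Union>\<Phi>" "x \<in> locs (conf s A) r2 - locs (conf s (A - {0})) r2" "\<And>y. y \<in> \<Union>\<Phi> \<Longrightarrow> dist x y \<le> 2 * r1"
    by (rule new_simplices_local[OF \<Phi>]) blast
  obtain p where p: "p \<in> conf s A" "snd p \<le> r2" "x = fst p" using x(2) by (auto simp: locs_def)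
  have "p \<notin> conf s (A - {0})" using x(2) p by (auto simp: locs_def)
  then have "p \<in> cell s 0" using p(1) unfolding conf_def by blast
  then obtain u where u: "u \<in> unit_cube" "x = rv 0 + u" using p(3) by (metis cellE)
  fix y assume y: "y \<in> \<Union>\<Phi>"
  have "y \<in> locs (conf s A) r2" using mult_complexD(7)[OF \<Phi>(1)] y by blast
  then obtain p' where p': "p' \<in> conf s A" "snd p' \<le> r2" "y = fst p'" by (auto simp: locs_def)
  then obtain z where z: "z \<in> A" "p' \<in> cell s z" unfolding conf_def by blast
  then obtain w where w: "w \<in> unit_cube" "y = rv z + w" using p'(3) by (metis cellE)
  have "dist x y \<le> 2 * real T" using x(3)[OF y] r1 by simp
  then have "z \<in> local_ball T" unfolding u(2) w(2) by (rule near_cubes[OF u(1) w(1)])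
  then have "p' \<in> conf s (A \<inter> local_ball T)" using z unfolding conf_def by blast
  then show "y \<in> locs (conf s (A \<inter> local_ball T)) (fst (snd b))" using p' by (auto simp: locs_def b)
qed

lemma card_new_simplices:
  assumes "b \<in> params T" "finite A"
  shows "card {\<Phi> \<in> cplx (conf s A) b - cplx (conf s (A - {0})) b. card \<Phi> = m} \<le> 2 ^ (m * point_count (local_ball T) s)"
proof -
  let ?Q = "fst ` conf s (local_ball T)"
  have "card {\<Phi> \<in> cplx (conf s A) b - cplx (conf s (A - {0})) b. card \<Phi> = m} \<le> 2 ^ (m * card ?Q)"
  proof (rule card_simplices_le)
    show "finite ?Q" by (simp add: finite_conf finite_local_ball)
    fix \<Phi> assume P: "\<Phi> \<in> {\<Phi> \<in> cplx (conf s A) b - cplx (conf s (A - {0})) b. card \<Phi> = m}"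
    then have "\<Union>\<Phi> \<subseteq> locs (conf s (A \<inter> local_ball T)) (fst (snd b))" using new_simplex_local[OF _ _ assms(1)] by blast
    also have "\<dots> \<subseteq> ?Q" unfolding locs_def using conf_mono[of "A \<inter> local_ball T" "local_ball T" s] by blast
    finally show "\<Phi> \<subseteq> Pow ?Q \<and> card \<Phi> = m" using P by blast
  qed
  also have "\<dots> \<le> 2 ^ (m * point_count (local_ball T) s)"
    using card_locs_conf[OF finite_local_ball, of s T] by (intro power_increasing mult_le_mono2) auto
  finally show ?thesis .
qed

text \<open>
  The simplices that disappear with the cube at the origin are sets of subsets of the points in
  the local ball, which bounds their number in terms of the number of these points.
\<close>

theorem pbeta_add_bound:
  assumes p: "b \<in> params T" "d \<in> params T" and A: "finite A"
  shows "\<bar>pbeta q b d (conf s A) - pbeta q b d (conf (s(0 := {||})) A)\<bar> \<le> 2 * 2 ^ ((q + 2) * point_count (local_ball T) s)"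
proof -
  have "\<bar>pbeta q b d (conf s A) - pbeta q b d (conf (s(0 := {||})) A)\<bar> \<le>
      card {\<Phi> \<in> cplx (conf s A) b - cplx (conf s (A - {0})) b. card \<Phi> = Suc q} + card {\<Phi> \<in> cplx (conf s A) d - cplx (conf s (A - {0})) d. card \<Phi> = Suc (Suc q)}"
    unfolding pbeta_def conf_delete
    by (rule pb_log_diff_bound) (intro finite_cplx finite_conf A cplx_mono conf_mono Diff_subset)+
  also have "\<dots> \<le> real (2 ^ (Suc q * point_count (local_ball T) s) + 2 ^ (Suc (Suc q) * point_count (local_ball T) s))"
    using card_new_simplices[OF p(1) A, of s "Suc q"] card_new_simplices[OF p(2) A, of s "Suc (Suc q)"]
    by (intro of_nat_mono add_mono)
  also have "\<dots> \<le> real (2 ^ ((q + 2) * point_count (local_ball T) s) + 2 ^ ((q + 2) * point_count (local_ball T) s))"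
    by (intro of_nat_mono add_mono power_increasing mult_le_mono1) auto
  finally show ?thesis by simp
qed

text \<open>
  Both inclusions use locality: the vertices of a new simplex lie in the local ball, and the cubes
  are disjoint, so a vertex cannot reappear from another cube.
\<close>

lemma new_simplices_const:
  assumes p: "b \<in> params T" and A: "local_ball T \<subseteq> A"
  shows "cplx (conf s A) b - cplx (conf s (A - {0})) b =
    cplx (conf s (local_ball T)) b - cplx (conf s (local_ball T - {0})) b"
proof (rule subset_antisym; rule subsetI)
  obtain r1 r2 k where b: "b = (r1, r2, k)" by (cases b)
  fix \<Phi> assume P: "\<Phi> \<in> cplx (conf s A) b - cplx (conf s (A - {0})) b"
  have "\<Union>\<Phi> \<subseteq> locs (conf s (A \<inter> local_ball T)) (fst (snd b))" using new_simplex_local[OF _ _ p] P by blast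
  moreover have "A \<inter> local_ball T = local_ball T" using A by blast
  ultimately have "\<Union>\<Phi> \<subseteq> locs (conf s (local_ball T)) r2" by (simp add: b)
  then have "\<Phi> \<in> cplx (conf s (local_ball T)) b" using P unfolding b cplx.simps mult_complex_def cech_complex_def by blast
  moreover have "cplx (conf s (local_ball T - {0})) b \<subseteq> cplx (conf s (A - {0})) b"
    using A by (intro cplx_mono conf_mono) blast
  ultimately show "\<Phi> \<in> cplx (conf s (local_ball T)) b - cplx (conf s (local_ball T - {0})) b" using P by blast
next
  obtain r1 r2 k where b: "b = (r1, r2, k)" by (cases b)
  fix \<Phi> assume P: "\<Phi> \<in> cplx (conf s (local_ball T)) b - cplx (conf s (local_ball T - {0})) b"
  have in_A: "\<Phi> \<in> cplx (conf s A) b" using P cplx_mono[OF conf_mono[OF A]] by blast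
  have "\<Phi> \<notin> cplx (conf s (A - {0})) b"
  proof
    assume "\<Phi> \<in> cplx (conf s (A - {0})) b"
    then have 1: "\<Union>\<Phi> \<subseteq> locs (conf s (A - {0})) r2"
      unfolding b cplx.simps by (rule mult_complexD(7))
    have 2: "\<Union>\<Phi> \<subseteq> locs (conf s (local_ball T)) r2"
      using P mult_complexD(7)[of \<Phi> r1 k "locs (conf s (local_ball T)) r2"] by (simp add: b)
    have "\<Union>\<Phi> \<subseteq> locs (conf s (local_ball T - {0})) r2"
    proof
      fix x assume "x \<in> \<Union>\<Phi>"
      then have "x \<in> locs (conf s (A - {0})) r2" "x \<in> locs (conf s (local_ball T)) r2" using 1 2 by blast+
      then obtain p1 p2 where p12: "p1 \<in> conf s (A - {0})" "snd p1 \<le> r2" "x = fst p1" "p2 \<in> conf s (local_ball T)" "x = fst p2"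
        unfolding locs_def by blast
      obtain z1 where z1: "z1 \<in> A - {0}" "p1 \<in> cell s z1" using p12(1) unfolding conf_def by blast
      obtain z2 where z2: "z2 \<in> local_ball T" "p2 \<in> cell s z2" using p12(4) unfolding conf_def by blast
      obtain u1 where u1: "u1 \<in> unit_cube" "x = rv z1 + u1" using z1(2) p12(3) by (metis cellE)
      obtain u2 where u2: "u2 \<in> unit_cube" "x = rv z2 + u2" using z2(2) p12(5) by (metis cellE)
      have "z1 = z2" using cube_unique[OF u1(1) u2(1)] u1(2) u2(2) by simp
      then have "p1 \<in> conf s (local_ball T - {0})" using z1 z2 unfolding conf_def by blast
      then show "x \<in> locs (conf s (local_ball T - {0})) r2" using p12 unfolding locs_def by blast
    qed
    then have "\<Phi> \<in> cplx (conf s (local_ball T - {0})) b"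
      using P unfolding b cplx.simps mult_complex_def cech_complex_def by blast
    then show False using P by blast
  qed
  then show "\<Phi> \<in> cplx (conf s A) b - cplx (conf s (A - {0})) b" using in_A by blast
qed

theorem pbeta_add_stabilizes:
  assumes p: "b \<in> params T" "d \<in> params T"
  shows "\<exists>B. finite B \<and> (\<forall>A A'. finite A \<longrightarrow> finite A' \<longrightarrow> B \<subseteq> A \<longrightarrow> B \<subseteq> A' \<longrightarrow>
    pbeta q b d (conf s A) - pbeta q b d (conf (s(0 := {||})) A) = pbeta q b d (conf s A') - pbeta q b d (conf (s(0 := {||})) A'))"
  unfolding pbeta_def conf_delete
proof (rule pb_log_diff_stabilizes[where ?A0.0 = "local_ball T"])
  show "cplx (conf s A) b - cplx (conf s (A - {0})) b = cplx (conf s (local_ball T)) b - cplx (conf s (local_ball T - {0})) b"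
    "cplx (conf s A) d - cplx (conf s (A - {0})) d = cplx (conf s (local_ball T)) d - cplx (conf s (local_ball T - {0})) d"
    if "local_ball T \<subseteq> A" for A
    by (rule new_simplices_const[OF p(1) that], rule new_simplices_const[OF p(2) that])
qed (intro finite_local_ball finite_cplx finite_conf finite_Diff cplx_mono conf_mono Diff_subset Diff_mono subset_refl; assumption)+

text \<open>
  Linear combinations are treated at once, since all of them are needed for a limit in several
  dimensions.
\<close>

definition betti_functional :: "nat \<Rightarrow> ('j::finite \<Rightarrow> param) \<Rightarrow> ('j \<Rightarrow> param) \<Rightarrow> real^'j \<Rightarrow>
    (int, 'd::{finite,linorder}) vec set \<Rightarrow> ((int, 'd) vec \<Rightarrow> 'd mpoint fset) \<Rightarrow> real" where
  "betti_functional q b d v A s = (\<Sum>j\<in>UNIV. v $ j * pbeta q (b j) (d j) (conf s A))"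

lemma depends_betti_functional:
  fixes A :: "(int, 'd::{finite,linorder}) vec set"
  shows "depends_on A (betti_functional q b d v A)"
  unfolding depends_on_def betti_functional_def
proof (intro allI impI)
  fix s s' :: "(int, 'd) vec \<Rightarrow> 'd mpoint fset" assume "\<forall>z\<in>A. s z = s' z"
  then have "conf s A = conf s' A" by (intro conf_agree) blast
  then show "(\<Sum>j\<in>UNIV. v $ j * pbeta q (b j) (d j) (conf s A)) = (\<Sum>j\<in>UNIV. v $ j * pbeta q (b j) (d j) (conf s' A))" by simp
qed

lemma betti_functional_shift:
  assumes "finite A"
  shows "betti_functional q b d v ((+) z ` A) s = betti_functional q b d v A (\<lambda>y. s (z + y))"
  unfolding betti_functional_def conf_shift pbeta_translate[OF finite_conf[OF assms]] ..

lemma betti_functional_bound: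
  assumes p: "\<And>j. b j \<in> params T" "\<And>j. d j \<in> params T" and A: "finite A"
  shows "\<bar>betti_functional q b d v A s - betti_functional q b d v A (s(0 := {||}))\<bar>
    \<le> (\<Sum>j\<in>UNIV. \<bar>v $ j\<bar>) * (2 * 2 ^ ((q + 2) * point_count (local_ball T) s))"
proof -
  have "\<bar>betti_functional q b d v A s - betti_functional q b d v A (s(0 := {||}))\<bar>
    = \<bar>\<Sum>j\<in>UNIV. v $ j * (pbeta q (b j) (d j) (conf s A) - pbeta q (b j) (d j) (conf (s(0 := {||})) A))\<bar>"
    unfolding betti_functional_def by (simp add: sum_subtractf right_diff_distrib)
  also have "\<dots> \<le> (\<Sum>j\<in>UNIV. \<bar>v $ j * (pbeta q (b j) (d j) (conf s A) - pbeta q (b j) (d j) (conf (s(0 := {||})) A))\<bar>)"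
    by (rule sum_abs)
  also have "\<dots> \<le> (\<Sum>j\<in>UNIV. \<bar>v $ j\<bar> * (2 * 2 ^ ((q + 2) * point_count (local_ball T) s)))"
    unfolding abs_mult by (intro sum_mono mult_left_mono pbeta_add_bound p A) simp
  finally show ?thesis by (simp add: sum_distrib_right)
qed

lemma betti_functional_stabilizes:
  fixes b d :: "'j::finite \<Rightarrow> param"
  assumes p: "\<And>j. b j \<in> params T" "\<And>j. d j \<in> params T"
  shows "\<exists>B. finite B \<and> (\<forall>A A'. finite A \<longrightarrow> finite A' \<longrightarrow> B \<subseteq> A \<longrightarrow> B \<subseteq> A' \<longrightarrow>
    betti_functional q b d v A s - betti_functional q b d v A (s(0 := {||}))
    = betti_functional q b d v A' s - betti_functional q b d v A' (s(0 := {||})))"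
proof -
  have ex: "\<forall>j. \<exists>B. finite B \<and> (\<forall>A A'. finite A \<longrightarrow> finite A' \<longrightarrow> B \<subseteq> A \<longrightarrow> B \<subseteq> A' \<longrightarrow>
    pbeta q (b j) (d j) (conf s A) - pbeta q (b j) (d j) (conf (s(0 := {||})) A) = pbeta q (b j) (d j) (conf s A') - pbeta q (b j) (d j) (conf (s(0 := {||})) A'))"
    by (rule allI) (rule pbeta_add_stabilizes[OF p(1) p(2)])
  obtain B where B: "\<forall>j. finite (B j) \<and> (\<forall>A A'. finite A \<longrightarrow> finite A' \<longrightarrow> B j \<subseteq> A \<longrightarrow> B j \<subseteq> A' \<longrightarrow>
    pbeta q (b j) (d j) (conf s A) - pbeta q (b j) (d j) (conf (s(0 := {||})) A) = pbeta q (b j) (d j) (conf s A') - pbeta q (b j) (d j) (conf (s(0 := {||})) A'))"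
    using choice[OF ex] by (rule exE)
  show ?thesis
  proof (intro exI[of _ "\<Union>j. B j"] conjI allI impI)
    show "finite (\<Union>j. B j)" using conjunct1[OF spec[OF B]] by simp
    fix A A' assume A: "finite A" "finite A'" "(\<Union>j. B j) \<subseteq> A" "(\<Union>j. B j) \<subseteq> A'"
    have "pbeta q (b j) (d j) (conf s A) - pbeta q (b j) (d j) (conf (s(0 := {||})) A) = pbeta q (b j) (d j) (conf s A') - pbeta q (b j) (d j) (conf (s(0 := {||})) A')" for j
    proof -
      have "B j \<subseteq> A" "B j \<subseteq> A'" using A(3,4) by blast+
      then show ?thesis using conjunct2[OF spec[OF B, of j], rule_format, OF A(1,2)] by simp
    qed
    then show "betti_functional q b d v A s - betti_functional q b d v A (s(0 := {||}))
      = betti_functional q b d v A' s - betti_functional q b d v A' (s(0 := {||}))"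
      unfolding betti_functional_def by (simp flip: sum_subtractf right_diff_distrib)
  qed
qed

lemma pbeta_bound:
  fixes C :: "('d::{finite,linorder}) mpoint set"
  assumes C: "finite C"
  shows "\<bar>pbeta q b d C\<bar> \<le> 2 * 2 ^ ((q + 2) * card (fst ` C))"
proof -
  have e: "cplx ({} :: 'd mpoint set) b = ({} :: (real, 'd) vec set set set)" for b :: param
    by (cases b) (auto simp: locs_def mult_complex_def cech_complex_def)
  have z: "pbeta q b d ({} :: 'd mpoint set) = 0"
  proof -
    have c: "cycles q ({} :: (real, 'd) vec set set set) = {0}" "boundaries q ({} :: (real, 'd) vec set set set) = {0}"
      by (auto simp: cycles_def boundaries_def chain_space_def additive_mapD(2)[OF additive_boundary])
    show ?thesis unfolding pbeta_def e pb_log_def pb_sum_def c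
      by (simp add: plus_set_def additive_mapD(2)[OF additive_chain_map])
  qed
  have n: "card {\<Phi> \<in> cplx C b - cplx ({} :: 'd mpoint set) b. card \<Phi> = m} \<le> 2 ^ ((q + 2) * card (fst ` C))" if "m \<le> q + 2" for b m
  proof -
    have "card {\<Phi> \<in> cplx C b - cplx ({} :: 'd mpoint set) b. card \<Phi> = m} \<le> 2 ^ (m * card (fst ` C))"
    proof (rule card_simplices_le)
      fix \<Phi> assume "\<Phi> \<in> {\<Phi> \<in> cplx C b - cplx ({} :: 'd mpoint set) b. card \<Phi> = m}"
      then have P: "\<Phi> \<in> cplx C b" "card \<Phi> = m" by auto
      obtain r1 r2 k where b: "b = (r1, r2, k)" by (cases b)
      have "\<Union>\<Phi> \<subseteq> locs C r2" using P(1) mult_complexD(7)[of \<Phi> r1 k "locs C r2"] by (simp add: b)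
      also have "\<dots> \<subseteq> fst ` C" unfolding locs_def by blast
      finally show "\<Phi> \<subseteq> Pow (fst ` C) \<and> card \<Phi> = m" using P(2) by blast
    qed (use C in simp)
    also have "\<dots> \<le> 2 ^ ((q + 2) * card (fst ` C))" using that by (intro power_increasing mult_le_mono1) auto
    finally show ?thesis .
  qed
  have "\<bar>pbeta q b d C - pbeta q b d ({} :: 'd mpoint set)\<bar> \<le> card {\<Phi> \<in> cplx C b - cplx ({} :: 'd mpoint set) b. card \<Phi> = Suc q} + card {\<Phi> \<in> cplx C d - cplx ({} :: 'd mpoint set) d. card \<Phi> = Suc (Suc q)}"
    unfolding pbeta_def by (rule pb_log_diff_bound) (intro finite_cplx C cplx_mono empty_subsetI)+
  also have "\<dots> \<le> real (2 ^ ((q + 2) * card (fst ` C)) + 2 ^ ((q + 2) * card (fst ` C)))"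
    by (intro of_nat_mono add_mono n) auto
  finally show ?thesis unfolding z by simp
qed

lemma betti_functional_size:
  assumes A: "finite A"
  shows "\<bar>betti_functional q b d v A s\<bar> \<le> (\<Sum>j\<in>UNIV. \<bar>v $ j\<bar>) * (2 * 2 ^ ((q + 2) * point_count A s))"
proof -
  have "\<bar>betti_functional q b d v A s\<bar> \<le> (\<Sum>j\<in>UNIV. \<bar>v $ j * pbeta q (b j) (d j) (conf s A)\<bar>)"
    unfolding betti_functional_def by (rule sum_abs)
  also have "\<dots> \<le> (\<Sum>j\<in>UNIV. \<bar>v $ j\<bar> * (2 * 2 ^ ((q + 2) * point_count A s)))"
    unfolding abs_mult
  proof (intro sum_mono mult_left_mono)
    fix j
    have "\<bar>pbeta q (b j) (d j) (conf s A)\<bar> \<le> 2 * 2 ^ ((q + 2) * card (fst ` conf s A))"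
      by (rule pbeta_bound[OF finite_conf[OF A]])
    also have "\<dots> \<le> 2 * 2 ^ ((q + 2) * point_count A s)"
      using card_locs_conf[OF A, of s] by (intro mult_left_mono power_increasing mult_le_mono2) auto
    finally show "\<bar>pbeta q (b j) (d j) (conf s A)\<bar> \<le> 2 * 2 ^ ((q + 2) * point_count A s)" .
  qed simp
  finally show ?thesis by (simp add: sum_distrib_right)
qed

section \<open>Measurability by discretization of space\<close>

definition grid :: "nat \<Rightarrow> real^'d \<Rightarrow> real^'d" where
  "grid m x = (\<chi> i. of_int \<lfloor>2 ^ m * x $ i\<rfloor> / 2 ^ m)"

text \<open>
  A bound for the displacement of a point by the rounding of its coordinates. The type argument
  provides the dimension.
\<close>

definition mesh :: "nat \<Rightarrow> (real^'d::finite) itself \<Rightarrow> real" where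
  "mesh m _ = real CARD('d) / 2 ^ m"

lemma dist_grid: "dist (grid m x) x \<le> mesh m TYPE(real^'d)" for x :: "real^'d::finite"
proof -
  have "\<bar>(grid m x - x) $ i\<bar> \<le> 1 / 2 ^ m" for i
  proof -
    have "(grid m x - x) $ i = (of_int \<lfloor>2 ^ m * x $ i\<rfloor> - 2 ^ m * x $ i) / 2 ^ m"
      by (simp add: grid_def diff_divide_distrib)
    also have "\<bar>\<dots>\<bar> = \<bar>of_int \<lfloor>2 ^ m * x $ i\<rfloor> - 2 ^ m * x $ i\<bar> / 2 ^ m" by (simp add: abs_divide)
    also have "\<dots> \<le> 1 / 2 ^ m" by (rule divide_right_mono) (linarith, simp)
    finally show ?thesis .
  qed
  then have "(\<Sum>i\<in>UNIV. \<bar>(grid m x - x) $ i\<bar>) \<le> (\<Sum>i\<in>(UNIV::'d set). 1 / 2 ^ m)" by (intro sum_mono)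
  then show ?thesis using norm_le_l1_cart[of "grid m x - x"] by (simp add: dist_norm mesh_def)
qed

lemma mesh_tendsto: "(\<lambda>m. mesh m TYPE(real^'d::finite)) \<longlonglongrightarrow> 0"
proof -
  have "(\<lambda>m. real CARD('d) * (1/2) ^ m) \<longlonglongrightarrow> real CARD('d) * 0"
    by (intro tendsto_mult_left LIMSEQ_power_zero) simp
  then show ?thesis by (simp add: mesh_def power_divide)
qed

lemma grid_tendsto: "(\<lambda>m. grid m x) \<longlonglongrightarrow> x" for x :: "real^'d::finite"
proof (rule metric_tendsto_imp_tendsto[OF mesh_tendsto])
  show "eventually (\<lambda>m. dist (grid m x) x \<le> dist (mesh m TYPE(real^'d)) 0) sequentially"
    using dist_grid[of _ x] by (intro always_eventually allI) (simp add: mesh_def)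
qed

lemma eventually_grid_less:
  fixes x y :: "(real, 'd::{finite,linorder}) vec"
  assumes "lex_less x y"
  shows "eventually (\<lambda>m. lex_less (grid m x) (grid m y)) sequentially"
proof -
  obtain i where i: "x $ i < y $ i" "\<And>j. j < i \<Longrightarrow> x $ j = y $ j" using assms unfolding lex_less_def by blast
  have "(\<lambda>m. grid m y $ i - grid m x $ i) \<longlonglongrightarrow> y $ i - x $ i"
    by (intro tendsto_diff tendsto_vec_nth grid_tendsto)
  then have "eventually (\<lambda>m. 0 < grid m y $ i - grid m x $ i) sequentially"
    by (rule order_tendstoD) (use i in simp)
  then show ?thesis
  proof eventually_elim
    case (elim m)
    then show ?case unfolding lex_less_def using i(2) by (intro exI[of _ i]) (simp add: grid_def)
  qed
qed

lemma eventually_grid_lex: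
  fixes P :: "(real, 'd::{finite,linorder}) vec set"
  assumes "finite P"
  shows "eventually (\<lambda>m. \<forall>x\<in>P. \<forall>y\<in>P. lex_less (grid m x) (grid m y) \<longleftrightarrow> lex_less x y) sequentially"
proof -
  have "eventually (\<lambda>m. lex_less (grid m x) (grid m y) \<longleftrightarrow> lex_less x y) sequentially" for x y :: "(real, 'd) vec"
  proof (cases "x = y")
    case True then show ?thesis by (simp add: lex_less_irrefl)
  next
    case False
    show ?thesis
    proof (cases "lex_less x y")
      case True then show ?thesis using eventually_grid_less by simp
    next
      case F: False
      then have "lex_less y x" using lex_less_total[OF False] by blast
      from eventually_grid_less[OF this] show ?thesis
        by eventually_elim (use F lex_less_trans lex_less_irrefl in blast)
    qed
  qed
  then show ?thesis by (intro eventually_ball_finite assms ballI)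
qed

lemma inj_on_of_lex:
  assumes "\<forall>x\<in>P. \<forall>y\<in>P. lex_less (h x) (h y) \<longleftrightarrow> lex_less x y"
  shows "inj_on h P"
proof (rule inj_onI, rule ccontr)
  fix x y assume "x \<in> P" "y \<in> P" "h x = h y" "x \<noteq> y"
  then show False using lex_less_total[of x y] assms lex_less_irrefl by metis
qed

lemma cech_radius_perturb:
  fixes \<sigma> :: "'a::euclidean_space set"
  assumes \<sigma>: "finite \<sigma>" "\<sigma> \<noteq> {}" and h: "\<And>x. x \<in> \<sigma> \<Longrightarrow> dist (h x) x \<le> e"
  shows "\<bar>cech_radius (h ` \<sigma>) - cech_radius \<sigma>\<bar> \<le> e"
proof -
  have h\<sigma>: "finite (h ` \<sigma>)" "h ` \<sigma> \<noteq> {}" using \<sigma> by auto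
  obtain c where c: "\<forall>x\<in>\<sigma>. dist c x \<le> cech_radius \<sigma>" using cech_radius_exists[OF \<sigma>] by blast
  have "\<forall>x\<in>h ` \<sigma>. dist c x \<le> cech_radius \<sigma> + e"
  proof (rule ballI, erule imageE)
    fix y x assume "y = h x" "x \<in> \<sigma>"
    then show "dist c y \<le> cech_radius \<sigma> + e" using bspec[OF c, of x] h[of x] dist_triangle[of c "h x" x] by (simp add: dist_commute)
  qed
  then have 1: "cech_radius (h ` \<sigma>) \<le> cech_radius \<sigma> + e" unfolding cech_radius_le_iff[OF h\<sigma>] by blast
  obtain c' where c': "\<forall>x\<in>h ` \<sigma>. dist c' x \<le> cech_radius (h ` \<sigma>)" using cech_radius_exists[OF h\<sigma>] by blast
  have "\<forall>x\<in>\<sigma>. dist c' x \<le> cech_radius (h ` \<sigma>) + e"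
  proof
    fix x assume "x \<in> \<sigma>"
    then show "dist c' x \<le> cech_radius (h ` \<sigma>) + e" using bspec[OF c', of "h x"] h[of x] dist_triangle[of c' x "h x"] by simp
  qed
  then have 2: "cech_radius \<sigma> \<le> cech_radius (h ` \<sigma>) + e" unfolding cech_radius_le_iff[OF \<sigma>] by blast
  show ?thesis using 1 2 by linarith
qed

text \<open>
  Rounding moves the radius by at most the mesh width. The enlarged threshold keeps the sets that
  satisfy the condition, equality included; the sets that violate it do so by a positive amount,
  which eventually exceeds twice the mesh width.
\<close>

lemma eventually_grid_cech:
  fixes P :: "(real^'d::finite) set"
  assumes P: "finite P"
  shows "eventually (\<lambda>m. \<forall>\<sigma>\<in>Pow P - {{}}. cech_radius (grid m ` \<sigma>) \<le> r + mesh m TYPE(real^'d) \<longleftrightarrow> cech_radius \<sigma> \<le> r) sequentially"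
proof (intro eventually_ball_finite ballI)
  fix \<sigma> assume "\<sigma> \<in> Pow P - {{}}"
  then have \<sigma>: "finite \<sigma>" "\<sigma> \<noteq> {}" using P finite_subset by auto
  have c: "\<bar>cech_radius (grid m ` \<sigma>) - cech_radius \<sigma>\<bar> \<le> mesh m TYPE(real^'d)" for m
    by (rule cech_radius_perturb[OF \<sigma> dist_grid])
  show "eventually (\<lambda>m. cech_radius (grid m ` \<sigma>) \<le> r + mesh m TYPE(real^'d) \<longleftrightarrow> cech_radius \<sigma> \<le> r) sequentially"
  proof (cases "cech_radius \<sigma> \<le> r")
    case True
    have "cech_radius (grid m ` \<sigma>) \<le> r + mesh m TYPE(real^'d)" for m using True c[of m] by linarith
    then show ?thesis using True by simp
  next
    case False
    then have "0 < (cech_radius \<sigma> - r) / 2" by simp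
    from order_tendstoD(2)[OF mesh_tendsto[where 'd = 'd] this] show ?thesis
    proof eventually_elim
      case (elim m)
      then show ?case using False c[of m] by (simp add: abs_le_iff)
    qed
  qed
qed (use P in simp)

text \<open>
  For a fixed finite configuration a fine grid separates the points, preserves their order and
  respects the thresholds, so the Betti number can be computed from the occupied grid points.
\<close>

lemma grid_relabel:
  fixes C :: "('d::{finite,linorder}) mpoint set"
  assumes C: "finite C"
  shows "eventually (\<lambda>m. pb_log q (lex_smallest k')
      (mult_complex (r1 + mesh m TYPE((real, 'd) vec)) k (grid m ` locs C r2))
      (mult_complex (r1' + mesh m TYPE((real, 'd) vec)) k' (grid m ` locs C r2')) = pbeta q (r1, r2, k) (r1', r2', k') C) sequentially"
proof -
  have P: "finite (fst ` C)" using C by simp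
  show ?thesis
    using eventually_grid_lex[OF P] eventually_grid_cech[OF P, of r1] eventually_grid_cech[OF P, of r1']
  proof eventually_elim
    case (elim m)
    have sub: "locs C r \<subseteq> fst ` C" for r unfolding locs_def by blast
    show ?case unfolding pbeta_def cplx.simps snd_conv
      by (rule pb_log_mult_relabel[OF P inj_on_of_lex[OF elim(1)] sub sub]) (use elim in auto)
  qed
qed

lemma grid_vimage: "grid m -` {c} \<in> sets borel" for c :: "real^'d::finite"
proof -
  have "grid m -` {c} = {x. \<forall>i. of_int \<lfloor>2 ^ m * x $ i\<rfloor> / 2 ^ m = c $ i}"
    by (auto simp: grid_def vec_eq_iff)
  moreover have "{x \<in> space borel. \<forall>i. of_int \<lfloor>2 ^ m * x $ i\<rfloor> / 2 ^ m = c $ i} \<in> sets (borel :: (real^'d) measure)"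
    by measurable
  ultimately show ?thesis by simp
qed

lemma countable_range_grid: "countable (range (grid m :: real^'d::finite \<Rightarrow> real^'d))"
proof -
  have "range (grid m :: real^'d \<Rightarrow> real^'d) \<subseteq> (\<lambda>v. \<chi> i. of_int (v $ i) / 2 ^ m) ` (UNIV :: (int^'d) set)"
  proof (rule image_subsetI)
    fix x :: "real^'d"
    show "grid m x \<in> (\<lambda>v. \<chi> i. of_int (v $ i) / 2 ^ m) ` (UNIV :: (int^'d) set)"
      by (rule image_eqI[of _ _ "\<chi> i. \<lfloor>2 ^ m * x $ i\<rfloor>"]) (simp_all add: grid_def vec_eq_iff)
  qed
  moreover have "countable (UNIV :: (int^'d) set)"
  proof -
    have "inj (\<lambda>v::int^'d. vec_nth v)" by (simp add: inj_on_def vec_nth_inject)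
    moreover have "countable (range (\<lambda>v::int^'d. vec_nth v))" by (rule countableI_type)
    ultimately show ?thesis by (rule countable_image_inj_on[rotated])
  qed
  ultimately show ?thesis using countable_subset countable_image by blast
qed

definition grid_sets :: "nat \<Rightarrow> (real^'d::finite) set set" where
  "grid_sets m = {G. finite G \<and> G \<subseteq> range (grid m)}"

lemma countable_grid_sets: "countable (grid_sets m)"
  unfolding grid_sets_def by (rule countable_Collect_finite_subset[OF countable_range_grid])

lemma eq_iff_mem_iff: "U \<subseteq> R \<Longrightarrow> G \<subseteq> R \<Longrightarrow> U = G \<longleftrightarrow> (\<forall>c\<in>R. c \<in> U \<longleftrightarrow> c \<in> G)"
  by blast

text \<open>
  The set of occupied grid points takes countably many values, and each of them is a condition on
  the occupation of countably many boxes.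
\<close>

lemma measurable_occupied:
  fixes C :: "'w \<Rightarrow> ('d::finite) mpoint set"
  assumes fin: "\<And>\<omega>. \<omega> \<in> space \<Omega> \<Longrightarrow> finite (C \<omega>)"
    and meas: "\<And>E. E \<in> sets (borel \<Otimes>\<^sub>M borel) \<Longrightarrow> {\<omega> \<in> space \<Omega>. C \<omega> \<inter> E \<noteq> {}} \<in> sets \<Omega>"
    and R: "R \<in> sets borel"
  shows "(\<lambda>\<omega>. grid m ` fst ` {p \<in> C \<omega>. snd p \<in> R}) \<in> measurable \<Omega> (count_space (grid_sets m))"
proof (subst measurable_count_space_eq_countable[OF countable_grid_sets], intro conjI ballI)
  let ?U = "\<lambda>\<omega>. grid m ` fst ` {p \<in> C \<omega>. snd p \<in> R}"
  show "?U \<in> space \<Omega> \<rightarrow> grid_sets m" using fin by (auto simp: grid_sets_def)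
  fix G :: "(real^'d) set"
  assume G: "G \<in> grid_sets m"
  have c: "{\<omega> \<in> space \<Omega>. c \<in> ?U \<omega>} \<in> sets \<Omega>" for c
  proof -
    have "{\<omega> \<in> space \<Omega>. c \<in> ?U \<omega>} = {\<omega> \<in> space \<Omega>. C \<omega> \<inter> (grid m -` {c} \<times> R) \<noteq> {}}" by force
    moreover have "grid m -` {c} \<times> R \<in> sets (borel \<Otimes>\<^sub>M borel)" by (intro pair_measureI grid_vimage R)
    ultimately show ?thesis using meas by simp
  qed
  have "?U -` {G} \<inter> space \<Omega> = {\<omega> \<in> space \<Omega>. \<forall>c\<in>range (grid m). c \<in> ?U \<omega> \<longleftrightarrow> c \<in> G}"
  proof -
    have "?U \<omega> = G \<longleftrightarrow> (\<forall>c\<in>range (grid m). c \<in> ?U \<omega> \<longleftrightarrow> c \<in> G)" for \<omega>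
    proof (rule eq_iff_mem_iff)
      show "?U \<omega> \<subseteq> range (grid m)" by blast
      show "G \<subseteq> range (grid m)" using G by (simp add: grid_sets_def)
    qed
    then show ?thesis by auto
  qed
  also have "\<dots> \<in> sets \<Omega>"
  proof (rule sets.sets_Collect_countable_All'[OF _ countable_range_grid])
    show "{\<omega> \<in> space \<Omega>. c \<in> ?U \<omega> \<longleftrightarrow> c \<in> G} \<in> sets \<Omega>" for c
      by (cases "c \<in> G") (simp_all only: simp_thms c sets.sets_Collect_neg[OF c])
  qed
  finally show "?U -` {G} \<inter> space \<Omega> \<in> sets \<Omega>" .
qed

text \<open>
  The Betti number is the pointwise limit of functions of the occupied grid points. So events of
  the form \<open>C \<omega>\<close> hits \<open>E\<close> suffice for its measurability.
\<close>

theorem measurable_pbeta: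
  fixes C :: "'w \<Rightarrow> ('d::{finite,linorder}) mpoint set"
  assumes fin: "\<And>\<omega>. \<omega> \<in> space \<Omega> \<Longrightarrow> finite (C \<omega>)"
    and meas: "\<And>E. E \<in> sets (borel \<Otimes>\<^sub>M borel) \<Longrightarrow> {\<omega> \<in> space \<Omega>. C \<omega> \<inter> E \<noteq> {}} \<in> sets \<Omega>"
  shows "(\<lambda>\<omega>. pbeta q b d (C \<omega>)) \<in> borel_measurable \<Omega>"
proof -
  obtain r1 r2 k where b: "b = (r1, r2, k)" by (cases b)
  obtain r1' r2' k' where d: "d = (r1', r2', k')" by (cases d)
  let ?g = "\<lambda>m G G'. pb_log q (lex_smallest k') (mult_complex (r1 + mesh m TYPE((real, 'd) vec)) k G)
      (mult_complex (r1' + mesh m TYPE((real, 'd) vec)) k' G')"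
  have locs: "grid m ` locs (C \<omega>) r = grid m ` fst ` {p \<in> C \<omega>. snd p \<in> {..r}}" for m r \<omega>
    by (simp add: locs_def)
  have U: "(\<lambda>\<omega>. grid m ` locs (C \<omega>) r) \<in> measurable \<Omega> (count_space (grid_sets m))" for m r
    unfolding locs by (rule measurable_occupied[OF fin meas]) auto
  show ?thesis unfolding b d
  proof (rule borel_measurable_LIMSEQ_real)
    fix m
    show "(\<lambda>\<omega>. ?g m (grid m ` locs (C \<omega>) r2) (grid m ` locs (C \<omega>) r2')) \<in> borel_measurable \<Omega>"
    proof (rule measurable_compose_countable'[OF _ U countable_grid_sets, where f = "\<lambda>G \<omega>. ?g m G (grid m ` locs (C \<omega>) r2')"])
      fix G :: "(real, 'd) vec set"
      show "(\<lambda>\<omega>. ?g m G (grid m ` locs (C \<omega>) r2')) \<in> borel_measurable \<Omega>"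
        by (rule measurable_compose_countable'[OF _ U countable_grid_sets, where f = "\<lambda>G' \<omega>. ?g m G G'"]) simp
    qed
  next
    fix \<omega> assume "\<omega> \<in> space \<Omega>"
    show "(\<lambda>m. ?g m (grid m ` locs (C \<omega>) r2) (grid m ` locs (C \<omega>) r2')) \<longlonglongrightarrow> pbeta q (r1, r2, k) (r1', r2', k') (C \<omega>)"
      by (rule tendsto_eventually[OF grid_relabel[OF fin[OF \<open>\<omega> \<in> space \<Omega>\<close>]]])
  qed
qed

lemma measurable_card_locations:
  fixes C :: "'w \<Rightarrow> ('d::{finite,linorder}) mpoint set"
  assumes fin: "\<And>\<omega>. \<omega> \<in> space \<Omega> \<Longrightarrow> finite (C \<omega>)"
    and meas: "\<And>E. E \<in> sets (borel \<Otimes>\<^sub>M borel) \<Longrightarrow> {\<omega> \<in> space \<Omega>. C \<omega> \<inter> E \<noteq> {}} \<in> sets \<Omega>"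
  shows "(\<lambda>\<omega>. real (card (fst ` C \<omega>))) \<in> borel_measurable \<Omega>"
proof (rule borel_measurable_LIMSEQ_real)
  fix m
  have "(\<lambda>\<omega>. grid m ` fst ` {p \<in> C \<omega>. snd p \<in> UNIV}) \<in> measurable \<Omega> (count_space (grid_sets m))"
    by (rule measurable_occupied[OF fin meas]) auto
  then show "(\<lambda>\<omega>. real (card (grid m ` fst ` C \<omega>))) \<in> borel_measurable \<Omega>"
    using measurable_compose[of "\<lambda>\<omega>. grid m ` fst ` C \<omega>" \<Omega> "count_space (grid_sets m)" "\<lambda>G. real (card G)" borel] by simp
next
  fix \<omega> assume "\<omega> \<in> space \<Omega>"
  then have "finite (fst ` C \<omega>)" using fin by simp
  from eventually_grid_lex[OF this]
  have "eventually (\<lambda>m. real (card (grid m ` fst ` C \<omega>)) = real (card (fst ` C \<omega>))) sequentially"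
    by eventually_elim (use inj_on_of_lex card_image in metis)
  then show "(\<lambda>m. real (card (grid m ` fst ` C \<omega>))) \<longlonglongrightarrow> real (card (fst ` C \<omega>))" by (rule tendsto_eventually)
qed

text \<open>Generated by the void events, which are closed under intersection.\<close>

definition config_algebra :: "('d::finite) mpoint fset measure" where
  "config_algebra = sigma UNIV {{C. fset C \<inter> E = {}} | E. E \<in> sets (borel \<Otimes>\<^sub>M borel)}"

lemma space_config_algebra [simp]: "space config_algebra = UNIV"
  by (simp add: config_algebra_def space_measure_of_conv)

lemma sets_config_algebra: "sets config_algebra = sigma_sets UNIV {{C. fset C \<inter> E = {}} | E. E \<in> sets (borel \<Otimes>\<^sub>M borel)}"
  by (simp add: config_algebra_def sets_measure_of_conv)

lemma hit_config_algebra: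
  assumes "E \<in> sets (borel \<Otimes>\<^sub>M borel)" shows "{C. fset C \<inter> E \<noteq> {}} \<in> sets config_algebra"
proof -
  have "{C. fset C \<inter> E = {}} \<in> sets config_algebra" unfolding sets_config_algebra by (rule sigma_sets.Basic) (use assms in blast)
  then have "space config_algebra - {C. fset C \<inter> E = {}} \<in> sets config_algebra" by (rule sets.compl_sets)
  moreover have "space config_algebra - {C. fset C \<inter> E = {}} = {C. fset C \<inter> E \<noteq> {}}" by auto
  ultimately show ?thesis by simp
qed

lemma unit_cube_measurable: "unit_cube \<in> sets (borel :: (real^'d::finite) measure)"
proof -
  have "{x \<in> space borel. \<forall>k. 0 \<le> x $ k \<and> x $ k < 1} \<in> sets (borel :: (real^'d) measure)" by measurable
  then show ?thesis by (simp add: unit_cube_def)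
qed

lemma hit_conf:
  fixes A :: "(int, 'd::finite) vec set"
  assumes A: "finite A" and E: "E \<in> sets (borel \<Otimes>\<^sub>M borel)" and S: "sets S = sets config_algebra"
  shows "{s \<in> space (PiM UNIV (\<lambda>_. S)). conf s A \<inter> E \<noteq> {}} \<in> sets (PiM UNIV (\<lambda>_. S))"
proof -
  let ?E = "\<lambda>z. (\<lambda>p. (rv z + fst p, snd p)) -` E \<inter> space (borel \<Otimes>\<^sub>M borel) \<inter> (unit_cube \<times> UNIV)"
  have Em: "?E z \<in> sets (borel \<Otimes>\<^sub>M borel)" for z
  proof (rule sets.Int)
    have "(\<lambda>p. (rv z + fst p, snd p)) \<in> measurable (borel \<Otimes>\<^sub>M borel) (borel \<Otimes>\<^sub>M (borel :: real measure))"
      by measurable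
    from measurable_sets[OF this E]
    show "(\<lambda>p. (rv z + fst p, snd p)) -` E \<inter> space (borel \<Otimes>\<^sub>M borel) \<in> sets (borel \<Otimes>\<^sub>M borel)" .
    show "unit_cube \<times> UNIV \<in> sets ((borel :: (real^'d) measure) \<Otimes>\<^sub>M (borel :: real measure))" by (intro pair_measureI unit_cube_measurable) simp
  qed
  have "{s \<in> space (PiM UNIV (\<lambda>_. S)). conf s A \<inter> E \<noteq> {}} =
      (\<Union>z\<in>A. (\<lambda>s. s z) -` {C. fset C \<inter> ?E z \<noteq> {}} \<inter> space (PiM UNIV (\<lambda>_. S)))"
    unfolding conf_def cell_def by (fastforce simp: space_pair_measure)
  also have "\<dots> \<in> sets (PiM UNIV (\<lambda>_. S))"
    by (intro sets.finite_UN A measurable_sets[OF measurable_component_singleton]) (auto simp: S intro: hit_config_algebra Em)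
  finally show ?thesis .
qed

lemma measurable_betti_functional:
  assumes A: "finite A" and S: "sets S = sets config_algebra"
  shows "betti_functional q b d v A \<in> borel_measurable (PiM UNIV (\<lambda>_. S))"
  unfolding betti_functional_def
  by (intro borel_measurable_sum borel_measurable_times borel_measurable_const measurable_pbeta finite_conf A hit_conf S)

lemma measurable_point_count:
  fixes A :: "(int, 'd::{finite,linorder}) vec set"
  assumes S: "sets S = sets config_algebra"
  shows "(\<lambda>s. real (point_count A s)) \<in> borel_measurable (PiM UNIV (\<lambda>_. S))"
proof -
  have "(\<lambda>C. real (card (fst ` fset C))) \<in> borel_measurable (config_algebra :: 'd mpoint fset measure)"
    by (rule measurable_card_locations) (simp_all add: hit_config_algebra)
  then have "(\<lambda>C. real (card (fst ` fset C))) \<in> borel_measurable S" using measurable_cong_sets[OF S refl] by blast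
  then have "(\<lambda>s. real (card (fst ` fset (s z)))) \<in> borel_measurable (PiM UNIV (\<lambda>_. S))" for z
    by (rule measurable_compose[OF measurable_component_singleton[of z UNIV "\<lambda>_. S"], rotated]) simp
  then show ?thesis unfolding point_count_def of_nat_sum by (intro borel_measurable_sum)
qed

section \<open>Void probabilities of a marked Poisson process\<close>

locale marked_poisson =
  fixes W :: "'w measure" and rate :: real and T :: nat
    and X :: "nat \<Rightarrow> 'w \<Rightarrow> 'a::euclidean_space" and M :: "nat \<Rightarrow> 'w \<Rightarrow> real"
  assumes marked: "independently_marked_poisson W rate T X M"
begin

lemma poisson: "homogeneous_poisson W rate X"
  using marked unfolding independently_marked_poisson_def by blast

sublocale prob_space W using poisson unfolding homogeneous_poisson_def by (rule conjunct1)

abbreviation N :: "'a set \<Rightarrow> 'w \<Rightarrow> nat" where "N A \<omega> \<equiv> card {i. X i \<omega> \<in> A}"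

definition mark_law :: "real measure" where "mark_law = distr W borel (M 0)"

lemma X_measurable [measurable]: "X i \<in> borel_measurable W"
  using poisson unfolding homogeneous_poisson_def by (elim conjE) (rule spec)

lemma M_measurable [measurable]: "M i \<in> borel_measurable W"
  using marked unfolding independently_marked_poisson_def indep_vars_def by blast

lemma finite_points: "\<omega> \<in> space W \<Longrightarrow> bounded A \<Longrightarrow> finite {i. X i \<omega> \<in> A}"
  using poisson unfolding homogeneous_poisson_def by blast

lemma count_law:
  assumes "A \<in> sets borel" "bounded A"
  shows "prob {\<omega> \<in> space W. N A \<omega> = k} = (rate * measure lborel A) ^ k / fact k * exp (- (rate * measure lborel A))"
  using poisson assms unfolding homogeneous_poisson_def by blast

lemma indep_counts:
  fixes A :: "nat \<Rightarrow> 'a set"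
  assumes "\<And>l. l < m \<Longrightarrow> A l \<in> sets borel \<and> bounded (A l)" "disjoint_family_on A {..<m}"
  shows "indep_vars (\<lambda>_. count_space UNIV) (\<lambda>l \<omega>. N (A l) \<omega>) {..<m}"
  using poisson assms unfolding homogeneous_poisson_def by blast

lemma measurable_count:
  assumes "A \<in> sets borel" "bounded A"
  shows "N A \<in> measurable W (count_space UNIV)"
proof -
  have "indep_vars (\<lambda>_. count_space UNIV) (\<lambda>l \<omega>. N A \<omega>) {..<Suc 0}"
    by (rule indep_counts[where A = "\<lambda>_. A"]) (use assms in \<open>auto simp: disjoint_family_on_def\<close>)
  then show ?thesis unfolding indep_vars_def by simp
qed

text \<open>
  The probability generating function of a Poisson variable, also for arguments larger than one,
  where it provides exponential moments.
\<close>

lemma generating_function_count: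
  assumes A: "A \<in> sets borel" "bounded A" and c: "0 \<le> c"
  shows "integrable W (\<lambda>\<omega>. c ^ N A \<omega>)"
    and "expectation (\<lambda>\<omega>. c ^ N A \<omega>) = exp (rate * measure lborel A * (c - 1))"
proof -
  let ?a = "rate * measure lborel A"
  have Nm: "N A \<in> measurable W (count_space UNIV)" by (rule measurable_count[OF A])
  have m: "(\<lambda>\<omega>. c ^ N A \<omega>) \<in> borel_measurable W"
    by (rule measurable_compose[OF Nm, of "\<lambda>k. c ^ k"]) simp
  have ev: "{\<omega> \<in> space W. N A \<omega> = k} \<in> sets W" for k
    using measurable_sets[OF Nm, of "{k}"] by (simp add: vimage_def Int_def conj_commute)
  have "(\<integral>\<^sup>+\<omega>. ennreal (c ^ N A \<omega>) \<partial>W) =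
      (\<integral>\<^sup>+\<omega>. suminf (\<lambda>k. ennreal (c ^ k) * indicator {\<omega> \<in> space W. N A \<omega> = k} \<omega>) \<partial>W)"
  proof (rule nn_integral_cong)
    fix \<omega> assume \<omega>: "\<omega> \<in> space W"
    have "suminf (\<lambda>k. ennreal (c ^ k) * indicator {\<omega> \<in> space W. N A \<omega> = k} \<omega>) =
        (\<Sum>k\<in>{N A \<omega>}. ennreal (c ^ k) * indicator {\<omega> \<in> space W. N A \<omega> = k} \<omega>)"
      by (rule suminf_finite) (simp_all add: indicator_def)
    then show "ennreal (c ^ N A \<omega>) = suminf (\<lambda>k. ennreal (c ^ k) * indicator {\<omega> \<in> space W. N A \<omega> = k} \<omega>)"
      using \<omega> by simp
  qed
  also have "\<dots> = suminf (\<lambda>k. \<integral>\<^sup>+\<omega>. ennreal (c ^ k) * indicator {\<omega> \<in> space W. N A \<omega> = k} \<omega> \<partial>W)"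
    by (rule nn_integral_suminf) (use ev in measurable)
  also have "\<dots> = suminf (\<lambda>k. ennreal (c ^ k * prob {\<omega> \<in> space W. N A \<omega> = k}))"
    by (intro suminf_cong) (simp add: nn_integral_cmult_indicator ev emeasure_eq_measure ennreal_mult' c)
  also have "\<dots> = ennreal (exp (?a * (c - 1)))"
  proof (rule suminf_ennreal_eq)
    show "0 \<le> c ^ k * prob {\<omega> \<in> space W. N A \<omega> = k}" for k using c by simp
    have "(\<lambda>k. (c * ?a) ^ k /\<^sub>R fact k * exp (- ?a)) sums (exp (c * ?a) * exp (- ?a))"
      by (intro sums_mult2 exp_converges)
    moreover have "(\<lambda>k. (c * ?a) ^ k /\<^sub>R fact k * exp (- ?a)) = (\<lambda>k. c ^ k * prob {\<omega> \<in> space W. N A \<omega> = k})"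
      by (rule ext) (simp add: count_law[OF A] power_mult_distrib field_simps)
    ultimately show "(\<lambda>k. c ^ k * prob {\<omega> \<in> space W. N A \<omega> = k}) sums exp (?a * (c - 1))"
      by (simp add: exp_add[symmetric] algebra_simps)
  qed
  finally have "(\<integral>\<^sup>+\<omega>. ennreal (c ^ N A \<omega>) \<partial>W) = ennreal (exp (?a * (c - 1)))" .
  then have "integrable W (\<lambda>\<omega>. c ^ N A \<omega>) \<and> expectation (\<lambda>\<omega>. c ^ N A \<omega>) = exp (?a * (c - 1))"
    by (subst (asm) nn_integral_eq_integrable) (use m c in auto)
  then show "integrable W (\<lambda>\<omega>. c ^ N A \<omega>)"
    and "expectation (\<lambda>\<omega>. c ^ N A \<omega>) = exp (rate * measure lborel A * (c - 1))" by simp_all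
qed

text \<open>
  If \<open>g\<close> takes finitely many values, then the product over the points is a product of
  powers of the counts in its level sets, which are independent Poisson variables.
\<close>

lemma level_product:
  fixes g :: "'a \<Rightarrow> real" and m :: nat
  assumes D: "D \<in> sets borel" "bounded D" and g: "g \<in> borel_measurable borel" "\<And>x. 0 \<le> g x" "\<And>x. g x \<le> 1"
    and m: "0 < m"
  defines "gm \<equiv> \<lambda>x. of_int \<lfloor>real m * g x\<rfloor> / real m"
  shows "(\<lambda>\<omega>. \<Prod>i\<in>{i. X i \<omega> \<in> D}. gm (X i \<omega>)) \<in> borel_measurable W"
    and "expectation (\<lambda>\<omega>. \<Prod>i\<in>{i. X i \<omega> \<in> D}. gm (X i \<omega>)) = exp (- (rate * (\<integral>x. indicator D x * (1 - gm x) \<partial>lborel)))"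
proof -
  define A where "A l = {x \<in> D. \<lfloor>real m * g x\<rfloor> = int l}" for l :: nat
  have lev: "\<exists>l<Suc m. \<lfloor>real m * g x\<rfloor> = int l" for x
  proof (intro exI[of _ "nat \<lfloor>real m * g x\<rfloor>"] conjI)
    have "real m * g x \<le> real m * 1" using g(3)[of x] by (intro mult_left_mono) auto
    then have "\<lfloor>real m * g x\<rfloor> \<le> int m" by (simp add: floor_le_iff)
    then show "nat \<lfloor>real m * g x\<rfloor> < Suc m" by simp
    show "\<lfloor>real m * g x\<rfloor> = int (nat \<lfloor>real m * g x\<rfloor>)" using g(2)[of x] by simp
  qed
  have A: "A l \<in> sets borel" "bounded (A l)" for l
  proof -
    have "{x \<in> space borel. \<lfloor>real m * g x\<rfloor> = int l} \<in> sets borel" using g(1) by measurable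
    then have "D \<inter> {x \<in> space borel. \<lfloor>real m * g x\<rfloor> = int l} \<in> sets borel" using D(1) by (rule sets.Int[rotated])
    moreover have "D \<inter> {x \<in> space borel. \<lfloor>real m * g x\<rfloor> = int l} = A l" by (auto simp: A_def)
    ultimately show "A l \<in> sets borel" by simp
    show "bounded (A l)" by (rule bounded_subset[OF D(2)]) (auto simp: A_def)
  qed
  have disj: "disjoint_family_on A {..<Suc m}" by (auto simp: disjoint_family_on_def A_def)
  have eq: "(\<Prod>i\<in>{i. X i \<omega> \<in> D}. gm (X i \<omega>)) = (\<Prod>l<Suc m. (real l / real m) ^ N (A l) \<omega>)" if \<omega>: "\<omega> \<in> space W" for \<omega>
  proof -
    let ?I = "{i. X i \<omega> \<in> D}" and ?lev = "\<lambda>i. nat \<lfloor>real m * g (X i \<omega>)\<rfloor>"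
    have "(\<Prod>i\<in>?I. gm (X i \<omega>)) = (\<Prod>l<Suc m. \<Prod>i\<in>{i \<in> ?I. ?lev i = l}. gm (X i \<omega>))"
    proof (rule prod.group[symmetric])
      show "finite ?I" by (rule finite_points[OF \<omega> D(2)])
      show "?lev ` ?I \<subseteq> {..<Suc m}"
      proof (rule image_subsetI)
        fix i show "?lev i \<in> {..<Suc m}" using lev[of "X i \<omega>"] by auto
      qed
    qed simp
    also have "\<dots> = (\<Prod>l<Suc m. (real l / real m) ^ N (A l) \<omega>)"
    proof (rule prod.cong[OF refl])
      fix l
      have "{i \<in> ?I. ?lev i = l} = {i. X i \<omega> \<in> A l}" using g(2) by (auto simp: A_def)
      moreover have "(\<Prod>i\<in>{i. X i \<omega> \<in> A l}. gm (X i \<omega>)) = (\<Prod>i\<in>{i. X i \<omega> \<in> A l}. real l / real m)"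
        by (rule prod.cong[OF refl]) (simp add: A_def gm_def)
      ultimately show "(\<Prod>i\<in>{i \<in> ?I. ?lev i = l}. gm (X i \<omega>)) = (real l / real m) ^ N (A l) \<omega>" by simp
    qed
    finally show ?thesis .
  qed
  have ind: "indep_vars (\<lambda>_. borel) (\<lambda>l \<omega>. (real l / real m) ^ N (A l) \<omega>) {..<Suc m}"
    by (rule indep_vars_compose2[OF indep_counts[of "Suc m" A], where Y = "\<lambda>l k. (real l / real m) ^ k"]) (use A disj in auto)
  have meas: "(\<lambda>\<omega>. \<Prod>l<Suc m. (real l / real m) ^ N (A l) \<omega>) \<in> borel_measurable W"
    by (rule borel_measurable_prod) (use ind in \<open>auto simp: indep_vars_def\<close>)
  show "(\<lambda>\<omega>. \<Prod>i\<in>{i. X i \<omega> \<in> D}. gm (X i \<omega>)) \<in> borel_measurable W"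
    by (rule measurable_cong[THEN iffD2, OF eq meas])
  have "expectation (\<lambda>\<omega>. \<Prod>i\<in>{i. X i \<omega> \<in> D}. gm (X i \<omega>)) = expectation (\<lambda>\<omega>. \<Prod>l<Suc m. (real l / real m) ^ N (A l) \<omega>)"
    by (rule Bochner_Integration.integral_cong[OF refl eq])
  also have "\<dots> = (\<Prod>l<Suc m. expectation (\<lambda>\<omega>. (real l / real m) ^ N (A l) \<omega>))"
    by (rule indep_vars_lebesgue_integral[OF _ ind]) (simp_all add: generating_function_count(1)[OF A])
  also have "\<dots> = (\<Prod>l<Suc m. exp (rate * measure lborel (A l) * (real l / real m - 1)))"
    by (intro prod.cong[OF refl] generating_function_count(2)[OF A]) simp
  also have "\<dots> = exp (\<Sum>l<Suc m. rate * measure lborel (A l) * (real l / real m - 1))"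
    by (rule exp_sum[symmetric]) simp
  also have "(\<Sum>l<Suc m. rate * measure lborel (A l) * (real l / real m - 1)) = - (rate * (\<Sum>l<Suc m. (1 - real l / real m) * measure lborel (A l)))"
    unfolding sum_distrib_left sum_negf[symmetric] by (rule sum.cong[OF refl]) (simp add: algebra_simps)
  also have "(\<Sum>l<Suc m. (1 - real l / real m) * measure lborel (A l)) = (\<integral>x. indicator D x * (1 - gm x) \<partial>lborel)"
  proof -
    have int: "integrable lborel (\<lambda>x. (1 - real l / real m) * indicator (A l) x)" for l
      using A[of l] emeasure_bounded_finite[OF A(2)[of l]] by (intro integrable_mult_right integrable_real_indicator) auto
    have "(\<integral>x. indicator D x * (1 - gm x) \<partial>lborel) = (\<integral>x. (\<Sum>l<Suc m. (1 - real l / real m) * indicator (A l) x) \<partial>lborel)"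
    proof (rule Bochner_Integration.integral_cong[OF refl])
      fix x
      obtain l where l: "l < Suc m" "\<lfloor>real m * g x\<rfloor> = int l" using lev[of x] by blast
      have "(\<Sum>l<Suc m. (1 - real l / real m) * indicator (A l) x) = (\<Sum>l'\<in>{l}. (1 - real l' / real m) * indicator (A l') x)"
        by (rule sum.mono_neutral_right) (use l in \<open>auto simp: A_def\<close>)
      then show "indicator D x * (1 - gm x) = (\<Sum>l<Suc m. (1 - real l / real m) * indicator (A l) x)"
        using l by (simp add: A_def gm_def indicator_def)
    qed
    also have "\<dots> = (\<Sum>l<Suc m. \<integral>x. (1 - real l / real m) * indicator (A l) x \<partial>lborel)"
      by (rule Bochner_Integration.integral_sum[OF int])
    also have "\<dots> = (\<Sum>l<Suc m. (1 - real l / real m) * measure lborel (A l))"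
      by (intro sum.cong[OF refl]) simp
    finally show ?thesis by simp
  qed
  finally show "expectation (\<lambda>\<omega>. \<Prod>i\<in>{i. X i \<omega> \<in> D}. gm (X i \<omega>)) = exp (- (rate * (\<integral>x. indicator D x * (1 - gm x) \<partial>lborel)))" .
qed

text \<open>
  Rounding \<open>g\<close> down to multiples of \<open>1 / m\<close> reduces the claim to the
  case of finitely many values; both sides pass to the limit by dominated convergence.
\<close>

theorem generating_functional:
  fixes g :: "'a \<Rightarrow> real"
  assumes D: "D \<in> sets borel" "bounded D" and g: "g \<in> borel_measurable borel" "\<And>x. 0 \<le> g x" "\<And>x. g x \<le> 1"
  shows "(\<lambda>\<omega>. \<Prod>i\<in>{i. X i \<omega> \<in> D}. g (X i \<omega>)) \<in> borel_measurable W"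
    and "expectation (\<lambda>\<omega>. \<Prod>i\<in>{i. X i \<omega> \<in> D}. g (X i \<omega>)) = exp (- (rate * (\<integral>x. indicator D x * (1 - g x) \<partial>lborel)))"
proof -
  \<comment> \<open>Multiples of \<open>1 / (m + 1)\<close>, which avoids division by zero.\<close>
  define gm where "gm m x = of_int \<lfloor>real (Suc m) * g x\<rfloor> / real (Suc m)" for m x
  have gm: "0 \<le> gm m x" "gm m x \<le> g x" "g x - gm m x \<le> 1 / real (Suc m)" for m x
  proof -
    have f: "of_int \<lfloor>real (Suc m) * g x\<rfloor> \<le> real (Suc m) * g x" "real (Suc m) * g x - of_int \<lfloor>real (Suc m) * g x\<rfloor> \<le> 1"
      by linarith+
    show "0 \<le> gm m x" unfolding gm_def using g(2)[of x] by simp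
    show "gm m x \<le> g x" unfolding gm_def using f(1) by (simp add: divide_le_eq mult.commute)
    have "g x - gm m x = (real (Suc m) * g x - of_int \<lfloor>real (Suc m) * g x\<rfloor>) / real (Suc m)"
      unfolding gm_def by (simp add: diff_divide_distrib)
    also have "\<dots> \<le> 1 / real (Suc m)" by (rule divide_right_mono[OF f(2)]) simp
    finally show "g x - gm m x \<le> 1 / real (Suc m)" .
  qed
  have lim: "(\<lambda>m. gm m x) \<longlonglongrightarrow> g x" for x
  proof (rule metric_tendsto_imp_tendsto[OF LIMSEQ_inverse_real_of_nat])
    show "eventually (\<lambda>m. dist (gm m x) (g x) \<le> dist (inverse (real (Suc m))) 0) sequentially"
      using gm(2)[of _ x] gm(3)[of x] by (intro always_eventually allI) (simp add: dist_real_def inverse_eq_divide)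
  qed
  have gm_meas: "gm m \<in> borel_measurable borel" for m unfolding gm_def using g(1) by measurable
  note lp = level_product[OF D g, of "Suc m" for m, folded gm_def, simplified]
  have limW: "(\<lambda>m. \<Prod>i\<in>{i. X i \<omega> \<in> D}. gm m (X i \<omega>)) \<longlonglongrightarrow> (\<Prod>i\<in>{i. X i \<omega> \<in> D}. g (X i \<omega>))" for \<omega>
    by (intro tendsto_prod lim)
  show meas: "(\<lambda>\<omega>. \<Prod>i\<in>{i. X i \<omega> \<in> D}. g (X i \<omega>)) \<in> borel_measurable W"
    by (rule borel_measurable_LIMSEQ_real[OF limW lp(1)])
  have "(\<lambda>m. expectation (\<lambda>\<omega>. \<Prod>i\<in>{i. X i \<omega> \<in> D}. gm m (X i \<omega>))) \<longlonglongrightarrow> expectation (\<lambda>\<omega>. \<Prod>i\<in>{i. X i \<omega> \<in> D}. g (X i \<omega>))"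
  proof (rule integral_dominated_convergence[where w = "\<lambda>_. 1"])
    show "AE \<omega> in W. norm (\<Prod>i\<in>{i. X i \<omega> \<in> D}. gm m (X i \<omega>)) \<le> 1" for m
    proof (rule AE_I2)
      fix \<omega>
      have "\<bar>\<Prod>i\<in>{i. X i \<omega> \<in> D}. gm m (X i \<omega>)\<bar> = (\<Prod>i\<in>{i. X i \<omega> \<in> D}. gm m (X i \<omega>))"
        using gm(1) by (intro abs_of_nonneg prod_nonneg) auto
      also have "\<dots> \<le> 1" using gm(1) gm(2) g(3) by (intro prod_le_1) (meson order_trans)
      finally show "norm (\<Prod>i\<in>{i. X i \<omega> \<in> D}. gm m (X i \<omega>)) \<le> 1" by simp
    qed
  qed (use meas lp(1) limW in auto)
  moreover have "(\<lambda>m. expectation (\<lambda>\<omega>. \<Prod>i\<in>{i. X i \<omega> \<in> D}. gm m (X i \<omega>))) \<longlonglongrightarrow> exp (- (rate * (\<integral>x. indicator D x * (1 - g x) \<partial>lborel)))"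
    unfolding lp(2)
  proof (intro tendsto_exp tendsto_minus tendsto_mult_left)
    have intD: "integrable lborel (\<lambda>x. indicator D x :: real)"
      using D emeasure_bounded_finite[OF D(2)] by (intro integrable_real_indicator) auto
    show "(\<lambda>m. \<integral>x. indicator D x * (1 - gm m x) \<partial>lborel) \<longlonglongrightarrow> (\<integral>x. indicator D x * (1 - g x) \<partial>lborel)"
    proof (rule integral_dominated_convergence[where w = "\<lambda>x. indicator D x"])
      show "AE x in lborel. norm (indicator D x * (1 - gm m x)) \<le> indicator D x" for m
      proof (rule AE_I2)
        fix x show "norm (indicator D x * (1 - gm m x)) \<le> indicator D x"
          using gm(1,2)[of m x] g(3)[of x] by (auto simp: indicator_def)
      qed
      show "AE x in lborel. (\<lambda>m. indicator D x * (1 - gm m x)) \<longlonglongrightarrow> indicator D x * (1 - g x)"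
        by (intro AE_I2 tendsto_mult_left tendsto_diff tendsto_const lim)
    qed (use intD D(1) g(1) gm_meas in \<open>auto intro!: borel_measurable_times borel_measurable_diff\<close>)
  qed
  ultimately show "expectation (\<lambda>\<omega>. \<Prod>i\<in>{i. X i \<omega> \<in> D}. g (X i \<omega>)) = exp (- (rate * (\<integral>x. indicator D x * (1 - g x) \<partial>lborel)))"
    by (rule LIMSEQ_unique)
qed

text \<open>
  The conditional probability that a point at \<open>x\<close> has a mark that places it in
  \<open>E\<close>.
\<close>

definition sections :: "('a \<times> real) set \<Rightarrow> 'a \<Rightarrow> real" where
  "sections E x = measure mark_law (Pair x -` E)"

definition intensity :: "('a \<times> real) set \<Rightarrow> real" where
  "intensity E = (\<integral>x. sections E x \<partial>lborel)"

lemma prob_space_mark_law: "prob_space mark_law" unfolding mark_law_def by (rule prob_space_distr) simp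

lemma sets_mark_law [simp, measurable_cong]: "sets mark_law = sets borel" by (simp add: mark_law_def)

lemma sets_borel_mark_law: "sets (borel \<Otimes>\<^sub>M mark_law) = sets (borel \<Otimes>\<^sub>M (borel :: real measure))"
  by (rule sets_pair_measure_cong) simp_all

lemma measurable_sections:
  assumes "E \<in> sets (borel \<Otimes>\<^sub>M borel)" shows "sections E \<in> borel_measurable borel"
proof -
  interpret mk: prob_space mark_law by (rule prob_space_mark_law)
  have "(\<lambda>x. emeasure mark_law (Pair x -` E)) \<in> borel_measurable borel"
    by (rule mk.measurable_emeasure_Pair) (use assms sets_borel_mark_law in simp)
  then show ?thesis unfolding sections_def measure_def by simp
qed

lemma mark_section:
  assumes "E \<in> sets (borel \<Otimes>\<^sub>M borel)" shows "Pair x -` E \<in> sets mark_law"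
  using sets_Pair1[OF assms] by simp

lemma sections_bounds: "0 \<le> sections E x" "sections E x \<le> 1"
proof -
  interpret mk: prob_space mark_law by (rule prob_space_mark_law)
  show "0 \<le> sections E x" "sections E x \<le> 1" by (simp_all add: sections_def)
qed

lemma sections_outside: "E \<subseteq> D \<times> UNIV \<Longrightarrow> x \<notin> D \<Longrightarrow> sections E x = 0"
proof -
  assume "E \<subseteq> D \<times> UNIV" "x \<notin> D"
  then have "Pair x -` E = {}" by blast
  then show ?thesis by (simp add: sections_def)
qed

lemma integrable_sections:
  assumes "E \<in> sets (borel \<Otimes>\<^sub>M borel)" "E \<subseteq> D \<times> UNIV" "D \<in> sets borel" "bounded D"
  shows "integrable lborel (sections E)"
proof (rule Bochner_Integration.integrable_bound[of _ "indicator D"])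
  show "integrable lborel (indicator D :: 'a \<Rightarrow> real)"
    using assms emeasure_bounded_finite[OF assms(4)] by (intro integrable_real_indicator) auto
  show "sections E \<in> borel_measurable lborel" using measurable_sections[OF assms(1)] by simp
  show "AE x in lborel. norm (sections E x) \<le> norm (indicator D x :: real)"
    using sections_outside[OF assms(2)] sections_bounds[of E] by (intro AE_I2) (auto simp: indicator_def)
qed

lemma intensity_Union:
  assumes J: "finite J" "disjoint_family_on E J"
    and E: "\<And>z. z \<in> J \<Longrightarrow> E z \<in> sets (borel \<Otimes>\<^sub>M borel) \<and> E z \<subseteq> D \<times> UNIV" and D: "D \<in> sets borel" "bounded D"
  shows "intensity (\<Union>z\<in>J. E z) = (\<Sum>z\<in>J. intensity (E z))"
proof -
  interpret mk: prob_space mark_law by (rule prob_space_mark_law)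
  have "sections (\<Union>z\<in>J. E z) x = (\<Sum>z\<in>J. sections (E z) x)" for x
  proof -
    have "Pair x -` (\<Union>z\<in>J. E z) = (\<Union>z\<in>J. Pair x -` E z)" by blast
    moreover have "measure mark_law (\<Union>z\<in>J. Pair x -` E z) = (\<Sum>z\<in>J. measure mark_law (Pair x -` E z))"
    proof (rule mk.finite_measure_finite_Union[OF J(1)])
      show "(\<lambda>z. Pair x -` E z) ` J \<subseteq> sets mark_law" using E mark_section by blast
      show "disjoint_family_on (\<lambda>z. Pair x -` E z) J" using J(2) unfolding disjoint_family_on_def by blast
    qed
    ultimately show ?thesis by (simp add: sections_def)
  qed
  then have "intensity (\<Union>z\<in>J. E z) = (\<integral>x. (\<Sum>z\<in>J. sections (E z) x) \<partial>lborel)" by (simp add: intensity_def)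
  also have "\<dots> = (\<Sum>z\<in>J. intensity (E z))"
    unfolding intensity_def by (rule Bochner_Integration.integral_sum) (use E D integrable_sections in blast)
  finally show ?thesis .
qed

lemma intensity_translate:
  assumes "E \<in> sets (borel \<Otimes>\<^sub>M borel)"
  shows "intensity {p. (fst p - v, snd p) \<in> E} = intensity E"
proof -
  have "intensity E = (\<integral>x. sections E x \<partial>(distr lborel borel ((+) (- v))))" by (simp add: intensity_def lborel_distr_plus)
  also have "\<dots> = (\<integral>x. sections E (- v + x) \<partial>lborel)"
    by (rule integral_distr) (use measurable_sections[OF assms] in simp_all)
  also have "\<dots> = intensity {p. (fst p - v, snd p) \<in> E}"
    unfolding intensity_def sections_def by (simp add: vimage_def)
  finally show ?thesis by simp
qed

definition loc_law :: "(nat \<Rightarrow> 'a) measure" where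
  "loc_law = distr W (PiM UNIV (\<lambda>_. borel)) (\<lambda>\<omega> i. X i \<omega>)"

lemma X_seq_measurable: "(\<lambda>\<omega> i. X i \<omega>) \<in> measurable W (PiM UNIV (\<lambda>_. borel))"
  by (rule measurable_PiM_single') auto

lemma M_seq_measurable: "(\<lambda>\<omega> i. M i \<omega>) \<in> measurable W (PiM UNIV (\<lambda>_. borel))"
  by (rule measurable_PiM_single') auto

lemma marks_law: "distr W (PiM UNIV (\<lambda>_. borel)) (\<lambda>\<omega> i. M i \<omega>) = PiM UNIV (\<lambda>_. mark_law)"
proof -
  have ind: "indep_vars (\<lambda>_. borel) M UNIV" and "\<forall>i. distr W borel (M i) = mark_law"
    using marked unfolding independently_marked_poisson_def mark_law_def by auto
  then have eq: "distr W borel (M i) = mark_law" for i by blast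
  have "distr W (PiM UNIV (\<lambda>_. borel)) (\<lambda>\<omega>. \<lambda>i\<in>UNIV. M i \<omega>) = PiM UNIV (\<lambda>i. distr W borel (M i))"
    using ind by (subst (asm) indep_vars_iff_distr_eq_PiM') auto
  then show ?thesis by (simp add: eq restrict_UNIV)
qed

text \<open>
  Independence of the generated sigma-algebras says that the joint law is a product measure, so
  that Fubini's theorem applies.
\<close>

lemma locations_marks_law:
  "loc_law \<Otimes>\<^sub>M PiM UNIV (\<lambda>_. mark_law) =
    distr W (PiM UNIV (\<lambda>_. borel) \<Otimes>\<^sub>M PiM UNIV (\<lambda>_. borel)) (\<lambda>\<omega>. (\<lambda>i. X i \<omega>, \<lambda>i. M i \<omega>))"
  unfolding marks_law[symmetric] loc_law_def
proof (rule pair_measure_eqI)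
  let ?PX = "PiM UNIV (\<lambda>_. borel) :: (nat \<Rightarrow> 'a) measure" and ?PM = "PiM UNIV (\<lambda>_. borel) :: (nat \<Rightarrow> real) measure"
  have pX: "prob_space (distr W ?PX (\<lambda>\<omega> i. X i \<omega>))" by (rule prob_space_distr[OF X_seq_measurable])
  have pM: "prob_space (distr W ?PM (\<lambda>\<omega> i. M i \<omega>))" by (rule prob_space_distr[OF M_seq_measurable])
  show "sigma_finite_measure (distr W ?PX (\<lambda>\<omega> i. X i \<omega>))" by (rule prob_space_imp_sigma_finite[OF pX])
  show "sigma_finite_measure (distr W ?PM (\<lambda>\<omega> i. M i \<omega>))" by (rule prob_space_imp_sigma_finite[OF pM])
  show "sets (distr W ?PX (\<lambda>\<omega> i. X i \<omega>) \<Otimes>\<^sub>M distr W ?PM (\<lambda>\<omega> i. M i \<omega>)) =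
      sets (distr W (?PX \<Otimes>\<^sub>M ?PM) (\<lambda>\<omega>. (\<lambda>i. X i \<omega>, \<lambda>i. M i \<omega>)))"
    unfolding sets_distr by (rule sets_pair_measure_cong) simp_all
  fix A B assume "A \<in> sets (distr W ?PX (\<lambda>\<omega> i. X i \<omega>))" "B \<in> sets (distr W ?PM (\<lambda>\<omega> i. M i \<omega>))"
  then have AB: "A \<in> sets ?PX" "B \<in> sets ?PM" by simp_all
  have ind: "indep_set {(\<lambda>\<omega> i. X i \<omega>) -` A \<inter> space W | A. A \<in> sets ?PX} {(\<lambda>\<omega> i. M i \<omega>) -` A \<inter> space W | A. A \<in> sets ?PM}"
    using marked unfolding independently_marked_poisson_def by (elim conjE)
  have p: "prob (((\<lambda>\<omega> i. X i \<omega>) -` A \<inter> space W) \<inter> ((\<lambda>\<omega> i. M i \<omega>) -` B \<inter> space W)) =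
      prob ((\<lambda>\<omega> i. X i \<omega>) -` A \<inter> space W) * prob ((\<lambda>\<omega> i. M i \<omega>) -` B \<inter> space W)"
    by (rule indep_setD[OF ind]) (use AB in auto)
  have pm: "(\<lambda>\<omega>. (\<lambda>i. X i \<omega>, \<lambda>i. M i \<omega>)) \<in> measurable W (?PX \<Otimes>\<^sub>M ?PM)"
    by (rule measurable_Pair[OF X_seq_measurable M_seq_measurable])
  have "(\<lambda>\<omega>. (\<lambda>i. X i \<omega>, \<lambda>i. M i \<omega>)) -` (A \<times> B) \<inter> space W =
      ((\<lambda>\<omega> i. X i \<omega>) -` A \<inter> space W) \<inter> ((\<lambda>\<omega> i. M i \<omega>) -` B \<inter> space W)" by blast
  then show "emeasure (distr W ?PX (\<lambda>\<omega> i. X i \<omega>)) A * emeasure (distr W ?PM (\<lambda>\<omega> i. M i \<omega>)) B =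
      emeasure (distr W (?PX \<Otimes>\<^sub>M ?PM) (\<lambda>\<omega>. (\<lambda>i. X i \<omega>, \<lambda>i. M i \<omega>))) (A \<times> B)"
    using AB p by (simp add: emeasure_distr[OF X_seq_measurable] emeasure_distr[OF M_seq_measurable] emeasure_distr[OF pm]
        emeasure_eq_measure ennreal_mult)
qed

text \<open>
  Given the locations, the marks are independent, so the conditional probability that no point
  lies in \<open>E\<close> is the product of the factors \<open>1 - sections E x\<close> over the
  locations \<open>x\<close>. Its expectation is a value of the generating functional.
\<close>

theorem void_probability:
  assumes E: "E \<in> sets (borel \<Otimes>\<^sub>M borel)" "E \<subseteq> D \<times> UNIV" and D: "D \<in> sets borel" "bounded D"
  shows "prob {\<omega> \<in> space W. \<forall>i. (X i \<omega>, M i \<omega>) \<notin> E} = exp (- (rate * intensity E))"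
proof -
  let ?PX = "PiM UNIV (\<lambda>_. borel) :: (nat \<Rightarrow> 'a) measure" and ?PM = "PiM UNIV (\<lambda>_. borel) :: (nat \<Rightarrow> real) measure"
  let ?Q = "PiM UNIV (\<lambda>_. mark_law) :: (nat \<Rightarrow> real) measure"
  interpret mk: prob_space mark_law by (rule prob_space_mark_law)
  interpret pp: product_prob_space "\<lambda>_::nat. mark_law" UNIV by unfold_locales
  have sQ: "sets ?Q = sets ?PM" by (rule sets_PiM_cong) simp_all
  have spQ: "space ?Q = UNIV" by (simp add: space_PiM mark_law_def)
  \<comment> \<open>The void event as a set of pairs of sequences.\<close>
  define V where "V = {p \<in> space (?PX \<Otimes>\<^sub>M ?PM). \<forall>i::nat. (fst p i, snd p i) \<notin> E}"
  have Vi: "{p \<in> space (?PX \<Otimes>\<^sub>M ?PM). (fst p i, snd p i) \<notin> E} \<in> sets (?PX \<Otimes>\<^sub>M ?PM)" for i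
  proof -
    have "(\<lambda>p. (fst p i, snd p i)) \<in> measurable (?PX \<Otimes>\<^sub>M ?PM) (borel \<Otimes>\<^sub>M borel)" by measurable
    from measurable_sets[OF this sets.compl_sets[OF E(1)]] show ?thesis
      by (simp add: vimage_def Int_def conj_commute space_pair_measure)
  qed
  have V: "V \<in> sets (?PX \<Otimes>\<^sub>M ?PM)" unfolding V_def by (rule sets.sets_Collect_countable_All[OF Vi])
  have sV: "V \<in> sets (loc_law \<Otimes>\<^sub>M ?Q)"
    using V sets_pair_measure_cong[of loc_law ?PX ?Q ?PM] sQ by (simp add: loc_law_def)
  have pm: "(\<lambda>\<omega>. (\<lambda>i. X i \<omega>, \<lambda>i. M i \<omega>)) \<in> measurable W (?PX \<Otimes>\<^sub>M ?PM)"
    by (rule measurable_Pair[OF X_seq_measurable M_seq_measurable])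
  have "emeasure W {\<omega> \<in> space W. \<forall>i. (X i \<omega>, M i \<omega>) \<notin> E} = emeasure (loc_law \<Otimes>\<^sub>M ?Q) V"
    unfolding locations_marks_law emeasure_distr[OF pm V]
    by (rule arg_cong[of _ _ "emeasure W"]) (auto simp: V_def space_pair_measure space_PiM)
  also have "\<dots> = (\<integral>\<^sup>+x. emeasure ?Q (Pair x -` V) \<partial>loc_law)"
    by (rule pp.emeasure_pair_measure_alt[OF sV])
  also have "\<dots> = (\<integral>\<^sup>+\<omega>. emeasure ?Q (Pair (\<lambda>i. X i \<omega>) -` V) \<partial>W)"
    unfolding loc_law_def
  proof (rule nn_integral_distr[OF X_seq_measurable])
    have "V \<in> sets (?PX \<Otimes>\<^sub>M ?Q)" using V sets_pair_measure_cong[of ?PX ?PX ?Q ?PM] sQ by simp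
    then show "(\<lambda>x. emeasure ?Q (Pair x -` V)) \<in> borel_measurable (distr W ?PX (\<lambda>\<omega> i. X i \<omega>))"
      using pp.measurable_emeasure_Pair by simp
  qed
  also have "\<dots> = (\<integral>\<^sup>+\<omega>. ennreal (\<Prod>i\<in>{i. X i \<omega> \<in> D}. 1 - sections E (X i \<omega>)) \<partial>W)"
  proof (rule nn_integral_cong)
    fix \<omega> assume \<omega>: "\<omega> \<in> space W"
    let ?J = "{i. X i \<omega> \<in> D}"
    have c: "space mark_law - Pair x -` E \<in> sets mark_law" for x by (rule sets.compl_sets[OF mark_section[OF E(1)]])
    have "Pair (\<lambda>i. X i \<omega>) -` V = {m \<in> space ?Q. \<forall>i\<in>?J. m i \<in> space mark_law - Pair (X i \<omega>) -` E}"
      using E(2) by (auto simp: V_def space_pair_measure space_PiM mark_law_def)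
    then have "emeasure ?Q (Pair (\<lambda>i. X i \<omega>) -` V) = (\<Prod>i\<in>?J. emeasure mark_law (space mark_law - Pair (X i \<omega>) -` E))"
      by (simp only: pp.emeasure_PiM_Collect[OF subset_UNIV finite_points[OF \<omega> D(2)] c])
    also have "\<dots> = (\<Prod>i\<in>?J. ennreal (1 - sections E (X i \<omega>)))"
      by (rule prod.cong[OF refl]) (simp add: mk.emeasure_eq_measure sections_def mk.prob_compl[OF mark_section[OF E(1)]])
    also have "\<dots> = ennreal (\<Prod>i\<in>?J. 1 - sections E (X i \<omega>))"
      by (rule prod_ennreal) (use sections_bounds in simp)
    finally show "emeasure ?Q (Pair (\<lambda>i. X i \<omega>) -` V) = ennreal (\<Prod>i\<in>?J. 1 - sections E (X i \<omega>))" .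
  qed
  also have "\<dots> = ennreal (expectation (\<lambda>\<omega>. \<Prod>i\<in>{i. X i \<omega> \<in> D}. 1 - sections E (X i \<omega>)))"
  proof (rule nn_integral_eq_integral)
    have b: "0 \<le> (\<Prod>i\<in>{i. X i \<omega> \<in> D}. 1 - sections E (X i \<omega>))" "(\<Prod>i\<in>{i. X i \<omega> \<in> D}. 1 - sections E (X i \<omega>)) \<le> 1" for \<omega>
      using sections_bounds by (auto intro!: prod_nonneg prod_le_1)
    show "integrable W (\<lambda>\<omega>. \<Prod>i\<in>{i. X i \<omega> \<in> D}. 1 - sections E (X i \<omega>))"
      by (rule integrable_const_bound[where B = 1])
        (use b in \<open>auto intro!: AE_I2 generating_functional(1) D borel_measurable_diff measurable_sections E simp: sections_bounds\<close>)
    show "AE \<omega> in W. 0 \<le> (\<Prod>i\<in>{i. X i \<omega> \<in> D}. 1 - sections E (X i \<omega>))" using b by simp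
  qed
  also have "expectation (\<lambda>\<omega>. \<Prod>i\<in>{i. X i \<omega> \<in> D}. 1 - sections E (X i \<omega>)) =
      exp (- (rate * (\<integral>x. indicator D x * (1 - (1 - sections E x)) \<partial>lborel)))"
    by (rule generating_functional(2)[OF D]) (auto intro!: borel_measurable_diff measurable_sections E simp: sections_bounds)
  also have "(\<integral>x. indicator D x * (1 - (1 - sections E x)) \<partial>lborel) = intensity E"
    unfolding intensity_def
    by (rule Bochner_Integration.integral_cong[OF refl]) (use sections_outside[OF E(2)] in \<open>auto simp: indicator_def\<close>)
  finally show ?thesis by (simp add: emeasure_eq_measure)
qed

end

section \<open>Independence of the cells\<close>

definition cube :: "int^'d \<Rightarrow> (real^'d) set" where "cube z = {x. x - rv z \<in> unit_cube}"

lemma cube_measurable: "cube z \<in> sets (borel :: (real^'d::finite) measure)"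
proof -
  have "(\<lambda>x. x - rv z) -` unit_cube \<inter> space borel \<in> sets borel"
    by (rule measurable_sets[OF _ unit_cube_measurable]) measurable
  then show ?thesis by (simp add: cube_def vimage_def)
qed

lemma bounded_cube: "bounded (cube z :: (real^'d::finite) set)"
proof (rule boundedI)
  fix x :: "real^'d" assume x: "x \<in> cube z"
  have "norm x \<le> norm (x - rv z) + norm (rv z)" using norm_triangle_ineq[of "x - rv z" "rv z"] by simp
  also have "norm (x - rv z) \<le> (\<Sum>k\<in>UNIV. \<bar>(x - rv z) $ k\<bar>)" by (rule norm_le_l1_cart)
  also have "\<dots> \<le> (\<Sum>k\<in>(UNIV :: 'd set). 1)" using x by (intro sum_mono) (auto simp: cube_def unit_cube_def less_imp_le)
  finally show "norm x \<le> real CARD('d) + norm (rv z)" by simp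
qed

lemma cube_disjoint: "x \<in> cube z \<Longrightarrow> x \<in> cube w \<Longrightarrow> z = w"
  unfolding cube_def by (rule cube_unique[of "x - rv z" "x - rv w"]) auto

lemma cubes_box:
  fixes x :: "real^'d::finite"
  shows "x \<in> (\<Union>z\<in>box_cube n. cube z) \<longleftrightarrow> (\<forall>k. 0 \<le> x $ k \<and> x $ k < real n)"
proof
  assume "x \<in> (\<Union>z\<in>box_cube n. cube z)"
  then obtain z where z: "\<And>k. 0 \<le> z $ k \<and> z $ k < int n" "x - rv z \<in> unit_cube" by (auto simp: box_cube_def cube_def)
  show "\<forall>k. 0 \<le> x $ k \<and> x $ k < real n"
  proof
    fix k
    have "0 \<le> x $ k - of_int (z $ k)" "x $ k - of_int (z $ k) < 1" using z(2) by (auto simp: unit_cube_def rv_def)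
    moreover have "0 \<le> real_of_int (z $ k)" "real_of_int (z $ k) + 1 \<le> real n" using z(1)[of k] by linarith+
    ultimately show "0 \<le> x $ k \<and> x $ k < real n" by linarith
  qed
next
  assume x: "\<forall>k. 0 \<le> x $ k \<and> x $ k < real n"
  have "(\<chi> k. \<lfloor>x $ k\<rfloor>) \<in> box_cube n" using x by (simp add: box_cube_def floor_less_iff)
  moreover have "x \<in> cube (\<chi> k. \<lfloor>x $ k\<rfloor>)" unfolding cube_def unit_cube_def rv_def by simp linarith
  ultimately show "x \<in> (\<Union>z\<in>box_cube n. cube z)" by blast
qed

text \<open>The part of the closed window that the half open unit cubes do not cover.\<close>

definition box_border :: "nat \<Rightarrow> (real^'d::finite) set" where
  "box_border n = cbox 0 (vec (real n)) - (\<Union>z\<in>box_cube n. cube z)"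

lemma box_border_measurable: "box_border n \<in> sets borel"
  unfolding box_border_def by (intro sets.Diff sets.finite_UN finite_box_cube cube_measurable) simp

lemma bounded_box_border: "bounded (box_border n)"
  unfolding box_border_def by (rule bounded_diff) simp

lemma box_border_null: "measure lborel (box_border n :: (real^'d::finite) set) = 0"
proof -
  have "box_border n \<subseteq> (\<Union>k. {x :: real^'d. x $ k = real n})"
  proof
    fix x :: "real^'d" assume x: "x \<in> box_border n"
    then have c: "\<And>k. 0 \<le> x $ k \<and> x $ k \<le> real n" and "\<not> (\<forall>k. 0 \<le> x $ k \<and> x $ k < real n)"
      using cubes_box[of x n]
      unfolding box_border_def by (simp_all add: mem_box_cart)
    then obtain k where "\<not> x $ k < real n" by blast
    then show "x \<in> (\<Union>k. {x. x $ k = real n})" using c[of k] by auto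
  qed
  moreover have "negligible (\<Union>k. {x :: real^'d. x $ k = real n})"
    by (rule negligible_Union) (auto simp: cart_eq_inner_axis negligible_standard_hyperplane)
  ultimately have "negligible (box_border n :: (real^'d) set)" by (rule negligible_subset[rotated])
  then have "measure lebesgue (box_border n :: (real^'d) set) = 0" by (rule negligible_imp_measure0)
  moreover have "measure lebesgue (box_border n :: (real^'d) set) = measure lborel (box_border n :: (real^'d) set)"
    by (rule measure_completion) (simp add: box_border_measurable)
  ultimately show ?thesis by simp
qed

locale marked_poisson_cells = marked_poisson W rate T X M
  for W :: "'w measure" and rate :: real and T :: nat
    and X :: "nat \<Rightarrow> 'w \<Rightarrow> (real, 'd::{finite,linorder}) vec" and M :: "nat \<Rightarrow> 'w \<Rightarrow> real"
begin

text \<open>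
  Positions are taken relative to the corner of the cube, so that all cells can have the same law.
\<close>

definition cells :: "'w \<Rightarrow> (int, 'd) vec \<Rightarrow> 'd mpoint fset" where
  "cells \<omega> z = Abs_fset ((\<lambda>i. (X i \<omega> - rv z, M i \<omega>)) ` {i. X i \<omega> \<in> cube z})"

lemma fset_cells: "\<omega> \<in> space W \<Longrightarrow> fset (cells \<omega> z) = (\<lambda>i. (X i \<omega> - rv z, M i \<omega>)) ` {i. X i \<omega> \<in> cube z}"
  unfolding cells_def by (rule Abs_fset_inverse) (simp add: finite_points bounded_cube)

definition placed :: "(int, 'd) vec \<Rightarrow> 'd mpoint set \<Rightarrow> 'd mpoint set" where
  "placed z E = {p. (fst p - rv z, snd p) \<in> E \<inter> (unit_cube \<times> UNIV)}"

lemma restricted_measurable: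
  "E \<in> sets (borel \<Otimes>\<^sub>M borel) \<Longrightarrow> E \<inter> (unit_cube \<times> UNIV) \<in> sets ((borel :: ((real, 'd) vec) measure) \<Otimes>\<^sub>M (borel :: real measure))"
  by (intro sets.Int pair_measureI unit_cube_measurable) auto

lemma placed_measurable:
  assumes "E \<in> sets (borel \<Otimes>\<^sub>M borel)" shows "placed z E \<in> sets (borel \<Otimes>\<^sub>M borel)"
proof -
  have "(\<lambda>p. (fst p - rv z, snd p)) \<in> measurable ((borel :: ((real, 'd) vec) measure) \<Otimes>\<^sub>M (borel :: real measure)) (borel \<Otimes>\<^sub>M borel)"
    by measurable
  from measurable_sets[OF this restricted_measurable[OF assms]] show ?thesis
    by (simp add: placed_def vimage_def space_pair_measure)
qed

lemma placed_subset: "placed z E \<subseteq> cube z \<times> UNIV"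
  by (auto simp: placed_def cube_def)

lemma void_iff:
  "\<omega> \<in> space W \<Longrightarrow> fset (cells \<omega> z) \<inter> E = {} \<longleftrightarrow> (\<forall>i. (X i \<omega>, M i \<omega>) \<notin> placed z E)"
  by (auto simp: fset_cells placed_def cube_def)

text \<open>
  Void conditions on different cubes combine to a void condition on one set, whose intensity is
  the sum of the intensities of its pieces. By translation invariance these do not depend on the
  position of the cubes.
\<close>

theorem void_cells:
  assumes J: "finite J" and E: "\<And>z. z \<in> J \<Longrightarrow> E z \<in> sets (borel \<Otimes>\<^sub>M borel)"
  shows "prob {\<omega> \<in> space W. \<forall>z\<in>J. fset (cells \<omega> z) \<inter> E z = {}} = (\<Prod>z\<in>J. exp (- (rate * intensity (E z \<inter> (unit_cube \<times> UNIV)))))"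
proof -
  let ?D = "\<Union>z\<in>J. cube z"
  have D: "?D \<in> sets borel" "bounded ?D"
    using J by (auto intro!: sets.finite_UN cube_measurable bounded_UN bounded_cube)
  have P: "placed z (E z) \<in> sets (borel \<Otimes>\<^sub>M borel) \<and> placed z (E z) \<subseteq> ?D \<times> UNIV" if "z \<in> J" for z
    using placed_measurable[OF E[OF that]] placed_subset[of z "E z"] that by blast
  have "{\<omega> \<in> space W. \<forall>z\<in>J. fset (cells \<omega> z) \<inter> E z = {}} = {\<omega> \<in> space W. \<forall>i. (X i \<omega>, M i \<omega>) \<notin> (\<Union>z\<in>J. placed z (E z))}"
    using void_iff by blast
  also have "prob \<dots> = exp (- (rate * intensity (\<Union>z\<in>J. placed z (E z))))"
    by (rule void_probability[OF _ _ D]) (use P J in \<open>auto intro!: sets.finite_UN\<close>)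
  also have "intensity (\<Union>z\<in>J. placed z (E z)) = (\<Sum>z\<in>J. intensity (placed z (E z)))"
  proof (rule intensity_Union[OF J _ P D])
    show "disjoint_family_on (\<lambda>z. placed z (E z)) J"
      unfolding disjoint_family_on_def using placed_subset cube_disjoint by blast
  qed
  also have "\<dots> = (\<Sum>z\<in>J. intensity (E z \<inter> (unit_cube \<times> UNIV)))"
    unfolding placed_def by (intro sum.cong[OF refl] intensity_translate restricted_measurable E)
  finally show ?thesis by (simp add: sum_distrib_left sum_negf[symmetric] exp_sum[OF J])
qed

lemma void_event:
  assumes "E \<in> sets (borel \<Otimes>\<^sub>M borel)"
  shows "{\<omega> \<in> space W. fset (cells \<omega> z) \<inter> E = {}} \<in> sets W"
proof -
  have m: "(\<lambda>\<omega>. (X i \<omega>, M i \<omega>)) \<in> measurable W (borel \<Otimes>\<^sub>M borel)" for i by measurable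
  have "{\<omega> \<in> space W. (X i \<omega>, M i \<omega>) \<notin> placed z E} \<in> sets W" for i
    using measurable_sets[OF m sets.compl_sets[OF placed_measurable[OF assms]]]
    by (simp add: vimage_def Int_def conj_commute space_pair_measure)
  then have "{\<omega> \<in> space W. \<forall>i. (X i \<omega>, M i \<omega>) \<notin> placed z E} \<in> sets W" by (rule sets.sets_Collect_countable_All)
  moreover have "{\<omega> \<in> space W. fset (cells \<omega> z) \<inter> E = {}} = {\<omega> \<in> space W. \<forall>i. (X i \<omega>, M i \<omega>) \<notin> placed z E}"
    by (rule Collect_cong) (simp only: void_iff cong: conj_cong)
  ultimately show ?thesis by simp
qed

lemma cell_measurable: "(\<lambda>\<omega>. cells \<omega> z) \<in> measurable W config_algebra"
proof (rule measurable_sigma_sets[OF sets_config_algebra])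
  show "(\<lambda>\<omega>. cells \<omega> z) -` y \<inter> space W \<in> sets W"
    if y: "y \<in> {{C. fset C \<inter> E = {}} | E. E \<in> sets (borel \<Otimes>\<^sub>M borel)}" for y
  proof -
    obtain E where E: "E \<in> sets (borel \<Otimes>\<^sub>M borel)" "y = {C. fset C \<inter> E = {}}" using y by blast
    have "(\<lambda>\<omega>. cells \<omega> z) -` y \<inter> space W = {\<omega> \<in> space W. fset (cells \<omega> z) \<inter> E = {}}" using E(2) by auto
    then show ?thesis using void_event[OF E(1)] by simp
  qed
qed auto

definition cell_law :: "'d mpoint fset measure" where
  "cell_law = distr W config_algebra (\<lambda>\<omega>. cells \<omega> 0)"

lemma sets_cell_law [simp]: "sets cell_law = sets config_algebra" by (simp add: cell_law_def)

lemma space_cell_law [simp]: "space cell_law = UNIV" by (simp add: cell_law_def)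

lemma prob_space_cell_law: "prob_space cell_law" unfolding cell_law_def by (rule prob_space_distr[OF cell_measurable])

text \<open>
  Two laws that agree on the void events are equal, since these events generate the sigma-algebra
  and are closed under intersection.
\<close>

lemma cells_identically_distributed: "distr W config_algebra (\<lambda>\<omega>. cells \<omega> z) = cell_law"
proof -
  let ?G = "{{C :: 'd mpoint fset. fset C \<inter> E = {}} | E. E \<in> sets (borel \<Otimes>\<^sub>M borel)}"
  have v: "emeasure (distr W config_algebra (\<lambda>\<omega>. cells \<omega> z)) {C. fset C \<inter> E = {}} = ennreal (exp (- (rate * intensity (E \<inter> (unit_cube \<times> UNIV)))))"
    if E: "E \<in> sets (borel \<Otimes>\<^sub>M borel)" for z E
  proof -
    have s: "{C. fset C \<inter> E = {}} \<in> sets config_algebra" unfolding sets_config_algebra by (rule sigma_sets.Basic) (use E in blast)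
    have "(\<lambda>\<omega>. cells \<omega> z) -` {C. fset C \<inter> E = {}} \<inter> space W = {\<omega> \<in> space W. \<forall>z\<in>{z}. fset (cells \<omega> z) \<inter> E = {}}" by auto
    then show ?thesis using void_cells[of "{z}" "\<lambda>_. E"] E by (simp add: emeasure_distr[OF cell_measurable s] emeasure_eq_measure)
  qed
  show ?thesis unfolding cell_law_def
  proof (rule measure_eqI_generator_eq[where E = ?G and \<Omega> = UNIV and A = "\<lambda>_. UNIV"])
    show "Int_stable ?G"
    proof (rule Int_stableI)
      fix a b assume "a \<in> ?G" "b \<in> ?G"
      then obtain E E' where "a = {C. fset C \<inter> E = {}}" "E \<in> sets (borel \<Otimes>\<^sub>M borel)" "b = {C. fset C \<inter> E' = {}}" "E' \<in> sets (borel \<Otimes>\<^sub>M borel)" by blast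
      then have "a \<inter> b = {C. fset C \<inter> (E \<union> E') = {}}" "E \<union> E' \<in> sets (borel \<Otimes>\<^sub>M borel)" by auto
      then show "a \<inter> b \<in> ?G" by blast
    qed
    show "range (\<lambda>_::nat. UNIV) \<subseteq> ?G" by (auto intro!: exI[of _ "{}"])
    show "emeasure (distr W config_algebra (\<lambda>\<omega>. cells \<omega> z)) a = emeasure (distr W config_algebra (\<lambda>\<omega>. cells \<omega> 0)) a" if "a \<in> ?G" for a
      using that v by auto
    interpret d: prob_space "distr W config_algebra (\<lambda>\<omega>. cells \<omega> z)" by (rule prob_space_distr[OF cell_measurable])
    show "emeasure (distr W config_algebra (\<lambda>\<omega>. cells \<omega> z)) UNIV \<noteq> \<infinity>" by simp
  qed (simp_all add: sets_config_algebra)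
qed

lemma cells_independent: "indep_vars (\<lambda>_. config_algebra) (\<lambda>z \<omega>. cells \<omega> z) UNIV"
proof -
  let ?G = "{{C :: 'd mpoint fset. fset C \<inter> E = {}} | E. E \<in> sets (borel \<Otimes>\<^sub>M borel)}"
  define F where "F z = {{\<omega> \<in> space W. fset (cells \<omega> z) \<inter> E = {}} | E. E \<in> sets (borel \<Otimes>\<^sub>M borel)}" for z
  have "indep_sets F UNIV"
  proof (rule indep_setsI)
    show "F z \<subseteq> events" for z unfolding F_def using void_event by blast
    fix A J assume J: "finite (J :: ((int, 'd) vec) set)" and A: "\<forall>j\<in>J. A j \<in> F j" and ne: "J \<noteq> {}"
    have ex: "\<forall>j\<in>J. \<exists>E. E \<in> sets (borel \<Otimes>\<^sub>M borel) \<and> A j = {\<omega> \<in> space W. fset (cells \<omega> j) \<inter> E = {}}"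
      using A unfolding F_def by blast
    obtain E where E': "\<forall>j\<in>J. E j \<in> sets (borel \<Otimes>\<^sub>M borel) \<and> A j = {\<omega> \<in> space W. fset (cells \<omega> j) \<inter> E j = {}}"
      using bchoice[OF ex] by (rule exE)
    have E: "E j \<in> sets (borel \<Otimes>\<^sub>M borel)" "A j = {\<omega> \<in> space W. fset (cells \<omega> j) \<inter> E j = {}}" if "j \<in> J" for j
      using bspec[OF E' that] by simp_all
    have "(\<Inter>j\<in>J. A j) = {\<omega> \<in> space W. \<forall>z\<in>J. fset (cells \<omega> z) \<inter> E z = {}}" using E(2) ne by auto
    then have "prob (\<Inter>j\<in>J. A j) = (\<Prod>z\<in>J. exp (- (rate * intensity (E z \<inter> (unit_cube \<times> UNIV)))))"
      using void_cells[OF J E(1)] by simp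
    also have "\<dots> = (\<Prod>j\<in>J. prob (A j))"
    proof (rule prod.cong[OF refl])
      fix z assume "z \<in> J"
      then show "exp (- (rate * intensity (E z \<inter> (unit_cube \<times> UNIV)))) = prob (A z)"
        using void_cells[of "{z}" E] E by simp
    qed
    finally show "prob (\<Inter>j\<in>J. A j) = (\<Prod>j\<in>J. prob (A j))" .
  qed
  moreover have "Int_stable (F z)" for z
  proof (rule Int_stableI)
    fix a b assume "a \<in> F z" "b \<in> F z"
    then obtain E E' where "a = {\<omega> \<in> space W. fset (cells \<omega> z) \<inter> E = {}}" "E \<in> sets (borel \<Otimes>\<^sub>M borel)"
      "b = {\<omega> \<in> space W. fset (cells \<omega> z) \<inter> E' = {}}" "E' \<in> sets (borel \<Otimes>\<^sub>M borel)" unfolding F_def by blast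
    then have "a \<inter> b = {\<omega> \<in> space W. fset (cells \<omega> z) \<inter> (E \<union> E') = {}}" "E \<union> E' \<in> sets (borel \<Otimes>\<^sub>M borel)" by auto
    then show "a \<inter> b \<in> F z" unfolding F_def by blast
  qed
  ultimately have ind: "indep_sets (\<lambda>z. sigma_sets (space W) (F z)) UNIV" by (rule indep_sets_sigma)
  have "{(\<lambda>\<omega>. cells \<omega> z) -` A \<inter> space W | A. A \<in> sets config_algebra} = sigma_sets (space W) (F z)" for z
  proof -
    have "{(\<lambda>\<omega>. cells \<omega> z) -` A \<inter> space W | A. A \<in> sigma_sets UNIV ?G} = sigma_sets (space W) {(\<lambda>\<omega>. cells \<omega> z) -` A \<inter> space W | A. A \<in> ?G}"
      by (rule sigma_sets_vimage_commute) simp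
    also have "{(\<lambda>\<omega>. cells \<omega> z) -` A \<inter> space W | A. A \<in> ?G} = F z"
    proof (rule subset_antisym; rule subsetI)
      fix a assume "a \<in> {(\<lambda>\<omega>. cells \<omega> z) -` A \<inter> space W | A. A \<in> ?G}"
      then obtain E where E: "E \<in> sets (borel \<Otimes>\<^sub>M borel)" "a = (\<lambda>\<omega>. cells \<omega> z) -` {C. fset C \<inter> E = {}} \<inter> space W" by blast
      have "a = {\<omega> \<in> space W. fset (cells \<omega> z) \<inter> E = {}}" using E(2) by auto
      then show "a \<in> F z" using E(1) unfolding F_def by blast
    next
      fix a assume "a \<in> F z"
      then obtain E where E: "E \<in> sets (borel \<Otimes>\<^sub>M borel)" "a = {\<omega> \<in> space W. fset (cells \<omega> z) \<inter> E = {}}" unfolding F_def by blast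
      have "a = (\<lambda>\<omega>. cells \<omega> z) -` {C. fset C \<inter> E = {}} \<inter> space W" using E(2) by auto
      then show "a \<in> {(\<lambda>\<omega>. cells \<omega> z) -` A \<inter> space W | A. A \<in> ?G}" using E(1) by blast
    qed
    finally show ?thesis unfolding sets_config_algebra .
  qed
  then show ?thesis unfolding indep_vars_def2 using ind cell_measurable by simp
qed

abbreviation product_law :: "((int, 'd) vec \<Rightarrow> 'd mpoint fset) measure" where
  "product_law \<equiv> PiM UNIV (\<lambda>_. cell_law)"

lemma cells_measurable: "cells \<in> measurable W product_law"
  by (rule measurable_PiM_single') (use cell_measurable in \<open>simp_all add: measurable_cong_sets[OF refl sets_cell_law]\<close>)

theorem cells_law: "distr W product_law cells = product_law"
proof -
  have "distr W (PiM UNIV (\<lambda>_. config_algebra)) (\<lambda>\<omega>. \<lambda>z\<in>UNIV. cells \<omega> z) = PiM UNIV (\<lambda>z. distr W config_algebra (\<lambda>\<omega>. cells \<omega> z))"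
    using cells_independent by (subst (asm) indep_vars_iff_distr_eq_PiM') (auto intro: cell_measurable)
  also have "\<dots> = product_law" unfolding cells_identically_distributed ..
  also have "distr W (PiM UNIV (\<lambda>_. config_algebra)) (\<lambda>\<omega>. \<lambda>z\<in>UNIV. cells \<omega> z) = distr W product_law cells"
    by (rule distr_cong) (auto intro!: sets_PiM_cong simp: restrict_UNIV)
  finally show ?thesis .
qed

lemma point_count_cells:
  assumes \<omega>: "\<omega> \<in> space W" and A: "finite A"
  shows "point_count A (cells \<omega>) \<le> N (\<Union>z\<in>A. cube z) \<omega>"
proof -
  have "point_count A (cells \<omega>) \<le> (\<Sum>z\<in>A. card {i. X i \<omega> \<in> cube z})"
    unfolding point_count_def fset_cells[OF \<omega>] image_image
    by (intro sum_mono card_image_le finite_points[OF \<omega> bounded_cube])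
  also have "\<dots> = card (\<Union>z\<in>A. {i. X i \<omega> \<in> cube z})"
    by (rule card_UN_disjoint[symmetric]) (use A finite_points[OF \<omega> bounded_cube] cube_disjoint in blast)+
  also have "(\<Union>z\<in>A. {i. X i \<omega> \<in> cube z}) = {i. X i \<omega> \<in> (\<Union>z\<in>A. cube z)}" by blast
  finally show ?thesis .
qed

text \<open>
  The total number of points in finitely many cubes is at most a Poisson variable, which has
  finite exponential moments.
\<close>

lemma L2_of_growth:
  assumes A: "finite A" and F: "F \<in> borel_measurable product_law"
    and bound: "\<And>s. \<bar>F s\<bar> \<le> K * 2 ^ (m * point_count A s)"
  shows "L2 product_law F"
  unfolding L2_def
proof
  show "F \<in> borel_measurable product_law" by (rule F)
  let ?D = "\<Union>z\<in>A. cube z"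
  have D: "?D \<in> sets borel" "bounded ?D"
    using A by (auto intro!: sets.finite_UN cube_measurable bounded_UN bounded_cube)
  have "integrable W (\<lambda>\<omega>. (F (cells \<omega>))\<^sup>2)"
  proof (rule Bochner_Integration.integrable_bound)
    show "integrable W (\<lambda>\<omega>. K\<^sup>2 * (4 ^ m) ^ N ?D \<omega>)"
      by (intro integrable_mult_right generating_function_count(1)[OF D]) simp
    show "(\<lambda>\<omega>. (F (cells \<omega>))\<^sup>2) \<in> borel_measurable W"
      by (intro borel_measurable_power measurable_compose[OF cells_measurable F])
    show "AE \<omega> in W. norm ((F (cells \<omega>))\<^sup>2) \<le> norm (K\<^sup>2 * (4 ^ m) ^ N ?D \<omega>)"
    proof (rule AE_I2)
      fix \<omega> assume \<omega>: "\<omega> \<in> space W"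
      have "(F (cells \<omega>))\<^sup>2 = \<bar>F (cells \<omega>)\<bar>\<^sup>2" by simp
      also have "\<dots> \<le> (K * 2 ^ (m * point_count A (cells \<omega>)))\<^sup>2" by (intro power_mono bound) simp
      also have "\<dots> = K\<^sup>2 * (4 ^ m) ^ point_count A (cells \<omega>)"
      proof -
        have "((2::real) ^ (m * point_count A (cells \<omega>)))\<^sup>2 = (2\<^sup>2) ^ (m * point_count A (cells \<omega>))"
          by (simp only: power_mult[symmetric] mult.commute)
        then show ?thesis by (simp add: power_mult_distrib power_mult)
      qed
      also have "\<dots> \<le> K\<^sup>2 * (4 ^ m) ^ N ?D \<omega>"
        by (intro mult_left_mono power_increasing point_count_cells[OF \<omega> A]) simp_all
      finally show "norm ((F (cells \<omega>))\<^sup>2) \<le> norm (K\<^sup>2 * (4 ^ m) ^ N ?D \<omega>)" by simp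
    qed
  qed
  then have "integrable (distr W product_law cells) (\<lambda>s. (F s)\<^sup>2)"
    by (subst integrable_distr_eq[OF cells_measurable]) (use F in auto)
  then show "integrable product_law (\<lambda>s. (F s)\<^sup>2)" by (simp only: cells_law)
qed

text \<open>
  The border is contained in finitely many hyperplanes, so it has volume zero and contains almost
  surely no point of the process.
\<close>

lemma AE_no_border: "AE \<omega> in W. \<forall>i. X i \<omega> \<notin> box_border n"
proof -
  have "prob {\<omega> \<in> space W. N (box_border n) \<omega> = 0} = 1"
    using count_law[OF box_border_measurable bounded_box_border, of n 0] by (simp add: box_border_null)
  then have "AE \<omega> in W. N (box_border n) \<omega> = 0"
    using prob_eq_1[of "{\<omega> \<in> space W. N (box_border n) \<omega> = 0}"]
      measurable_sets[OF measurable_count[OF box_border_measurable[of n] bounded_box_border], of "{0}"]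
    by (simp add: vimage_def Int_def conj_commute)
  then show ?thesis
  proof (rule AE_mp, intro AE_I2 impI)
    fix \<omega> assume "\<omega> \<in> space W" "N (box_border n) \<omega> = 0"
    then show "\<forall>i. X i \<omega> \<notin> box_border n" using finite_points[OF _ bounded_box_border, of \<omega> n] by simp
  qed
qed

definition window :: "nat \<Rightarrow> 'w \<Rightarrow> 'd mpoint set" where
  "window n \<omega> = (\<lambda>i. (X i \<omega>, M i \<omega>)) ` {i. X i \<omega> \<in> cbox 0 (vec (real n))}"

lemma finite_window: "\<omega> \<in> space W \<Longrightarrow> finite (window n \<omega>)"
  unfolding window_def by (intro finite_imageI finite_points) simp_all

lemma window_eq_conf:
  assumes \<omega>: "\<omega> \<in> space W" and border: "\<forall>i. X i \<omega> \<notin> box_border n"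
  shows "window n \<omega> = conf (cells \<omega>) (box_cube n)"
proof -
  have "cell (cells \<omega>) z = (\<lambda>i. (X i \<omega>, M i \<omega>)) ` {i. X i \<omega> \<in> cube z}" for z
  proof -
    have "{p. p \<in> fset (cells \<omega> z) \<and> fst p \<in> unit_cube} = (\<lambda>i. (X i \<omega> - rv z, M i \<omega>)) ` {i. X i \<omega> \<in> cube z}"
      unfolding fset_cells[OF \<omega>] by (auto simp: cube_def)
    then show ?thesis unfolding cell_def by (simp add: image_image)
  qed
  then have "conf (cells \<omega>) (box_cube n) = (\<lambda>i. (X i \<omega>, M i \<omega>)) ` {i. X i \<omega> \<in> (\<Union>z\<in>box_cube n. cube z)}"
    unfolding conf_def by blast
  moreover have "X i \<omega> \<in> cbox 0 (vec (real n)) \<longleftrightarrow> X i \<omega> \<in> (\<Union>z\<in>box_cube n. cube z)" for i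
  proof
    assume "X i \<omega> \<in> cbox 0 (vec (real n))"
    then show "X i \<omega> \<in> (\<Union>z\<in>box_cube n. cube z)" using border unfolding box_border_def by blast
  next
    assume "X i \<omega> \<in> (\<Union>z\<in>box_cube n. cube z)"
    then show "X i \<omega> \<in> cbox 0 (vec (real n))" unfolding cubes_box by (auto simp: mem_box_cart less_imp_le)
  qed
  ultimately show ?thesis unfolding window_def by simp
qed

lemma filtration_eq_cplx: "filtration (\<lambda>i. X i \<omega>) (\<lambda>i. M i \<omega>) n b = cplx (window n \<omega>) b"
proof (cases b)
  case (fields r1 r2 k)
  have "{X i \<omega> | i. X i \<omega> \<in> cbox 0 (vec (real n)) \<and> M i \<omega> \<le> r2} = locs (window n \<omega>) r2"
    unfolding locs_def window_def by force
  then show ?thesis by (simp add: fields)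
qed

lemma filtration_betti_eq:
  assumes "b \<in> params T" "d \<in> params T" "param_le b d" "\<omega> \<in> space W"
  shows "real (filtration_betti (\<lambda>i. X i \<omega>) (\<lambda>i. M i \<omega>) q n b d) = pbeta q b d (window n \<omega>)"
  unfolding filtration_betti_def filtration_eq_cplx
  by (rule persistent_betti_eq_pbeta[OF finite_window[OF assms(4)] assms(1-3)])

lemma measurable_window_pbeta: "(\<lambda>\<omega>. pbeta q b d (window n \<omega>)) \<in> borel_measurable W"
proof (rule measurable_pbeta[OF finite_window])
  fix E :: "'d mpoint set" assume E: "E \<in> sets (borel \<Otimes>\<^sub>M borel)"
  have m: "(\<lambda>\<omega>. (X i \<omega>, M i \<omega>)) \<in> measurable W (borel \<Otimes>\<^sub>M borel)" for i by measurable
  have B: "E \<inter> (cbox 0 (vec (real n)) \<times> UNIV) \<in> sets (borel \<Otimes>\<^sub>M borel)"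
    using E by (intro sets.Int pair_measureI) auto
  have "{\<omega> \<in> space W. window n \<omega> \<inter> E \<noteq> {}} = (\<Union>i. (\<lambda>\<omega>. (X i \<omega>, M i \<omega>)) -` (E \<inter> (cbox 0 (vec (real n)) \<times> UNIV)) \<inter> space W)"
    unfolding window_def by auto
  also have "\<dots> \<in> sets W" by (intro sets.countable_UN) (use measurable_sets[OF m B] in auto)
  finally show "{\<omega> \<in> space W. window n \<omega> \<inter> E \<noteq> {}} \<in> sets W" .
qed

end

section \<open>Betti numbers of the Poisson process\<close>

text \<open>
  The variances of the projections converge, hence so do the covariances by polarization. The
  limit form is bilinear and positive semidefinite, so it is the covariance of a centered normal
  law. Tightness follows from Chebyshev's inequality, since the second moments are bounded.
\<close>

theorem (in prob_space) gaussian_limit_from_projections: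
  fixes Y :: "nat \<Rightarrow> 'a \<Rightarrow> real^'j::finite"
  assumes Y: "\<And>n. Y n \<in> borel_measurable M"
    and sq: "\<And>n v. L2 M (\<lambda>\<omega>. v \<bullet> Y n \<omega>)"
    and var: "\<And>v. (\<lambda>n. expectation (\<lambda>\<omega>. (v \<bullet> Y n \<omega>)\<^sup>2)) \<longlonglongrightarrow> (\<sigma> v)\<^sup>2"
    and char: "\<And>v. (\<lambda>n. expectation (\<lambda>\<omega>. cis (v \<bullet> Y n \<omega>))) \<longlonglongrightarrow> complex_of_real (exp (- (\<sigma> v)\<^sup>2 / 2))"
  shows "\<exists>Z :: (real^'j) measure. centered_normal Z \<and> weakly_converges (\<lambda>n. distr M borel (Y n)) Z"
proof -
  define C where "C n u v = expectation (\<lambda>\<omega>. (u \<bullet> Y n \<omega>) * (v \<bullet> Y n \<omega>))" for n u v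
  define B where "B u v = lim (\<lambda>n. C n u v)" for u v
  have intC: "integrable M (\<lambda>\<omega>. (u \<bullet> Y n \<omega>) * (v \<bullet> Y n \<omega>))" for n u v
    by (rule L2_integrable_mult[OF sq sq])
  have C_diag: "C n v v = expectation (\<lambda>\<omega>. (v \<bullet> Y n \<omega>)\<^sup>2)" for n v
    by (simp add: C_def power2_eq_square)
  have C_add: "C n u (v + w) = C n u v + C n u w" for n u v w
    unfolding C_def inner_add_left ring_distribs by (rule Bochner_Integration.integral_add[OF intC intC])
  have C_scale: "C n u (c *\<^sub>R v) = c * C n u v" for n u v c
    unfolding C_def inner_scaleR_left by (simp add: mult.left_commute)
  have C_sym: "C n u v = C n v u" for n u v unfolding C_def by (simp add: mult.commute)
  \<comment> \<open>Polarization expresses the mixed moments by the moments of projections.\<close>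
  have C_polar: "C n u v = (C n (u + v) (u + v) - C n u u - C n v v) / 2" for n u v
    using C_add[of n "u + v" u v] C_add[of n u u v] C_add[of n v u v] C_sym[of n "u + v" u] C_sym[of n "u + v" v] C_sym[of n u v]
    by simp
  have diag: "(\<lambda>n. C n v v) \<longlonglongrightarrow> (\<sigma> v)\<^sup>2" for v unfolding C_diag by (rule var)
  have "convergent (\<lambda>n. C n u v)" for u v
  proof -
    have "(\<lambda>n. (C n (u + v) (u + v) - C n u u - C n v v) / 2) \<longlonglongrightarrow> ((\<sigma> (u + v))\<^sup>2 - (\<sigma> u)\<^sup>2 - (\<sigma> v)\<^sup>2) / 2"
      by (intro tendsto_intros diag) simp
    then show ?thesis unfolding C_polar[of _ u v] by (rule convergentI)
  qed
  then have lim: "(\<lambda>n. C n u v) \<longlonglongrightarrow> B u v" for u v unfolding B_def by (simp only: convergent_LIMSEQ_iff)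
  have B_diag: "B v v = (\<sigma> v)\<^sup>2" for v by (rule LIMSEQ_unique[OF lim diag])
  have "linear (B u)" for u
  proof (rule linearI)
    show "B u (v + w) = B u v + B u w" for v w
      by (rule LIMSEQ_unique[OF lim]) (unfold C_add, intro tendsto_add lim)
    show "B u (c *\<^sub>R v) = c *\<^sub>R B u v" for c v
      by (rule LIMSEQ_unique[OF lim]) (unfold C_scale real_scaleR_def, intro tendsto_mult_left lim)
  qed
  moreover have "B u v = B v u" for u v unfolding B_def C_sym[of _ u v] ..
  moreover have "0 \<le> B v v" for v unfolding B_diag by simp
  ultimately obtain a :: "real^'j \<Rightarrow> real^'j" where a: "\<And>v. B v v = (\<Sum>e\<in>Basis. (v \<bullet> a e)\<^sup>2)"
    using psd_form_sum_of_squares[of B] by blast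
  obtain Z :: "(real^'j) measure" where Z: "centered_normal Z"
    "\<And>v. (LINT x|Z. cis (v \<bullet> x)) = complex_of_real (exp (- (\<Sum>e\<in>Basis. (v \<bullet> a e)\<^sup>2) / 2))"
    using centered_normal_exists[of a] by blast
  have "weakly_converges (\<lambda>n. distr M borel (Y n)) Z"
  proof (rule weakly_convergesI_char)
    show "prob_space (distr M borel (Y n))" for n by (rule prob_space_distr[OF Y])
    show "sets (distr M borel (Y n)) = sets borel" for n by simp
    show "prob_space Z" "sets Z = sets borel" using Z(1) unfolding centered_normal_def by simp_all
    show "(\<lambda>n. LINT x|distr M borel (Y n). cis (v \<bullet> x)) \<longlonglongrightarrow> (LINT x|Z. cis (v \<bullet> x))" for v
    proof -
      have "(\<lambda>x. cis (v \<bullet> x)) \<in> borel_measurable borel"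
        by (intro borel_measurable_continuous_onI continuous_intros)
      then have "(LINT x|distr M borel (Y n). cis (v \<bullet> x)) = expectation (\<lambda>\<omega>. cis (v \<bullet> Y n \<omega>))" for n
        by (rule integral_distr[OF Y])
      then show ?thesis unfolding Z(2) a[symmetric] B_diag using char[of v] by simp
    qed
    define S where "S n = (\<Sum>e\<in>(Basis :: (real^'j) set). C n e e)" for n
    have intS: "integrable M (\<lambda>\<omega>. (norm (Y n \<omega>))\<^sup>2)" "expectation (\<lambda>\<omega>. (norm (Y n \<omega>))\<^sup>2) = S n" for n
    proof -
      have eq: "(norm y)\<^sup>2 = (\<Sum>e\<in>Basis. (e \<bullet> y) * (e \<bullet> y))" for y :: "real^'j"
        unfolding power2_norm_eq_inner by (subst euclidean_inner) (simp add: inner_commute)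
      show "integrable M (\<lambda>\<omega>. (norm (Y n \<omega>))\<^sup>2)" unfolding eq by (intro Bochner_Integration.integrable_sum intC)
      show "expectation (\<lambda>\<omega>. (norm (Y n \<omega>))\<^sup>2) = S n" unfolding eq S_def C_def
        by (rule Bochner_Integration.integral_sum[OF intC])
    qed
    have "(\<lambda>n. S n) \<longlonglongrightarrow> (\<Sum>e\<in>(Basis :: (real^'j) set). (\<sigma> e)\<^sup>2)" unfolding S_def by (intro tendsto_sum diag)
    then have "Bseq S" by (intro convergent_imp_Bseq convergentI)
    then obtain K where K: "K > 0" "\<And>n. \<bar>S n\<bar> \<le> K" unfolding Bseq_def by auto
    fix e :: real assume e: "e > 0"
    \<comment> \<open>With \<open>K\<close> a bound for the second moments, \<open>R \<ge> 1\<close>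
      and \<open>R \<ge> K / e\<close> give \<open>K / R\<^sup>2 \<le> e\<close>.\<close>
    show "\<exists>R0. \<forall>R\<ge>R0. \<forall>n. measure (distr M borel (Y n)) {x. R < norm x} \<le> e"
    proof (intro exI[of _ "max 1 (K / e)"] allI impI)
      fix R n assume R: "max 1 (K / e) \<le> R"
      have "measure (distr M borel (Y n)) {x. R < norm x} = prob {\<omega> \<in> space M. R < norm (Y n \<omega>)}"
      proof -
        have "open {x :: real^'j. R < norm x}" by (intro open_Collect_less continuous_intros)
        then have "{x :: real^'j. R < norm x} \<in> sets borel" by (rule borel_open)
        then show ?thesis by (subst measure_distr[OF Y]) (auto intro!: arg_cong[of _ _ prob])
      qed
      also have "\<dots> \<le> prob {\<omega> \<in> space M. R\<^sup>2 \<le> (norm (Y n \<omega>))\<^sup>2}"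
      proof (rule finite_measure_mono)
        have "0 \<le> R" using R by simp
        then show "{\<omega> \<in> space M. R < norm (Y n \<omega>)} \<subseteq> {\<omega> \<in> space M. R\<^sup>2 \<le> (norm (Y n \<omega>))\<^sup>2}"
          by (auto intro!: power_mono)
        show "{\<omega> \<in> space M. R\<^sup>2 \<le> (norm (Y n \<omega>))\<^sup>2} \<in> sets M" using Y[of n] by measurable
      qed
      also have "\<dots> \<le> S n / R\<^sup>2"
        using integral_Markov_inequality_measure[OF intS(1)[of n], of "space M" "R\<^sup>2"] R by (simp add: intS(2))
      also have "\<dots> \<le> e"
      proof -
        have "K \<le> e * R" using R e by (simp add: divide_le_eq mult.commute)
        also have "\<dots> \<le> e * R\<^sup>2" using R e by (simp add: power2_eq_square)
        finally have "S n \<le> e * R\<^sup>2" using K(2)[of n] by linarith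
        then show ?thesis using R by (simp add: divide_le_eq)
      qed
      finally show "measure (distr M borel (Y n)) {x. R < norm x} \<le> e" .
    qed
  qed
  then show ?thesis using Z(1) by blast
qed

context marked_poisson_cells
begin

text \<open>
  The square integrable bound for the deletion effects is exponential in the number of points near
  the origin.
\<close>

lemma betti_functional_stabilizing:
  fixes b d :: "'j::finite \<Rightarrow> param"
  assumes p: "\<And>j. b j \<in> params T" "\<And>j. d j \<in> params T"
  shows "stabilizing_functional cell_law {||} (betti_functional q b d v)
    (\<lambda>s. (\<Sum>j\<in>UNIV. \<bar>v $ j\<bar>) * (2 * 2 ^ ((q + 2) * point_count (local_ball T) s)))"
proof -
  have pc: "(\<lambda>s. (2::real) ^ ((q + 2) * point_count (local_ball T) s)) \<in> borel_measurable product_law"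
  proof -
    have "(\<lambda>s. (2::real) powr (real (q + 2) * real (point_count (local_ball T) s))) \<in> borel_measurable product_law"
      by (intro powr_real_measurable borel_measurable_times borel_measurable_const measurable_point_count) simp
    moreover have "(2::real) powr (real (q + 2) * real (point_count (local_ball T) s)) = 2 ^ ((q + 2) * point_count (local_ball T) s)"
      for s :: "(int, 'd) vec \<Rightarrow> 'd mpoint fset"
      by (simp only: of_nat_mult[symmetric] powr_realpow zero_less_numeral)
    ultimately show ?thesis by (simp only:)
  qed
  interpret cl: prob_space cell_law by (rule prob_space_cell_law)
  show ?thesis
  proof unfold_locales
    show "space cell_law = UNIV" by simp
    fix A :: "(int, 'd) vec set" assume A: "finite A"
    show "L2 product_law (betti_functional q b d v A)"
      by (rule L2_of_growth[OF A measurable_betti_functional[OF A], where K = "(\<Sum>j\<in>UNIV. \<bar>v $ j\<bar>) * 2" and m = "q + 2"])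
        (use betti_functional_size[OF A, of q b d v] in \<open>simp_all only: mult.assoc sets_cell_law\<close>)
    show "depends_on A (betti_functional q b d v A)" by (rule depends_betti_functional)
    show "betti_functional q b d v ((+) z ` A) s = betti_functional q b d v A (\<lambda>y. s (z + y))" for z s
      by (rule betti_functional_shift[OF A])
    show "\<bar>betti_functional q b d v A s - betti_functional q b d v A (s(0 := {||}))\<bar>
      \<le> (\<Sum>j\<in>UNIV. \<bar>v $ j\<bar>) * (2 * 2 ^ ((q + 2) * point_count (local_ball T) s))" for s
      by (rule betti_functional_bound[OF p A])
  next
    show "L2 product_law (\<lambda>s. (\<Sum>j\<in>UNIV. \<bar>v $ j\<bar>) * (2 * 2 ^ ((q + 2) * point_count (local_ball T) s)))"
    proof (rule L2_of_growth[OF finite_local_ball, where K = "(\<Sum>j\<in>UNIV. \<bar>v $ j\<bar>) * 2" and m = "q + 2"])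
      show "(\<lambda>s. (\<Sum>j\<in>UNIV. \<bar>v $ j\<bar>) * (2 * 2 ^ ((q + 2) * point_count (local_ball T) s))) \<in> borel_measurable product_law"
        by (intro borel_measurable_times borel_measurable_const pc)
      show "\<bar>(\<Sum>j\<in>UNIV. \<bar>v $ j\<bar>) * (2 * 2 ^ ((q + 2) * point_count (local_ball T) s))\<bar>
        \<le> (\<Sum>j\<in>UNIV. \<bar>v $ j\<bar>) * 2 * 2 ^ ((q + 2) * point_count (local_ball T) s)" for s
        by (simp add: abs_mult sum_nonneg)
    qed
    show "\<exists>B. finite B \<and> (\<forall>A A'. finite A \<longrightarrow> finite A' \<longrightarrow> B \<subseteq> A \<longrightarrow> B \<subseteq> A' \<longrightarrow>
        betti_functional q b d v A s - betti_functional q b d v A (s(0 := {||}))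
        = betti_functional q b d v A' s - betti_functional q b d v A' (s(0 := {||})))" for s
      by (rule betti_functional_stabilizes[OF p])
  qed
qed

lemma normalization_eq: "real n powr (real CARD('d) / 2) = sqrt (real n ^ CARD('d))"
proof (cases "n = 0")
  case False
  then have "real n powr (real CARD('d) / 2) = (real n powr real CARD('d)) powr (1 / 2)" by (simp add: powr_powr)
  also have "\<dots> = sqrt (real n ^ CARD('d))" using False by (simp add: powr_realpow powr_half_sqrt)
  finally show ?thesis .
qed simp

text \<open>
  Almost surely no point lies on the border of the window, so the projections of the Betti vector
  have the same law as the stabilizing functionals of independent cells, and their limits
  determine the limit of the vector.
\<close>

theorem central_limit_betti:
  fixes q :: nat and b d :: "'j::finite \<Rightarrow> param"
  assumes p: "\<And>j. b j \<in> params T" "\<And>j. d j \<in> params T" "\<And>j. param_le (b j) (d j)"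
  defines "V \<equiv> \<lambda>n \<omega>. betti_vector (\<lambda>i. X i \<omega>) (\<lambda>i. M i \<omega>) q n b d"
  shows "\<exists>Z :: (real ^ 'j) measure. centered_normal Z \<and>
    weakly_converges (\<lambda>n. distr W borel (\<lambda>\<omega>. (V n \<omega> - expectation (V n)) /\<^sub>R (real n powr (real CARD('d) / 2)))) Z"
proof -
  have F: "stabilizing_functional cell_law {||} (betti_functional q b d v)
    (\<lambda>s. (\<Sum>j\<in>UNIV. \<bar>v $ j\<bar>) * (2 * 2 ^ ((q + 2) * point_count (local_ball T) s)))" for v
    by (rule betti_functional_stabilizing[OF p(1,2)])
  note P = stabilizing_functional.P_def[OF F]
  let ?c = "\<lambda>n. sqrt (real n ^ CARD('d))"
  have V_comp: "V n \<omega> $ j = pbeta q (b j) (d j) (window n \<omega>)" if "\<omega> \<in> space W" for n \<omega> j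
    unfolding V_def betti_vector_def using filtration_betti_eq[OF p(1)[of j] p(2)[of j] p(3)[of j] that] by simp
  have V_comp_meas: "(\<lambda>\<omega>. V n \<omega> $ j) \<in> borel_measurable W" for n j
    by (rule measurable_cong[THEN iffD2, OF V_comp measurable_window_pbeta])
  have expand: "(\<Sum>j\<in>UNIV. y $ j *\<^sub>R (axis j 1 :: real^'j)) = y" for y
    by (simp add: basis_expansion flip: scalar_mult_eq_scaleR)
  have V_meas: "V n \<in> borel_measurable W" for n
  proof -
    have "(\<lambda>\<omega>. \<Sum>j\<in>UNIV. V n \<omega> $ j *\<^sub>R (axis j 1 :: real^'j)) \<in> borel_measurable W"
      by (intro borel_measurable_sum borel_measurable_scaleR V_comp_meas borel_measurable_const)
    then show ?thesis by (simp add: expand)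
  qed
  have proj: "AE \<omega> in W. v \<bullet> V n \<omega> = betti_functional q b d v (box_cube n) (cells \<omega>)" for v n
    using AE_no_border[of n]
  proof (rule AE_mp, intro AE_I2 impI)
    fix \<omega> assume \<omega>: "\<omega> \<in> space W" "\<forall>i. X i \<omega> \<notin> box_border n"
    show "v \<bullet> V n \<omega> = betti_functional q b d v (box_cube n) (cells \<omega>)"
      unfolding inner_vec_def betti_functional_def window_eq_conf[OF \<omega>, symmetric] by (simp add: V_comp[OF \<omega>(1)])
  qed
  have V_proj_meas: "(\<lambda>\<omega>. v \<bullet> V n \<omega>) \<in> borel_measurable W" for v n
    by (intro borel_measurable_inner borel_measurable_const V_meas)
  have BF_meas: "betti_functional q b d v (box_cube n) \<in> borel_measurable product_law" for v n
    by (rule measurable_betti_functional[OF finite_box_cube]) simp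
  have BF_L2: "L2 product_law (betti_functional q b d v (box_cube n))" for v n
    by (rule stabilizing_functional.sq[OF F finite_box_cube])
  have transfer: "integrable W f" "expectation f = (\<integral>s. g s \<partial>product_law)"
    if "AE \<omega> in W. f \<omega> = g (cells \<omega>)" "f \<in> borel_measurable W" "integrable product_law g"
    for f :: "'w \<Rightarrow> 'x::{banach,second_countable_topology}" and g
  proof -
    have g: "integrable (distr W product_law cells) g" using that(3) by (simp only: cells_law)
    then have gc: "integrable W (\<lambda>\<omega>. g (cells \<omega>))" by (rule integrable_distr[OF cells_measurable])
    show "integrable W f" by (rule integrable_cong_AE_imp[OF gc that(2)]) (use that(1) in auto)
    have "expectation f = expectation (\<lambda>\<omega>. g (cells \<omega>))"
      by (rule integral_cong_AE[OF that(2) borel_measurable_integrable[OF gc] that(1)])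
    also have "\<dots> = (\<integral>s. g s \<partial>distr W product_law cells)"
      by (rule integral_distr[symmetric, OF cells_measurable]) (use that(3) in auto)
    finally show "expectation f = (\<integral>s. g s \<partial>product_law)" by (simp only: cells_law)
  qed
  interpret PL: prob_space product_law by (rule prob_space_PiM) (rule prob_space_cell_law)
  have BF_int: "integrable product_law (betti_functional q b d v (box_cube n))" for v n
    by (rule PL.L2_integrable[OF BF_L2])
  have proj_int: "integrable W (\<lambda>\<omega>. v \<bullet> V n \<omega>)" "expectation (\<lambda>\<omega>. v \<bullet> V n \<omega>) = (\<integral>s. betti_functional q b d v (box_cube n) s \<partial>product_law)" for v n
    by (rule transfer[OF proj V_proj_meas BF_int])+
  have V_int: "integrable W (V n)" for n
  proof -
    have "integrable W (\<lambda>\<omega>. V n \<omega> $ j)" for j using proj_int(1)[of "axis j 1" n] by (simp add: inner_axis')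
    then have "integrable W (\<lambda>\<omega>. \<Sum>j\<in>UNIV. V n \<omega> $ j *\<^sub>R (axis j 1 :: real^'j))"
      by (intro Bochner_Integration.integrable_sum integrable_scaleR_left)
    then show ?thesis by (simp add: expand)
  qed
  define Y where "Y n \<omega> = (V n \<omega> - expectation (V n)) /\<^sub>R ?c n" for n \<omega>
  define G where "G v n s = stabilizing_functional.normalized cell_law (betti_functional q b d v) n s" for v n s
  have Y_meas: "Y n \<in> borel_measurable W" for n
    unfolding Y_def[abs_def] by (intro borel_measurable_scaleR borel_measurable_diff borel_measurable_const V_meas)
  have YG: "AE \<omega> in W. v \<bullet> Y n \<omega> = G v n (cells \<omega>)" for v n
    using proj[of v n]
  proof (rule AE_mp, intro AE_I2 impI)
    fix \<omega> assume eq: "v \<bullet> V n \<omega> = betti_functional q b d v (box_cube n) (cells \<omega>)"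
    have "v \<bullet> expectation (V n) = expectation (\<lambda>\<omega>. v \<bullet> V n \<omega>)"
      by (rule integral_inner_right[symmetric]) (rule V_int)
    then show "v \<bullet> Y n \<omega> = G v n (cells \<omega>)"
      unfolding Y_def G_def stabilizing_functional.normalized_def[OF F] stabilizing_functional.centered_cube_def[OF F] P
      by (simp add: inner_diff_right eq proj_int(2) divide_inverse mult.commute)
  qed
  have G_L2: "L2 product_law (G v n)" for v n
    using stabilizing_functional.L2_normalized[OF F, of v n] unfolding P G_def[abs_def] by simp
  obtain \<sigma> where \<sigma>: "\<And>v. 0 \<le> \<sigma> v" "\<And>v. (\<lambda>n. norm2 product_law (G v n)) \<longlonglongrightarrow> \<sigma> v"
    "\<And>v. (\<lambda>n. \<integral>s. cis (G v n s) \<partial>product_law) \<longlonglongrightarrow> complex_of_real (exp (- (\<sigma> v)\<^sup>2 / 2))"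
  proof -
    have "\<forall>v. \<exists>\<sigma>. \<sigma> \<ge> 0 \<and> (\<lambda>n. norm2 product_law (G v n)) \<longlonglongrightarrow> \<sigma> \<and>
      (\<lambda>n. \<integral>s. cis (G v n s) \<partial>product_law) \<longlonglongrightarrow> complex_of_real (exp (- \<sigma>\<^sup>2 / 2))"
      using stabilizing_functional.central_limit[OF F] unfolding P G_def[abs_def] by simp
    then show ?thesis using that by (auto dest!: choice)
  qed
  have "\<exists>Z :: (real^'j) measure. centered_normal Z \<and> weakly_converges (\<lambda>n. distr W borel (Y n)) Z"
  proof (rule gaussian_limit_from_projections[OF Y_meas])
    have m: "(\<lambda>\<omega>. v \<bullet> Y n \<omega>) \<in> borel_measurable W" for v n
      by (intro borel_measurable_inner borel_measurable_const Y_meas)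
    have sq: "AE \<omega> in W. (v \<bullet> Y n \<omega>)\<^sup>2 = (G v n (cells \<omega>))\<^sup>2" for v n
      using YG[of v n] by (rule AE_mp) (intro AE_I2 impI, simp)
    have tr: "integrable W (\<lambda>\<omega>. (v \<bullet> Y n \<omega>)\<^sup>2)" "expectation (\<lambda>\<omega>. (v \<bullet> Y n \<omega>)\<^sup>2) = (norm2 product_law (G v n))\<^sup>2" for v n
      using transfer[OF sq borel_measurable_power[OF m], of v n] G_L2[of v n] unfolding norm2_sq L2_def by simp_all
    show "L2 W (\<lambda>\<omega>. v \<bullet> Y n \<omega>)" for v n unfolding L2_def using m tr(1) by blast
    show "(\<lambda>n. expectation (\<lambda>\<omega>. (v \<bullet> Y n \<omega>)\<^sup>2)) \<longlonglongrightarrow> (\<sigma> v)\<^sup>2" for v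
      unfolding tr(2) by (intro tendsto_power \<sigma>(2))
    have cs: "AE \<omega> in W. cis (v \<bullet> Y n \<omega>) = cis (G v n (cells \<omega>))" for v n
      using YG[of v n] by (rule AE_mp) (intro AE_I2 impI, simp)
    have cis_meas: "cis \<in> borel_measurable borel" by (intro borel_measurable_continuous_onI continuous_intros)
    have "expectation (\<lambda>\<omega>. cis (v \<bullet> Y n \<omega>)) = (\<integral>s. cis (G v n s) \<partial>product_law)" for v n
    proof (rule transfer(2)[OF cs measurable_compose[OF m cis_meas]])
      show "integrable product_law (\<lambda>s. cis (G v n s))"
        by (rule PL.integrable_const_bound[where B = 1]) (use measurable_compose[OF L2_measurable[OF G_L2] cis_meas] in auto)
    qed
    then show "(\<lambda>n. expectation (\<lambda>\<omega>. cis (v \<bullet> Y n \<omega>))) \<longlonglongrightarrow> complex_of_real (exp (- (\<sigma> v)\<^sup>2 / 2))" for v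
      using \<sigma>(3)[of v] by simp
  qed
  then show ?thesis unfolding Y_def[abs_def] normalization_eq .
qed

end

theorem theorem3p3:
  fixes W :: "'w measure" and rate :: real and T q :: nat
    and X :: "nat \<Rightarrow> 'w \<Rightarrow> (real, 'd::{finite,linorder}) vec" and M :: "nat \<Rightarrow> 'w \<Rightarrow> real"
    and b d :: "'j::finite \<Rightarrow> param"
  assumes "T \<ge> 1" and "rate > 0"
    and "independently_marked_poisson W rate T X M"
    and "q \<le> CARD('d)"
    and "\<And>j. b j \<in> params T" and "\<And>j. d j \<in> params T"
    and "\<And>j. param_le (b j) (d j)"
  shows "\<exists>Z :: (real ^ 'j) measure. centered_normal Z \<and>
    weakly_converges
      (\<lambda>n. distr W borel (\<lambda>\<omega>.
        (betti_vector (\<lambda>i. X i \<omega>) (\<lambda>i. M i \<omega>) q n b d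
          - prob_space.expectation W (\<lambda>\<omega>'. betti_vector (\<lambda>i. X i \<omega>') (\<lambda>i. M i \<omega>') q n b d))
        /\<^sub>R (real n powr (real CARD('d) / 2))))
      Z"
proof -
  interpret marked_poisson_cells W rate T X M by unfold_locales (rule assms(3))
  show ?thesis by (rule central_limit_betti[OF assms(5-7)])
qed

end
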